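(* Let the regularity assumption in the context hold, let soft Q-learning be run with an exploratory behavioural policy and suitable step sizes as in the context, and let $t_k=\mathcal{O}(k2^k)$ be the iteration numbers defined there. Consider, for given $x$, the vanilla hypergradient estimator $\widehat{\frac{dF_{t_K}}{dx}}$ and the randomly-truncated soft Q-learning (RT-Q) hypergradient estimator $\frac{dF^{RT}_{t_K}}{dx}$ described in the context. Then, with constants in $\mathcal{O}(\cdot)$ independent of $K$: (i) Vanilla soft Q-learning: the bias is $\mathcal{O}(2^{-K/2})$, the variance is $\mathcal{O}(1)$, and the lower-level iteration complexity is $\mathcal{O}(K2^K)$. (ii) RT-Q: the bias is $\mathcal{O}(2^{-K/2})$, the variance is $\mathcal{O}(K)$, and the (expected) lower-level iteration complexity is $\mathcal{O}(K^2)$. Here, for an estimator $\widehat G$ of $\frac{dF(x)}{dx}$, the bias is $\left\|\mathbb{E}\left[\frac{dF(x)}{dx}-\widehat G\right]\right\|_\infty$, the variance is $\mathbb{E}\left[\|\widehat G-\mathbb{E}[\widehat G]\|_\infty^2\right]$, and the lower-level iteration complexity is the expected number of soft Q-learning iterations used to build $\widehat G$.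
   Context: Setting. $X\subseteq\mathbb{R}^d$ is open and $\xi$ is a random context with distribution $\mathbb{P}_\xi$. For every $x\in X$ and every context $\xi$ there is a Markov decision process $\mathcal M_{x,\xi}=(\mathcal S,\mathcal A,r_{x,\xi},P_{x,\xi},\mu_{x,\xi},\gamma)$ with finite state space $\mathcal S$, finite action space $\mathcal A$, reward $r_{x,\xi}$, transition kernel $P_{x,\xi}(s';s,a)$, initial distribution $\mu_{x,\xi}$ and discount factor $\gamma\in(0,1)$. A policy $\pi$ assigns to each state $s$ a distribution $\pi(\cdot;s)$ on $\mathcal A$ and is viewed as a vector in $\mathbb{R}^{\mathcal S\times\mathcal A}$. Fix $\lambda>0$ and let $H(\pi;s)=-\sum_a\pi(a;s)\log\pi(a;s)$. Define $V^\pi_{\lambda,x,\xi}(s)=\mathbb{E}[\sum_{t\ge0}\gamma^t(r_{x,\xi}(s_t,a_t)+\lambda H(\pi;s_t))\mid s_0=s]$ with $a_t\sim\pi(\cdot;s_t)$, $s_{t+1}\sim P_{x,\xi}(\cdot;s_t,a_t)$. The unique optimal entropy-regularized policy is $\pi^*_{x,\xi}(a;s)\propto\exp(Q^*_{\lambda,x,\xi}(s,a)/\lambda)$, with $Q^*_{\lambda,x,\xi}$ the optimal regularized Q-function. The leader's loss is $f(x,\pi,\xi)\in\mathbb{R}$ and $F(x)=\mathbb{E}_\xi[f(x,\pi^*_{x,\xi},\xi)]$. Regularity assumption. $f$ is differentiable in $(x,\pi)$ and there are constants $L_f,S_f$ such that for all $\xi$, $x_1,x_2$, $\pi_1,\pi_2$: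 $|f(x_1,\pi_1,\xi)-f(x_2,\pi_2,\xi)|\le L_f(\|x_1-x_2\|_\infty+\|\pi_1-\pi_2\|_\infty)$, $\|\partial_xf(x_1,\pi_1,\xi)-\partial_xf(x_2,\pi_2,\xi)\|_\infty\le S_f(\|x_1-x_2\|_\infty+\|\pi_1-\pi_2\|_\infty)$, and $\|\partial_\pi f(x_1,\pi_1,\xi)-\partial_\pi f(x_2,\pi_2,\xi)\|_\infty\le S_f(\|x_1-x_2\|_\infty+\|\pi_1-\pi_2\|_\infty)$. Moreover $r_{x,\xi}$ and $P_{x,\xi}$ are differentiable in $x$ and there are constants $\overline R,K_1,K_2$ such that for all $x,\xi,s,a,s'$: $|r_{x,\xi}(s,a)|<\overline R$, $\|\partial_x\log P_{x,\xi}(s';s,a)\|_\infty<K_1$ (where $P_{x,\xi}(s';s,a)>0$), $\|\partial_xr_{x,\xi}(s,a)\|_\infty<K_2$. Soft Q-learning on $\mathcal M_{x,\xi}$ with behavioural policy $\pi_B$ and step sizes $\alpha_t$. Start with $Q=0$ and some $s_0$. At step $t$ sample $a\sim\pi_B(\cdot;s_t)$, observe $r_{x,\xi}(s_t,a)$ and $s_{t+1}\sim P_{x,\xi}(\cdot;s_t,a)$, and update only the entry $$Q(s_t,a)\leftarrow Q(s_t,a)+\alpha_t\Bigl(r_{x,\xi}(s_t,a)+\gamma\lambda\log\sum_{a'}\exp(Q(s_{t+1},a')/\lambda)-Q(s_t,a)\Bigr).$$ After $n$ iterations with iterate $Q^n$ the policy is $\pi^n(a;s)=\exp(Q^n(s,a)/\lambda)/\sum_{a'}\exp(Q^n(s,a')/\lambda)$.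 $\pi_B$ is sufficiently exploratory, so that the induced Markov chain is ergodic, and the step sizes (independent of $K$) are suitably chosen so that numbers $t_k=\mathcal{O}(k2^k)$ of iterations guarantee $\lambda\,\mathbb{E}\|\pi^{t_k}-\pi^*_{x,\xi}\|_\infty^2\le\mathbb{E}\|Q^{t_k}-Q^*_{\lambda,x,\xi}\|_\infty^2\le2^{-k}$ (up to constants). GradientEstimator$(\xi,x,s,a,\pi)$. $\mathrm{Geo}(1-q)$ denotes the law on $\{0,1,2,\dots\}$ with mass $(1-q)q^k$ at $k$. Draw independently $T_Q,T_V\sim\mathrm{Geo}(1-\gamma)$ and $T'_Q,T'_V\sim\mathrm{Geo}(1-\gamma^{1/2})$. Sample a trajectory $(s_t,a_t)_{0\le t\le T_Q+T'_Q+1}$ of $\mathcal M_{x,\xi}$ under $\pi$ with $(s_0,a_0)=(s,a)$ and set $$\widehat{\partial_xQ^\pi}(s,a)=\sum_{t=0}^{T_Q}\partial_xr_{x,\xi}(s_t,a_t)+\frac{\gamma}{1-\gamma}\,\partial_x\log P_{x,\xi}(s_{T_Q+1};s_{T_Q},a_{T_Q})\sum_{t=T_Q+1}^{T_Q+T'_Q+1}\gamma^{(t-T_Q-1)/2}\bigl(r_{x,\xi}(s_t,a_t)+\lambda H(\pi;s_t)\bigr).$$ Define $\widehat{\partial_xV^\pi}(s)$ by the same formula with $T_V,T'_V$ and an independent trajectory under $\pi$ with $s_0=s$, $a_0\sim\pi(\cdot;s)$. Output $\widehat{\partial_xA^\pi}(s,a)=\widehat{\partial_xQ^\pi}(s,a)-\widehat{\partial_xV^\pi}(s)$.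 Let $\nu$ be a fixed distribution on $\mathcal S$ with full support. For a policy $\pi$, state $s$, action $a$ and vector $g\in\mathbb{R}^d$ write $G(\pi,s,a,g)=\frac{\partial_1f(x,\pi,\xi)}{\partial x}+\frac{1}{\lambda\nu(s)}\frac{\partial_2f(x,\pi,\xi)}{\partial\pi(a;s)}\,g$, where $\partial_1,\partial_2$ denote partial derivatives in the first and second argument. Vanilla estimator. Sample $\xi\sim\mathbb{P}_\xi$, run soft Q-learning for $t_K$ iterations to get $\pi^{t_K}$, sample $s\sim\nu$, $a\sim\pi^{t_K}(\cdot;s)$, and set $\widehat{\frac{dF_{t_K}}{dx}}=G\bigl(\pi^{t_K},s,a,\widehat{\partial_xA^{\pi^{t_K}}}(s,a)\bigr)$. RT-Q estimator. Sample $\xi\sim\mathbb{P}_\xi$ and $k\in\{1,\dots,K\}$ with probability $p_k=2^{-k}/(1-2^{-K})$. Run soft Q-learning for $t_{k+1}$ iterations, recording $\pi^{t_1},\pi^{t_k},\pi^{t_{k+1}}$. Sample $s\sim\nu$, $a\sim\pi^{t_{k+1}}(\cdot;s)$, $a'\sim\pi^{t_1}(\cdot;s)$. For $j\in\{k,k+1\}$ let $\widetilde{\partial_xA^{\pi^{t_j}}}(s,a)$ be the average of $2^k$ independent outputs of GradientEstimator$(\xi,x,s,a,\pi^{t_j})$, and let $\widehat{\partial_xA^{\pi^{t_1}}}(s,a')$ be one output of GradientEstimator$(\xi,x,s,a',\pi^{t_1})$. Set $\widetilde{\frac{dF_{t_{k+1}}}{dx}}=G\bigl(\pi^{t_{k+1}},s,a,\widetilde{\partial_xA^{\pi^{t_{k+1}}}}(s,a)\bigr)$,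 $\widetilde{\frac{dF^{t_{k+1}}_{t_k}}{dx}}=\frac{\partial_1f(x,\pi^{t_k},\xi)}{\partial x}+\frac{\pi^{t_k}(a;s)}{\pi^{t_{k+1}}(a;s)}\frac{1}{\lambda\nu(s)}\frac{\partial_2f(x,\pi^{t_k},\xi)}{\partial\pi(a;s)}\widetilde{\partial_xA^{\pi^{t_k}}}(s,a)$, $\widehat{\frac{dF_{t_1}}{dx}}=G\bigl(\pi^{t_1},s,a',\widehat{\partial_xA^{\pi^{t_1}}}(s,a')\bigr)$, and $$\frac{dF^{RT}_{t_K}}{dx}=\widehat{\frac{dF_{t_1}}{dx}}+\frac{1}{p_k}\left(\widetilde{\frac{dF_{t_{k+1}}}{dx}}-\widetilde{\frac{dF^{t_{k+1}}_{t_k}}{dx}}\right).$$ *)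

theory Defs
  imports "HOL-Probability.Probability" "HOL-Library.Landau_Symbols"
begin

section \<open>Gradients\<close>

text \<open>On \<^typ>\<open>real^'d\<close> and \<^typ>\<open>real^'a^'s\<close> (seen as the space of \<open>'s \<times> 'a\<close> arrays) the entries of
  \<open>gradient f z\<close> are the partial derivatives of \<open>f\<close>, and \<^const>\<open>infnorm\<close> is the maximum of the
  absolute values of all entries. The value is meaningful only where \<open>f\<close> is differentiable.\<close>

definition gradient :: "('v::euclidean_space \<Rightarrow> real) \<Rightarrow> 'v \<Rightarrow> 'v" where
  "gradient f z = (\<Sum>b\<in>Basis. frechet_derivative f (at z) b *\<^sub>R b)"

section \<open>Markov decision processes and policies\<close>

record ('s, 'a) mdp =
  reward :: "'s \<Rightarrow> 'a \<Rightarrow> real"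
  kernel :: "'s \<Rightarrow> 'a \<Rightarrow> 's pmf"
  init :: "'s pmf"
  discount :: real

definition is_policy :: "real^'a::finite^'s::finite \<Rightarrow> bool" where
  "is_policy \<pi> \<longleftrightarrow> (\<forall>s a. 0 \<le> \<pi> $ s $ a) \<and> (\<forall>s. (\<Sum>a\<in>UNIV. \<pi> $ s $ a) = 1)"

definition act_pmf :: "real^'a::finite^'s::finite \<Rightarrow> 's \<Rightarrow> 'a pmf" where
  "act_pmf \<pi> s = embed_pmf (\<lambda>a. \<pi> $ s $ a)"

lemma pmf_act_pmf:
  assumes "is_policy \<pi>"
  shows "pmf (act_pmf \<pi> s) a = \<pi> $ s $ a"
  unfolding act_pmf_def
proof (rule pmf_embed_pmf)
  show "0 \<le> \<pi> $ s $ a" for a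
    using assms by (simp add: is_policy_def)
  have "(\<integral>\<^sup>+ a. ennreal (\<pi> $ s $ a) \<partial>count_space UNIV) = ennreal (\<Sum>a\<in>UNIV. \<pi> $ s $ a)"
    using assms by (simp add: nn_integral_count_space_finite is_policy_def)
  then show "(\<integral>\<^sup>+ a. ennreal (\<pi> $ s $ a) \<partial>count_space UNIV) = 1"
    using assms by (simp add: is_policy_def)
qed

definition policy_entropy :: "real^'a::finite^'s::finite \<Rightarrow> 's \<Rightarrow> real" where
  "policy_entropy \<pi> s = - (\<Sum>a\<in>UNIV. \<pi> $ s $ a * ln (\<pi> $ s $ a))"

definition softmax_policy :: "real \<Rightarrow> real^'a::finite^'s::finite \<Rightarrow> real^'a^'s" where
  "softmax_policy lam Q =
     (\<chi> s a. exp (Q $ s $ a / lam) / (\<Sum>a'\<in>UNIV. exp (Q $ s $ a' / lam)))"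

definition sa_step :: "('s, 'a) mdp \<Rightarrow> real^'a::finite^'s::finite \<Rightarrow> 's \<times> 'a \<Rightarrow> ('s \<times> 'a) pmf" where
  "sa_step m \<pi> z = do {
     s' \<leftarrow> kernel m (fst z) (snd z);
     a' \<leftarrow> act_pmf \<pi> s';
     return_pmf (s', a') }"

section \<open>Entropy-regularized values\<close>

text \<open>The law of the infinite trajectory \<open>(s\<^sub>t, a\<^sub>t)\<^sub>t\<close> under \<open>\<pi>\<close> with \<open>s\<^sub>0 = s\<close> is the
  Ionescu-Tulcea measure of the kernels \<open>path_kernel\<close>.\<close>

definition path_kernel ::
  "('s, 'a) mdp \<Rightarrow> real^'a::finite^'s::finite \<Rightarrow> 's \<Rightarrow> nat \<Rightarrow> (nat \<Rightarrow> 's \<times> 'a) \<Rightarrow> ('s \<times> 'a) measure" where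
  "path_kernel m \<pi> s n \<omega> =
     measure_pmf (case n of 0 \<Rightarrow> map_pmf (Pair s) (act_pmf \<pi> s) | Suc i \<Rightarrow> sa_step m \<pi> (\<omega> i))"

definition path_measure ::
  "('s, 'a) mdp \<Rightarrow> real^'a::finite^'s::finite \<Rightarrow> 's \<Rightarrow> (nat \<Rightarrow> 's \<times> 'a) measure" where
  "path_measure m \<pi> s =
     projective_family.lim UNIV
       (Ionescu_Tulcea.CI (path_kernel m \<pi> s) (\<lambda>_. count_space UNIV)) (\<lambda>_. count_space UNIV)"

lemma Ionescu_Tulcea_path_kernel:
  fixes m :: "('s::finite, 'a::finite) mdp"
  shows "Ionescu_Tulcea (path_kernel m \<pi> s) (\<lambda>_. count_space UNIV)"
proof (rule Ionescu_Tulcea.intro)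
  fix i :: nat and x :: "nat \<Rightarrow> 's \<times> 'a"
  show "prob_space (path_kernel m \<pi> s i x)"
    by (simp add: path_kernel_def prob_space_measure_pmf)
next
  fix i
  show "path_kernel m \<pi> s i \<in> measurable (PiM {0..<i} (\<lambda>_. count_space UNIV))
          (subprob_algebra (count_space UNIV))"
  proof (cases i)
    case 0
    have "measure_pmf p \<in> space (subprob_algebra (count_space UNIV))" for p :: "('s \<times> 'a) pmf"
      by (rule measure_pmf_in_subprob_space)
    then show ?thesis
      using 0 by (simp add: path_kernel_def [abs_def])
  next
    case (Suc j)
    have "(\<lambda>\<omega>. \<omega> j) \<in> measurable (PiM {0..<i} (\<lambda>_. count_space UNIV)) (count_space (UNIV :: ('s \<times> 'a) set))"
      using Suc by (intro measurable_component_singleton) auto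
    moreover have "(\<lambda>z. measure_pmf (sa_step m \<pi> z))
        \<in> measurable (count_space UNIV) (subprob_algebra (count_space UNIV))"
      by (simp add: measure_pmf_in_subprob_space)
    ultimately have "(\<lambda>\<omega>. measure_pmf (sa_step m \<pi> (\<omega> j)))
        \<in> measurable (PiM {0..<i} (\<lambda>_. count_space UNIV)) (subprob_algebra (count_space UNIV))"
      by (rule measurable_compose)
    then show ?thesis
      using Suc by (simp add: path_kernel_def [abs_def])
  qed
qed

lemma prob_space_path_measure:
  fixes m :: "('s::finite, 'a::finite) mdp"
  shows "prob_space (path_measure m \<pi> s)"
proof -
  interpret Ionescu_Tulcea "path_kernel m \<pi> s" "\<lambda>_. count_space UNIV"
    by (rule Ionescu_Tulcea_path_kernel)
  have "emeasure PF.lim (PF.emb UNIV {} (space (PiM {} (\<lambda>_. count_space UNIV)))) = 1"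
    using lim[of "{}" "space (PiM {} (\<lambda>_. count_space UNIV))"]
      prob_space.emeasure_space_1[OF PF.prob_space_P[of "{}"]]
    by (simp add: PF.space_P)
  moreover have "PF.emb UNIV {} (space (PiM {} (\<lambda>_. count_space UNIV))) = space PF.lim"
    by (auto simp: prod_emb_def space_PiM restrict_def)
  ultimately show ?thesis
    unfolding path_measure_def by (intro prob_spaceI) simp
qed

definition soft_value :: "real \<Rightarrow> ('s, 'a) mdp \<Rightarrow> real^'a::finite^'s::finite \<Rightarrow> 's \<Rightarrow> real" where
  "soft_value lam m \<pi> s =
     (\<integral>\<omega>. (\<Sum>t. discount m ^ t * (reward m (fst (\<omega> t)) (snd (\<omega> t)) + lam * policy_entropy \<pi> (fst (\<omega> t))))
        \<partial>path_measure m \<pi> s)"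

definition opt_soft_value :: "real \<Rightarrow> ('s::finite, 'a::finite) mdp \<Rightarrow> 's \<Rightarrow> real" where
  "opt_soft_value lam m s = (SUP \<pi>\<in>{\<pi>. is_policy \<pi>}. soft_value lam m \<pi> s)"

text \<open>The entropy bonus of the first step is not part of the Q-function; this is the convention
  under which the soft Q-learning update below has the optimal Q-function as its fixed point.\<close>

definition opt_soft_q :: "real \<Rightarrow> ('s::finite, 'a::finite) mdp \<Rightarrow> real^'a^'s" where
  "opt_soft_q lam m =
     (\<chi> s a. reward m s a
        + discount m * measure_pmf.expectation (kernel m s a) (opt_soft_value lam m))"

definition opt_policy :: "real \<Rightarrow> ('s::finite, 'a::finite) mdp \<Rightarrow> real^'a^'s" where
  "opt_policy lam m = softmax_policy lam (opt_soft_q lam m)"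

section \<open>Leader objective and regularity\<close>

definition leader_objective ::
  "real \<Rightarrow> 'x measure \<Rightarrow> (real^'d \<Rightarrow> 'x \<Rightarrow> ('s::finite, 'a::finite) mdp)
    \<Rightarrow> (real^'d \<Rightarrow> real^'a^'s \<Rightarrow> 'x \<Rightarrow> real) \<Rightarrow> real^'d \<Rightarrow> real" where
  "leader_objective lam \<Xi> M f x = (\<integral>\<xi>. f x (opt_policy lam (M x \<xi>)) \<xi> \<partial>\<Xi>)"

text \<open>The set \<open>U\<close> is an open neighbourhood of the policies on which the loss is defined. An open
  domain is needed for the partial derivatives with respect to the single entries of a policy, since
  the policies themselves have empty interior among all arrays.\<close>

definition regular_loss ::
  "(real^'d::finite) set \<Rightarrow> (real^'a::finite^'s::finite) set \<Rightarrow> 'x measure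
    \<Rightarrow> (real^'d \<Rightarrow> real^'a^'s \<Rightarrow> 'x \<Rightarrow> real) \<Rightarrow> real \<Rightarrow> real \<Rightarrow> bool" where
  "regular_loss X U \<Xi> f L\<^sub>f S\<^sub>f \<longleftrightarrow>
     (\<forall>\<xi>\<in>space \<Xi>. \<forall>x\<in>X. \<forall>\<pi>\<in>U. (\<lambda>(y, p). f y p \<xi>) differentiable (at (x, \<pi>))) \<and>
     (\<forall>\<xi>\<in>space \<Xi>. \<forall>x\<^sub>1\<in>X. \<forall>x\<^sub>2\<in>X. \<forall>\<pi>\<^sub>1\<in>U. \<forall>\<pi>\<^sub>2\<in>U.
        \<bar>f x\<^sub>1 \<pi>\<^sub>1 \<xi> - f x\<^sub>2 \<pi>\<^sub>2 \<xi>\<bar> \<le> L\<^sub>f * (infnorm (x\<^sub>1 - x\<^sub>2) + infnorm (\<pi>\<^sub>1 - \<pi>\<^sub>2)) \<and>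
        infnorm (gradient (\<lambda>y. f y \<pi>\<^sub>1 \<xi>) x\<^sub>1 - gradient (\<lambda>y. f y \<pi>\<^sub>2 \<xi>) x\<^sub>2)
          \<le> S\<^sub>f * (infnorm (x\<^sub>1 - x\<^sub>2) + infnorm (\<pi>\<^sub>1 - \<pi>\<^sub>2)) \<and>
        infnorm (gradient (\<lambda>p. f x\<^sub>1 p \<xi>) \<pi>\<^sub>1 - gradient (\<lambda>p. f x\<^sub>2 p \<xi>) \<pi>\<^sub>2)
          \<le> S\<^sub>f * (infnorm (x\<^sub>1 - x\<^sub>2) + infnorm (\<pi>\<^sub>1 - \<pi>\<^sub>2)))"

definition regular_mdps ::
  "(real^'d::finite) set \<Rightarrow> 'x measure \<Rightarrow> (real^'d \<Rightarrow> 'x \<Rightarrow> ('s::finite, 'a::finite) mdp)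
    \<Rightarrow> real \<Rightarrow> real \<Rightarrow> real \<Rightarrow> bool" where
  "regular_mdps X \<Xi> M R K\<^sub>1 K\<^sub>2 \<longleftrightarrow>
     (\<forall>\<xi>\<in>space \<Xi>. \<forall>x\<in>X. \<forall>s a.
        (\<lambda>y. reward (M y \<xi>) s a) differentiable (at x) \<and>
        \<bar>reward (M x \<xi>) s a\<bar> < R \<and>
        infnorm (gradient (\<lambda>y. reward (M y \<xi>) s a) x) < K\<^sub>2 \<and>
        (\<forall>s'. (\<lambda>y. pmf (kernel (M y \<xi>) s a) s') differentiable (at x) \<and>
              (pmf (kernel (M x \<xi>) s a) s' > 0 \<longrightarrow>
                 infnorm (gradient (\<lambda>y. ln (pmf (kernel (M y \<xi>) s a) s')) x) < K\<^sub>1)))"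

definition measurable_data ::
  "(real^'d) set \<Rightarrow> (real^'a^'s) set \<Rightarrow> 'x measure \<Rightarrow> (real^'d \<Rightarrow> 'x \<Rightarrow> ('s::finite, 'a::finite) mdp)
    \<Rightarrow> (real^'d \<Rightarrow> real^'a^'s \<Rightarrow> 'x \<Rightarrow> real) \<Rightarrow> bool" where
  "measurable_data X U \<Xi> M f \<longleftrightarrow>
     (\<forall>x\<in>X. (\<forall>s a. (\<lambda>\<xi>. reward (M x \<xi>) s a) \<in> borel_measurable \<Xi> \<and>
                   (\<forall>s'. (\<lambda>\<xi>. pmf (kernel (M x \<xi>) s a) s') \<in> borel_measurable \<Xi>)) \<and>
            (\<forall>\<pi>\<in>U. f x \<pi> \<in> borel_measurable \<Xi>))"

section \<open>Soft Q-learning\<close>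

definition state_step :: "('s, 'a) mdp \<Rightarrow> real^'a::finite^'s::finite \<Rightarrow> 's \<Rightarrow> 's pmf" where
  "state_step m \<pi> s = do { a \<leftarrow> act_pmf \<pi> s; kernel m s a }"

definition ergodic_policy :: "('s, 'a) mdp \<Rightarrow> real^'a::finite^'s::finite \<Rightarrow> bool" where
  "ergodic_policy m \<pi> \<longleftrightarrow>
     (let reach = (\<lambda>n s. set_pmf (((\<lambda>p. bind_pmf p (state_step m \<pi>)) ^^ n) (return_pmf s)))
      in (\<forall>s s'. \<exists>n. s' \<in> reach n s) \<and>
         (\<forall>s. Gcd {n. n > 0 \<and> s \<in> reach n s} = 1))"

definition q_update ::
  "real \<Rightarrow> ('s, 'a) mdp \<Rightarrow> real \<Rightarrow> 's \<Rightarrow> 'a \<Rightarrow> 's \<Rightarrow> real^'a::finite^'s::finite \<Rightarrow> real^'a^'s" where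
  "q_update lam m \<eta> s a s' Q =
     (\<chi> u b. if u = s \<and> b = a
        then Q $ s $ a + \<eta> * (reward m s a
               + discount m * lam * ln (\<Sum>a'\<in>UNIV. exp (Q $ s' $ a' / lam)) - Q $ s $ a)
        else Q $ u $ b)"

text \<open>The run is recorded as the list of the pairs (iterate, current state), initial pair included,
  so that a run of \<open>n\<close> iterations has length \<open>n + 1\<close>.\<close>

primrec soft_q_run ::
  "real \<Rightarrow> ('s, 'a) mdp \<Rightarrow> real^'a::finite^'s::finite \<Rightarrow> (nat \<Rightarrow> real) \<Rightarrow> 's \<Rightarrow> nat
    \<Rightarrow> ((real^'a^'s) \<times> 's) list pmf" where
  "soft_q_run lam m \<pi>\<^sub>B \<alpha> s\<^sub>0 0 = return_pmf [(0, s\<^sub>0)]"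
| "soft_q_run lam m \<pi>\<^sub>B \<alpha> s\<^sub>0 (Suc n) = do {
     h \<leftarrow> soft_q_run lam m \<pi>\<^sub>B \<alpha> s\<^sub>0 n;
     let Q = fst (last h);
     let s = snd (last h);
     a \<leftarrow> act_pmf \<pi>\<^sub>B s;
     s' \<leftarrow> kernel m s a;
     return_pmf (h @ [(q_update lam m (\<alpha> n) s a s' Q, s')]) }"

definition q_iterate :: "((real^'a^'s) \<times> 's) list \<Rightarrow> nat \<Rightarrow> real^'a::finite^'s::finite" where
  "q_iterate h n = fst (h ! n)"

definition num_iterations :: "((real^'a^'s) \<times> 's) list \<Rightarrow> nat" where
  "num_iterations h = length h - 1"

section \<open>The gradient estimator\<close>

primrec trajectory ::
  "('s, 'a) mdp \<Rightarrow> real^'a::finite^'s::finite \<Rightarrow> nat \<Rightarrow> 's \<times> 'a \<Rightarrow> ('s \<times> 'a) list pmf" where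
  "trajectory m \<pi> 0 z = return_pmf [z]"
| "trajectory m \<pi> (Suc n) z = do {
     z' \<leftarrow> sa_step m \<pi> z;
     \<tau> \<leftarrow> trajectory m \<pi> n z';
     return_pmf (z # \<tau>) }"

text \<open>From here on \<open>m\<close> is the family \<open>x \<mapsto> \<M>\<^sub>x\<close> of decision processes for one fixed context.
  Note that \<^term>\<open>geometric_pmf (1 - q)\<close> has mass \<open>(1 - q) q\<^sup>k\<close> at \<open>k\<close>.\<close>

definition dQ_estimator ::
  "real \<Rightarrow> (real^'d \<Rightarrow> ('s::finite, 'a::finite) mdp) \<Rightarrow> real^'d \<Rightarrow> real^'a^'s \<Rightarrow> 's \<Rightarrow> 'a
    \<Rightarrow> (real^'d) pmf" where
  "dQ_estimator lam m x \<pi> s a = do {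
     let \<gamma> = discount (m x);
     T \<leftarrow> geometric_pmf (1 - \<gamma>);
     T' \<leftarrow> geometric_pmf (1 - \<gamma> powr (1/2));
     \<tau> \<leftarrow> trajectory (m x) \<pi> (T + T' + 1) (s, a);
     let st = (\<lambda>t. fst (\<tau> ! t));
     let ac = (\<lambda>t. snd (\<tau> ! t));
     return_pmf
       ((\<Sum>t=0..T. gradient (\<lambda>y. reward (m y) (st t) (ac t)) x)
        + (\<gamma> / (1 - \<gamma>)
           * (\<Sum>t=T+1..T+T'+1. \<gamma> powr (real (t - T - 1) / 2)
                * (reward (m x) (st t) (ac t) + lam * policy_entropy \<pi> (st t))))
          *\<^sub>R gradient (\<lambda>y. ln (pmf (kernel (m y) (st T) (ac T)) (st (T + 1)))) x) }"

definition dV_estimator ::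
  "real \<Rightarrow> (real^'d \<Rightarrow> ('s::finite, 'a::finite) mdp) \<Rightarrow> real^'d \<Rightarrow> real^'a^'s \<Rightarrow> 's
    \<Rightarrow> (real^'d) pmf" where
  "dV_estimator lam m x \<pi> s = do {
     a \<leftarrow> act_pmf \<pi> s;
     dQ_estimator lam m x \<pi> s a }"

definition gradient_estimator ::
  "real \<Rightarrow> (real^'d \<Rightarrow> ('s::finite, 'a::finite) mdp) \<Rightarrow> real^'d \<Rightarrow> real^'a^'s \<Rightarrow> 's \<Rightarrow> 'a
    \<Rightarrow> (real^'d) pmf" where
  "gradient_estimator lam m x \<pi> s a = do {
     gQ \<leftarrow> dQ_estimator lam m x \<pi> s a;
     gV \<leftarrow> dV_estimator lam m x \<pi> s;
     return_pmf (gQ - gV) }"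

section \<open>Hypergradient estimators\<close>

text \<open>For one fixed context, with loss \<open>f x \<pi>\<close>, the estimators return the estimate together with
  the number of soft Q-learning iterations that were run to obtain it.\<close>

definition hypergradient_term ::
  "real \<Rightarrow> 's pmf \<Rightarrow> (real^'d::finite \<Rightarrow> real^'a::finite^'s::finite \<Rightarrow> real) \<Rightarrow> real^'d
    \<Rightarrow> real^'a^'s \<Rightarrow> 's \<Rightarrow> 'a \<Rightarrow> real^'d \<Rightarrow> real^'d" where
  "hypergradient_term lam \<nu> f x \<pi> s a g =
     gradient (\<lambda>y. f y \<pi>) x + (1 / (lam * pmf \<nu> s) * gradient (f x) \<pi> $ s $ a) *\<^sub>R g"

definition vanilla_estimator ::
  "real \<Rightarrow> (real^'d \<Rightarrow> ('s::finite, 'a::finite) mdp) \<Rightarrow> (real^'d \<Rightarrow> real^'a^'s \<Rightarrow> real) \<Rightarrow> real^'d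
    \<Rightarrow> real^'a^'s \<Rightarrow> (nat \<Rightarrow> real) \<Rightarrow> 's \<Rightarrow> (nat \<Rightarrow> nat) \<Rightarrow> 's pmf \<Rightarrow> nat \<Rightarrow> ((real^'d) \<times> nat) pmf" where
  "vanilla_estimator lam m f x \<pi>\<^sub>B \<alpha> s\<^sub>0 t \<nu> K = do {
     h \<leftarrow> soft_q_run lam (m x) \<pi>\<^sub>B \<alpha> s\<^sub>0 (t K);
     let \<pi> = softmax_policy lam (q_iterate h (t K));
     s \<leftarrow> \<nu>;
     a \<leftarrow> act_pmf \<pi> s;
     g \<leftarrow> gradient_estimator lam m x \<pi> s a;
     return_pmf (hypergradient_term lam \<nu> f x \<pi> s a g, num_iterations h) }"

definition level_prob :: "nat \<Rightarrow> nat \<Rightarrow> real" where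
  "level_prob K k = (if k \<in> {1..K} then (1/2)^k / (1 - (1/2)^K) else 0)"

definition level_pmf :: "nat \<Rightarrow> nat pmf" where
  "level_pmf K = embed_pmf (level_prob K)"

lemma pmf_level_pmf:
  assumes "K \<ge> 1"
  shows "pmf (level_pmf K) k = level_prob K k"
  unfolding level_pmf_def
proof (rule pmf_embed_pmf)
  have lt: "(1/2::real) ^ K < 1"
    using assms by (simp add: power_less_one_iff)
  show nonneg: "0 \<le> level_prob K k" for k
    using lt by (auto simp: level_prob_def)
  have *: "(\<Sum>k=1..K. (1/2::real)^k) = 1 - (1/2)^K" for K
    by (induction K) auto
  have "(\<integral>\<^sup>+ k. ennreal (level_prob K k) \<partial>count_space UNIV)
      = (\<Sum>k\<in>{1..K}. ennreal (level_prob K k))"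
    by (rule nn_integral_count_space'[where A="{1..K}"]) (auto simp: level_prob_def)
  also have "\<dots> = ennreal (\<Sum>k=1..K. level_prob K k)"
    using nonneg by (simp add: sum_ennreal)
  also have "(\<Sum>k=1..K. level_prob K k) = (\<Sum>k=1..K. (1/2)^k) / (1 - (1/2)^K)"
    unfolding sum_divide_distrib by (intro sum.cong) (auto simp: level_prob_def)
  also have "\<dots> = 1"
    using lt unfolding * by simp
  finally show "(\<integral>\<^sup>+ k. ennreal (level_prob K k) \<partial>count_space UNIV) = 1"
    by simp
qed

definition average :: "'v::real_vector list \<Rightarrow> 'v" where
  "average gs = (1 / real (length gs)) *\<^sub>R sum_list gs"

definition rtq_estimator ::
  "real \<Rightarrow> (real^'d \<Rightarrow> ('s::finite, 'a::finite) mdp) \<Rightarrow> (real^'d \<Rightarrow> real^'a^'s \<Rightarrow> real) \<Rightarrow> real^'d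
    \<Rightarrow> real^'a^'s \<Rightarrow> (nat \<Rightarrow> real) \<Rightarrow> 's \<Rightarrow> (nat \<Rightarrow> nat) \<Rightarrow> 's pmf \<Rightarrow> nat \<Rightarrow> ((real^'d) \<times> nat) pmf" where
  "rtq_estimator lam m f x \<pi>\<^sub>B \<alpha> s\<^sub>0 t \<nu> K = do {
     k \<leftarrow> level_pmf K;
     h \<leftarrow> soft_q_run lam (m x) \<pi>\<^sub>B \<alpha> s\<^sub>0 (t (k + 1));
     let \<pi> = (\<lambda>j. softmax_policy lam (q_iterate h (t j)));
     s \<leftarrow> \<nu>;
     a \<leftarrow> act_pmf (\<pi> (k + 1)) s;
     a' \<leftarrow> act_pmf (\<pi> 1) s;
     gs_next \<leftarrow> replicate_pmf (2 ^ k) (gradient_estimator lam m x (\<pi> (k + 1)) s a);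
     gs_cur \<leftarrow> replicate_pmf (2 ^ k) (gradient_estimator lam m x (\<pi> k) s a);
     g1 \<leftarrow> gradient_estimator lam m x (\<pi> 1) s a';
     let dF_next = hypergradient_term lam \<nu> f x (\<pi> (k + 1)) s a (average gs_next);
     let dF_cur = gradient (\<lambda>y. f y (\<pi> k)) x
           + (\<pi> k $ s $ a / \<pi> (k + 1) $ s $ a * (1 / (lam * pmf \<nu> s))
              * gradient (f x) (\<pi> k) $ s $ a) *\<^sub>R average gs_cur;
     let dF_1 = hypergradient_term lam \<nu> f x (\<pi> 1) s a' g1;
     return_pmf (dF_1 + (1 / level_prob K k) *\<^sub>R (dF_next - dF_cur), num_iterations h) }"

section \<open>Bias, variance and complexity\<close>

text \<open>Law of the pair (estimate, number of iterations) when the context is drawn from \<open>\<Xi>\<close>. Estimates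
  carry the Borel sets; the conversion by \<^const>\<open>distr\<close> is needed because all sets of vectors are
  measurable for \<^const>\<open>measure_pmf\<close>, which would be too many for measurability in the context.\<close>

definition estimator_law ::
  "'x measure \<Rightarrow> ('x \<Rightarrow> ((real^'d) \<times> nat) pmf) \<Rightarrow> ((real^'d) \<times> nat) measure" where
  "estimator_law \<Xi> E =
     \<Xi> \<bind> (\<lambda>\<xi>. distr (measure_pmf (E \<xi>)) (borel \<Otimes>\<^sub>M count_space UNIV) (\<lambda>z. z))"

definition estimator_bias :: "((real^'d::finite) \<times> nat) measure \<Rightarrow> real^'d \<Rightarrow> real" where
  "estimator_bias L g = infnorm (\<integral>z. (g - fst z) \<partial>L)"

definition estimator_variance :: "((real^'d::finite) \<times> nat) measure \<Rightarrow> real" where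
  "estimator_variance L = (\<integral>z. (infnorm (fst z - (\<integral>w. fst w \<partial>L)))\<^sup>2 \<partial>L)"

definition iteration_complexity :: "((real^'d) \<times> nat) measure \<Rightarrow> real" where
  "iteration_complexity L = (\<integral>z. real (snd z) \<partial>L)"

text \<open>Since the Bochner integral of a non-integrable function is 0, the three quantities above are
  only meaningful together with the following condition.\<close>

definition well_defined_moments :: "((real^'d::finite) \<times> nat) measure \<Rightarrow> bool" where
  "well_defined_moments L \<longleftrightarrow>
     prob_space L \<and> integrable L fst \<and>
     integrable L (\<lambda>z. (infnorm (fst z - (\<integral>w. fst w \<partial>L)))\<^sup>2) \<and>
     integrable L (\<lambda>z. real (snd z))"

end

theory Submission
  imports Defs
begin

text \<open>Fix a context. The optimal policy is the softmax of the optimal Q-function \<open>Q*\<close>, which is a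
fixed point of the soft Bellman operator (\<open>opt_soft_value_eq\<close>, \<open>soft_bellman_opt_soft_q\<close>).
Differentiating the fixed point equation in \<open>x\<close> shows that the derivative \<open>W\<close> of \<open>Q*\<close> solves the linear
equation \<open>W = D + \<gamma> P W\<close>, where \<open>P\<close> is the transition operator of the optimal policy and \<open>D\<close> collects
the derivative of the reward and that of the kernel applied to the value function
(\<open>Q_opt_has_derivative\<close>). The gradient estimator has a mean for every policy, and conditioning on
whether its geometric horizons are zero yields the same linear equation with the value function of
that policy (\<open>expectation_dQ_estimator_Bellman\<close>). So \<open>W\<close> is the mean of the estimator at the optimal policy,
and the gradient of the leader's objective is the expectation over the context of \<open>\<Psi> Q*\<close>, where
\<open>\<Psi> Q\<close> is the mean of the hypergradient estimator run at the softmax policy of \<open>Q\<close>.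

Bias. Step sizes in \<open>[0, 1]\<close> keep all iterates in a box that depends only on the constants of the
problem. On this box the softmax probabilities are bounded away from zero, so the entropy, all values
and finally \<open>\<Psi>\<close> are bounded and Lipschitz in \<open>Q\<close>, uniformly in the context
(\<open>blip_policy_hypergradient\<close>). The bias at level \<open>K\<close> is therefore at most a constant times the mean distance
of the iterate from \<open>Q*\<close>, that is \<open>O(2\<^bsup>-K/2\<^esup>)\<close>. For the randomly truncated estimator the weights
\<open>1/p\<^sub>k\<close> cancel the probabilities \<open>p\<^sub>k\<close>, and the differences of levels telescope to level \<open>K + 1\<close>.

Variance. The squared gradient estimate grows quadratically in a geometric time, hence has a bounded
mean. In the difference of two levels both terms use the same state and action, the importance ratio
corrects the law of the action, and the gradient estimates are averages of \<open>2\<^sup>k\<close> samples. So the second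
moment of the difference is at most a constant times \<open>2\<^sup>-\<^sup>k\<close> plus the mean squared distance of successive
iterates, which is again \<open>O(2\<^sup>-\<^sup>k)\<close> (\<open>level_estimator_moments\<close>). The sum of \<open>p\<^sub>k (1/p\<^sub>k)\<^sup>2 2\<^sup>-\<^sup>k\<close> over \<open>K\<close> levels is at
most \<open>K\<close>. The expected number of iterations is the sum of \<open>p\<^sub>k t\<^sub>k\<^sub>+\<^sub>1 = O(k)\<close>.

The law of an estimator is a mixture over the context. To integrate against it, the estimators are
written as images of discrete laws with measurable point masses (\<open>measurable_family\<close>), a form that is
preserved by sequential composition.\<close>

section \<open>Gradients and differentiation under the integral\<close>

text \<open>The supremum over a finite index set is attained, so an estimate that contracts the supremum can be
solved for it. Uniqueness, perturbation bounds and differentiability of solutions of Bellman equations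
are all instances.\<close>

lemma sup_contraction_bound:
  fixes e :: "'z::finite \<Rightarrow> 'v::real_normed_vector"
  assumes q: "q < 1"
    and step: "\<And>B z. (\<forall>z'. norm (e z') \<le> B) \<Longrightarrow> norm (e z) \<le> c + q * B"
  shows "norm (e z) \<le> c / (1 - q)"
proof -
  define B where "B = Max (range (\<lambda>z. norm (e z)))"
  have le: "norm (e z') \<le> B" for z'
    unfolding B_def by (rule Max_ge) auto
  have "B \<in> range (\<lambda>z. norm (e z))"
    unfolding B_def by (rule Max_in) auto
  then obtain z0 where "B = norm (e z0)" by auto
  then have "B \<le> c + q * B" using step[of B z0] le by auto
  then have "B \<le> c / (1 - q)"
    using q by (simp add: field_simps)
  with le[of z] show ?thesis by linarith
qed

lemma gradient_eqI:
  assumes "(f has_derivative (\<lambda>h. g \<bullet> h)) (at z)"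
  shows "gradient f z = g"
proof -
  have "frechet_derivative f (at z) = (\<lambda>h. g \<bullet> h)"
    using frechet_derivative_at[OF assms] by simp
  then show ?thesis
    unfolding gradient_def by (simp add: euclidean_representation)
qed

lemma has_derivative_gradient:
  assumes "f differentiable (at z)"
  shows "(f has_derivative (\<lambda>h. gradient f z \<bullet> h)) (at z)"
proof -
  let ?D = "frechet_derivative f (at z)"
  have D: "(f has_derivative ?D) (at z)"
    using assms frechet_derivative_works by blast
  interpret bounded_linear ?D
    using D by (rule has_derivative_bounded_linear)
  have "?D = (\<lambda>h. gradient f z \<bullet> h)"
  proof
    fix h
    have "?D h = ?D (\<Sum>b\<in>Basis. (h \<bullet> b) *\<^sub>R b)"
      by (simp add: euclidean_representation)
    also have "\<dots> = (\<Sum>b\<in>Basis. ?D b * (h \<bullet> b))"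
      by (simp add: sum scaleR mult.commute)
    also have "\<dots> = gradient f z \<bullet> h"
      unfolding gradient_def inner_sum_left
      by (intro sum.cong refl) (simp add: inner_commute)
    finally show "?D h = gradient f z \<bullet> h" .
  qed
  with D show ?thesis by simp
qed

text \<open>A countable sequence of difference quotients determines the gradient. This transfers bounds and
measurability from a function to its gradient.\<close>

lemma difference_quotient_LIMSEQ_gradient:
  fixes f :: "'v::euclidean_space \<Rightarrow> real"
  assumes f: "f differentiable (at z)"
  shows "(\<lambda>n. real (Suc n) * (f (z + (1 / real (Suc n)) *\<^sub>R b) - f z)) \<longlonglongrightarrow> gradient f z \<bullet> b"
proof -
  have D: "((\<lambda>t. f (z + t *\<^sub>R b)) has_derivative (\<lambda>t. gradient f z \<bullet> (t *\<^sub>R b))) (at 0)"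
    by (rule has_derivative_compose[where g = f and f = "\<lambda>t. z + t *\<^sub>R b", simplified])
      (auto intro!: derivative_eq_intros has_derivative_gradient[OF f])
  then have "((\<lambda>t. f (z + t *\<^sub>R b)) has_field_derivative (gradient f z \<bullet> b)) (at 0)"
    by (simp add: has_field_derivative_def mult.commute[of _ "gradient f z \<bullet> b"])
  then have "((\<lambda>t. (f (z + t *\<^sub>R b) - f z) / t) \<longlongrightarrow> gradient f z \<bullet> b) (at 0)"
    by (simp add: has_field_derivative_iff)
  moreover have "filterlim (\<lambda>n. 1 / real (Suc n)) (at 0) sequentially"
    unfolding filterlim_at using LIMSEQ_inverse_real_of_nat
    by (auto simp: inverse_eq_divide)
  ultimately have "(\<lambda>n. (f (z + (1 / real (Suc n)) *\<^sub>R b) - f z) / (1 / real (Suc n)))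
      \<longlonglongrightarrow> gradient f z \<bullet> b"
    by (rule filterlim_compose)
  then show ?thesis by (simp add: mult.commute)
qed

lemma norm_le_DIM_infnorm: "norm (v::'v::euclidean_space) \<le> real DIM('v) * infnorm v"
proof -
  have "norm v \<le> (\<Sum>b\<in>Basis. \<bar>v \<bullet> b\<bar>)" by (rule norm_le_l1)
  also have "\<dots> \<le> (\<Sum>b\<in>(Basis::'v set). infnorm v)"
    by (intro sum_mono Basis_le_infnorm) auto
  finally show ?thesis by simp
qed

lemma norm_gradient_le_Lipschitz:
  fixes f :: "'v::euclidean_space \<Rightarrow> real"
  assumes f: "f differentiable (at z)" and S: "open S" "z \<in> S"
    and L: "\<And>y. y \<in> S \<Longrightarrow> \<bar>f y - f z\<bar> \<le> L * infnorm (y - z)" "0 \<le> L"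
  shows "norm (gradient f z) \<le> real DIM('v) * L"
proof -
  have *: "\<bar>gradient f z \<bullet> b\<bar> \<le> L" if "b \<in> Basis" for b
  proof (rule LIMSEQ_le_const2)
    show "(\<lambda>n. \<bar>real (Suc n) * (f (z + (1 / real (Suc n)) *\<^sub>R b) - f z)\<bar>) \<longlonglongrightarrow> \<bar>gradient f z \<bullet> b\<bar>"
      by (intro tendsto_rabs difference_quotient_LIMSEQ_gradient f)
    have "(\<lambda>n. z + (1 / real (Suc n)) *\<^sub>R b) \<longlonglongrightarrow> z + 0 *\<^sub>R b"
      using LIMSEQ_inverse_real_of_nat by (intro tendsto_intros) (simp add: inverse_eq_divide)
    then have "eventually (\<lambda>n. z + (1 / real (Suc n)) *\<^sub>R b \<in> S) sequentially"
      using S by (auto dest: topological_tendstoD)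
    then obtain N where N: "\<And>n. n \<ge> N \<Longrightarrow> z + (1 / real (Suc n)) *\<^sub>R b \<in> S"
      by (auto simp: eventually_sequentially)
    have "\<bar>real (Suc n) * (f (z + (1 / real (Suc n)) *\<^sub>R b) - f z)\<bar> \<le> L" if "n \<ge> N" for n
    proof -
      have "\<bar>f (z + (1 / real (Suc n)) *\<^sub>R b) - f z\<bar> \<le> L * infnorm ((1 / real (Suc n)) *\<^sub>R b)"
        using L(1)[OF N[OF that]] by simp
      also have "\<dots> \<le> L * norm ((1 / real (Suc n)) *\<^sub>R b)"
        by (intro mult_left_mono infnorm_le_norm L)
      also have "\<dots> = L / real (Suc n)" using \<open>b \<in> Basis\<close> by simp
      finally have "real (Suc n) * \<bar>f (z + (1 / real (Suc n)) *\<^sub>R b) - f z\<bar> \<le> L"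
        by (simp add: field_simps)
      then show ?thesis by (simp add: abs_mult)
    qed
    then show "\<exists>N. \<forall>n\<ge>N. \<bar>real (Suc n) * (f (z + (1 / real (Suc n)) *\<^sub>R b) - f z)\<bar> \<le> L"
      by blast
  qed
  have "infnorm (gradient f z) \<le> L"
    unfolding infnorm_def using * by (intro cSup_least) auto
  then have "real DIM('v) * infnorm (gradient f z) \<le> real DIM('v) * L"
    by (intro mult_left_mono) auto
  then show ?thesis using norm_le_DIM_infnorm[of "gradient f z"] by linarith
qed

lemma borel_measurable_gradient:
  fixes \<phi> :: "'x \<Rightarrow> 'v::euclidean_space \<Rightarrow> real"
  assumes S: "open S" "z \<in> S"
    and meas: "\<And>y. y \<in> S \<Longrightarrow> (\<lambda>\<xi>. \<phi> \<xi> y) \<in> borel_measurable N"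
    and diff: "\<And>\<xi>. \<xi> \<in> space N \<Longrightarrow> \<phi> \<xi> differentiable (at z)"
  shows "(\<lambda>\<xi>. gradient (\<phi> \<xi>) z) \<in> borel_measurable N"
proof (rule borel_measurable_euclidean_space[THEN iffD2], rule ballI)
  fix b :: 'v assume "b \<in> Basis"
  have "(\<lambda>n. z + (1 / real (Suc n)) *\<^sub>R b) \<longlonglongrightarrow> z + 0 *\<^sub>R b"
    using LIMSEQ_inverse_real_of_nat by (intro tendsto_intros) (simp add: inverse_eq_divide)
  then have "eventually (\<lambda>n. z + (1 / real (Suc n)) *\<^sub>R b \<in> S) sequentially"
    using S by (auto dest: topological_tendstoD)
  then obtain m where m: "\<And>n. n \<ge> m \<Longrightarrow> z + (1 / real (Suc n)) *\<^sub>R b \<in> S"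
    by (auto simp: eventually_sequentially)
  show "(\<lambda>\<xi>. gradient (\<phi> \<xi>) z \<bullet> b) \<in> borel_measurable N"
  proof (rule borel_measurable_LIMSEQ_real)
    show "(\<lambda>n. real (Suc (n + m)) * (\<phi> \<xi> (z + (1 / real (Suc (n + m))) *\<^sub>R b) - \<phi> \<xi> z))
        \<longlonglongrightarrow> gradient (\<phi> \<xi>) z \<bullet> b" if "\<xi> \<in> space N" for \<xi>
      by (rule LIMSEQ_ignore_initial_segment[OF difference_quotient_LIMSEQ_gradient[OF diff[OF that]]])
    show "(\<lambda>\<xi>. real (Suc (n + m)) * (\<phi> \<xi> (z + (1 / real (Suc (n + m))) *\<^sub>R b) - \<phi> \<xi> z))
        \<in> borel_measurable N" for n
      by (intro borel_measurable_times borel_measurable_const borel_measurable_diff meas m S) simp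
  qed
qed

text \<open>If \<open>g\<close> takes finitely many values, the composition is patched together from finitely many of the
functions \<open>\<phi> p\<close>. Continuity in \<open>p\<close> passes this on to limits of simple functions. The approximants need not
lie in \<open>U\<close>, but since \<open>U\<close> is open they eventually do.\<close>

lemma borel_measurable_Caratheodory:
  fixes \<phi> :: "'p::euclidean_space \<Rightarrow> 'x \<Rightarrow> 'v::euclidean_space"
  assumes U: "open U" and meas: "\<And>p. p \<in> U \<Longrightarrow> \<phi> p \<in> borel_measurable N"
    and cont: "\<And>\<xi>. \<xi> \<in> space N \<Longrightarrow> continuous_on U (\<lambda>p. \<phi> p \<xi>)"
    and g: "g \<in> borel_measurable N" "\<And>\<xi>. \<xi> \<in> space N \<Longrightarrow> g \<xi> \<in> U"
  shows "(\<lambda>\<xi>. \<phi> (g \<xi>) \<xi>) \<in> borel_measurable N"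
proof -
  obtain s where s: "\<And>i. simple_function N (s i)" "\<And>\<xi>. \<xi> \<in> space N \<Longrightarrow> (\<lambda>i. s i \<xi>) \<longlonglongrightarrow> g \<xi>"
    using borel_measurable_implies_sequence_metric[OF g(1)] by metis
  show ?thesis
  proof (rule borel_measurable_LIMSEQ_metric)
    fix i
    show "(\<lambda>\<xi>. if s i \<xi> \<in> U then \<phi> (s i \<xi>) \<xi> else 0) \<in> borel_measurable N"
    proof (rule measurable_compose_countable'[where I = "s i ` space N"
          and f = "\<lambda>p \<xi>. if p \<in> U then \<phi> p \<xi> else 0"])
      show "(\<lambda>\<xi>. if p \<in> U then \<phi> p \<xi> else 0) \<in> borel_measurable N" for p
        using meas[of p] by (cases "p \<in> U") simp_all
      show "s i \<in> measurable N (count_space (s i ` space N))"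
        using s(1)[of i] unfolding simple_function_def
        by (auto simp: measurable_count_space_eq2)
      show "countable (s i ` space N)"
        using s(1)[of i] unfolding simple_function_def by (auto intro: countable_finite)
    qed
  next
    fix \<xi> assume \<xi>: "\<xi> \<in> space N"
    have ev: "eventually (\<lambda>i. s i \<xi> \<in> U) sequentially"
      using s(2)[OF \<xi>] U g(2)[OF \<xi>] by (auto dest: topological_tendstoD)
    have "isCont (\<lambda>p. \<phi> p \<xi>) (g \<xi>)"
      using cont[OF \<xi>] U g(2)[OF \<xi>] by (simp add: continuous_on_eq_continuous_at)
    then have "(\<lambda>i. \<phi> (s i \<xi>) \<xi>) \<longlonglongrightarrow> \<phi> (g \<xi>) \<xi>"
      using s(2)[OF \<xi>] by (rule isCont_tendsto_compose)
    then show "(\<lambda>i. if s i \<xi> \<in> U then \<phi> (s i \<xi>) \<xi> else 0) \<longlonglongrightarrow> \<phi> (g \<xi>) \<xi>"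
      by (rule Lim_transform_eventually) (use ev in \<open>eventually_elim, simp\<close>)
  qed
qed

text \<open>Dominated convergence, applied to the remainder of the first-order expansion divided by \<open>norm (y - z)\<close>
along an arbitrary sequence that tends to \<open>z\<close>. The Lipschitz bound dominates the difference quotient, and the
bound on \<open>D\<close> its linear part.\<close>

lemma has_derivative_integral_dominated:
  fixes \<phi> :: "'v::euclidean_space \<Rightarrow> 'x \<Rightarrow> real"
  assumes N: "prob_space N" and S: "open S" "z \<in> S"
    and int: "\<And>y. y \<in> S \<Longrightarrow> integrable N (\<phi> y)"
    and der: "\<And>\<xi>. \<xi> \<in> space N \<Longrightarrow> ((\<lambda>y. \<phi> y \<xi>) has_derivative (\<lambda>h. D \<xi> \<bullet> h)) (at z)"
    and Lip: "\<And>\<xi> y. \<xi> \<in> space N \<Longrightarrow> y \<in> S \<Longrightarrow> \<bar>\<phi> y \<xi> - \<phi> z \<xi>\<bar> \<le> C * norm (y - z)"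
    and bound: "\<And>\<xi>. \<xi> \<in> space N \<Longrightarrow> norm (D \<xi>) \<le> C"
  shows "integrable N D"
    and "((\<lambda>y. \<integral>\<xi>. \<phi> y \<xi> \<partial>N) has_derivative (\<lambda>h. (\<integral>\<xi>. D \<xi> \<partial>N) \<bullet> h)) (at z)"
proof -
  interpret prob_space N by fact
  have D_eq: "D \<xi> = gradient (\<lambda>y. \<phi> y \<xi>) z" if "\<xi> \<in> space N" for \<xi>
    using gradient_eqI[OF der[OF that]] by simp
  have "(\<lambda>\<xi>. gradient (\<lambda>y. \<phi> y \<xi>) z) \<in> borel_measurable N"
    using int der by (intro borel_measurable_gradient[OF S]) (auto intro: differentiableI)
  then have meas: "D \<in> borel_measurable N"
    by (subst measurable_cong[OF D_eq])
  show intD: "integrable N D"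
    by (rule integrable_const_bound[where B = C]) (use meas bound in auto)
  have C: "0 \<le> C" using not_empty bound norm_ge_zero order_trans by blast
  show "((\<lambda>y. \<integral>\<xi>. \<phi> y \<xi> \<partial>N) has_derivative (\<lambda>h. (\<integral>\<xi>. D \<xi> \<partial>N) \<bullet> h)) (at z)"
    unfolding has_derivative_at_within diff_diff_eq inverse_eq_divide
  proof (intro conjI bounded_linear_inner_right)
    let ?r = "\<lambda>y \<xi>. (1 / norm (y - z)) *\<^sub>R (\<phi> y \<xi> - (\<phi> z \<xi> + D \<xi> \<bullet> (y - z)))"
    show "((\<lambda>y. (1 / norm (y - z)) *\<^sub>R ((\<integral>\<xi>. \<phi> y \<xi> \<partial>N) - ((\<integral>\<xi>. \<phi> z \<xi> \<partial>N) + (\<integral>\<xi>. D \<xi> \<partial>N) \<bullet> (y - z))))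
        \<longlongrightarrow> 0) (at z)"
      unfolding tendsto_at_iff_sequentially
    proof (intro allI impI)
      fix Y assume Y: "\<forall>i. Y i \<in> UNIV - {z}" "Y \<longlonglongrightarrow> z"
      then have "eventually (\<lambda>i. Y i \<in> S) sequentially"
        using S by (auto dest: topological_tendstoD)
      then obtain m where m: "\<And>i. i \<ge> m \<Longrightarrow> Y i \<in> S"
        by (auto simp: eventually_sequentially)
      have "(\<lambda>i. \<integral>\<xi>. ?r (Y (i + m)) \<xi> \<partial>N) \<longlonglongrightarrow> (\<integral>\<xi>. 0 \<partial>N)"
      proof (rule integral_dominated_convergence[where w = "\<lambda>_. 2 * C"])
        show "?r (Y (i + m)) \<in> borel_measurable N" for i
          using int[OF m[of "i + m"]] int[OF S(2)] meas by (auto intro!: borel_measurable_integrable)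
        show "AE \<xi> in N. (\<lambda>i. ?r (Y (i + m)) \<xi>) \<longlonglongrightarrow> 0"
        proof (rule AE_I2)
          fix \<xi> assume "\<xi> \<in> space N"
          from der[OF this] have "((\<lambda>y. ?r y \<xi>) \<longlongrightarrow> 0) (at z)"
            by (simp only: has_derivative_at_within diff_diff_eq inverse_eq_divide)
          then have "(\<lambda>i. ?r (Y i) \<xi>) \<longlonglongrightarrow> 0"
            using Y unfolding tendsto_at_iff_sequentially by (auto simp: o_def)
          then show "(\<lambda>i. ?r (Y (i + m)) \<xi>) \<longlonglongrightarrow> 0"
            by (rule LIMSEQ_ignore_initial_segment)
        qed
        show "AE \<xi> in N. norm (?r (Y (i + m)) \<xi>) \<le> 2 * C" for i
        proof (rule AE_I2)
          fix \<xi> assume \<xi>: "\<xi> \<in> space N"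
          let ?y = "Y (i + m)"
          have pos: "norm (?y - z) > 0" using Y by auto
          have "\<bar>\<phi> ?y \<xi> - (\<phi> z \<xi> + D \<xi> \<bullet> (?y - z))\<bar> \<le> \<bar>\<phi> ?y \<xi> - \<phi> z \<xi>\<bar> + \<bar>D \<xi> \<bullet> (?y - z)\<bar>"
            by linarith
          also have "\<dots> \<le> C * norm (?y - z) + norm (D \<xi>) * norm (?y - z)"
            by (intro add_mono Lip \<xi> m Cauchy_Schwarz_ineq2) simp
          also have "\<dots> \<le> 2 * C * norm (?y - z)"
            using mult_right_mono[OF bound[OF \<xi>] norm_ge_zero[of "?y - z"]] by simp
          finally show "norm (?r ?y \<xi>) \<le> 2 * C"
            using pos by (simp add: field_simps)
        qed
      qed auto
      moreover have "(\<integral>\<xi>. ?r (Y (i + m)) \<xi> \<partial>N) = (1 / norm (Y (i + m) - z)) *\<^sub>R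
          ((\<integral>\<xi>. \<phi> (Y (i + m)) \<xi> \<partial>N) - ((\<integral>\<xi>. \<phi> z \<xi> \<partial>N) + (\<integral>\<xi>. D \<xi> \<partial>N) \<bullet> (Y (i + m) - z)))" for i
        using int[OF m[of "i + m"]] int[OF S(2)] intD by simp
      ultimately show "((\<lambda>y. (1 / norm (y - z)) *\<^sub>R ((\<integral>\<xi>. \<phi> y \<xi> \<partial>N) - ((\<integral>\<xi>. \<phi> z \<xi> \<partial>N) + (\<integral>\<xi>. D \<xi> \<partial>N) \<bullet> (y - z)))) \<circ> Y)
          \<longlonglongrightarrow> 0"
        by - (rule LIMSEQ_offset[where k = m], simp only: o_def Bochner_Integration.integral_zero)
    qed
  qed
qed

section \<open>Means and second moments of mixtures\<close>

abbreviation \<E> where "\<E> p \<equiv> measure_pmf.expectation p"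

text \<open>The law of total expectation for functions that are integrable but unbounded, as estimates with
geometric horizons are. It follows from the nonnegative case applied to the positive and the negative part.\<close>

lemma
  fixes f :: "'b \<Rightarrow> real"
  assumes \<kappa>: "\<kappa> \<in> measurable M (subprob_algebra B)" and f: "f \<in> borel_measurable B"
    and int: "integrable (M \<bind> \<kappa>) f" and ne: "space M \<noteq> {}"
  shows integrable_integral_bind_real: "integrable M (\<lambda>x. \<integral>y. f y \<partial>\<kappa> x)"
    and integral_bind_integrable_real: "(\<integral>y. f y \<partial>(M \<bind> \<kappa>)) = (\<integral>x. \<integral>y. f y \<partial>\<kappa> x \<partial>M)"
proof -
  define P where "P x = (\<integral>\<^sup>+y. ennreal (f y) \<partial>\<kappa> x)" for x
  define Q where "Q x = (\<integral>\<^sup>+y. ennreal (- f y) \<partial>\<kappa> x)" for x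
  note [measurable] = f
  have meas[measurable]: "P \<in> borel_measurable M" "Q \<in> borel_measurable M"
    unfolding P_def [abs_def] Q_def [abs_def]
    using measurable_compose[OF \<kappa> nn_integral_measurable_subprob_algebra[of "\<lambda>y. ennreal (f y)" B]]
      measurable_compose[OF \<kappa> nn_integral_measurable_subprob_algebra[of "\<lambda>y. ennreal (- f y)" B]]
    by simp_all
  have eq: "(\<integral>\<^sup>+y. ennreal (f y) \<partial>(M \<bind> \<kappa>)) = (\<integral>\<^sup>+x. P x \<partial>M)"
      "(\<integral>\<^sup>+y. ennreal (- f y) \<partial>(M \<bind> \<kappa>)) = (\<integral>\<^sup>+x. Q x \<partial>M)"
    unfolding P_def Q_def by (auto intro!: nn_integral_bind[OF _ \<kappa>])
  have fin: "(\<integral>\<^sup>+x. P x \<partial>M) < \<infinity>" "(\<integral>\<^sup>+x. Q x \<partial>M) < \<infinity>"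
    using int unfolding real_integrable_def eq by (auto simp: less_top)
  have AEfin: "AE x in M. P x < \<infinity> \<and> Q x < \<infinity>"
    using nn_integral_noteq_infinite[OF meas(1)] nn_integral_noteq_infinite[OF meas(2)] fin
    by (auto simp: less_top)
  have AEeq: "AE x in M. (\<integral>y. f y \<partial>\<kappa> x) = enn2real (P x) - enn2real (Q x)"
    using AEfin
  proof (rule AE_mp, intro AE_I2 impI)
    fix x assume x: "x \<in> space M" and "P x < \<infinity> \<and> Q x < \<infinity>"
    moreover have "f \<in> borel_measurable (\<kappa> x)"
      using f sets_kernel[OF \<kappa> x] by (simp cong: measurable_cong_sets)
    ultimately have "integrable (\<kappa> x) f"
      unfolding real_integrable_def P_def Q_def by auto
    then show "(\<integral>y. f y \<partial>\<kappa> x) = enn2real (P x) - enn2real (Q x)"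
      unfolding P_def Q_def by (rule real_lebesgue_integral_def)
  qed
  have int': "integrable M (\<lambda>x. enn2real (R x)) \<and> (\<integral>x. enn2real (R x) \<partial>M) = enn2real (\<integral>\<^sup>+x. R x \<partial>M)"
    if [measurable]: "R \<in> borel_measurable M" and fin: "(\<integral>\<^sup>+x. R x \<partial>M) < \<infinity>" for R
  proof -
    have "AE x in M. R x \<noteq> \<infinity>" using nn_integral_noteq_infinite[OF that(1)] fin by auto
    then have "AE x in M. ennreal (enn2real (R x)) = R x"
      by eventually_elim (simp add: less_top)
    then have e: "(\<integral>\<^sup>+x. ennreal (enn2real (R x)) \<partial>M) = (\<integral>\<^sup>+x. R x \<partial>M)"
      by (rule nn_integral_cong_AE)
    have "integrable M (\<lambda>x. enn2real (R x))"
      by (rule integrableI_nonneg) (use e fin in auto)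
    then show ?thesis using e
      by (metis enn2real_nonneg integral_eq_nn_integral AE_I2 borel_measurable_integrable)
  qed
  have diff: "integrable M (\<lambda>x. enn2real (P x) - enn2real (Q x))"
    using int'[OF meas(1) fin(1)] int'[OF meas(2) fin(2)] by simp
  have m: "(\<lambda>x. \<integral>y. f y \<partial>\<kappa> x) \<in> borel_measurable M"
    by (rule measurable_compose[OF \<kappa> integral_measurable_subprob_algebra[OF f]])
  show "integrable M (\<lambda>x. \<integral>y. f y \<partial>\<kappa> x)"
    by (rule integrable_cong_AE_imp[OF diff m]) (use AEeq in eventually_elim, simp)
  have "(\<integral>y. f y \<partial>(M \<bind> \<kappa>)) = enn2real (\<integral>\<^sup>+x. P x \<partial>M) - enn2real (\<integral>\<^sup>+x. Q x \<partial>M)"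
    unfolding real_lebesgue_integral_def[OF int] eq ..
  also have "\<dots> = (\<integral>x. enn2real (P x) - enn2real (Q x) \<partial>M)"
    using int'[OF meas(1) fin(1)] int'[OF meas(2) fin(2)] by simp
  also have "\<dots> = (\<integral>x. \<integral>y. f y \<partial>\<kappa> x \<partial>M)"
    using AEeq by (intro integral_cong_AE m) (auto elim: AE_mp)
  finally show "(\<integral>y. f y \<partial>(M \<bind> \<kappa>)) = (\<integral>x. \<integral>y. f y \<partial>\<kappa> x \<partial>M)" .
qed

lemma
  fixes f :: "'b \<Rightarrow> 'v::euclidean_space"
  assumes \<kappa>: "\<kappa> \<in> measurable M (subprob_algebra B)"
    and int: "integrable (M \<bind> \<kappa>) f" and ne: "space M \<noteq> {}"
  shows integrable_integral_bind: "(\<And>x. x \<in> space M \<Longrightarrow> integrable (\<kappa> x) f) \<Longrightarrow> integrable M (\<lambda>x. \<integral>y. f y \<partial>\<kappa> x)"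
    and integral_bind_integrable: "(\<And>x. x \<in> space M \<Longrightarrow> integrable (\<kappa> x) f) \<Longrightarrow> (\<integral>y. f y \<partial>(M \<bind> \<kappa>)) = (\<integral>x. \<integral>y. f y \<partial>\<kappa> x \<partial>M)"
proof -
  assume inner: "\<And>x. x \<in> space M \<Longrightarrow> integrable (\<kappa> x) f"
  have sets: "sets (M \<bind> \<kappa>) = sets B"
    by (rule sets_bind[OF sets_kernel[OF \<kappa>] ne])
  have f: "f \<in> borel_measurable B"
    using borel_measurable_integrable[OF int] sets by (simp cong: measurable_cong_sets)
  have comp: "(\<lambda>y. f y \<bullet> b) \<in> borel_measurable B" "integrable (M \<bind> \<kappa>) (\<lambda>y. f y \<bullet> b)" for b
    using f int by auto
  have eq: "(\<integral>y. f y \<partial>\<kappa> x) \<bullet> b = (\<integral>y. f y \<bullet> b \<partial>\<kappa> x)" if "x \<in> space M" for x b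
    using inner[OF that] by (simp add: integral_inner_left)
  have i: "integrable M (\<lambda>x. (\<integral>y. f y \<partial>\<kappa> x) \<bullet> b)" for b
    using integrable_integral_bind_real[OF \<kappa> comp ne, of b]
    by (subst Bochner_Integration.integrable_cong[OF refl eq])
  have "integrable M (\<lambda>x. \<Sum>b\<in>Basis. ((\<integral>y. f y \<partial>\<kappa> x) \<bullet> b) *\<^sub>R b)"
    by (intro Bochner_Integration.integrable_sum integrable_scaleR_left i)
  then show 1: "integrable M (\<lambda>x. \<integral>y. f y \<partial>\<kappa> x)"
    by (simp add: euclidean_representation)
  show "(\<integral>y. f y \<partial>(M \<bind> \<kappa>)) = (\<integral>x. \<integral>y. f y \<partial>\<kappa> x \<partial>M)"
  proof (rule euclidean_eqI)
    fix b :: 'v assume "b \<in> Basis"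
    have "(\<integral>y. f y \<partial>(M \<bind> \<kappa>)) \<bullet> b = (\<integral>y. f y \<bullet> b \<partial>(M \<bind> \<kappa>))"
      using int by (simp add: integral_inner_left)
    also have "\<dots> = (\<integral>x. \<integral>y. f y \<bullet> b \<partial>\<kappa> x \<partial>M)"
      by (rule integral_bind_integrable_real[OF \<kappa> comp ne])
    also have "\<dots> = (\<integral>x. (\<integral>y. f y \<partial>\<kappa> x) \<bullet> b \<partial>M)"
      by (intro Bochner_Integration.integral_cong refl eq[symmetric])
    also have "\<dots> = (\<integral>x. \<integral>y. f y \<partial>\<kappa> x \<partial>M) \<bullet> b"
      using 1 by (simp add: integral_inner_left)
    finally show "(\<integral>y. f y \<partial>(M \<bind> \<kappa>)) \<bullet> b = (\<integral>x. \<integral>y. f y \<partial>\<kappa> x \<partial>M) \<bullet> b" .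
  qed
qed

text \<open>Bias and variance only need the mean and a bound on the second moment. Integrability is part of the
predicate, so that the rules for affine maps, sums and mixtures compose without side conditions.\<close>

definition has_moments :: "'b measure \<Rightarrow> ('b \<Rightarrow> 'v::euclidean_space) \<Rightarrow> 'v \<Rightarrow> real \<Rightarrow> bool" where
  "has_moments p X \<mu> B \<longleftrightarrow> prob_space p \<and> integrable p X \<and> (\<integral>z. X z \<partial>p) = \<mu> \<and>
     integrable p (\<lambda>z. (norm (X z))\<^sup>2) \<and> (\<integral>z. (norm (X z))\<^sup>2 \<partial>p) \<le> B"

lemma has_momentsI:
  assumes p: "prob_space p" and X: "X \<in> borel_measurable p"
    and nn: "(\<integral>\<^sup>+z. ennreal ((norm (X z))\<^sup>2) \<partial>p) \<le> ennreal B" and B: "0 \<le> B"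
  shows "has_moments p X (\<integral>z. X z \<partial>p) B"
proof -
  interpret prob_space p by fact
  have sq: "integrable p (\<lambda>z. (norm (X z))\<^sup>2)"
    by (rule integrableI_nonneg) (use X nn in \<open>auto intro: le_less_trans\<close>)
  have "integrable p X"
  proof (rule Bochner_Integration.integrable_bound)
    show "integrable p (\<lambda>z. 1 + (norm (X z))\<^sup>2)" using sq by simp
    show "AE z in p. norm (X z) \<le> norm (1 + (norm (X z))\<^sup>2)"
    proof (rule AE_I2)
      fix z
      \<comment> \<open>a square integrable function on a probability space is integrable\<close>
      have "0 \<le> (norm (X z) - 1 / 2)\<^sup>2" by simp
      then have "norm (X z) \<le> 1 + (norm (X z))\<^sup>2"
        by (simp add: power2_eq_square algebra_simps)
      then show "norm (X z) \<le> norm (1 + (norm (X z))\<^sup>2)" by simp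
    qed
  qed (use X in simp)
  moreover have "(\<integral>z. (norm (X z))\<^sup>2 \<partial>p) \<le> B"
    using nn B sq by (subst (asm) nn_integral_eq_integral) auto
  ultimately show ?thesis using p sq by (simp add: has_moments_def)
qed

lemma has_moments_nn:
  assumes "has_moments p X \<mu> B"
  shows "(\<integral>\<^sup>+z. ennreal ((norm (X z))\<^sup>2) \<partial>p) \<le> ennreal B" "0 \<le> B"
proof -
  have "0 \<le> (\<integral>z. (norm (X z))\<^sup>2 \<partial>p)" by simp
  then show "0 \<le> B" using assms unfolding has_moments_def by linarith
  show "(\<integral>\<^sup>+z. ennreal ((norm (X z))\<^sup>2) \<partial>p) \<le> ennreal B"
    using assms unfolding has_moments_def by (subst nn_integral_eq_integral) (auto intro: ennreal_leI)
qed

lemma has_moments_mono: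
  assumes "has_moments p X \<mu> B" "B \<le> B'"
  shows "has_moments p X \<mu> B'"
  using assms by (auto simp: has_moments_def)

lemma has_moments_return_pmf: "has_moments (measure_pmf (return_pmf c)) X (X c) ((norm (X c))\<^sup>2)"
  by (simp add: has_moments_def prob_space_measure_pmf integrable_measure_pmf_finite)

lemma has_moments_map_pmf:
  "has_moments (measure_pmf (map_pmf g p)) X \<mu> B \<longleftrightarrow> has_moments (measure_pmf p) (\<lambda>z. X (g z)) \<mu> B"
  by (simp add: has_moments_def prob_space_measure_pmf)

text \<open>The difference of the two sides bounds the variance, which is nonnegative.\<close>

lemma has_moments_norm_mean:
  assumes "has_moments p X \<mu> B"
  shows "(norm \<mu>)\<^sup>2 \<le> B"
proof -
  interpret prob_space p using assms by (simp add: has_moments_def)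
  have i: "integrable p X" "integrable p (\<lambda>z. (norm (X z))\<^sup>2)" and mu: "\<mu> = (\<integral>z. X z \<partial>p)"
    using assms by (auto simp: has_moments_def)
  have "0 \<le> (\<integral>z. (norm (X z - \<mu>))\<^sup>2 \<partial>p)" by simp
  also have "\<dots> = (\<integral>z. (norm (X z))\<^sup>2 - 2 * (X z \<bullet> \<mu>) + (norm \<mu>)\<^sup>2 \<partial>p)"
    by (intro Bochner_Integration.integral_cong refl)
      (simp add: power2_norm_eq_inner algebra_simps inner_commute)
  also have "\<dots> = (\<integral>z. (norm (X z))\<^sup>2 \<partial>p) - 2 * (\<mu> \<bullet> \<mu>) + (norm \<mu>)\<^sup>2"
    using i by (simp add: mu prob_space)
  finally show ?thesis using assms by (simp add: has_moments_def power2_norm_eq_inner)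
qed

lemma has_moments_affine:
  assumes "has_moments p X \<mu> B"
  shows "has_moments p (\<lambda>z. a *\<^sub>R X z + c) (a *\<^sub>R \<mu> + c) (a\<^sup>2 * B + 2 * a * (\<mu> \<bullet> c) + (norm c)\<^sup>2)"
proof -
  interpret prob_space p using assms by (simp add: has_moments_def)
  have i: "integrable p X" "integrable p (\<lambda>z. (norm (X z))\<^sup>2)" and mu: "(\<integral>z. X z \<partial>p) = \<mu>"
    and le: "(\<integral>z. (norm (X z))\<^sup>2 \<partial>p) \<le> B"
    using assms by (auto simp: has_moments_def)
  have e: "(\<lambda>z. (norm (a *\<^sub>R X z + c))\<^sup>2) = (\<lambda>z. a\<^sup>2 * (norm (X z))\<^sup>2 + 2 * a * (X z \<bullet> c) + (norm c)\<^sup>2)"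
    unfolding power2_norm_eq_inner
    by (rule ext) (simp add: inner_add_left inner_add_right inner_commute power2_eq_square[of a] algebra_simps
        del: inner_same_Basis dot_square_norm)
  show ?thesis
    using i le mult_left_mono[OF le, of "a\<^sup>2"]
    unfolding has_moments_def e by (simp add: mu prob_space prob_space_axioms)
qed

lemma has_moments_affine_le:
  assumes "has_moments p X \<mu> B"
  shows "has_moments p (\<lambda>z. a *\<^sub>R X z + c) (a *\<^sub>R \<mu> + c) (2 * a\<^sup>2 * B + 2 * (norm c)\<^sup>2)"
proof (rule has_moments_mono[OF has_moments_affine[OF assms]])
  have "0 \<le> (norm (a *\<^sub>R \<mu> - c))\<^sup>2" by simp
  also have "(norm (a *\<^sub>R \<mu> - c))\<^sup>2 = a\<^sup>2 * (norm \<mu>)\<^sup>2 - 2 * a * (\<mu> \<bullet> c) + (norm c)\<^sup>2"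
    unfolding power2_norm_eq_inner
    by (simp add: inner_diff_left inner_diff_right inner_commute power2_eq_square[of a] algebra_simps)
  also have "a\<^sup>2 * (norm \<mu>)\<^sup>2 \<le> a\<^sup>2 * B"
    by (intro mult_left_mono has_moments_norm_mean[OF assms]) simp
  finally show "a\<^sup>2 * B + 2 * a * (\<mu> \<bullet> c) + (norm c)\<^sup>2 \<le> 2 * a\<^sup>2 * B + 2 * (norm c)\<^sup>2"
    using zero_le_power2[of "norm c"] by linarith
qed

lemma has_moments_center:
  assumes "has_moments p X \<mu> B"
  shows "has_moments p (\<lambda>z. X z - \<mu>) 0 B"
  using has_moments_affine[OF assms, of 1 "- \<mu>"]
  by (auto simp: power2_norm_eq_inner intro: has_moments_mono)

lemma has_moments_add:
  assumes "has_moments p X \<mu> B" "has_moments p Y \<mu>' B'"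
  shows "has_moments p (\<lambda>z. X z + Y z) (\<mu> + \<mu>') (2 * B + 2 * B')"
proof -
  have i: "integrable p X" "integrable p (\<lambda>z. (norm (X z))\<^sup>2)" "(\<integral>z. X z \<partial>p) = \<mu>"
    "(\<integral>z. (norm (X z))\<^sup>2 \<partial>p) \<le> B" and
    j: "integrable p Y" "integrable p (\<lambda>z. (norm (Y z))\<^sup>2)" "(\<integral>z. Y z \<partial>p) = \<mu>'"
    "(\<integral>z. (norm (Y z))\<^sup>2 \<partial>p) \<le> B'" and p: "prob_space p"
    using assms by (auto simp: has_moments_def)
  have pt: "(norm (X z + Y z))\<^sup>2 \<le> 2 * (norm (X z))\<^sup>2 + 2 * (norm (Y z))\<^sup>2" for z
  proof -
    have "0 \<le> (norm (X z - Y z))\<^sup>2" by simp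
    then show ?thesis by (simp add: power2_norm_eq_inner algebra_simps inner_commute)
  qed
  have int: "integrable p (\<lambda>z. (norm (X z + Y z))\<^sup>2)"
    by (rule Bochner_Integration.integrable_bound[of _ "\<lambda>z. 2 * (norm (X z))\<^sup>2 + 2 * (norm (Y z))\<^sup>2"])
      (use i j pt in \<open>auto simp: borel_measurable_integrable\<close>)
  have "(\<integral>z. (norm (X z + Y z))\<^sup>2 \<partial>p) \<le> (\<integral>z. 2 * (norm (X z))\<^sup>2 + 2 * (norm (Y z))\<^sup>2 \<partial>p)"
    by (rule integral_mono) (use int i j pt in auto)
  also have "\<dots> \<le> 2 * B + 2 * B'" using i j by simp
  finally show ?thesis using i j int p by (simp add: has_moments_def)
qed

lemma has_moments_bind:
  assumes M: "prob_space M" and \<kappa>: "\<kappa> \<in> measurable M (subprob_algebra S)"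
    and X: "X \<in> borel_measurable S"
    and AE: "\<And>x. x \<in> space M \<Longrightarrow> has_moments (\<kappa> x) X (\<mu> x) (B x)"
    and B: "integrable M B"
  shows "has_moments (M \<bind> \<kappa>) X (\<integral>x. \<mu> x \<partial>M) (\<integral>x. B x \<partial>M)" "integrable M \<mu>"
proof -
  interpret M: prob_space M by fact
  have ne: "space M \<noteq> {}" by (rule M.not_empty)
  have sets: "sets (M \<bind> \<kappa>) = sets S"
    by (rule sets_bind[OF sets_kernel[OF \<kappa>] ne])
  have "prob_space (\<kappa> x)" if "x \<in> space M" for x
    using AE[OF that] by (simp add: has_moments_def)
  then have prob: "prob_space (M \<bind> \<kappa>)"
    by (intro M.prob_space_bind[OF _ \<kappa>]) auto
  have nn: "(\<integral>\<^sup>+z. ennreal ((norm (X z))\<^sup>2) \<partial>(M \<bind> \<kappa>)) \<le> ennreal (\<integral>x. B x \<partial>M)"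
  proof -
    have "(\<integral>\<^sup>+z. ennreal ((norm (X z))\<^sup>2) \<partial>(M \<bind> \<kappa>)) = (\<integral>\<^sup>+x. \<integral>\<^sup>+z. ennreal ((norm (X z))\<^sup>2) \<partial>\<kappa> x \<partial>M)"
      by (rule nn_integral_bind[OF _ \<kappa>]) (use X in measurable)
    also have "\<dots> \<le> (\<integral>\<^sup>+x. ennreal (B x) \<partial>M)"
      by (intro nn_integral_mono has_moments_nn(1)[OF AE])
    also have "\<dots> = ennreal (\<integral>x. B x \<partial>M)"
      by (rule nn_integral_eq_integral[OF B]) (use has_moments_nn[OF AE] in auto)
    finally show ?thesis .
  qed
  have "0 \<le> (\<integral>x. B x \<partial>M)"
    by (intro Bochner_Integration.integral_nonneg) (use has_moments_nn[OF AE] in auto)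
  then have hm: "has_moments (M \<bind> \<kappa>) X (\<integral>z. X z \<partial>(M \<bind> \<kappa>)) (\<integral>x. B x \<partial>M)"
    using X sets nn prob by (intro has_momentsI) (auto cong: measurable_cong_sets)
  then have int: "integrable (M \<bind> \<kappa>) X" by (simp add: has_moments_def)
  have inner: "x \<in> space M \<Longrightarrow> integrable (\<kappa> x) X" "x \<in> space M \<Longrightarrow> (\<integral>z. X z \<partial>\<kappa> x) = \<mu> x" for x
    using AE by (auto simp: has_moments_def)
  have "(\<integral>z. X z \<partial>(M \<bind> \<kappa>)) = (\<integral>x. \<mu> x \<partial>M)"
    by (subst integral_bind_integrable[OF \<kappa> int ne inner(1)], assumption)
      (intro Bochner_Integration.integral_cong refl inner(2))
  with hm show "has_moments (M \<bind> \<kappa>) X (\<integral>x. \<mu> x \<partial>M) (\<integral>x. B x \<partial>M)" by simp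
  show "integrable M \<mu>"
    using integrable_integral_bind[OF \<kappa> int ne inner(1)]
    by (subst Bochner_Integration.integrable_cong[OF refl inner(2)[symmetric]])
qed

lemma has_moments_bind_pmf:
  assumes F: "\<And>i. i \<in> set_pmf q \<Longrightarrow> has_moments (measure_pmf (F i)) X (\<mu> i) (B i)"
    and B: "integrable (measure_pmf q) B"
  shows "has_moments (measure_pmf (bind_pmf q F)) X (\<E> q \<mu>) (\<E> q B)"
    and "integrable (measure_pmf q) \<mu>"
proof -
  \<comment> \<open>the hypothesis speaks of the support only, so the other points are redirected to one point of it\<close>
  obtain i0 where i0: "i0 \<in> set_pmf q" using set_pmf_not_empty[of q] by blast
  define r where "r i = (if i \<in> set_pmf q then i else i0)" for i
  have r: "r i \<in> set_pmf q" "i \<in> set_pmf q \<Longrightarrow> r i = i" for i using i0 by (auto simp: r_def)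
  have AE: "AE i in measure_pmf q. g (r i) = g i" for g :: "'a \<Rightarrow> 'z" by (auto simp: AE_measure_pmf_iff r)
  have Br: "integrable (measure_pmf q) (\<lambda>i. B (r i))"
    using B by (subst integrable_cong_AE[OF _ _ AE]) auto
  have \<kappa>: "(\<lambda>i. measure_pmf (F (r i))) \<in> measurable (measure_pmf q) (subprob_algebra (count_space UNIV))"
    by (simp add: measure_pmf_in_subprob_space)
  have eq: "measure_pmf (bind_pmf q F) = measure_pmf q \<bind> (\<lambda>i. measure_pmf (F (r i)))"
    by (simp add: r flip: measure_pmf_bind cong: bind_pmf_cong)
  note hm = has_moments_bind[OF prob_space_measure_pmf \<kappa> _ F[OF r(1)] Br]
  have "(\<integral>i. \<mu> (r i) \<partial>measure_pmf q) = (\<integral>i. \<mu> i \<partial>measure_pmf q)" "(\<integral>i. B (r i) \<partial>measure_pmf q) = (\<integral>i. B i \<partial>measure_pmf q)"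
    by (rule integral_cong_AE[OF _ _ AE]; simp)+
  then show "has_moments (measure_pmf (bind_pmf q F)) X (\<E> q \<mu>) (\<E> q B)"
    unfolding eq using hm(1) by simp
  have "integrable (measure_pmf q) (\<lambda>i. \<mu> (r i))" by (rule hm(2)) simp
  then show "integrable (measure_pmf q) \<mu>" by (subst (asm) integrable_cong_AE[OF _ _ AE]) auto
qed

lemma has_moments_bind_pmf_const:
  assumes F: "\<And>i. i \<in> set_pmf q \<Longrightarrow> has_moments (measure_pmf (F i)) X (\<mu> i) B"
  shows "has_moments (measure_pmf (bind_pmf q F)) X (\<E> q \<mu>) B"
    and "integrable (measure_pmf q) \<mu>"
  using has_moments_bind_pmf[of q F X \<mu> "\<lambda>_. B", OF F] by auto

text \<open>A new sample is independent of the others and their centered sum has mean zero, so the mixed term of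
the square vanishes and the second moments add up.\<close>

lemma has_moments_centered_sum_replicate_pmf:
  assumes p: "has_moments (measure_pmf p) (\<lambda>v. v) \<mu> B"
  shows "has_moments (measure_pmf (replicate_pmf n p)) (\<lambda>vs. sum_list vs - real n *\<^sub>R \<mu>) 0 (real n * B)"
proof (induction n)
  case 0
  show ?case
    using has_moments_return_pmf[of "[]" "\<lambda>vs. sum_list vs - real 0 *\<^sub>R \<mu>"] by simp
next
  case (Suc n)
  have "has_moments (measure_pmf p) (\<lambda>v. v - \<mu>) 0 B" by (rule has_moments_center[OF p])
  then have c: "integrable p (\<lambda>v. v - \<mu>)" "(\<integral>v. v - \<mu> \<partial>measure_pmf p) = 0"
      "integrable p (\<lambda>v. (norm (v - \<mu>))\<^sup>2)" "(\<integral>v. (norm (v - \<mu>))\<^sup>2 \<partial>measure_pmf p) \<le> B"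
    by (auto simp: has_moments_def)
  have "has_moments (measure_pmf (replicate_pmf n p)) (\<lambda>vs. 1 *\<^sub>R (sum_list vs - real n *\<^sub>R \<mu>) + (v - \<mu>))
      (1 *\<^sub>R 0 + (v - \<mu>)) (1\<^sup>2 * (real n * B) + 2 * 1 * (0 \<bullet> (v - \<mu>)) + (norm (v - \<mu>))\<^sup>2)" for v
    by (rule has_moments_affine[OF Suc.IH])
  then have inner: "has_moments (measure_pmf (map_pmf ((#) v) (replicate_pmf n p)))
      (\<lambda>vs. sum_list vs - real (Suc n) *\<^sub>R \<mu>) (v - \<mu>) (real n * B + (norm (v - \<mu>))\<^sup>2)" for v
    by (simp add: has_moments_map_pmf algebra_simps)
  have rep: "replicate_pmf (Suc n) p = bind_pmf p (\<lambda>v. map_pmf ((#) v) (replicate_pmf n p))"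
    by (simp add: map_pmf_def)
  have mean: "(\<integral>v. v - \<mu> \<partial>measure_pmf p) = 0" by (rule c(2))
  have "has_moments (measure_pmf (replicate_pmf (Suc n) p)) (\<lambda>vs. sum_list vs - real (Suc n) *\<^sub>R \<mu>)
      (\<integral>v. v - \<mu> \<partial>measure_pmf p) (\<integral>v. real n * B + (norm (v - \<mu>))\<^sup>2 \<partial>measure_pmf p)"
    unfolding rep by (rule has_moments_bind_pmf(1)[OF inner]) (use c in simp)
  moreover have "(\<integral>v. real n * B + (norm (v - \<mu>))\<^sup>2 \<partial>measure_pmf p) \<le> real (Suc n) * B"
    using c by (simp add: algebra_simps)
  ultimately show ?case
    unfolding mean by (rule has_moments_mono)
qed

text \<open>Averaging \<open>2\<^sup>k\<close> samples makes the noise of a level as small as the squared error of its iterate.\<close>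

lemma has_moments_average_replicate_pmf:
  assumes p: "has_moments (measure_pmf p) (\<lambda>v. v) \<mu> B" and n: "n > 0"
  shows "has_moments (measure_pmf (replicate_pmf n p)) (\<lambda>vs. average vs - \<mu>) 0 (B / real n)"
proof -
  have "has_moments (measure_pmf (replicate_pmf n p)) (\<lambda>vs. (1 / real n) *\<^sub>R (sum_list vs - real n *\<^sub>R \<mu>) + 0)
      ((1 / real n) *\<^sub>R 0 + 0) ((1 / real n)\<^sup>2 * (real n * B) + 2 * (1 / real n) * (0 \<bullet> (0 :: 'a)) + (norm (0::'a))\<^sup>2)"
    by (rule has_moments_affine[OF has_moments_centered_sum_replicate_pmf[OF p]])
  then have *: "has_moments (measure_pmf (replicate_pmf n p)) (\<lambda>vs. (1 / real n) *\<^sub>R sum_list vs - \<mu>) 0 (B / real n)"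
    using n by (simp add: algebra_simps power2_eq_square)
  have eq: "map_pmf (\<lambda>vs. (1 / real n) *\<^sub>R sum_list vs - \<mu>) (replicate_pmf n p)
      = map_pmf (\<lambda>vs. average vs - \<mu>) (replicate_pmf n p)"
    by (rule map_pmf_cong) (auto simp: set_replicate_pmf average_def)
  show ?thesis
    using * has_moments_map_pmf[of "\<lambda>vs. (1 / real n) *\<^sub>R sum_list vs - \<mu>" _ "\<lambda>v. v"]
      has_moments_map_pmf[of "\<lambda>vs. average vs - \<mu>" _ "\<lambda>v. v"] eq by metis
qed

section \<open>Families of discrete distributions depending measurably on a parameter\<close>

text \<open>A discrete law that depends on a parameter, written as the image of a law on the natural numbers with
measurable point masses. The sampled objects may be of any type, for instance lists of iterates. The
role of a \<open>\<sigma>\<close>-algebra on that type is played by the set \<open>G\<close> of those parameter-dependent values that count as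
measurable.\<close>

definition measurable_family :: "'x measure \<Rightarrow> ('x \<Rightarrow> 'y) set \<Rightarrow> ('x \<Rightarrow> 'y pmf) \<Rightarrow> bool" where
  "measurable_family N G E \<longleftrightarrow>
     (\<exists>p v. (\<forall>\<xi>\<in>space N. E \<xi> = map_pmf (v \<xi>) (p \<xi>)) \<and>
            (\<forall>n::nat. (\<lambda>\<xi>. pmf (p \<xi>) n) \<in> borel_measurable N) \<and> (\<forall>n. (\<lambda>\<xi>. v \<xi> n) \<in> G))"

lemma measurable_family_return: "g \<in> G \<Longrightarrow> measurable_family N G (\<lambda>\<xi>. return_pmf (g \<xi>))"
  unfolding measurable_family_def
  by (rule exI[of _ "\<lambda>_. return_pmf 0"], rule exI[of _ "\<lambda>\<xi> _. g \<xi>"]) simp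

lemma measurable_family_countable:
  fixes E :: "'x \<Rightarrow> 'c::countable pmf"
  assumes "\<And>c. (\<lambda>\<xi>. pmf (E \<xi>) c) \<in> borel_measurable N"
  shows "measurable_family N (range (\<lambda>c \<xi>. c)) E"
  unfolding measurable_family_def
proof (intro exI conjI ballI allI)
  show "E \<xi> = map_pmf from_nat (map_pmf to_nat (E \<xi>))" for \<xi>
    by (simp add: pmf.map_comp o_def)
  show "(\<lambda>\<xi>. from_nat n) \<in> range (\<lambda>c \<xi>. c)" for n by blast
  show "(\<lambda>\<xi>. pmf (map_pmf to_nat (E \<xi>)) n) \<in> borel_measurable N" for n
  proof (cases "n \<in> range (to_nat :: 'c \<Rightarrow> nat)")
    case True
    then obtain c :: 'c where "n = to_nat c" by blast
    then show ?thesis using assms[of c] by (simp add: pmf_map_inj')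
  next
    case False
    then have "pmf (map_pmf to_nat (E \<xi>)) n = 0" for \<xi>
      by (intro pmf_map_outside) auto
    then show ?thesis by simp
  qed
qed

text \<open>The two indices, that of the first draw and that of the second draw given the first, are encoded as one
natural number. Its point mass is a product of two measurable functions.\<close>

lemma measurable_family_bind:
  assumes E: "measurable_family N G E"
    and F: "\<And>g. g \<in> G \<Longrightarrow> measurable_family N H (\<lambda>\<xi>. F \<xi> (g \<xi>))"
  shows "measurable_family N H (\<lambda>\<xi>. bind_pmf (E \<xi>) (F \<xi>))"
proof -
  obtain p v where p: "\<And>\<xi>. \<xi> \<in> space N \<Longrightarrow> E \<xi> = map_pmf (v \<xi>) (p \<xi>)"
    "\<And>n::nat. (\<lambda>\<xi>. pmf (p \<xi>) n) \<in> borel_measurable N" "\<And>n. (\<lambda>\<xi>. v \<xi> n) \<in> G"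
    using E unfolding measurable_family_def by blast
  have "\<forall>n. \<exists>q w. (\<forall>\<xi>\<in>space N. F \<xi> (v \<xi> n) = map_pmf (w \<xi>) (q \<xi>)) \<and>
      (\<forall>m::nat. (\<lambda>\<xi>. pmf (q \<xi>) m) \<in> borel_measurable N) \<and> (\<forall>m. (\<lambda>\<xi>. w \<xi> m) \<in> H)"
    using F[OF p(3)] unfolding measurable_family_def by blast
  then obtain q w where q: "\<And>n \<xi>. \<xi> \<in> space N \<Longrightarrow> F \<xi> (v \<xi> n) = map_pmf (w n \<xi>) (q n \<xi>)"
    "\<And>n m::nat. (\<lambda>\<xi>. pmf (q n \<xi>) m) \<in> borel_measurable N" "\<And>n m. (\<lambda>\<xi>. w n \<xi> m) \<in> H"
    by metis
  define P where "P \<xi> = bind_pmf (p \<xi>) (\<lambda>n. map_pmf (\<lambda>m. prod_encode (n, m)) (q n \<xi>))" for \<xi>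
  define W where "W \<xi> c = (case prod_decode c of (n, m) \<Rightarrow> w n \<xi> m)" for \<xi> c
  have pmfP: "pmf (P \<xi>) (prod_encode (n, m)) = pmf (p \<xi>) n * pmf (q n \<xi>) m" for \<xi> n m
  proof -
    have "pmf (map_pmf (\<lambda>m. prod_encode (i, m)) (q i \<xi>)) (prod_encode (n, m))
        = indicator {n} i * pmf (q n \<xi>) m" for i
    proof (cases "i = n")
      case True
      have "inj (\<lambda>m. prod_encode (n, m))" by (auto simp: inj_def)
      with True show ?thesis using pmf_map_inj'[of "\<lambda>m. prod_encode (n, m)" "q n \<xi>" m] by simp
    next
      case False
      then show ?thesis by (subst pmf_map_outside) auto
    qed
    then show ?thesis
      unfolding P_def pmf_bind by (simp add: pmf.rep_eq)
  qed
  show ?thesis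
    unfolding measurable_family_def
  proof (intro exI conjI ballI allI)
    fix \<xi> assume "\<xi> \<in> space N"
    then show "bind_pmf (E \<xi>) (F \<xi>) = map_pmf (W \<xi>) (P \<xi>)"
      by (simp add: p(1) q(1) P_def W_def bind_map_pmf map_bind_pmf pmf.map_comp o_def)
  next
    fix c
    obtain n m where c: "c = prod_encode (n, m)" by (metis prod_decode_inverse surj_pair)
    show "(\<lambda>\<xi>. pmf (P \<xi>) c) \<in> borel_measurable N"
      unfolding c pmfP using p(2) q(2) by simp
    show "(\<lambda>\<xi>. W \<xi> c) \<in> H" unfolding W_def c using q(3) by simp
  qed
qed

lemma measurable_family_cong:
  "(\<And>\<xi>. \<xi> \<in> space N \<Longrightarrow> E \<xi> = E' \<xi>) \<Longrightarrow> measurable_family N G E \<longleftrightarrow> measurable_family N G E'"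
  unfolding measurable_family_def by auto

lemma measurable_family_bind_countable:
  fixes E :: "'x \<Rightarrow> 'c::countable pmf"
  assumes "\<And>c. (\<lambda>\<xi>. pmf (E \<xi>) c) \<in> borel_measurable N"
    and "\<And>c. measurable_family N H (\<lambda>\<xi>. F \<xi> c)"
  shows "measurable_family N H (\<lambda>\<xi>. bind_pmf (E \<xi>) (F \<xi>))"
  by (rule measurable_family_bind[OF measurable_family_countable]) (use assms in auto)

text \<open>The length of the sample is the same for all parameters, so a parameter-dependent sample is a fixed list
of measurable functions.\<close>

lemma measurable_family_replicate_pmf:
  assumes "measurable_family N G E"
  shows "measurable_family N {gs. \<exists>hs. length hs = n \<and> set hs \<subseteq> G \<and> (\<forall>\<xi>. gs \<xi> = map (\<lambda>h. h \<xi>) hs)}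
    (\<lambda>\<xi>. replicate_pmf n (E \<xi>))"
proof (induction n)
  case 0
  show ?case by (simp, rule measurable_family_return) simp
next
  case (Suc n)
  show ?case
    unfolding replicate_pmf.simps
  proof (rule measurable_family_bind[OF assms], rule measurable_family_bind[OF Suc.IH],
      rule measurable_family_return)
    fix g gs
    assume g: "g \<in> G" and "gs \<in> {gs. \<exists>hs. length hs = n \<and> set hs \<subseteq> G \<and> (\<forall>\<xi>. gs \<xi> = map (\<lambda>h. h \<xi>) hs)}"
    then obtain hs where "length hs = n" "set hs \<subseteq> G" "\<And>\<xi>. gs \<xi> = map (\<lambda>h. h \<xi>) hs" by blast
    with g show "(\<lambda>\<xi>. g \<xi> # gs \<xi>) \<in> {gs. \<exists>hs. length hs = Suc n \<and> set hs \<subseteq> G \<and> (\<forall>\<xi>. gs \<xi> = map (\<lambda>h. h \<xi>) hs)}"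
      by (auto intro!: exI[of _ "g # hs"])
  qed
qed

text \<open>The measure of a measurable set is the countable sum of the point masses of the indices whose value lies
in it.\<close>

lemma measurable_family_kernel:
  assumes E: "measurable_family N (measurable N B) E" and B: "space B = UNIV"
  shows "(\<lambda>\<xi>. distr (measure_pmf (E \<xi>)) B (\<lambda>z. z)) \<in> measurable N (subprob_algebra B)"
proof (rule measurable_subprob_algebra)
  have id: "(\<lambda>z. z) \<in> measurable (measure_pmf q) B" for q :: "'b pmf"
    using B by (simp add: measurable_def)
  show "subprob_space (distr (measure_pmf (E \<xi>)) B (\<lambda>z. z))" for \<xi>
    by (intro prob_space_imp_subprob_space prob_space.prob_space_distr prob_space_measure_pmf id)
  show "sets (distr (measure_pmf (E \<xi>)) B (\<lambda>z. z)) = sets B" for \<xi> by simp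
  fix A assume A: "A \<in> sets B"
  obtain p v where p: "\<And>\<xi>. \<xi> \<in> space N \<Longrightarrow> E \<xi> = map_pmf (v \<xi>) (p \<xi>)"
    "\<And>n::nat. (\<lambda>\<xi>. pmf (p \<xi>) n) \<in> borel_measurable N" "\<And>n. (\<lambda>\<xi>. v \<xi> n) \<in> measurable N B"
    using E unfolding measurable_family_def by blast
  have "emeasure (distr (measure_pmf (E \<xi>)) B (\<lambda>z. z)) A
      = (\<Sum>n. ennreal (pmf (p \<xi>) n) * indicator A (v \<xi> n))" if "\<xi> \<in> space N" for \<xi>
  proof -
    have "emeasure (distr (measure_pmf (E \<xi>)) B (\<lambda>z. z)) A = emeasure (measure_pmf (E \<xi>)) A"
      using id A by (simp add: emeasure_distr)
    also have "\<dots> = (\<integral>\<^sup>+n. indicator A (v \<xi> n) \<partial>measure_pmf (p \<xi>))"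
      unfolding p(1)[OF that] by (simp add: emeasure_map_pmf flip: nn_integral_indicator)
        (intro nn_integral_cong, simp split: split_indicator)
    also have "\<dots> = (\<integral>\<^sup>+n. ennreal (pmf (p \<xi>) n) * indicator A (v \<xi> n) \<partial>count_space UNIV)"
      by (simp add: nn_integral_measure_pmf)
    finally show ?thesis by (simp add: nn_integral_count_space_nat)
  qed
  moreover have "(\<lambda>\<xi>. \<Sum>n. ennreal (pmf (p \<xi>) n) * indicator A (v \<xi> n)) \<in> borel_measurable N"
  proof (intro borel_measurable_suminf_order borel_measurable_times_ennreal)
    show "(\<lambda>\<xi>. ennreal (pmf (p \<xi>) n)) \<in> borel_measurable N" for n using p(2) by simp
    show "(\<lambda>\<xi>. indicator A (v \<xi> n) :: ennreal) \<in> borel_measurable N" for n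
      using p(3) A by measurable
  qed
  ultimately show "(\<lambda>\<xi>. emeasure (distr (measure_pmf (E \<xi>)) B (\<lambda>z. z)) A) \<in> borel_measurable N"
    by (simp cong: measurable_cong)
qed

lemma
  fixes Y :: "'b \<Rightarrow> 'v::euclidean_space"
  assumes N: "prob_space N" and E: "measurable_family N (measurable N B) E" and B: "space B = UNIV"
    and Y: "Y \<in> borel_measurable B"
    and hm: "\<And>\<xi>. \<xi> \<in> space N \<Longrightarrow> has_moments (measure_pmf (E \<xi>)) Y (\<mu> \<xi>) C"
  shows has_moments_mixture: "has_moments (N \<bind> (\<lambda>\<xi>. distr (measure_pmf (E \<xi>)) B (\<lambda>z. z))) Y (\<integral>\<xi>. \<mu> \<xi> \<partial>N) C"
    and integrable_mean_mixture: "integrable N \<mu>"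
proof -
  interpret prob_space N by fact
  note \<kappa> = measurable_family_kernel[OF E B]
  have id: "(\<lambda>z. z) \<in> measurable (measure_pmf q) B" for q :: "'b pmf"
    using B by (simp add: measurable_def)
  have hm': "has_moments (distr (measure_pmf (E \<xi>)) B (\<lambda>z. z)) Y (\<mu> \<xi>) C" if "\<xi> \<in> space N" for \<xi>
    using hm[OF that] Y id unfolding has_moments_def
    by (simp add: integrable_distr_eq integral_distr prob_space.prob_space_distr)
  have C: "integrable N (\<lambda>_. C)" by simp
  show "has_moments (N \<bind> (\<lambda>\<xi>. distr (measure_pmf (E \<xi>)) B (\<lambda>z. z))) Y (\<integral>\<xi>. \<mu> \<xi> \<partial>N) C"
    using has_moments_bind(1)[OF N \<kappa> Y hm' C] by (simp add: prob_space)
  show "integrable N \<mu>" by (rule has_moments_bind(2)[OF N \<kappa> Y hm' C])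
qed

section \<open>Softmax policies and the soft Bellman operator\<close>

text \<open>The scaled log-sum-exp function, a smooth maximum over the actions. Its gradient is the softmax policy.\<close>

definition soft_maximum :: "real \<Rightarrow> real^'a::finite^'s::finite \<Rightarrow> 's \<Rightarrow> real" where
  "soft_maximum lam Q s = lam * ln (\<Sum>a\<in>UNIV. exp (Q $ s $ a / lam))"

lemma sum_exp_pos: "0 < (\<Sum>a\<in>UNIV. exp (h a :: real))" for h :: "'a::finite \<Rightarrow> real"
  by (rule sum_pos) auto

lemma softmax_policy_eq_exp:
  assumes "lam > 0"
  shows "softmax_policy lam Q $ s $ a = exp ((Q $ s $ a - soft_maximum lam Q s) / lam)"
  using assms sum_exp_pos[of "\<lambda>a. Q $ s $ a / lam"]
  by (simp add: softmax_policy_def soft_maximum_def diff_divide_distrib exp_diff)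

lemma softmax_policy_pos: "0 < softmax_policy lam Q $ s $ a"
  using sum_exp_pos[of "\<lambda>a. Q $ s $ a / lam"] by (simp add: softmax_policy_def)

lemma is_policy_softmax_policy: "is_policy (softmax_policy lam Q)"
proof -
  have "(\<Sum>a\<in>UNIV. softmax_policy lam Q $ s $ a) = 1" for s
    using sum_exp_pos[of "\<lambda>a. Q $ s $ a / lam"]
    by (simp add: softmax_policy_def flip: sum_divide_distrib)
  then show ?thesis
    by (simp add: is_policy_def softmax_policy_pos less_imp_le)
qed

lemma ln_softmax_policy:
  assumes "lam > 0"
  shows "ln (softmax_policy lam Q $ s $ a) = (Q $ s $ a - soft_maximum lam Q s) / lam"
  by (simp add: softmax_policy_eq_exp[OF assms])

text \<open>The soft maximum is monotone and commutes with adding constants, so it is nonexpansive in the sup norm.\<close>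

lemma soft_maximum_mono_shift:
  assumes lam: "lam > 0" and le: "\<And>a. Q $ s $ a \<le> Q' $ s $ a + \<delta>"
  shows "soft_maximum lam Q s \<le> soft_maximum lam Q' s + \<delta>"
proof -
  have "(\<Sum>a\<in>UNIV. exp (Q $ s $ a / lam)) \<le> (\<Sum>a\<in>UNIV. exp (Q' $ s $ a / lam) * exp (\<delta> / lam))"
  proof (rule sum_mono)
    fix a
    have "Q $ s $ a / lam \<le> Q' $ s $ a / lam + \<delta> / lam"
      using divide_right_mono[OF le[of a], of lam] lam by (simp add: add_divide_distrib)
    then show "exp (Q $ s $ a / lam) \<le> exp (Q' $ s $ a / lam) * exp (\<delta> / lam)"
      by (simp flip: exp_add)
  qed
  then have "ln (\<Sum>a\<in>UNIV. exp (Q $ s $ a / lam)) \<le> ln ((\<Sum>a\<in>UNIV. exp (Q' $ s $ a / lam)) * exp (\<delta> / lam))"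
    using sum_exp_pos[of "\<lambda>a. Q $ s $ a / lam"] by (simp add: sum_distrib_right)
  also have "\<dots> = ln (\<Sum>a\<in>UNIV. exp (Q' $ s $ a / lam)) + \<delta> / lam"
    using sum_exp_pos[of "\<lambda>a. Q' $ s $ a / lam"] by (simp add: ln_mult)
  finally have "lam * ln (\<Sum>a\<in>UNIV. exp (Q $ s $ a / lam))
      \<le> lam * (ln (\<Sum>a\<in>UNIV. exp (Q' $ s $ a / lam)) + \<delta> / lam)"
    using lam by simp
  then show ?thesis using lam by (simp add: soft_maximum_def algebra_simps)
qed

lemma soft_maximum_Lipschitz:
  assumes lam: "lam > 0" and le: "\<And>a. \<bar>Q $ s $ a - Q' $ s $ a\<bar> \<le> \<delta>"
  shows "\<bar>soft_maximum lam Q s - soft_maximum lam Q' s\<bar> \<le> \<delta>"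
proof -
  have "Q $ s $ a \<le> Q' $ s $ a + \<delta>" "Q' $ s $ a \<le> Q $ s $ a + \<delta>" for a
    using le[of a] by linarith+
  from soft_maximum_mono_shift[OF lam this(1)] soft_maximum_mono_shift[OF lam this(2)]
  show ?thesis by linarith
qed

lemma abs_soft_maximum_le:
  fixes Q :: "real^'a::finite^'s::finite"
  assumes lam: "lam > 0" and le: "\<And>a. \<bar>Q $ s $ a\<bar> \<le> B"
  shows "\<bar>soft_maximum lam Q s\<bar> \<le> B + lam * ln (real CARD('a))"
proof -
  have "\<bar>soft_maximum lam Q s - soft_maximum lam (0 :: real^'a^'s) s\<bar> \<le> B"
    by (rule soft_maximum_Lipschitz[OF lam]) (use le in simp)
  moreover have "soft_maximum lam (0 :: real^'a^'s) s = lam * ln (real CARD('a))"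
    by (simp add: soft_maximum_def)
  moreover have "0 \<le> lam * ln (real CARD('a))"
    using lam by (simp add: Suc_leI)
  ultimately show ?thesis by linarith
qed

lemma soft_maximum_eq_softmax_policy:
  assumes lam: "lam > 0"
  shows "(\<Sum>a\<in>UNIV. softmax_policy lam Q $ s $ a * Q $ s $ a) + lam * policy_entropy (softmax_policy lam Q) s
    = soft_maximum lam Q s"
proof -
  let ?p = "softmax_policy lam Q"
  have one: "(\<Sum>a\<in>UNIV. ?p $ s $ a) = 1"
    using is_policy_softmax_policy[of lam Q] by (simp add: is_policy_def)
  have "lam * (?p $ s $ a * ln (?p $ s $ a)) = ?p $ s $ a * Q $ s $ a - ?p $ s $ a * soft_maximum lam Q s" for a
    using lam by (simp add: ln_softmax_policy[OF lam] field_simps)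
  then have "lam * policy_entropy ?p s
      = - ((\<Sum>a\<in>UNIV. ?p $ s $ a * Q $ s $ a) - (\<Sum>a\<in>UNIV. ?p $ s $ a) * soft_maximum lam Q s)"
    by (simp add: policy_entropy_def sum_distrib_left sum_distrib_right sum_subtractf)
  then show ?thesis by (simp add: one)
qed

text \<open>The difference of the two sides is \<open>lam\<close> times the relative entropy of \<open>\<pi>\<close> with respect to the softmax policy,
which is nonnegative because \<open>ln u \<le> u - 1\<close>.\<close>

lemma Gibbs_variational_le:
  assumes lam: "lam > 0" and \<pi>: "is_policy \<pi>"
  shows "(\<Sum>a\<in>UNIV. \<pi> $ s $ a * Q $ s $ a) + lam * policy_entropy \<pi> s \<le> soft_maximum lam Q s"
proof -
  let ?p = "softmax_policy lam Q"
  have one: "(\<Sum>a\<in>UNIV. ?p $ s $ a) = 1" "(\<Sum>a\<in>UNIV. \<pi> $ s $ a) = 1"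
    using is_policy_softmax_policy[of lam Q] \<pi> by (simp_all add: is_policy_def)
  have le: "\<pi> $ s $ a * (ln (?p $ s $ a) - ln (\<pi> $ s $ a)) \<le> ?p $ s $ a - \<pi> $ s $ a" for a
  proof (cases "\<pi> $ s $ a = 0")
    case True
    then show ?thesis using softmax_policy_pos[of lam Q s a] by simp
  next
    case False
    then have pos: "0 < \<pi> $ s $ a" using \<pi> by (simp add: is_policy_def less_le)
    have "ln (?p $ s $ a / \<pi> $ s $ a) \<le> ?p $ s $ a / \<pi> $ s $ a - 1"
      by (intro ln_le_minus_one divide_pos_pos softmax_policy_pos pos)
    then have "ln (?p $ s $ a) - ln (\<pi> $ s $ a) \<le> ?p $ s $ a / \<pi> $ s $ a - 1"
      using pos softmax_policy_pos[of lam Q s a] by (simp add: ln_div)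
    from mult_left_mono[OF this less_imp_le[OF pos]] pos show ?thesis
      by (simp add: right_diff_distrib)
  qed
  have "(\<Sum>a\<in>UNIV. \<pi> $ s $ a * (ln (?p $ s $ a) - ln (\<pi> $ s $ a)))
      \<le> (\<Sum>a\<in>UNIV. ?p $ s $ a - \<pi> $ s $ a)"
    by (intro sum_mono le)
  also have "\<dots> = 0" by (simp add: sum_subtractf one)
  finally have "lam * (\<Sum>a\<in>UNIV. \<pi> $ s $ a * (ln (?p $ s $ a) - ln (\<pi> $ s $ a))) \<le> lam * 0"
    using lam by (intro mult_left_mono) auto
  moreover have "lam * (\<Sum>a\<in>UNIV. \<pi> $ s $ a * (ln (?p $ s $ a) - ln (\<pi> $ s $ a)))
      = (\<Sum>a\<in>UNIV. \<pi> $ s $ a * Q $ s $ a) - soft_maximum lam Q s * (\<Sum>a\<in>UNIV. \<pi> $ s $ a) + lam * policy_entropy \<pi> s"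
  proof -
    have "lam * (\<pi> $ s $ a * (ln (?p $ s $ a) - ln (\<pi> $ s $ a)))
        = \<pi> $ s $ a * Q $ s $ a - soft_maximum lam Q s * \<pi> $ s $ a - lam * (\<pi> $ s $ a * ln (\<pi> $ s $ a))" for a
      using lam by (simp add: ln_softmax_policy[OF lam] field_simps)
    then show ?thesis
      by (simp add: policy_entropy_def sum_distrib_left sum_subtractf)
  qed
  ultimately show ?thesis by (simp add: one)
qed

definition expect_next :: "('s::finite, 'a) mdp \<Rightarrow> ('s \<Rightarrow> 'v::real_vector) \<Rightarrow> 's \<Rightarrow> 'a \<Rightarrow> 'v" where
  "expect_next m v s a = (\<Sum>s'\<in>UNIV. pmf (kernel m s a) s' *\<^sub>R v s')"

lemma expectation_kernel: "\<E> (kernel m s a) v = expect_next m v s a"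
  for v :: "'s::finite \<Rightarrow> 'v::euclidean_space"
  unfolding expect_next_def by (rule integral_measure_pmf) auto

lemma norm_weighted_sum_le:
  fixes v :: "'i::finite \<Rightarrow> 'v::real_normed_vector"
  assumes "\<And>i. 0 \<le> w i" "(\<Sum>i\<in>UNIV. w i) = 1" "\<And>i. norm (v i) \<le> B"
  shows "norm (\<Sum>i\<in>UNIV. w i *\<^sub>R v i) \<le> B"
proof -
  have "norm (\<Sum>i\<in>UNIV. w i *\<^sub>R v i) \<le> (\<Sum>i\<in>UNIV. w i * B)"
    by (rule sum_norm_le) (use assms in \<open>simp add: mult_left_mono\<close>)
  then show ?thesis using assms(2) by (simp flip: sum_distrib_right)
qed

lemma sum_pmf_UNIV: "(\<Sum>i\<in>UNIV. pmf p i) = 1" for p :: "'i::finite pmf"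
  by (rule sum_pmf_eq_1) auto

lemma norm_expect_next_le:
  assumes "\<And>s'. norm (v s') \<le> B"
  shows "norm (expect_next m v s a) \<le> B"
  unfolding expect_next_def
  by (rule norm_weighted_sum_le) (use assms in \<open>auto simp: sum_pmf_UNIV\<close>)

lemma expect_next_diff: "expect_next m v s a - expect_next m w s a = expect_next m (\<lambda>s'. v s' - w s') s a"
  by (simp add: expect_next_def scaleR_diff_right sum_subtractf)

definition soft_bellman :: "real \<Rightarrow> ('s::finite, 'a::finite) mdp \<Rightarrow> real^'a^'s \<Rightarrow> real^'a^'s" where
  "soft_bellman lam m Q = (\<chi> s a. reward m s a + discount m * expect_next m (soft_maximum lam Q) s a)"

definition entry_ball :: "real \<Rightarrow> (real^'a::finite^'s::finite) set" where
  "entry_ball B = {Q. \<forall>s a. \<bar>Q $ s $ a\<bar> \<le> B}"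

lemma norm_le_sum_entries: "norm Q \<le> (\<Sum>s\<in>UNIV. \<Sum>a\<in>UNIV. \<bar>Q $ s $ a\<bar>)"
  for Q :: "real^'a::finite^'s::finite"
proof -
  have "norm Q \<le> (\<Sum>s\<in>UNIV. norm (Q $ s))"
    unfolding norm_vec_def by (rule L2_set_le_sum) auto
  also have "\<dots> \<le> (\<Sum>s\<in>UNIV. \<Sum>a\<in>UNIV. \<bar>Q $ s $ a\<bar>)"
    by (intro sum_mono norm_le_l1_cart)
  finally show ?thesis .
qed

lemma abs_entry_le_norm: "\<bar>Q $ s $ a\<bar> \<le> norm Q" for Q :: "real^'a::finite^'s::finite"
  using component_le_norm_cart[of "Q $ s" a] Finite_Cartesian_Product.norm_nth_le[of Q s] by linarith

lemma compact_entry_ball: "compact (entry_ball B :: (real^'a::finite^'s::finite) set)"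
proof -
  have "closed (entry_ball B :: (real^'a^'s) set)"
    unfolding entry_ball_def by (intro closed_Collect_all closed_Collect_le continuous_intros)
  moreover have "bounded (entry_ball B :: (real^'a^'s) set)"
  proof (rule boundedI)
    fix Q :: "real^'a^'s" assume "Q \<in> entry_ball B"
    then have "(\<Sum>s\<in>UNIV. \<Sum>a\<in>UNIV. \<bar>Q $ s $ a\<bar>) \<le> (\<Sum>s\<in>(UNIV::'s set). \<Sum>a\<in>(UNIV::'a set). B)"
      by (intro sum_mono) (simp add: entry_ball_def)
    with norm_le_sum_entries[of Q] show "norm Q \<le> (\<Sum>s\<in>(UNIV::'s set). \<Sum>a\<in>(UNIV::'a set). B)"
      by linarith
  qed
  ultimately show ?thesis by (simp add: compact_eq_bounded_closed)
qed

lemma convex_entry_ball: "convex (entry_ball B)"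
proof (rule convexI)
  fix Q Q' :: "real^'a::finite^'s::finite" and u v :: real
  assume Q: "Q \<in> entry_ball B" "Q' \<in> entry_ball B" and uv: "0 \<le> u" "0 \<le> v" "u + v = 1"
  have "\<bar>u * Q $ s $ a + v * Q' $ s $ a\<bar> \<le> B" for s a
  proof -
    have "\<bar>u * Q $ s $ a + v * Q' $ s $ a\<bar> \<le> u * \<bar>Q $ s $ a\<bar> + v * \<bar>Q' $ s $ a\<bar>"
      using uv abs_triangle_ineq[of "u * Q $ s $ a" "v * Q' $ s $ a"] by (simp add: abs_mult)
    also have "\<dots> \<le> u * B + v * B"
      using Q uv by (intro add_mono mult_left_mono) (auto simp: entry_ball_def)
    finally show ?thesis using uv by (simp flip: distrib_right)
  qed
  then show "u *\<^sub>R Q + v *\<^sub>R Q' \<in> entry_ball B" by (simp add: entry_ball_def)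
qed

text \<open>The number \<open>B\<close> with \<open>R + \<gamma> (B + lam ln n) = B\<close>. Rewards are at most \<open>R\<close> and the soft maximum over \<open>n\<close> actions
exceeds the entries by at most \<open>lam ln n\<close>, so the bound \<open>B\<close> on a Q-function reproduces itself.\<close>

definition q_bound :: "real \<Rightarrow> real \<Rightarrow> real \<Rightarrow> real \<Rightarrow> real" where
  "q_bound R \<gamma> lam n = (R + \<gamma> * lam * ln n) / (1 - \<gamma>)"

lemma q_bound_fixed: "\<gamma> < 1 \<Longrightarrow> R + \<gamma> * (q_bound R \<gamma> lam n + lam * ln n) = q_bound R \<gamma> lam n"
  unfolding q_bound_def by (simp add: field_simps)

lemma q_bound_nonneg: "0 \<le> R \<Longrightarrow> 0 \<le> \<gamma> \<Longrightarrow> \<gamma> < 1 \<Longrightarrow> 0 \<le> lam \<Longrightarrow> 1 \<le> n \<Longrightarrow> 0 \<le> q_bound R \<gamma> lam n"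
  unfolding q_bound_def by simp

lemma soft_target_bound:
  fixes Q :: "real^'a::finite^'s::finite"
  assumes "lam > 0" "0 \<le> \<gamma>" "\<gamma> < 1" "\<bar>r\<bar> \<le> R" "Q \<in> entry_ball (q_bound R \<gamma> lam CARD('a))"
    and v: "\<bar>v\<bar> \<le> q_bound R \<gamma> lam CARD('a) + lam * ln (real CARD('a))"
  shows "\<bar>r + \<gamma> * v\<bar> \<le> q_bound R \<gamma> lam CARD('a)"
proof -
  have "\<bar>r + \<gamma> * v\<bar> \<le> \<bar>r\<bar> + \<gamma> * \<bar>v\<bar>"
    using assms(2) abs_triangle_ineq[of r "\<gamma> * v"] by (simp add: abs_mult)
  also have "\<dots> \<le> R + \<gamma> * (q_bound R \<gamma> lam CARD('a) + lam * ln (real CARD('a)))"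
    using assms by (intro add_mono mult_left_mono) auto
  finally show ?thesis using q_bound_fixed[OF assms(3)] by simp
qed

lemma soft_bellman_in_entry_ball:
  fixes m :: "('s::finite, 'a::finite) mdp"
  assumes lam: "lam > 0" and \<gamma>: "0 \<le> discount m" "discount m < 1"
    and r: "\<And>s a. \<bar>reward m s a\<bar> \<le> R"
    and Q: "Q \<in> entry_ball (q_bound R (discount m) lam CARD('a))"
  shows "soft_bellman lam m Q \<in> entry_ball (q_bound R (discount m) lam CARD('a))"
proof -
  let ?B = "q_bound R (discount m) lam CARD('a)"
  have "\<bar>soft_maximum lam Q s\<bar> \<le> ?B + lam * ln (real CARD('a))" for s
    by (rule abs_soft_maximum_le[OF lam]) (use Q in \<open>simp add: entry_ball_def\<close>)
  then have "\<bar>expect_next m (soft_maximum lam Q) s a\<bar> \<le> ?B + lam * ln (real CARD('a))" for s a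
    using norm_expect_next_le[of "soft_maximum lam Q" "?B + lam * ln (real CARD('a))"] by simp
  then show ?thesis
    using soft_target_bound[OF lam \<gamma> r Q] by (simp add: entry_ball_def soft_bellman_def)
qed

text \<open>The soft Bellman operator maps a compact convex box continuously to itself, so Brouwer's theorem yields
a fixed point together with a bound on it.\<close>

lemma ex_soft_bellman_fixed_point:
  fixes m :: "('s::finite, 'a::finite) mdp"
  assumes lam: "lam > 0" and \<gamma>: "0 \<le> discount m" "discount m < 1"
    and r: "\<And>s a. \<bar>reward m s a\<bar> \<le> R"
  obtains Q where "soft_bellman lam m Q = Q" "Q \<in> entry_ball (q_bound R (discount m) lam CARD('a))"
proof -
  let ?S = "entry_ball (q_bound R (discount m) lam CARD('a)) :: (real^'a^'s) set"
  have "0 \<le> R" using r abs_ge_zero order_trans by blast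
  then have "0 \<le> q_bound R (discount m) lam CARD('a)"
    using lam \<gamma> by (intro q_bound_nonneg) (auto simp: Suc_leI)
  then have "0 \<in> ?S" by (simp add: entry_ball_def)
  have c: "continuous_on ?S (soft_bellman lam m)"
    unfolding soft_bellman_def soft_maximum_def expect_next_def
    by (intro continuous_intros) (use lam in \<open>auto simp: less_imp_neq[symmetric, OF sum_exp_pos]\<close>)
  have "\<exists>Q\<in>?S. soft_bellman lam m Q = Q"
    by (rule brouwer[OF compact_entry_ball convex_entry_ball _ c])
      (use \<open>0 \<in> ?S\<close> soft_bellman_in_entry_ball[OF lam \<gamma> r] in auto)
  then show ?thesis using that by blast
qed

section \<open>Optimal soft values\<close>

primrec step_law :: "('s, 'a) mdp \<Rightarrow> real^'a::finite^'s::finite \<Rightarrow> 's \<Rightarrow> nat \<Rightarrow> ('s \<times> 'a) pmf" where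
  "step_law m \<pi> s 0 = map_pmf (Pair s) (act_pmf \<pi> s)"
| "step_law m \<pi> s (Suc n) = bind_pmf (step_law m \<pi> s n) (sa_step m \<pi>)"

text \<open>Coordinate \<open>n\<close> depends on the first \<open>n + 1\<close> kernels only, and each of these looks at nothing but the previous
coordinate. So the marginals of the trajectory follow the recursion of a Markov chain.\<close>

lemma distr_path_measure:
  fixes m :: "('s::finite, 'a::finite) mdp"
  shows "distr (path_measure m \<pi> s) (count_space UNIV) (\<lambda>\<omega>. \<omega> n) = measure_pmf (step_law m \<pi> s n)"
proof -
  interpret IT: Ionescu_Tulcea "path_kernel m \<pi> s" "\<lambda>_. count_space UNIV"
    by (rule Ionescu_Tulcea_path_kernel)
  let ?u = "\<lambda>x. undefined :: 's \<times> 'a"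
  let ?M = "\<lambda>_::nat. count_space UNIV :: ('s \<times> 'a) measure"
  have nn: "(\<integral>\<^sup>+\<omega>. f (\<omega> n) \<partial>IT.C 0 (Suc n) ?u) = (\<integral>\<^sup>+z. f z \<partial>measure_pmf (step_law m \<pi> s n))" for n f
  proof (induction n arbitrary: f)
    case 0
    have "(\<integral>\<^sup>+\<omega>. f (\<omega> 0) \<partial>IT.C 0 (Suc 0) ?u) = (\<integral>\<^sup>+\<omega>. \<integral>\<^sup>+\<omega>'. f (\<omega>' 0) \<partial>IT.eP 0 \<omega> \<partial>return (PiM {0..<0} ?M) ?u)"
      unfolding IT.C.simps add_0_left
      by (rule nn_integral_bind[OF _ measurable_cong_sets[THEN equalityD2, THEN subsetD, OF sets_return refl IT.measurable_eP]]) auto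
    also have "\<dots> = (\<integral>\<^sup>+\<omega>'. f (\<omega>' 0) \<partial>IT.eP 0 ?u)"
    proof (rule nn_integral_return)
      have "(\<lambda>\<omega>. f (\<omega> 0)) \<in> borel_measurable (PiM {0..<Suc 0} ?M)"
        by (rule measurable_compose[OF measurable_component_singleton]) auto
      from measurable_compose[OF IT.measurable_eP[of 0] nn_integral_measurable_subprob_algebra[OF this]]
      show "(\<lambda>\<omega>. \<integral>\<^sup>+\<omega>'. f (\<omega>' 0) \<partial>IT.eP 0 \<omega>) \<in> borel_measurable (PiM {0..<0} ?M)" .
    qed simp
    also have "\<dots> = (\<integral>\<^sup>+z. f z \<partial>path_kernel m \<pi> s 0 ?u)"
      by (subst IT.nn_integral_eP) auto
    also have "\<dots> = (\<integral>\<^sup>+z. f z \<partial>measure_pmf (step_law m \<pi> s 0))"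
      by (simp only: path_kernel_def nat.case step_law.simps)
    finally show ?case .
  next
    case (Suc n)
    have sp: "?u \<in> space (PiM {0..<0} ?M)" by simp
    have m: "IT.eP (Suc n) \<in> measurable (IT.C 0 (Suc n) ?u) (subprob_algebra (PiM {0..<Suc (Suc n)} ?M))"
      using IT.measurable_eP[of "Suc n"] IT.sets_C[OF sp, of "Suc n"] by (simp cong: measurable_cong_sets)
    have f: "(\<lambda>\<omega>. f (\<omega> (Suc n))) \<in> borel_measurable (PiM {0..<Suc (Suc n)} ?M)"
      by (rule measurable_compose[OF measurable_component_singleton]) auto
    have "(\<integral>\<^sup>+\<omega>. f (\<omega> (Suc n)) \<partial>IT.C 0 (Suc (Suc n)) ?u)
        = (\<integral>\<^sup>+\<omega>. \<integral>\<^sup>+\<omega>'. f (\<omega>' (Suc n)) \<partial>IT.eP (Suc n) \<omega> \<partial>IT.C 0 (Suc n) ?u)"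
      unfolding IT.C.simps(2)[of 0 "Suc n"] add_0_left by (rule nn_integral_bind[OF f m])
    also have "\<dots> = (\<integral>\<^sup>+\<omega>. \<integral>\<^sup>+z. f z \<partial>measure_pmf (sa_step m \<pi> (\<omega> n)) \<partial>IT.C 0 (Suc n) ?u)"
    proof (rule nn_integral_cong)
      fix \<omega> assume "\<omega> \<in> space (IT.C 0 (Suc n) ?u)"
      then have "\<omega> \<in> space (PiM {0..<Suc n} ?M)" using IT.space_C[OF sp, of "Suc n"] by simp
      then show "(\<integral>\<^sup>+\<omega>'. f (\<omega>' (Suc n)) \<partial>IT.eP (Suc n) \<omega>) = (\<integral>\<^sup>+z. f z \<partial>measure_pmf (sa_step m \<pi> (\<omega> n)))"
        by (subst IT.nn_integral_eP[OF _ f]) (simp_all add: path_kernel_def)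
    qed
    also have "\<dots> = (\<integral>\<^sup>+z. \<integral>\<^sup>+z'. f z' \<partial>measure_pmf (sa_step m \<pi> z) \<partial>measure_pmf (step_law m \<pi> s n))"
      by (rule Suc.IH)
    finally show ?case by simp
  qed
  have sets: "sets (path_measure m \<pi> s) = sets (PiM UNIV ?M)"
    unfolding path_measure_def by simp
  have meas: "(\<lambda>\<omega>. \<omega> n) \<in> measurable (path_measure m \<pi> s) (count_space UNIV)"
    using measurable_component_singleton[of n UNIV ?M] sets by (simp cong: measurable_cong_sets)
  show ?thesis
  proof (rule measure_eqI)
    fix A :: "('s \<times> 'a) set"
    let ?J = "{0..<Suc n}"
    let ?X = "{\<omega> \<in> space (PiM ?J ?M). \<omega> n \<in> A}"
    have X: "?X \<in> sets (PiM ?J ?M)"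
      by (rule measurable_sets_Collect[where P = "\<lambda>z. z \<in> A" and N = "count_space UNIV", simplified])
        (use measurable_component_singleton[of n ?J ?M] in auto)
    have "emeasure (distr (path_measure m \<pi> s) (count_space UNIV) (\<lambda>\<omega>. \<omega> n)) A
        = emeasure IT.PF.lim ((\<lambda>\<omega>. \<omega> n) -` A \<inter> space (path_measure m \<pi> s))"
      using meas by (simp add: emeasure_distr path_measure_def)
    also have "(\<lambda>\<omega>. \<omega> n) -` A \<inter> space (path_measure m \<pi> s) = IT.PF.emb UNIV ?J ?X"
      unfolding path_measure_def by (auto simp: prod_emb_def space_PiM)
    also have "emeasure IT.PF.lim (IT.PF.emb UNIV ?J ?X) = emeasure (IT.CI ?J) ?X"
      by (rule IT.lim[OF _ X]) simp
    also have "\<dots> = emeasure (IT.C 0 (Suc n) ?u) (IT.PF.emb ?J ?J ?X)"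
      by (rule IT.emeasure_CI[OF _ X]) simp
    also have "IT.PF.emb ?J ?J ?X = ?X"
      by (rule prod_emb_id) (use sets.sets_into_space[OF X] in \<open>auto simp: space_PiM\<close>)
    also have "emeasure (IT.C 0 (Suc n) ?u) ?X = (\<integral>\<^sup>+\<omega>. indicator ?X \<omega> \<partial>IT.C 0 (Suc n) ?u)"
      using X IT.sets_C[of ?u 0 "Suc n"] by (intro nn_integral_indicator[symmetric]) simp
    also have "\<dots> = (\<integral>\<^sup>+\<omega>. indicator A (\<omega> n) \<partial>IT.C 0 (Suc n) ?u)"
      using IT.space_C[of ?u 0 "Suc n"]
      by (intro nn_integral_cong) (auto split: split_indicator)
    also have "\<dots> = emeasure (measure_pmf (step_law m \<pi> s n)) A"
      unfolding nn by simp
    finally show "emeasure (distr (path_measure m \<pi> s) (count_space UNIV) (\<lambda>\<omega>. \<omega> n)) A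
        = emeasure (measure_pmf (step_law m \<pi> s n)) A" .
  qed simp
qed

lemma expectation_bind_pmf_finite:
  fixes h :: "'b::finite \<Rightarrow> 'v::{banach, second_countable_topology}"
  shows "\<E> (bind_pmf p f) h = \<E> p (\<lambda>i::'i::finite. \<E> (f i) h)"
  by (subst pmf_expectation_bind[where A = UNIV]) (auto simp: integral_measure_pmf[of UNIV])

lemma expectation_act_pmf:
  fixes h :: "'a::finite \<Rightarrow> 'v::{banach, second_countable_topology}"
  assumes "is_policy \<pi>"
  shows "\<E> (act_pmf \<pi> s) h = (\<Sum>a\<in>UNIV. \<pi> $ s $ a *\<^sub>R h a)"
  by (subst integral_measure_pmf[of UNIV]) (auto simp: pmf_act_pmf[OF assms])

lemma expectation_sa_step:
  fixes h :: "'s::finite \<times> 'a::finite \<Rightarrow> 'v::euclidean_space"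
  assumes "is_policy \<pi>"
  shows "\<E> (sa_step m \<pi> z) h
    = expect_next m (\<lambda>s'. \<Sum>a\<in>UNIV. \<pi> $ s' $ a *\<^sub>R h (s', a)) (fst z) (snd z)"
  unfolding sa_step_def map_pmf_def[symmetric]
  by (simp add: expectation_bind_pmf_finite expectation_act_pmf[OF assms] flip: expectation_kernel)

text \<open>At every time the action is drawn from the policy given the state, also at time zero. Averaging over the
action first turns inequalities between state values into inequalities along the trajectory.\<close>

lemma expectation_step_law_average:
  fixes m :: "('s::finite, 'a::finite) mdp" and h :: "'s \<times> 'a \<Rightarrow> real"
  assumes \<pi>: "is_policy \<pi>"
  shows "\<E> (step_law m \<pi> s n) h
    = \<E> (step_law m \<pi> s n) (\<lambda>z. \<Sum>a\<in>UNIV. \<pi> $ fst z $ a * h (fst z, a))"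
proof (cases n)
  case 0
  have "(\<Sum>b\<in>UNIV. \<pi> $ s $ b * (\<Sum>a\<in>UNIV. \<pi> $ s $ a * h (s, a))) = (\<Sum>a\<in>UNIV. \<pi> $ s $ a * h (s, a))"
    using \<pi> by (simp add: is_policy_def flip: sum_distrib_right)
  then show ?thesis using 0 by (simp add: expectation_act_pmf[OF \<pi>])
next
  case (Suc k)
  have "(\<Sum>b\<in>UNIV. \<pi> $ s' $ b * (\<Sum>a\<in>UNIV. \<pi> $ s' $ a * h (s', a))) = (\<Sum>a\<in>UNIV. \<pi> $ s' $ a * h (s', a))" for s'
    using \<pi> by (simp add: is_policy_def flip: sum_distrib_right)
  then show ?thesis using Suc by (simp add: expectation_bind_pmf_finite expectation_sa_step[OF \<pi>])
qed

lemma expectation_step_law_Suc_state: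
  fixes m :: "('s::finite, 'a::finite) mdp" and V :: "'s \<Rightarrow> real"
  assumes \<pi>: "is_policy \<pi>"
  shows "\<E> (step_law m \<pi> s (Suc n)) (\<lambda>z. V (fst z))
    = \<E> (step_law m \<pi> s n) (\<lambda>z. expect_next m V (fst z) (snd z))"
proof -
  have "(\<Sum>a\<in>UNIV. \<pi> $ s' $ a * V s') = V s'" for s'
    using \<pi> by (simp add: is_policy_def flip: sum_distrib_right)
  then show ?thesis by (simp add: expectation_bind_pmf_finite expectation_sa_step[OF \<pi>])
qed

lemma abs_le_Max_range: "\<bar>h z\<bar> \<le> Max (range (\<lambda>z. \<bar>h z\<bar>))" for h :: "'z::finite \<Rightarrow> real"
  by (rule Max_ge) auto

lemma abs_expectation_le:
  fixes h :: "'z::finite \<Rightarrow> real"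
  assumes "\<And>z. \<bar>h z\<bar> \<le> C"
  shows "\<bar>\<E> p h\<bar> \<le> C"
proof -
  have "norm (\<Sum>z\<in>UNIV. pmf p z *\<^sub>R h z) \<le> C"
    by (rule norm_weighted_sum_le) (use assms in \<open>auto simp: sum_pmf_UNIV\<close>)
  then show ?thesis by (subst integral_measure_pmf[of UNIV]) auto
qed

lemma soft_value_series:
  fixes m :: "('s::finite, 'a::finite) mdp"
  assumes \<gamma>: "0 \<le> discount m" "discount m < 1"
  shows "(\<lambda>n. discount m ^ n * \<E> (step_law m \<pi> s n)
            (\<lambda>z. reward m (fst z) (snd z) + lam * policy_entropy \<pi> (fst z))) sums soft_value lam m \<pi> s"
proof -
  let ?P = "path_measure m \<pi> s"
  define h where "h z = reward m (fst z) (snd z) + lam * policy_entropy \<pi> (fst z)" for z :: "'s \<times> 'a"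
  interpret P: prob_space ?P by (rule prob_space_path_measure)
  interpret IT: Ionescu_Tulcea "path_kernel m \<pi> s" "\<lambda>_. count_space UNIV"
    by (rule Ionescu_Tulcea_path_kernel)
  have "sets ?P = sets (PiM UNIV (\<lambda>_. count_space UNIV))"
    unfolding path_measure_def by simp
  then have meas[measurable]: "(\<lambda>\<omega>. \<omega> n) \<in> measurable ?P (count_space UNIV)" for n
    using measurable_component_singleton[of n UNIV "\<lambda>_. count_space UNIV :: ('s \<times> 'a) measure"]
    by (simp cong: measurable_cong_sets)
  have [measurable]: "(\<lambda>\<omega>. h (\<omega> n)) \<in> borel_measurable ?P" for n
    by (rule measurable_compose[OF meas]) simp
  define C where "C = Max (range (\<lambda>z. \<bar>h z\<bar>))"
  have hC: "\<bar>h z\<bar> \<le> C" for z unfolding C_def by (rule abs_le_Max_range)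
  have bound: "norm (discount m ^ n * h z) \<le> C * discount m ^ n" for n z
    using hC[of z] \<gamma> by (simp add: abs_mult mult.commute mult_right_mono)
  have int: "integrable ?P (\<lambda>\<omega>. discount m ^ n * h (\<omega> n))" for n
    by (rule P.integrable_const_bound[where B = "C * discount m ^ n"]) (use bound in auto)
  have summ: "summable (\<lambda>n. C * discount m ^ n)"
    using \<gamma> by (intro summable_mult summable_geometric) simp
  have s1: "summable (\<lambda>n. norm (discount m ^ n * h (\<omega> n)))" for \<omega> :: "nat \<Rightarrow> 's \<times> 'a"
    by (rule summable_comparison_test[OF _ summ]) (use bound in auto)
  have s2: "summable (\<lambda>n. \<integral>\<omega>. norm (discount m ^ n * h (\<omega> n)) \<partial>?P)"
  proof (rule summable_comparison_test[OF _ summ], intro exI allI impI)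
    fix n
    have "(\<integral>\<omega>. norm (discount m ^ n * h (\<omega> n)) \<partial>?P) \<le> (\<integral>\<omega>. C * discount m ^ n \<partial>?P)"
      by (rule integral_mono) (use int bound in auto)
    then show "norm (\<integral>\<omega>. norm (discount m ^ n * h (\<omega> n)) \<partial>?P) \<le> C * discount m ^ n"
      by (simp add: P.prob_space)
  qed
  have "(\<lambda>n. \<integral>\<omega>. discount m ^ n * h (\<omega> n) \<partial>?P) sums (\<integral>\<omega>. (\<Sum>n. discount m ^ n * h (\<omega> n)) \<partial>?P)"
    by (rule sums_integral[OF int]) (use s1 s2 in auto)
  moreover have "(\<integral>\<omega>. discount m ^ n * h (\<omega> n) \<partial>?P) = discount m ^ n * \<E> (step_law m \<pi> s n) h" for n
    unfolding distr_path_measure[symmetric] by (simp add: integral_distr)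
  ultimately have "(\<lambda>n. discount m ^ n * \<E> (step_law m \<pi> s n) h)
      sums (\<integral>\<omega>. (\<Sum>n. discount m ^ n * h (\<omega> n)) \<partial>?P)"
    by (simp only:)
  then show ?thesis unfolding soft_value_def h_def .
qed

text \<open>The hypothesis says that \<open>V\<close> is a super-solution (for \<open>\<sigma> = 1\<close>) or a sub-solution (for \<open>\<sigma> = -1\<close>) of the linear
Bellman equation of \<open>\<pi>\<close>. Along the trajectory the rewards collected up to time \<open>n\<close> plus the discounted
value of the current state change monotonically in \<open>n\<close>, and the second part vanishes in the limit.\<close>

lemma soft_value_compare:
  fixes m :: "('s::finite, 'a::finite) mdp"
  assumes \<gamma>: "0 \<le> discount m" "discount m < 1" and \<pi>: "is_policy \<pi>"
    and rel: "\<And>s. \<sigma> * (\<Sum>a\<in>UNIV. \<pi> $ s $ a * (reward m s a + lam * policy_entropy \<pi> s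
        + discount m * expect_next m V s a)) \<le> \<sigma> * V s"
  shows "\<sigma> * soft_value lam m \<pi> s \<le> \<sigma> * V s"
proof -
  define h where "h z = reward m (fst z) (snd z) + lam * policy_entropy \<pi> (fst z)" for z :: "'s \<times> 'a"
  let ?E = "\<lambda>n. \<E> (step_law m \<pi> s n)"
  define b where "b n = ?E n (\<lambda>z. V (fst z))" for n
  have fin: "integrable (measure_pmf p) g" for p :: "('s \<times> 'a) pmf" and g :: "_ \<Rightarrow> real"
    by (rule integrable_measure_pmf_finite) simp
  have step: "\<sigma> * (?E n h + discount m * b (Suc n)) \<le> \<sigma> * b n" for n
  proof -
    have "?E n h + discount m * b (Suc n) = ?E n (\<lambda>z. h z + discount m * expect_next m V (fst z) (snd z))"
      unfolding b_def expectation_step_law_Suc_state[OF \<pi>] by (simp add: fin)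
    also have "\<dots> = ?E n (\<lambda>z. \<Sum>a\<in>UNIV. \<pi> $ fst z $ a * (h (fst z, a) + discount m * expect_next m V (fst z) a))"
      by (subst expectation_step_law_average[OF \<pi>]) simp
    finally have "\<sigma> * (?E n h + discount m * b (Suc n))
        = ?E n (\<lambda>z. \<sigma> * (\<Sum>a\<in>UNIV. \<pi> $ fst z $ a * (h (fst z, a) + discount m * expect_next m V (fst z) a)))"
      by (simp add: fin)
    also have "\<dots> \<le> ?E n (\<lambda>z. \<sigma> * V (fst z))"
      by (rule integral_mono) (use rel fin in \<open>auto simp: h_def\<close>)
    also have "\<dots> = \<sigma> * b n" by (simp add: fin b_def)
    finally show ?thesis .
  qed
  have b0: "b 0 = V s"
    using \<pi> by (simp add: b_def expectation_act_pmf[OF \<pi>] is_policy_def flip: sum_distrib_right)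
  have partial: "\<sigma> * ((\<Sum>k<n. discount m ^ k * ?E k h) + discount m ^ n * b n) \<le> \<sigma> * V s" for n
  proof (induction n)
    case 0 show ?case by (simp add: b0)
  next
    case (Suc n)
    have "discount m ^ n * (\<sigma> * (?E n h + discount m * b (Suc n))) \<le> discount m ^ n * (\<sigma> * b n)"
      by (rule mult_left_mono[OF step]) (use \<gamma> in simp)
    with Suc.IH show ?case by (simp add: algebra_simps)
  qed
  have "(\<lambda>n. discount m ^ n * b n) \<longlonglongrightarrow> 0"
  proof (rule Lim_null_comparison)
    have "\<bar>b n\<bar> \<le> Max (range (\<lambda>s. \<bar>V s\<bar>))" for n
      unfolding b_def by (rule abs_expectation_le) (rule abs_le_Max_range)
    then show "eventually (\<lambda>n. norm (discount m ^ n * b n) \<le> discount m ^ n * Max (range (\<lambda>s. \<bar>V s\<bar>))) sequentially"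
      using \<gamma> by (intro always_eventually allI) (simp add: abs_mult mult_left_mono)
    show "(\<lambda>n. discount m ^ n * Max (range (\<lambda>s. \<bar>V s\<bar>))) \<longlonglongrightarrow> 0"
      using \<gamma> by (intro tendsto_mult_left_zero LIMSEQ_power_zero) simp
  qed
  moreover have "(\<lambda>n. \<Sum>k<n. discount m ^ k * ?E k h) \<longlonglongrightarrow> soft_value lam m \<pi> s"
    using soft_value_series[OF \<gamma>, of \<pi> s lam] unfolding sums_def h_def .
  ultimately have "(\<lambda>n. \<sigma> * ((\<Sum>k<n. discount m ^ k * ?E k h) + discount m ^ n * b n))
      \<longlonglongrightarrow> \<sigma> * (soft_value lam m \<pi> s + 0)"
    by (intro tendsto_intros)
  then show ?thesis
    using partial by (intro LIMSEQ_le_const2[where a = "\<sigma> * V s"]) auto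
qed

text \<open>By the Gibbs inequality the soft maximum of a fixed point is a super-solution for every policy, and for
the softmax policy of the fixed point it is a solution. So the supremum over the policies is attained there.\<close>

lemma opt_soft_value_eq:
  fixes m :: "('s::finite, 'a::finite) mdp"
  assumes lam: "lam > 0" and \<gamma>: "0 \<le> discount m" "discount m < 1"
    and Q: "soft_bellman lam m Q = Q"
  shows "opt_soft_value lam m = soft_maximum lam Q"
proof
  fix s
  let ?V = "soft_maximum lam Q"
  have Qeq: "reward m s a + discount m * expect_next m ?V s a = Q $ s $ a" for s a
    using arg_cong[OF Q, of "\<lambda>q. q $ s $ a"] by (simp add: soft_bellman_def)
  have avg: "(\<Sum>a\<in>UNIV. \<pi> $ s $ a * (reward m s a + lam * policy_entropy \<pi> s + discount m * expect_next m ?V s a))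
      = (\<Sum>a\<in>UNIV. \<pi> $ s $ a * Q $ s $ a) + lam * policy_entropy \<pi> s" if "is_policy \<pi>" for \<pi> s
  proof -
    have "(\<Sum>a\<in>UNIV. \<pi> $ s $ a * (reward m s a + lam * policy_entropy \<pi> s + discount m * expect_next m ?V s a))
        = (\<Sum>a\<in>UNIV. \<pi> $ s $ a * Q $ s $ a + \<pi> $ s $ a * (lam * policy_entropy \<pi> s))"
      by (intro sum.cong refl) (simp add: Qeq[symmetric] algebra_simps)
    also have "\<dots> = (\<Sum>a\<in>UNIV. \<pi> $ s $ a * Q $ s $ a) + lam * policy_entropy \<pi> s"
      using that by (simp add: sum.distrib is_policy_def flip: sum_distrib_right)
    finally show ?thesis .
  qed
  have upper: "soft_value lam m \<pi> s \<le> ?V s" if "is_policy \<pi>" for \<pi>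
    using soft_value_compare[OF \<gamma> that, where \<sigma> = 1 and V = ?V] avg[OF that] Gibbs_variational_le[OF lam that]
    by simp
  have "- 1 * soft_value lam m (softmax_policy lam Q) s \<le> - 1 * ?V s"
    by (rule soft_value_compare[OF \<gamma> is_policy_softmax_policy])
      (simp add: avg[OF is_policy_softmax_policy] soft_maximum_eq_softmax_policy[OF lam])
  then have lower: "?V s \<le> soft_value lam m (softmax_policy lam Q) s" by simp
  have bdd: "bdd_above ((\<lambda>\<pi>. soft_value lam m \<pi> s) ` {\<pi>. is_policy \<pi>})"
    using upper by (intro bdd_aboveI2) auto
  show "opt_soft_value lam m s = ?V s"
    unfolding opt_soft_value_def
  proof (rule antisym)
    show "(SUP \<pi>\<in>{\<pi>. is_policy \<pi>}. soft_value lam m \<pi> s) \<le> ?V s"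
      by (rule cSUP_least) (use upper is_policy_softmax_policy in auto)
    show "?V s \<le> (SUP \<pi>\<in>{\<pi>. is_policy \<pi>}. soft_value lam m \<pi> s)"
      using lower cSUP_upper[OF _ bdd, of "softmax_policy lam Q"] is_policy_softmax_policy
      by fastforce
  qed
qed

lemma
  fixes m :: "('s::finite, 'a::finite) mdp"
  assumes lam: "lam > 0" and \<gamma>: "0 \<le> discount m" "discount m < 1"
    and r: "\<And>s a. \<bar>reward m s a\<bar> \<le> R"
  shows soft_bellman_opt_soft_q: "soft_bellman lam m (opt_soft_q lam m) = opt_soft_q lam m"
    and opt_soft_q_in_entry_ball: "opt_soft_q lam m \<in> entry_ball (q_bound R (discount m) lam CARD('a))"
proof -
  obtain Q where Q: "soft_bellman lam m Q = Q" "Q \<in> entry_ball (q_bound R (discount m) lam CARD('a))"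
    using ex_soft_bellman_fixed_point[OF lam \<gamma> r] by metis
  have "opt_soft_q lam m = soft_bellman lam m Q"
    unfolding opt_soft_q_def soft_bellman_def opt_soft_value_eq[OF lam \<gamma> Q(1)] expectation_kernel ..
  with Q show "soft_bellman lam m (opt_soft_q lam m) = opt_soft_q lam m"
    "opt_soft_q lam m \<in> entry_ball (q_bound R (discount m) lam CARD('a))" by simp_all
qed

section \<open>Mean and second moment of the gradient estimator\<close>

lemma
  fixes F :: "nat \<Rightarrow> 'v::euclidean_space"
  assumes q: "0 < q" "q < 1"
  shows integrable_geometric_pmf_iff:
      "integrable (geometric_pmf (1 - q)) F \<longleftrightarrow> summable (\<lambda>n. (1 - q) * q ^ n * norm (F n))"
    and geometric_pmf_sums: "integrable (geometric_pmf (1 - q)) F \<Longrightarrow>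
      (\<lambda>n. ((1 - q) * q ^ n) *\<^sub>R F n) sums \<E> (geometric_pmf (1 - q)) F"
proof -
  have pmf: "pmf (geometric_pmf (1 - q)) n = (1 - q) * q ^ n" for n
    using q by simp
  have iff: "integrable (geometric_pmf (1 - q)) F
      \<longleftrightarrow> integrable (count_space UNIV) (\<lambda>n. ((1 - q) * q ^ n) *\<^sub>R F n)"
    unfolding measure_pmf_eq_density pmf[symmetric] by (subst integrable_density) auto
  then show "integrable (geometric_pmf (1 - q)) F \<longleftrightarrow> summable (\<lambda>n. (1 - q) * q ^ n * norm (F n))"
    using q by (simp add: integrable_count_space_nat_iff abs_mult)
  assume int: "integrable (geometric_pmf (1 - q)) F"
  have "\<E> (geometric_pmf (1 - q)) F = (\<integral>n. ((1 - q) * q ^ n) *\<^sub>R F n \<partial>count_space UNIV)"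
    unfolding measure_pmf_eq_density pmf[symmetric] by (subst integral_density) auto
  then show "(\<lambda>n. ((1 - q) * q ^ n) *\<^sub>R F n) sums \<E> (geometric_pmf (1 - q)) F"
    using sums_integral_count_space_nat[of "\<lambda>n. ((1 - q) * q ^ n) *\<^sub>R F n"] int iff by simp
qed

lemma expectation_const_bound:
  fixes h :: "'b \<Rightarrow> 'v::euclidean_space"
  assumes "\<And>z. z \<in> set_pmf p \<Longrightarrow> norm (h z) \<le> C"
  shows "norm (\<E> p h) \<le> C" "integrable (measure_pmf p) h"
proof -
  show i: "integrable (measure_pmf p) h"
    by (rule measure_pmf.integrable_const_bound[where B = C]) (use assms in \<open>auto simp: AE_measure_pmf_iff\<close>)
  have "norm (\<E> p h) \<le> \<E> p (\<lambda>z. norm (h z))"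
    by (rule integral_norm_bound)
  also have "\<dots> \<le> \<E> p (\<lambda>_. C)"
    by (rule integral_mono_AE) (use i assms in \<open>auto simp: AE_measure_pmf_iff\<close>)
  finally show "norm (\<E> p h) \<le> C" by simp
qed

text \<open>Differentiating the geometric series twice bounds the series with weights \<open>(n + 1) (n + 2)\<close>.\<close>

lemma integrable_geometric_pmf_square:
  assumes q: "0 < q" "q < 1"
  shows "integrable (geometric_pmf (1 - q)) (\<lambda>n. (real n + 1)\<^sup>2)"
proof -
  have s0: "summable (\<lambda>n. 1 * x ^ n)" if "norm x < 1" for x :: real
    using that by (simp add: summable_geometric)
  have s1: "summable (\<lambda>n. diffs (\<lambda>_. 1) n * x ^ n)" if "norm x < 1" for x :: real
    by (rule termdiff_converges[OF that s0])
  have s2: "summable (\<lambda>n. diffs (diffs (\<lambda>_. 1)) n * q ^ n)"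
    by (rule termdiff_converges[of q 1, OF _ s1]) (use q in auto)
  have "summable (\<lambda>n. (1 - q) * q ^ n * norm ((real n + 1)\<^sup>2))"
  proof (rule summable_comparison_test[OF _ summable_mult[OF s2, of "1 - q"]], intro exI allI impI)
    fix n
    have "q ^ n * (real n + 1)\<^sup>2 \<le> q ^ n * ((real n + 1) * (real n + 2))"
      by (rule mult_left_mono) (use q in \<open>simp_all add: power2_eq_square algebra_simps\<close>)
    then have "(1 - q) * (q ^ n * (real n + 1)\<^sup>2) \<le> (1 - q) * (q ^ n * ((real n + 1) * (real n + 2)))"
      using q by (intro mult_left_mono) auto
    then show "norm ((1 - q) * q ^ n * norm ((real n + 1)\<^sup>2)) \<le> (1 - q) * (diffs (diffs (\<lambda>_. 1)) n * q ^ n)"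
      using q by (simp add: diffs_def algebra_simps abs_mult)
  qed
  then show ?thesis by (subst integrable_geometric_pmf_iff[OF q])
qed

text \<open>Conditioning on whether a geometric time is zero. If a quantity with horizon \<open>Suc n\<close> is a fixed part
plus the average of the same quantity with horizon \<open>n\<close> at the next state, then its mean over a geometric
horizon solves a Bellman equation with discount \<open>q k\<close>.\<close>

lemma geometric_pmf_resolvent:
  fixes F :: "'z::finite \<Rightarrow> nat \<Rightarrow> 'v::euclidean_space"
  assumes q: "0 < q" "q < 1"
    and int: "\<And>z. integrable (geometric_pmf (1 - q)) (F z)"
    and rec: "\<And>z n. F z (Suc n) = c z + k *\<^sub>R \<E> (w z) (\<lambda>z'. F z' n)"
  shows "\<E> (geometric_pmf (1 - q)) (F z) = (1 - q) *\<^sub>R F z 0 + q *\<^sub>R c z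
    + (q * k) *\<^sub>R \<E> (w z) (\<lambda>z'. \<E> (geometric_pmf (1 - q)) (F z'))"
proof -
  let ?E = "\<lambda>z. \<E> (geometric_pmf (1 - q)) (F z)"
  have fin: "\<E> (w z) h = (\<Sum>z'\<in>UNIV. pmf (w z) z' *\<^sub>R h z')" for h :: "'z \<Rightarrow> 'v"
    by (rule integral_measure_pmf) auto
  have S: "(\<lambda>n. ((1 - q) * q ^ n) *\<^sub>R F z n) sums ?E z" for z
    by (rule geometric_pmf_sums[OF q int])
  have "(\<lambda>n. (1 - q) * q ^ n) sums ((1 - q) * (1 / (1 - q)))"
    using q by (intro sums_mult geometric_sums) simp
  then have one: "(\<lambda>n. (1 - q) * q ^ n) sums 1" using q by simp
  have "(\<lambda>n. q *\<^sub>R (((1 - q) * q ^ n) *\<^sub>R c z + k *\<^sub>R (\<Sum>z'\<in>UNIV. pmf (w z) z' *\<^sub>R (((1 - q) * q ^ n) *\<^sub>R F z' n))))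
      sums (q *\<^sub>R (1 *\<^sub>R c z + k *\<^sub>R (\<Sum>z'\<in>UNIV. pmf (w z) z' *\<^sub>R ?E z')))"
    by (intro sums_scaleR_right sums_add sums_scaleR_left one sums_sum S)
  moreover have "q *\<^sub>R (((1 - q) * q ^ n) *\<^sub>R c z + k *\<^sub>R (\<Sum>z'\<in>UNIV. pmf (w z) z' *\<^sub>R (((1 - q) * q ^ n) *\<^sub>R F z' n)))
      = ((1 - q) * q ^ Suc n) *\<^sub>R F z (Suc n)" for n
    unfolding rec fin
    by (simp add: scaleR_add_right scaleR_sum_right mult_ac)
  ultimately have "(\<lambda>n. ((1 - q) * q ^ Suc n) *\<^sub>R F z (Suc n))
      sums (q *\<^sub>R (c z + k *\<^sub>R (\<Sum>z'\<in>UNIV. pmf (w z) z' *\<^sub>R ?E z')))"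
    by simp
  from sums_Suc[OF this] S[of z]
  have "?E z = q *\<^sub>R (c z + k *\<^sub>R (\<Sum>z'\<in>UNIV. pmf (w z) z' *\<^sub>R ?E z')) + ((1 - q) * q ^ 0) *\<^sub>R F z 0"
    by (rule sums_unique2[rotated])
  then show ?thesis unfolding fin by (simp add: scaleR_add_right)
qed

definition reward_gradient :: "(real^'d \<Rightarrow> ('s, 'a) mdp) \<Rightarrow> real^'d \<Rightarrow> 's \<times> 'a \<Rightarrow> real^'d" where
  "reward_gradient m x z = gradient (\<lambda>y. reward (m y) (fst z) (snd z)) x"

definition score :: "(real^'d \<Rightarrow> ('s, 'a) mdp) \<Rightarrow> real^'d \<Rightarrow> 's \<times> 'a \<Rightarrow> 's \<Rightarrow> real^'d" where
  "score m x z s' = gradient (\<lambda>y. ln (pmf (kernel (m y) (fst z) (snd z)) s')) x"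

definition soft_reward :: "real \<Rightarrow> ('s, 'a) mdp \<Rightarrow> real^'a::finite^'s::finite \<Rightarrow> 's \<times> 'a \<Rightarrow> real" where
  "soft_reward lam m \<pi> z = reward m (fst z) (snd z) + lam * policy_entropy \<pi> (fst z)"

text \<open>With the weights \<open>q\<^sup>j\<close> for \<open>q = \<gamma>\<^bsup>1/2\<^esup>\<close> and a horizon that exceeds \<open>j\<close> with probability \<open>q\<^sup>j\<close>, each reward
has the expected weight \<open>\<gamma>\<^sup>j\<close>.\<close>

definition weighted_return :: "real \<Rightarrow> ('z \<Rightarrow> real) \<Rightarrow> nat \<Rightarrow> 'z list \<Rightarrow> real" where
  "weighted_return q g n \<tau> = (\<Sum>j=0..n. q ^ j * g (\<tau> ! j))"

lemma weighted_return_Suc: "weighted_return q g (Suc n) (z # \<tau>) = g z + q * weighted_return q g n \<tau>"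
  unfolding weighted_return_def sum.atLeast0_atMost_Suc_shift by (simp add: sum_distrib_left mult_ac)

lemma weighted_return_0: "weighted_return q g 0 (z # \<tau>) = g z"
  by (simp add: weighted_return_def)

lemma abs_weighted_return_le:
  assumes q: "0 < q" "q < 1" and g: "\<And>z. \<bar>g z\<bar> \<le> G"
  shows "\<bar>weighted_return q g n \<tau>\<bar> \<le> G / (1 - q)"
proof -
  have G: "0 \<le> G" using g[of undefined] by linarith
  have "\<bar>weighted_return q g n \<tau>\<bar> \<le> (\<Sum>j=0..n. q ^ j * G)"
    unfolding weighted_return_def
    by (rule order_trans[OF sum_abs]) (use q g in \<open>auto intro!: sum_mono mult_left_mono simp: abs_mult\<close>)
  also have "\<dots> = G * (\<Sum>j<Suc n. q ^ j)"
    by (simp add: sum_distrib_left mult.commute atLeast0AtMost lessThan_Suc_atMost)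
  also have "\<dots> \<le> G * (1 / (1 - q))"
  proof (rule mult_left_mono[OF _ G])
    have "(\<Sum>j<Suc n. q ^ j) = (1 - q ^ Suc n) / (1 - q)"
      using q unfolding sum_gp_strict by simp
    also have "\<dots> \<le> 1 / (1 - q)"
      by (rule divide_right_mono) (use q zero_le_power[of q "Suc n"] in linarith)+
    finally show "(\<Sum>j<Suc n. q ^ j) \<le> 1 / (1 - q)" .
  qed
  finally show ?thesis by simp
qed

text \<open>The value that the Q-gradient estimator computes from a trajectory once both horizons have been drawn.\<close>

definition trajectory_gradient ::
  "real \<Rightarrow> (real^'d \<Rightarrow> ('s::finite, 'a::finite) mdp) \<Rightarrow> real^'d \<Rightarrow> real^'a^'s \<Rightarrow> nat \<Rightarrow> nat
    \<Rightarrow> ('s \<times> 'a) list \<Rightarrow> real^'d" where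
  "trajectory_gradient lam m x \<pi> T T' \<tau> =
     (\<Sum>t=0..T. reward_gradient m x (\<tau> ! t))
     + (discount (m x) / (1 - discount (m x))
          * weighted_return (discount (m x) powr (1/2)) (soft_reward lam (m x) \<pi>) T' (drop (Suc T) \<tau>))
       *\<^sub>R score m x (\<tau> ! T) (fst (\<tau> ! Suc T))"

lemma length_trajectory: "\<tau> \<in> set_pmf (trajectory m \<pi> n z) \<Longrightarrow> length \<tau> = Suc n"
  by (induction n arbitrary: z \<tau>) auto

lemma trajectory_Cons: "\<tau> \<in> set_pmf (trajectory m \<pi> n z) \<Longrightarrow> \<exists>\<tau>'. \<tau> = z # \<tau>'"
  by (cases n) auto

lemma finite_set_trajectory:
  fixes m :: "('s::finite, 'a::finite) mdp"
  shows "finite (set_pmf (trajectory m \<pi> n z))"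
  by (induction n arbitrary: z) auto

lemma dQ_estimator_eq:
  fixes m :: "real^'d \<Rightarrow> ('s::finite, 'a::finite) mdp"
  assumes \<gamma>: "0 < discount (m x)"
  shows "dQ_estimator lam m x \<pi> s a = bind_pmf (geometric_pmf (1 - discount (m x)))
    (\<lambda>T. bind_pmf (geometric_pmf (1 - discount (m x) powr (1/2)))
    (\<lambda>T'. map_pmf (trajectory_gradient lam m x \<pi> T T') (trajectory (m x) \<pi> (T + T' + 1) (s, a))))"
proof -
  have pw: "discount (m x) powr (real j / 2) = (discount (m x) powr (1/2)) ^ j" for j
    using \<gamma> by (simp add: powr_powr flip: powr_realpow)
  have eq: "(\<Sum>t=T+1..T+T'+1. discount (m x) powr (real (t - T - 1) / 2)
        * (reward (m x) (fst (\<tau> ! t)) (snd (\<tau> ! t)) + lam * policy_entropy \<pi> (fst (\<tau> ! t))))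
      = weighted_return (discount (m x) powr (1/2)) (soft_reward lam (m x) \<pi>) T' (drop (Suc T) \<tau>)"
    if "length \<tau> = T + T' + 2" for T T' \<tau>
  proof -
    have "(\<Sum>t=T+1..T+T'+1. discount (m x) powr (real (t - T - 1) / 2)
        * (reward (m x) (fst (\<tau> ! t)) (snd (\<tau> ! t)) + lam * policy_entropy \<pi> (fst (\<tau> ! t))))
      = (\<Sum>t=0+(T+1)..T'+(T+1). discount (m x) powr (real (t - T - 1) / 2)
        * soft_reward lam (m x) \<pi> (\<tau> ! t))"
      by (rule sum.cong) (auto simp: soft_reward_def)
    also have "\<dots> = weighted_return (discount (m x) powr (1/2)) (soft_reward lam (m x) \<pi>) T' (drop (Suc T) \<tau>)"
      unfolding sum.shift_bounds_cl_nat_ivl weighted_return_def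
      by (rule sum.cong) (use that in \<open>auto simp: pw add.commute\<close>)
    finally show ?thesis .
  qed
  show ?thesis
    unfolding dQ_estimator_def Let_def map_pmf_def
  proof (intro bind_pmf_cong refl)
    fix T T' and \<tau> :: "('s \<times> 'a) list"
    assume "\<tau> \<in> set_pmf (trajectory (m x) \<pi> (T + T' + 1) (s, a))"
    then have "length \<tau> = T + T' + 2" by (subst length_trajectory) auto
    from eq[OF this]
    show "return_pmf
       ((\<Sum>t=0..T. gradient (\<lambda>y. reward (m y) (fst (\<tau> ! t)) (snd (\<tau> ! t))) x)
        + (discount (m x) / (1 - discount (m x))
           * (\<Sum>t=T+1..T+T'+1. discount (m x) powr (real (t - T - 1) / 2)
                * (reward (m x) (fst (\<tau> ! t)) (snd (\<tau> ! t)) + lam * policy_entropy \<pi> (fst (\<tau> ! t)))))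
          *\<^sub>R gradient (\<lambda>y. ln (pmf (kernel (m y) (fst (\<tau> ! T)) (snd (\<tau> ! T))) (fst (\<tau> ! (T + 1))))) x)
      = return_pmf (trajectory_gradient lam m x \<pi> T T' \<tau>)"
      unfolding trajectory_gradient_def reward_gradient_def score_def by simp
  qed
qed

text \<open>Removing the first transition shortens the first horizon by one and removes one reward gradient. This is
the recursion to which \<open>geometric_pmf_resolvent\<close> applies.\<close>

lemma trajectory_gradient_Suc:
  "trajectory_gradient lam m x \<pi> (Suc T) T' (z # \<tau>)
     = reward_gradient m x z + trajectory_gradient lam m x \<pi> T T' \<tau>"
  unfolding trajectory_gradient_def sum.atLeast0_atMost_Suc_shift by simp

lemma trajectory_gradient_0:
  "trajectory_gradient lam m x \<pi> 0 T' (z # z' # \<tau>) = reward_gradient m x z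
     + (discount (m x) / (1 - discount (m x))
          * weighted_return (discount (m x) powr (1/2)) (soft_reward lam (m x) \<pi>) T' (z' # \<tau>))
       *\<^sub>R score m x z (fst z')"
  by (simp add: trajectory_gradient_def)

lemma expectation_trajectory_Suc:
  fixes m :: "('s::finite, 'a::finite) mdp" and h :: "_ \<Rightarrow> 'v::euclidean_space"
  shows "\<E> (trajectory m \<pi> (Suc n) z) h
    = \<E> (sa_step m \<pi> z) (\<lambda>z'. \<E> (trajectory m \<pi> n z') (\<lambda>\<tau>. h (z # \<tau>)))"
proof -
  have "\<E> (trajectory m \<pi> (Suc n) z) h
    = (\<Sum>z'\<in>UNIV. pmf (sa_step m \<pi> z) z' *\<^sub>R \<E> (trajectory m \<pi> n z') (\<lambda>\<tau>. h (z # \<tau>)))"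
    unfolding trajectory.simps map_pmf_def[symmetric]
    by (subst pmf_expectation_bind[where A = UNIV]) (auto simp: finite_set_trajectory)
  then show ?thesis by (subst integral_measure_pmf[of UNIV]) auto
qed

text \<open>The mean of the rollout inside the gradient estimator. By its Bellman equation below it is the regularized
action value of \<open>\<pi>\<close>, with the entropy bonus of the first step included.\<close>

definition policy_action_value ::
  "real \<Rightarrow> ('s::finite, 'a::finite) mdp \<Rightarrow> real^'a^'s \<Rightarrow> 's \<times> 'a \<Rightarrow> real" where
  "policy_action_value lam m \<pi> z = \<E> (geometric_pmf (1 - discount m powr (1/2)))
     (\<lambda>n. \<E> (trajectory m \<pi> n z)
        (weighted_return (discount m powr (1/2)) (soft_reward lam m \<pi>) n))"

lemma sqrt_discount:
  assumes "0 < \<gamma>" "\<gamma> < (1::real)"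
  shows "0 < \<gamma> powr (1/2)" "\<gamma> powr (1/2) < 1" "\<gamma> powr (1/2) * \<gamma> powr (1/2) = \<gamma>"
  using assms powr_less_mono2[of "1/2" \<gamma> 1] by (auto simp flip: powr_add)

lemma policy_action_value_Bellman:
  fixes m :: "('s::finite, 'a::finite) mdp"
  assumes \<gamma>: "0 < discount m" "discount m < 1"
  shows "policy_action_value lam m \<pi> z = soft_reward lam m \<pi> z
    + discount m * \<E> (sa_step m \<pi> z) (policy_action_value lam m \<pi>)"
proof -
  let ?q = "discount m powr (1/2)" and ?g = "soft_reward lam m \<pi>"
  note q = sqrt_discount[OF \<gamma>]
  define F where "F z n = \<E> (trajectory m \<pi> n z) (weighted_return ?q ?g n)" for z n
  have F0: "F z 0 = ?g z" for z by (simp add: F_def weighted_return_0)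
  have FSuc: "F z (Suc n) = ?g z + ?q *\<^sub>R \<E> (sa_step m \<pi> z) (\<lambda>z'. F z' n)" for z n
  proof -
    have "integrable (trajectory m \<pi> n z') h" for h :: "_ \<Rightarrow> real" and z'
      by (rule integrable_measure_pmf_finite[OF finite_set_trajectory])
    moreover have "integrable (sa_step m \<pi> z) h" for h :: "_ \<Rightarrow> real"
      by (rule integrable_measure_pmf_finite) simp
    ultimately show ?thesis
      unfolding F_def expectation_trajectory_Suc by (simp add: weighted_return_Suc)
  qed
  define G where "G = Max (range (\<lambda>z. \<bar>?g z\<bar>))"
  have g: "\<bar>?g z\<bar> \<le> G" for z unfolding G_def by (rule abs_le_Max_range)
  have int: "integrable (geometric_pmf (1 - ?q)) (F z)" for z
  proof (rule expectation_const_bound(2))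
    show "norm (F z n) \<le> G / (1 - ?q)" for n
      unfolding F_def
      by (rule expectation_const_bound) (use abs_weighted_return_le[where g = ?g, OF q(1,2) g] in simp)
  qed
  have U: "policy_action_value lam m \<pi> = (\<lambda>z. \<E> (geometric_pmf (1 - ?q)) (F z))"
    unfolding policy_action_value_def F_def ..
  show ?thesis
    using geometric_pmf_resolvent[where F = F, OF q(1,2) int FSuc, of z] q(3)
    unfolding U F0 by (simp add: algebra_simps)
qed

text \<open>The score is multiplied by a return that is bounded whatever the second horizon, and it occurs only at
transitions of positive probability. Only the reward gradients accumulate, so the growth is linear in the
first horizon.\<close>

lemma norm_trajectory_gradient_le:
  fixes m :: "real^'d \<Rightarrow> ('s::finite, 'a::finite) mdp"
  assumes \<gamma>: "0 < discount (m x)" "discount (m x) < 1"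
    and g: "\<And>z. \<bar>soft_reward lam (m x) \<pi> z\<bar> \<le> G"
    and K: "\<And>z. norm (reward_gradient m x z) \<le> K"
    and L: "\<And>z s'. pmf (kernel (m x) (fst z) (snd z)) s' > 0 \<Longrightarrow> norm (score m x z s') \<le> L"
    and \<tau>: "\<tau> \<in> set_pmf (trajectory (m x) \<pi> (T + T' + 1) z)"
  shows "norm (trajectory_gradient lam m x \<pi> T T' \<tau>)
    \<le> (K + discount (m x) / (1 - discount (m x)) * (G / (1 - discount (m x) powr (1/2))) * L) * (real T + 1)"
  using \<tau>
proof (induction T arbitrary: z \<tau>)
  let ?q = "discount (m x) powr (1/2)" and ?g = "soft_reward lam (m x) \<pi>"
  let ?c = "discount (m x) / (1 - discount (m x))"
  note q = sqrt_discount[OF \<gamma>]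
  have G: "0 \<le> G" using g[of undefined] by linarith
  have c: "0 \<le> ?c * (G / (1 - ?q))" using \<gamma> q G by simp
  have "set_pmf (kernel (m x) (fst z) (snd z)) \<noteq> {}" for z :: "'s \<times> 'a" by (rule set_pmf_not_empty)
  then obtain s' where "pmf (kernel (m x) (fst (undefined :: 's \<times> 'a)) (snd (undefined :: 's \<times> 'a))) s' > 0"
    using pmf_positive by fastforce
  from L[OF this] have L0: "0 \<le> L" using norm_ge_zero order_trans by blast
  {
    case 0
    then obtain z' where z': "z' \<in> set_pmf (sa_step (m x) \<pi> z)"
      and "\<exists>\<tau>'. \<tau> = z # \<tau>' \<and> \<tau>' \<in> set_pmf (trajectory (m x) \<pi> T' z')"
      by auto
    then obtain \<tau>' where \<tau>: "\<tau> = z # z' # \<tau>'" using trajectory_Cons by blast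
    have pos: "pmf (kernel (m x) (fst z) (snd z)) (fst z') > 0"
      using z' by (auto simp: sa_step_def intro: pmf_positive)
    have "norm ((?c * weighted_return ?q ?g T' (z' # \<tau>')) *\<^sub>R score m x z (fst z')) \<le> ?c * (G / (1 - ?q)) * L"
      using abs_weighted_return_le[where g = ?g, OF q(1,2) g, of T' "z' # \<tau>'"] L[OF pos] \<gamma> c
      unfolding norm_scaleR abs_mult by (intro mult_mono) auto
    then show ?case
      using K[of z] norm_triangle_ineq[of "reward_gradient m x z"
        "(?c * weighted_return ?q ?g T' (z' # \<tau>')) *\<^sub>R score m x z (fst z')"]
      unfolding \<tau> trajectory_gradient_0 by simp
  next
    case (Suc T)
    have "\<tau> \<in> set_pmf (trajectory (m x) \<pi> (Suc (T + T' + 1)) z)"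
      using Suc.prems by (simp only: add_Suc)
    then obtain z' \<tau>' where \<tau>: "\<tau> = z # \<tau>'" and \<tau>': "\<tau>' \<in> set_pmf (trajectory (m x) \<pi> (T + T' + 1) z')"
      unfolding trajectory.simps by (auto simp del: trajectory.simps)
    have "K \<le> K + ?c * (G / (1 - ?q)) * L" using mult_nonneg_nonneg[OF c L0] by linarith
    with Suc.IH[OF \<tau>'] K[of z] norm_triangle_ineq[of "reward_gradient m x z" "trajectory_gradient lam m x \<pi> T T' \<tau>'"]
    have "norm (reward_gradient m x z + trajectory_gradient lam m x \<pi> T T' \<tau>')
      \<le> (K + ?c * (G / (1 - ?q)) * L) + (K + ?c * (G / (1 - ?q)) * L) * (real T + 1)"
      by linarith
    also have "\<dots> = (K + ?c * (G / (1 - ?q)) * L) * (real (Suc T) + 1)"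
      unfolding of_nat_Suc by (simp only: distrib_left mult_1_right add_ac)
    finally show ?case unfolding \<tau> trajectory_gradient_Suc .
  }
qed

definition second_moment_geometric :: "real \<Rightarrow> real" where
  "second_moment_geometric \<gamma> = \<E> (geometric_pmf (1 - \<gamma>)) (\<lambda>n. (real n + 1)\<^sup>2)"

text \<open>The estimate grows linearly in a geometric time, whose second moment is finite. For the mean, horizon zero
contributes the reward gradient and the score times the value of the next state, and each longer horizon
contributes a reward gradient and passes on to the next state.\<close>

lemma
  fixes m :: "real^'d \<Rightarrow> ('s::finite, 'a::finite) mdp"
  assumes \<gamma>: "0 < discount (m x)" "discount (m x) < 1"
    and g: "\<And>z. \<bar>soft_reward lam (m x) \<pi> z\<bar> \<le> G"
    and K: "\<And>z. norm (reward_gradient m x z) \<le> K"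
    and L: "\<And>z s'. pmf (kernel (m x) (fst z) (snd z)) s' > 0 \<Longrightarrow> norm (score m x z s') \<le> L"
  shows has_moments_dQ_estimator: "has_moments (dQ_estimator lam m x \<pi> s a) (\<lambda>v. v)
      (\<E> (dQ_estimator lam m x \<pi> s a) (\<lambda>v. v))
      ((K + discount (m x) / (1 - discount (m x)) * (G / (1 - discount (m x) powr (1/2))) * L)\<^sup>2
        * second_moment_geometric (discount (m x)))"
    and expectation_dQ_estimator_Bellman:
      "\<E> (dQ_estimator lam m x \<pi> s a) (\<lambda>v. v) =
        reward_gradient m x (s, a)
        + discount (m x) *\<^sub>R \<E> (sa_step (m x) \<pi> (s, a))
            (\<lambda>z'. policy_action_value lam (m x) \<pi> z' *\<^sub>R score m x (s, a) (fst z'))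
        + discount (m x) *\<^sub>R \<E> (sa_step (m x) \<pi> (s, a))
            (\<lambda>z'. \<E> (dQ_estimator lam m x \<pi> (fst z') (snd z')) (\<lambda>v. v))"
proof -
  let ?\<gamma> = "discount (m x)" and ?q = "discount (m x) powr (1/2)" and ?g = "soft_reward lam (m x) \<pi>"
  let ?st = "sa_step (m x) \<pi>"
  define \<kappa> where "\<kappa> = K + ?\<gamma> / (1 - ?\<gamma>) * (G / (1 - ?q)) * L"
  note q = sqrt_discount[OF \<gamma>]
  define D where "D T T' z = map_pmf (trajectory_gradient lam m x \<pi> T T') (trajectory (m x) \<pi> (T + T' + 1) z)" for T T' z
  have bD: "norm v \<le> \<kappa> * (real T + 1)" if v_in: "v \<in> set_pmf (D T T' z)" for v T T' z
  proof -
    obtain \<tau> where "\<tau> \<in> set_pmf (trajectory (m x) \<pi> (T + T' + 1) z)"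
      and v: "v = trajectory_gradient lam m x \<pi> T T' \<tau>"
      using v_in unfolding D_def set_map_pmf by blast
    from norm_trajectory_gradient_le[OF \<gamma> g K L this(1)] show ?thesis
      unfolding v \<kappa>_def .
  qed
  have fin: "integrable (trajectory (m x) \<pi> n z) h" for n z and h :: "_ \<Rightarrow> 'v::euclidean_space"
    by (rule integrable_measure_pmf_finite[OF finite_set_trajectory])
  have finst: "integrable (?st z) h" for z and h :: "_ \<Rightarrow> 'v::euclidean_space"
    by (rule integrable_measure_pmf_finite) simp
  have hmD: "has_moments (D T T' z) (\<lambda>v. v) (\<E> (D T T' z) (\<lambda>v. v)) ((\<kappa> * (real T + 1))\<^sup>2)" for T T' z
  proof (rule has_momentsI)
    have "(norm v)\<^sup>2 \<le> (\<kappa> * (real T + 1))\<^sup>2" if "v \<in> set_pmf (D T T' z)" for v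
      using bD[OF that] by (intro power_mono) auto
    then have "(\<integral>\<^sup>+v. ennreal ((norm v)\<^sup>2) \<partial>measure_pmf (D T T' z))
        \<le> (\<integral>\<^sup>+v. ennreal ((\<kappa> * (real T + 1))\<^sup>2) \<partial>measure_pmf (D T T' z))"
      by (intro nn_integral_mono_AE) (auto simp: AE_measure_pmf_iff intro!: ennreal_leI)
    then show "(\<integral>\<^sup>+v. ennreal ((norm v)\<^sup>2) \<partial>measure_pmf (D T T' z)) \<le> ennreal ((\<kappa> * (real T + 1))\<^sup>2)"
      by (simp add: measure_pmf.emeasure_space_1)
  qed (auto simp: prob_space_measure_pmf)
  define e where "e z T = \<E> (geometric_pmf (1 - ?q)) (\<lambda>T'. \<E> (D T T' z) (\<lambda>v. v))" for z T
  have hme: "has_moments (bind_pmf (geometric_pmf (1 - ?q)) (\<lambda>T'. D T T' z)) (\<lambda>v. v)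
      (e z T) ((\<kappa> * (real T + 1))\<^sup>2)" for T z
    unfolding e_def by (rule has_moments_bind_pmf_const(1)) (rule hmD)
  have inte: "integrable (geometric_pmf (1 - ?q)) (\<lambda>T'. \<E> (D T T' z) (\<lambda>v. v))" for T z
    by (rule has_moments_bind_pmf_const(2)) (rule hmD)
  have sq: "(\<lambda>T. (\<kappa> * (real T + 1))\<^sup>2) = (\<lambda>T. \<kappa>\<^sup>2 * (real T + 1)\<^sup>2)"
    by (simp add: power_mult_distrib)
  have intsq: "integrable (geometric_pmf (1 - ?\<gamma>)) (\<lambda>T. (\<kappa> * (real T + 1))\<^sup>2)"
    unfolding sq by (intro integrable_mult_right impI integrable_geometric_pmf_square \<gamma>)
  have dQ: "dQ_estimator lam m x \<pi> (fst z) (snd z)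
      = bind_pmf (geometric_pmf (1 - ?\<gamma>)) (\<lambda>T. bind_pmf (geometric_pmf (1 - ?q)) (\<lambda>T'. D T T' z))" for z
    unfolding D_def dQ_estimator_eq[where m = m and x = x, OF \<gamma>(1)] by simp
  have hmQ: "has_moments (dQ_estimator lam m x \<pi> (fst z) (snd z)) (\<lambda>v. v)
      (\<E> (geometric_pmf (1 - ?\<gamma>)) (e z)) (\<E> (geometric_pmf (1 - ?\<gamma>)) (\<lambda>T. (\<kappa> * (real T + 1))\<^sup>2))" for z
    unfolding dQ by (rule has_moments_bind_pmf(1)[OF hme intsq])
  have intE: "integrable (geometric_pmf (1 - ?\<gamma>)) (e z)" for z
    by (rule has_moments_bind_pmf(2)[OF hme intsq])
  have W: "\<E> (dQ_estimator lam m x \<pi> (fst z) (snd z)) (\<lambda>v. v) = \<E> (geometric_pmf (1 - ?\<gamma>)) (e z)" for z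
    using hmQ[of z] by (simp add: has_moments_def)
  have "\<E> (geometric_pmf (1 - ?\<gamma>)) (\<lambda>T. (\<kappa> * (real T + 1))\<^sup>2) = \<kappa>\<^sup>2 * second_moment_geometric ?\<gamma>"
    unfolding sq second_moment_geometric_def by simp
  with hmQ[of "(s, a)"] W[of "(s, a)"]
  show "has_moments (dQ_estimator lam m x \<pi> s a) (\<lambda>v. v)
      (\<E> (dQ_estimator lam m x \<pi> s a) (\<lambda>v. v)) ((K + ?\<gamma> / (1 - ?\<gamma>) * (G / (1 - ?q)) * L)\<^sup>2 * second_moment_geometric ?\<gamma>)"
    by (simp add: \<kappa>_def)

  have eSuc: "e z (Suc T) = reward_gradient m x z + 1 *\<^sub>R \<E> (?st z) (\<lambda>z'. e z' T)" for z T
  proof -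
    have 1: "\<E> (D (Suc T) T' z) (\<lambda>v. v) = reward_gradient m x z + \<E> (?st z) (\<lambda>z'. \<E> (D T T' z') (\<lambda>v. v))" for T'
      unfolding D_def integral_map_pmf add_Suc expectation_trajectory_Suc trajectory_gradient_Suc
      by (simp add: fin finst del: trajectory.simps)
    have 2: "\<E> (geometric_pmf (1 - ?q)) (\<lambda>T'. \<E> (?st z) (\<lambda>z'. \<E> (D T T' z') (\<lambda>v. v)))
        = \<E> (?st z) (\<lambda>z'. e z' T)"
      unfolding integral_measure_pmf[of UNIV, OF finite] e_def
      by (simp add: integral_measure_pmf[of UNIV] inte)
    have 3: "integrable (geometric_pmf (1 - ?q)) (\<lambda>T'. \<E> (?st z) (\<lambda>z'. \<E> (D T T' z') (\<lambda>v. v)))"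
      by (subst integral_measure_pmf[of UNIV]) (auto simp: inte)
    show ?thesis unfolding e_def[of z] 1 using 2 3 by simp
  qed
  define F where "F z n = \<E> (trajectory (m x) \<pi> n z) (weighted_return ?q ?g n)" for z n
  have intF: "integrable (geometric_pmf (1 - ?q)) (F z)" for z
  proof (rule expectation_const_bound(2))
    show "norm (F z n) \<le> G / (1 - ?q)" for n
      unfolding F_def
      by (rule expectation_const_bound) (use abs_weighted_return_le[where g = ?g, OF q(1,2) g] in simp)
  qed
  have e0: "e z 0 = reward_gradient m x z + (?\<gamma> / (1 - ?\<gamma>)) *\<^sub>R
      \<E> (?st z) (\<lambda>z'. policy_action_value lam (m x) \<pi> z' *\<^sub>R score m x z (fst z'))" for z
  proof -
    have 0: "\<E> (trajectory (m x) \<pi> T' z') (\<lambda>\<tau>. trajectory_gradient lam m x \<pi> 0 T' (z # \<tau>))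
        = reward_gradient m x z + (?\<gamma> / (1 - ?\<gamma>)) *\<^sub>R (F z' T' *\<^sub>R score m x z (fst z'))" for T' z'
    proof -
      have "\<E> (trajectory (m x) \<pi> T' z') (\<lambda>\<tau>. trajectory_gradient lam m x \<pi> 0 T' (z # \<tau>))
        = \<E> (trajectory (m x) \<pi> T' z') (\<lambda>\<tau>. reward_gradient m x z + (?\<gamma> / (1 - ?\<gamma>))
            *\<^sub>R (weighted_return ?q ?g T' \<tau> *\<^sub>R score m x z (fst z')))"
        by (intro integral_cong_AE) (auto simp: AE_measure_pmf_iff trajectory_gradient_0 dest!: trajectory_Cons)
      also have "\<dots> = reward_gradient m x z + (?\<gamma> / (1 - ?\<gamma>)) *\<^sub>R (F z' T' *\<^sub>R score m x z (fst z'))"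
        unfolding F_def by (simp add: fin)
      finally show ?thesis .
    qed
    have 1: "\<E> (D 0 T' z) (\<lambda>v. v) = reward_gradient m x z + (?\<gamma> / (1 - ?\<gamma>)) *\<^sub>R
        \<E> (?st z) (\<lambda>z'. F z' T' *\<^sub>R score m x z (fst z'))" for T'
      unfolding D_def integral_map_pmf add_0_left Suc_eq_plus1[symmetric] expectation_trajectory_Suc 0
      by (simp add: finst del: scaleR_scaleR)
    have 2: "\<E> (geometric_pmf (1 - ?q)) (\<lambda>T'. \<E> (?st z) (\<lambda>z'. F z' T' *\<^sub>R score m x z (fst z')))
        = \<E> (?st z) (\<lambda>z'. policy_action_value lam (m x) \<pi> z' *\<^sub>R score m x z (fst z'))"
    proof -
      have "policy_action_value lam (m x) \<pi> z' = \<E> (geometric_pmf (1 - ?q)) (F z')" for z'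
        unfolding policy_action_value_def F_def ..
      then show ?thesis
        by (simp add: integral_measure_pmf[of UNIV] intF)
    qed
    have 3: "integrable (geometric_pmf (1 - ?q)) (\<lambda>T'. \<E> (?st z) (\<lambda>z'. F z' T' *\<^sub>R score m x z (fst z')))"
      by (subst integral_measure_pmf[of UNIV]) (auto simp: intF)
    show ?thesis unfolding e_def[of z 0] 1 using 2 3 by simp
  qed
  have "\<E> (geometric_pmf (1 - ?\<gamma>)) (e z) = (1 - ?\<gamma>) *\<^sub>R e z 0 + ?\<gamma> *\<^sub>R reward_gradient m x z
      + (?\<gamma> * 1) *\<^sub>R \<E> (?st z) (\<lambda>z'. \<E> (geometric_pmf (1 - ?\<gamma>)) (e z'))" for z
    by (rule geometric_pmf_resolvent[OF \<gamma> intE eSuc])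
  note rec = this[of "(s, a)"]
  have c: "(1 - ?\<gamma>) * (?\<gamma> / (1 - ?\<gamma>)) = ?\<gamma>" using \<gamma> by simp
  have W': "\<E> (dQ_estimator lam m x \<pi> s a) (\<lambda>v. v) = \<E> (geometric_pmf (1 - ?\<gamma>)) (e (s, a))"
    using W[of "(s, a)"] by simp
  show "\<E> (dQ_estimator lam m x \<pi> s a) (\<lambda>v. v) = reward_gradient m x (s, a)
        + ?\<gamma> *\<^sub>R \<E> (?st (s, a)) (\<lambda>z'. policy_action_value lam (m x) \<pi> z' *\<^sub>R score m x (s, a) (fst z'))
        + ?\<gamma> *\<^sub>R \<E> (?st (s, a)) (\<lambda>z'. \<E> (dQ_estimator lam m x \<pi> (fst z') (snd z')) (\<lambda>v. v))"
    unfolding W W' rec e0 scaleR_add_right scaleR_scaleR c by (simp add: algebra_simps)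
qed

section \<open>The derivative of the optimal policy\<close>

text \<open>Probabilities are exponentials of nonpositive numbers, so Lipschitz bounds for log-probabilities carry over.\<close>

lemma abs_exp_diff_le:
  fixes u v :: real
  assumes "u \<le> 0" "v \<le> 0"
  shows "\<bar>exp u - exp v\<bar> \<le> \<bar>u - v\<bar>"
proof -
  have *: "exp a - exp b \<le> a - b" if "b \<le> a" "a \<le> 0" for a b :: real
  proof -
    have "exp a - exp b = exp a * (1 - exp (b - a))"
      by (simp add: right_diff_distrib flip: exp_add)
    also have "\<dots> \<le> 1 * (1 - exp (b - a))"
      using that by (intro mult_right_mono) auto
    also have "\<dots> \<le> a - b" unfolding mult_1 using exp_ge_add_one_self[of "b - a"] by linarith
    finally show ?thesis .
  qed
  show ?thesis
    using *[of u v] *[of v u] assms by (cases "u \<le> v") (auto simp: abs_if)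
qed

lemma softmax_policy_Lipschitz:
  assumes lam: "lam > 0" and le: "\<And>s a. \<bar>Q $ s $ a - Q' $ s $ a\<bar> \<le> \<delta>"
  shows "\<bar>softmax_policy lam Q $ s $ a - softmax_policy lam Q' $ s $ a\<bar> \<le> 2 * \<delta> / lam"
proof -
  let ?u = "\<lambda>Q. (Q $ s $ a - soft_maximum lam Q s) / lam"
  have nonpos: "?u Q \<le> 0" for Q
  proof -
    have "softmax_policy lam Q $ s $ a \<le> (\<Sum>b\<in>UNIV. softmax_policy lam Q $ s $ b)"
      by (rule member_le_sum) (auto simp: softmax_policy_pos less_imp_le)
    also have "\<dots> = 1" using is_policy_softmax_policy[of lam Q] by (simp add: is_policy_def)
    finally show ?thesis using softmax_policy_eq_exp[OF lam, of Q s a] by simp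
  qed
  have "\<bar>soft_maximum lam Q s - soft_maximum lam Q' s\<bar> \<le> \<delta>"
    by (rule soft_maximum_Lipschitz[OF lam le])
  then have "\<bar>(Q $ s $ a - soft_maximum lam Q s) - (Q' $ s $ a - soft_maximum lam Q' s)\<bar> \<le> 2 * \<delta>"
    using le[of s a] by linarith
  then have "\<bar>?u Q - ?u Q'\<bar> \<le> 2 * \<delta> / lam"
    using lam by (simp add: diff_divide_distrib[symmetric] divide_right_mono)
  with abs_exp_diff_le[OF nonpos[of Q] nonpos[of Q']] show ?thesis
    by (simp add: softmax_policy_eq_exp[OF lam])
qed

definition kernel_gradient :: "(real^'d \<Rightarrow> ('s, 'a) mdp) \<Rightarrow> real^'d \<Rightarrow> 's \<times> 'a \<Rightarrow> 's \<Rightarrow> real^'d" where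
  "kernel_gradient m x z s' = gradient (\<lambda>y. pmf (kernel (m y) (fst z) (snd z)) s') x"

definition policy_state_value :: "real \<Rightarrow> ('s::finite, 'a::finite) mdp \<Rightarrow> real^'a^'s \<Rightarrow> 's \<Rightarrow> real" where
  "policy_state_value lam m \<pi> s = (\<Sum>a\<in>UNIV. \<pi> $ s $ a * policy_action_value lam m \<pi> (s, a))"

definition value_gradient ::
  "real \<Rightarrow> (real^'d \<Rightarrow> ('s::finite, 'a::finite) mdp) \<Rightarrow> real^'d \<Rightarrow> real^'a^'s \<Rightarrow> 's \<times> 'a \<Rightarrow> real^'d" where
  "value_gradient lam m x \<pi> z = \<E> (dQ_estimator lam m x \<pi> (fst z) (snd z)) (\<lambda>v. v)"

definition advantage_gradient ::
  "real \<Rightarrow> (real^'d \<Rightarrow> ('s::finite, 'a::finite) mdp) \<Rightarrow> real^'d \<Rightarrow> real^'a^'s \<Rightarrow> 's \<Rightarrow> 'a \<Rightarrow> real^'d" where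
  "advantage_gradient lam m x \<pi> s a = value_gradient lam m x \<pi> (s, a)
     - (\<Sum>b\<in>UNIV. \<pi> $ s $ b *\<^sub>R value_gradient lam m x \<pi> (s, b))"

text \<open>At the optimal policy this is the gradient of the leader's loss (\<open>leader_loss_has_derivative\<close>). At any other softmax
policy it is the mean of the hypergradient estimator that uses this policy.\<close>

definition policy_hypergradient ::
  "real \<Rightarrow> (real^'d \<Rightarrow> ('s::finite, 'a::finite) mdp) \<Rightarrow> (real^'d \<Rightarrow> real^'a^'s \<Rightarrow> real) \<Rightarrow> real^'d \<Rightarrow> real^'a^'s \<Rightarrow> real^'d" where
  "policy_hypergradient lam m f x \<pi> = gradient (\<lambda>y. f y \<pi>) x
     + (\<Sum>s\<in>UNIV. \<Sum>a\<in>UNIV. (gradient (f x) \<pi> $ s $ a * \<pi> $ s $ a / lam) *\<^sub>R advantage_gradient lam m x \<pi> s a)"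

text \<open>The decision processes of one context, as \<open>y\<close> varies.\<close>

locale soft_mdp_family =
  fixes m :: "real^'d \<Rightarrow> ('s::finite, 'a::finite) mdp" and X :: "(real^'d) set" and lam \<gamma> R Kr Kp :: real
  assumes open_X: "open X" and lam: "lam > 0" and \<gamma>: "0 < \<gamma>" "\<gamma> < 1"
    and discount: "\<And>y. y \<in> X \<Longrightarrow> discount (m y) = \<gamma>"
    and reward_differentiable: "\<And>y s a. y \<in> X \<Longrightarrow> (\<lambda>y. reward (m y) s a) differentiable (at y)"
    and reward_bound: "\<And>y s a. y \<in> X \<Longrightarrow> \<bar>reward (m y) s a\<bar> \<le> R"
    and norm_reward_gradient: "\<And>y z. y \<in> X \<Longrightarrow> norm (reward_gradient m y z) \<le> Kr"
    and kernel_differentiable: "\<And>y s a s'. y \<in> X \<Longrightarrow> (\<lambda>y. pmf (kernel (m y) s a) s') differentiable (at y)"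
    and norm_score: "\<And>y z s'. y \<in> X \<Longrightarrow> pmf (kernel (m y) (fst z) (snd z)) s' > 0 \<Longrightarrow> norm (score m y z s') \<le> Kp"
    and Kp: "0 \<le> Kp"
begin

lemma R_nonneg: "y \<in> X \<Longrightarrow> 0 \<le> R"
  using reward_bound abs_ge_zero order_trans by blast

text \<open>Where the probability is positive this is the chain rule for the logarithm. Where it is zero it has a
minimum, so its gradient vanishes as well.\<close>

lemma pmf_scaleR_score:
  assumes y: "y \<in> X"
  shows "pmf (kernel (m y) (fst z) (snd z)) s' *\<^sub>R score m y z s' = kernel_gradient m y z s'"
proof (cases "pmf (kernel (m y) (fst z) (snd z)) s' = 0")
  case True
  let ?p = "\<lambda>y. pmf (kernel (m y) (fst z) (snd z)) s'"
  have D: "(?p has_derivative (\<lambda>h. kernel_gradient m y z s' \<bullet> h)) (at y)"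
    unfolding kernel_gradient_def by (intro has_derivative_gradient kernel_differentiable y)
  have "(\<lambda>h. kernel_gradient m y z s' \<bullet> h) = (\<lambda>h. 0)"
    by (rule differential_zero_maxmin[OF _ _ D, of UNIV]) (use True in auto)
  then have "kernel_gradient m y z s' = 0"
    by (metis inner_eq_zero_iff)
  then show ?thesis using True by simp
next
  case False
  let ?p = "\<lambda>y. pmf (kernel (m y) (fst z) (snd z)) s'"
  have pos: "0 < ?p y" using False by (simp add: less_le)
  have D: "(?p has_derivative (\<lambda>h. kernel_gradient m y z s' \<bullet> h)) (at y)"
    unfolding kernel_gradient_def by (intro has_derivative_gradient kernel_differentiable y)
  have "((\<lambda>y. ln (?p y)) has_derivative (\<lambda>h. (inverse (?p y) *\<^sub>R kernel_gradient m y z s') \<bullet> h)) (at y)"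
    using pos by (auto intro!: derivative_eq_intros D simp: field_simps)
  then have "score m y z s' = inverse (?p y) *\<^sub>R kernel_gradient m y z s'"
    unfolding score_def by (rule gradient_eqI)
  then show ?thesis using False by simp
qed

lemma norm_kernel_gradient:
  assumes y: "y \<in> X"
  shows "norm (kernel_gradient m y z s') \<le> Kp"
proof (cases "pmf (kernel (m y) (fst z) (snd z)) s' = 0")
  case True
  then show ?thesis using pmf_scaleR_score[OF y, of z s'] Kp by auto
next
  case False
  then have "norm (score m y z s') \<le> Kp" by (intro norm_score[OF y]) (simp add: less_le)
  then have "pmf (kernel (m y) (fst z) (snd z)) s' * norm (score m y z s') \<le> 1 * Kp"
    by (intro mult_mono) (auto simp: pmf_le_1)
  then show ?thesis
    unfolding pmf_scaleR_score[OF y, symmetric] by simp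
qed

lemma Lipschitz_from_gradient:
  assumes B: "ball x e \<subseteq> X" "y \<in> ball x e"
    and g: "\<And>y. y \<in> X \<Longrightarrow> g differentiable (at y)" "\<And>y. y \<in> X \<Longrightarrow> norm (gradient g y) \<le> L"
  shows "\<bar>g y - g x\<bar> \<le> L * norm (y - x)"
proof -
  have x: "x \<in> ball x e" using B(2) by (metis centre_in_ball mem_ball order_le_less_trans zero_le_dist)
  have "norm (g y - g x) \<le> L * norm (y - x)"
  proof (rule differentiable_bound[where S = "ball x e" and f' = "\<lambda>y h. gradient g y \<bullet> h"])
    show "(g has_derivative (\<lambda>h. gradient g w \<bullet> h)) (at w within ball x e)" if "w \<in> ball x e" for w
      by (rule has_derivative_at_withinI, rule has_derivative_gradient, rule g(1)) (use B that in auto)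
    show "onorm (\<lambda>h. gradient g w \<bullet> h) \<le> L" if "w \<in> ball x e" for w
    proof (rule onorm_le)
      fix h
      have "norm (gradient g w \<bullet> h) \<le> norm (gradient g w) * norm h" by (simp add: Cauchy_Schwarz_ineq2)
      also have "\<dots> \<le> L * norm h" using g(2) B that by (intro mult_right_mono) auto
      finally show "norm (gradient g w \<bullet> h) \<le> L * norm h" .
    qed
  qed (use B x in auto)
  then show ?thesis by simp
qed

lemma reward_Lipschitz:
  assumes "ball x e \<subseteq> X" "y \<in> ball x e"
  shows "\<bar>reward (m y) s a - reward (m x) s a\<bar> \<le> Kr * norm (y - x)"
  by (rule Lipschitz_from_gradient[OF assms, where g = "\<lambda>y. reward (m y) s a"])
    (use reward_differentiable norm_reward_gradient[of _ "(s, a)"] in \<open>auto simp: reward_gradient_def\<close>)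

lemma kernel_Lipschitz:
  assumes "ball x e \<subseteq> X" "y \<in> ball x e"
  shows "\<bar>pmf (kernel (m y) s a) s' - pmf (kernel (m x) s a) s'\<bar> \<le> Kp * norm (y - x)"
  by (rule Lipschitz_from_gradient[OF assms, where g = "\<lambda>y. pmf (kernel (m y) s a) s'"])
    (use kernel_differentiable norm_kernel_gradient[of _ "(s, a)"] in \<open>auto simp: kernel_gradient_def\<close>)

definition Q_radius where "Q_radius = q_bound R \<gamma> lam CARD('a)"
definition V_bound where "V_bound = Q_radius + lam * ln (real CARD('a))"

abbreviation Q_opt where "Q_opt y \<equiv> opt_soft_q lam (m y)"

lemma Q_opt_fixed:
  assumes "y \<in> X"
  shows "Q_opt y $ s $ a = reward (m y) s a + \<gamma> * expect_next (m y) (soft_maximum lam (Q_opt y)) s a"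
proof -
  have "soft_bellman lam (m y) (Q_opt y) = Q_opt y"
    by (rule soft_bellman_opt_soft_q[where R = R]) (use lam \<gamma> discount[OF assms] reward_bound[OF assms] in auto)
  from arg_cong[OF this, of "\<lambda>q. q $ s $ a"] show ?thesis
    by (simp add: soft_bellman_def discount[OF assms])
qed

lemma Q_opt_in_entry_ball: "y \<in> X \<Longrightarrow> Q_opt y \<in> entry_ball Q_radius"
  unfolding Q_radius_def using opt_soft_q_in_entry_ball[where R = R and m = "m y" and lam = lam]
    lam \<gamma> discount reward_bound by simp

lemma soft_maximum_bound: "Q \<in> entry_ball Q_radius \<Longrightarrow> \<bar>soft_maximum lam Q s\<bar> \<le> V_bound"
  for Q :: "real^'a^'s"
  unfolding V_bound_def by (rule abs_soft_maximum_le[OF lam]) (simp add: entry_ball_def)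

definition Q_Lipschitz where
  "Q_Lipschitz = (Kr + \<gamma> * (real CARD('s) * Kp * V_bound)) / (1 - \<gamma>)"

lemma Q_opt_Lipschitz:
  assumes y: "ball x e \<subseteq> X" "y \<in> ball x e"
  shows "\<bar>Q_opt y $ s $ a - Q_opt x $ s $ a\<bar> \<le> Q_Lipschitz * norm (y - x)"
proof -
  have "x \<in> ball x e" using y(2) by (metis centre_in_ball mem_ball order_le_less_trans zero_le_dist)
  then have xX: "x \<in> X" and yX: "y \<in> X" using y by auto
  let ?V = "\<lambda>y. soft_maximum lam (Q_opt y)"
  let ?p = "\<lambda>y z s'. pmf (kernel (m y) (fst z) (snd z)) s'"
  let ?e = "\<lambda>z. Q_opt y $ fst z $ snd z - Q_opt x $ fst z $ snd z"
  let ?c = "Kr * norm (y - x) + \<gamma> * (real CARD('s) * Kp * V_bound) * norm (y - x)"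
  have "norm (?e (s, a)) \<le> ?c / (1 - \<gamma>)"
  proof (rule sup_contraction_bound[where e = ?e, OF \<gamma>(2)])
    fix b and z :: "'s \<times> 'a" assume b: "\<forall>z'. norm (?e z') \<le> b"
    have eq: "?e z = (reward (m y) (fst z) (snd z) - reward (m x) (fst z) (snd z))
        + \<gamma> * (\<Sum>s'\<in>UNIV. (?p y z s' - ?p x z s') * ?V y s')
        + \<gamma> * (\<Sum>s'\<in>UNIV. ?p x z s' * (?V y s' - ?V x s'))"
      by (simp add: Q_opt_fixed[OF xX] Q_opt_fixed[OF yX] expect_next_def sum_subtractf algebra_simps)
    have 1: "\<bar>reward (m y) (fst z) (snd z) - reward (m x) (fst z) (snd z)\<bar> \<le> Kr * norm (y - x)"
      by (rule reward_Lipschitz[OF y])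
    have 2: "\<bar>\<Sum>s'\<in>UNIV. (?p y z s' - ?p x z s') * ?V y s'\<bar> \<le> (\<Sum>s'\<in>(UNIV::'s set). Kp * norm (y - x) * V_bound)"
      by (rule order_trans[OF sum_abs], rule sum_mono, unfold abs_mult, rule mult_mono)
        (use kernel_Lipschitz[OF y] soft_maximum_bound[OF Q_opt_in_entry_ball[OF yX]] Kp in auto)
    have "\<bar>?V y s' - ?V x s'\<bar> \<le> b" for s'
      by (rule soft_maximum_Lipschitz[OF lam]) (use b in auto)
    then have 3: "\<bar>\<Sum>s'\<in>UNIV. ?p x z s' * (?V y s' - ?V x s')\<bar> \<le> b"
      using norm_weighted_sum_le[of "?p x z" "\<lambda>s'. ?V y s' - ?V x s'" b] by (simp add: sum_pmf_UNIV)
    have "norm (?e z) \<le> Kr * norm (y - x) + \<gamma> * (\<Sum>s'\<in>(UNIV::'s set). Kp * norm (y - x) * V_bound) + \<gamma> * b"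
    proof -
      have sc: "\<bar>\<gamma> * u\<bar> \<le> \<gamma> * c" if "\<bar>u\<bar> \<le> c" for u c
        using mult_left_mono[OF that, of \<gamma>] \<gamma> by (simp add: abs_mult)
      show ?thesis
        unfolding eq real_norm_def using 1 sc[OF 2] sc[OF 3] by linarith
    qed
    then show "norm (?e z) \<le> ?c + \<gamma> * b" by (simp add: algebra_simps)
  qed
  also have "?c / (1 - \<gamma>) = Q_Lipschitz * norm (y - x)"
    by (simp add: Q_Lipschitz_def add_divide_distrib algebra_simps)
  finally show ?thesis by simp
qed

text \<open>Both sides solve the linear Bellman equation of the optimal policy, and solutions are unique by contraction.\<close>

lemma policy_action_value_opt:
  assumes y: "y \<in> X"
  shows "policy_action_value lam (m y) (opt_policy lam (m y)) z
    = Q_opt y $ fst z $ snd z + lam * policy_entropy (opt_policy lam (m y)) (fst z)"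
proof -
  let ?\<pi> = "opt_policy lam (m y)"
  let ?w = "\<lambda>z. Q_opt y $ fst z $ snd z + lam * policy_entropy ?\<pi> (fst z)"
  have pol: "is_policy ?\<pi>" unfolding opt_policy_def by (rule is_policy_softmax_policy)
  have avg: "(\<Sum>a\<in>UNIV. ?\<pi> $ s $ a * ?w (s, a)) = soft_maximum lam (Q_opt y) s" for s
  proof -
    have "(\<Sum>a\<in>UNIV. ?\<pi> $ s $ a * ?w (s, a)) = (\<Sum>a\<in>UNIV. ?\<pi> $ s $ a * Q_opt y $ s $ a)
        + (\<Sum>a\<in>UNIV. ?\<pi> $ s $ a) * (lam * policy_entropy ?\<pi> s)"
      by (simp add: distrib_left sum.distrib sum_distrib_right)
    also have "\<dots> = soft_maximum lam (Q_opt y) s"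
      using soft_maximum_eq_softmax_policy[OF lam, of "Q_opt y" s] pol
      by (simp add: is_policy_def opt_policy_def)
    finally show ?thesis .
  qed
  have w: "?w z = soft_reward lam (m y) ?\<pi> z + \<gamma> * \<E> (sa_step (m y) ?\<pi> z) ?w" for z
    unfolding expectation_sa_step[OF pol] real_scaleR_def avg by (simp add: Q_opt_fixed[OF y] soft_reward_def)
  have u: "policy_action_value lam (m y) ?\<pi> z = soft_reward lam (m y) ?\<pi> z
      + \<gamma> * \<E> (sa_step (m y) ?\<pi> z) (policy_action_value lam (m y) ?\<pi>)" for z
    using policy_action_value_Bellman[of "m y" lam ?\<pi> z] \<gamma> by (simp add: discount[OF y])
  have fin: "integrable (sa_step (m y) ?\<pi> z) h" for z and h :: "_ \<Rightarrow> real"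
    by (rule integrable_measure_pmf_finite) simp
  have "norm (policy_action_value lam (m y) ?\<pi> z - ?w z) \<le> 0 / (1 - \<gamma>)"
  proof (rule sup_contraction_bound[where e = "\<lambda>z. policy_action_value lam (m y) ?\<pi> z - ?w z", OF \<gamma>(2)])
    fix b and z :: "'s \<times> 'a"
    assume b: "\<forall>z'. norm (policy_action_value lam (m y) ?\<pi> z' - ?w z') \<le> b"
    have "policy_action_value lam (m y) ?\<pi> z - ?w z
        = \<gamma> * \<E> (sa_step (m y) ?\<pi> z) (\<lambda>z'. policy_action_value lam (m y) ?\<pi> z' - ?w z')"
      by (subst u, subst w) (simp add: fin algebra_simps)
    also have "norm \<dots> \<le> \<gamma> * b"
      using \<gamma> abs_expectation_le[of "\<lambda>z'. policy_action_value lam (m y) ?\<pi> z' - ?w z'" b,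
          OF b[rule_format, unfolded real_norm_def]]
      by (simp add: abs_mult)
    finally show "norm (policy_action_value lam (m y) ?\<pi> z - ?w z) \<le> 0 + \<gamma> * b" by simp
  qed
  then show ?thesis by simp
qed

lemma policy_state_value_opt:
  assumes y: "y \<in> X"
  shows "policy_state_value lam (m y) (opt_policy lam (m y)) s = soft_maximum lam (Q_opt y) s"
proof -
  let ?\<pi> = "opt_policy lam (m y)"
  have pol: "is_policy ?\<pi>" unfolding opt_policy_def by (rule is_policy_softmax_policy)
  have "policy_state_value lam (m y) ?\<pi> s = (\<Sum>a\<in>UNIV. ?\<pi> $ s $ a * Q_opt y $ s $ a)
      + (\<Sum>a\<in>UNIV. ?\<pi> $ s $ a) * (lam * policy_entropy ?\<pi> s)"
    unfolding policy_state_value_def policy_action_value_opt[OF y]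
    by (simp add: distrib_left sum.distrib sum_distrib_right)
  then show ?thesis
    using soft_maximum_eq_softmax_policy[OF lam, of "Q_opt y" s] pol
    by (simp add: is_policy_def opt_policy_def)
qed

lemma value_gradient_Bellman:
  assumes y: "y \<in> X" and \<pi>: "is_policy \<pi>"
  shows "value_gradient lam m y \<pi> z = reward_gradient m y z
    + \<gamma> *\<^sub>R (\<Sum>s'\<in>UNIV. policy_state_value lam (m y) \<pi> s' *\<^sub>R kernel_gradient m y z s')
    + \<gamma> *\<^sub>R \<E> (sa_step (m y) \<pi> z) (value_gradient lam m y \<pi>)"
proof -
  have "\<bar>soft_reward lam (m y) \<pi> z\<bar> \<le> Max (range (\<lambda>z. \<bar>soft_reward lam (m y) \<pi> z\<bar>))" for z
    by (rule abs_le_Max_range)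
  from expectation_dQ_estimator_Bellman[where m = m and x = y, OF _ _ this
      norm_reward_gradient[OF y] norm_score[OF y], where s = "fst z" and a = "snd z"]
  have "value_gradient lam m y \<pi> z = reward_gradient m y z
        + \<gamma> *\<^sub>R \<E> (sa_step (m y) \<pi> z)
            (\<lambda>z'. policy_action_value lam (m y) \<pi> z' *\<^sub>R score m y z (fst z'))
        + \<gamma> *\<^sub>R \<E> (sa_step (m y) \<pi> z) (value_gradient lam m y \<pi>)"
    using \<gamma> by (simp add: discount[OF y] value_gradient_def [abs_def])
  also have "\<E> (sa_step (m y) \<pi> z)
            (\<lambda>z'. policy_action_value lam (m y) \<pi> z' *\<^sub>R score m y z (fst z'))
      = (\<Sum>s'\<in>UNIV. policy_state_value lam (m y) \<pi> s' *\<^sub>R kernel_gradient m y z s')"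
    unfolding expectation_sa_step[OF \<pi>] expect_next_def
    by (rule sum.cong)
      (simp_all add: policy_state_value_def scaleR_sum_left mult.commute flip: pmf_scaleR_score[OF y] scaleR_sum_left)
  finally show ?thesis .
qed

end

lemma has_derivative_iff_smallo:
  fixes f :: "'v::real_normed_vector \<Rightarrow> real"
  assumes "bounded_linear f'"
  shows "(f has_derivative f') (at x) \<longleftrightarrow> (\<lambda>y. f y - f x - f' (y - x)) \<in> o[nhds x](\<lambda>y. norm (y - x))"
proof -
  have "(f has_derivative f') (at x) \<longleftrightarrow>
      (\<forall>e>0. \<exists>d>0. \<forall>y. norm (y - x) < d \<longrightarrow> norm (f y - f x - f' (y - x)) \<le> e * norm (y - x))"
    using assms by (simp add: has_derivative_at_alt)
  also have "\<dots> \<longleftrightarrow> (\<lambda>y. f y - f x - f' (y - x)) \<in> o[nhds x](\<lambda>y. norm (y - x))"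
    unfolding smallo_def eventually_nhds_metric dist_norm by simp
  finally show ?thesis .
qed

lemma has_derivative_remainder:
  fixes f :: "'v::real_inner \<Rightarrow> real"
  assumes "(f has_derivative (\<lambda>h. g \<bullet> h)) (at x)"
  shows "(\<lambda>y. f y - f x - g \<bullet> (y - x)) \<in> o[nhds x](\<lambda>y. norm (y - x))"
  using assms has_derivative_iff_smallo[OF bounded_linear_inner_right] by blast

lemma has_derivative_entry: "((\<lambda>Q. Q $ s $ a) has_derivative (\<lambda>H. H $ s $ a)) (at (Q :: real^'a::finite^'s::finite))"
  by (rule bounded_linear_imp_has_derivative, rule bounded_linear_compose[of "\<lambda>v. v $ a"])
    (rule bounded_linear_vec_nth)+

text \<open>The derivative of the soft maximum is the average under the softmax policy, which makes the linearized
soft Bellman equation the Bellman equation of that policy.\<close>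

lemma soft_maximum_has_derivative_comp:
  fixes Q :: "'v::real_normed_vector \<Rightarrow> real^'a::finite^'s::finite"
  assumes lam: "lam > 0" and Q: "\<And>a. ((\<lambda>y. Q y $ s $ a) has_derivative D a) (at x)"
  shows "((\<lambda>y. soft_maximum lam (Q y) s) has_derivative
      (\<lambda>h. \<Sum>a\<in>UNIV. softmax_policy lam (Q x) $ s $ a * D a h)) (at x)"
proof -
  let ?S = "\<Sum>a\<in>UNIV. exp (Q x $ s $ a / lam)"
  have S: "0 < ?S" by (rule sum_exp_pos)
  have aux: "((\<lambda>y. lam * ln (g y)) has_derivative (\<lambda>h. lam * (g' h / g x))) (at x)"
    if "(g has_derivative g') (at x)" "0 < g x" for g :: "'v \<Rightarrow> real" and g'
    using that by (auto intro!: derivative_eq_intros simp: divide_inverse)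
  have "((\<lambda>y. \<Sum>a\<in>UNIV. exp (Q y $ s $ a / lam)) has_derivative
      (\<lambda>h. \<Sum>a\<in>UNIV. exp (Q x $ s $ a / lam) * (D a h / lam))) (at x)"
    using lam by (auto intro!: derivative_eq_intros Q simp: mult_ac)
  then have *: "((\<lambda>y. lam * ln (\<Sum>a\<in>UNIV. exp (Q y $ s $ a / lam))) has_derivative
      (\<lambda>h. lam * ((\<Sum>a\<in>UNIV. exp (Q x $ s $ a / lam) * (D a h / lam)) / ?S))) (at x)"
    by (rule aux) (rule S)
  have "lam * ((\<Sum>a\<in>UNIV. exp (Q x $ s $ a / lam) * (D a h / lam)) / ?S)
      = (\<Sum>a\<in>UNIV. softmax_policy lam (Q x) $ s $ a * D a h)" for h
    unfolding sum_divide_distrib sum_distrib_left softmax_policy_def vec_lambda_beta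
    by (rule sum.cong) (use lam in simp_all)
  with * show ?thesis unfolding soft_maximum_def by simp
qed

context soft_mdp_family
begin

text \<open>Implicit differentiation at a single point. The data are only assumed to be differentiable, so the
remainder \<open>\<epsilon>\<close> of the expansion is estimated directly: subtracting the equation of the candidate derivative
from the difference of the fixed point equations leaves \<open>\<epsilon> = \<rho> + \<gamma> P \<epsilon>\<close>, where all parts of \<open>\<rho>\<close> are
\<open>o(norm (y - x))\<close>, and the contraction passes this on to \<open>\<epsilon>\<close>.\<close>

lemma Q_opt_has_derivative:
  assumes x: "x \<in> X"
  shows "((\<lambda>y. Q_opt y $ s $ a) has_derivative
    (\<lambda>h. value_gradient lam m x (opt_policy lam (m x)) (s, a) \<bullet> h)) (at x)"
proof -
  obtain e where e: "e > 0" "ball x e \<subseteq> X" using open_X x open_contains_ball by blast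
  have ev: "\<forall>\<^sub>F y in nhds x. y \<in> ball x e"
    using e by (intro eventually_nhds_in_open) auto
  let ?\<pi> = "opt_policy lam (m x)"
  let ?V = "\<lambda>y. soft_maximum lam (Q_opt y)"
  let ?p = "\<lambda>y z s'. pmf (kernel (m y) (fst z) (snd z)) s'"
  let ?o = "o[nhds x](\<lambda>y. norm (y - x))"
  define W where "W = value_gradient lam m x ?\<pi>"
  define \<epsilon> where "\<epsilon> y z = Q_opt y $ fst z $ snd z - Q_opt x $ fst z $ snd z - W z \<bullet> (y - x)" for y z
  have pol: "is_policy ?\<pi>" unfolding opt_policy_def by (rule is_policy_softmax_policy)
  have QLip: "\<bar>Q_opt y $ s $ a - Q_opt x $ s $ a\<bar> \<le> Q_Lipschitz * norm (y - x)" if "y \<in> ball x e" for y s a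
    by (rule Q_opt_Lipschitz[OF e(2) that])
  have normQ: "norm (Q_opt y - Q_opt x) \<le> real CARD('s) * real CARD('a) * Q_Lipschitz * norm (y - x)" if "y \<in> ball x e" for y
  proof -
    have "norm (Q_opt y - Q_opt x) \<le> (\<Sum>s\<in>(UNIV::'s set). \<Sum>a\<in>(UNIV::'a set). Q_Lipschitz * norm (y - x))"
      by (rule order_trans[OF norm_le_sum_entries]) (intro sum_mono, use QLip[OF that] in simp)
    then show ?thesis by simp
  qed
  have bigQ: "(\<lambda>y. norm (Q_opt y - Q_opt x)) \<in> O[nhds x](\<lambda>y. norm (y - x))"
    by (rule bigoI[where c = "real CARD('s) * real CARD('a) * Q_Lipschitz"])
      (use ev normQ in \<open>auto elim!: eventually_mono\<close>)
  have limQ: "filterlim Q_opt (nhds (Q_opt x)) (nhds x)"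
  proof -
    have "((\<lambda>y. real CARD('s) * real CARD('a) * Q_Lipschitz * norm (y - x))
        \<longlongrightarrow> real CARD('s) * real CARD('a) * Q_Lipschitz * norm (x - x)) (nhds x)"
      by (intro tendsto_intros filterlim_ident)
    then have lim: "((\<lambda>y. real CARD('s) * real CARD('a) * Q_Lipschitz * norm (y - x)) \<longlongrightarrow> 0) (nhds x)"
      by simp
    have "\<forall>\<^sub>F y in nhds x. norm (norm (Q_opt y - Q_opt x)) \<le> real CARD('s) * real CARD('a) * Q_Lipschitz * norm (y - x)"
      by (rule eventually_mono[OF ev]) (use normQ in simp)
    from Lim_null_comparison[OF this lim] have "((\<lambda>y. norm (Q_opt y - Q_opt x)) \<longlongrightarrow> 0) (nhds x)" .
    then show ?thesis by (simp add: tendsto_norm_zero_iff LIM_zero_iff)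
  qed
  define \<rho>1 where "\<rho>1 z y = reward (m y) (fst z) (snd z) - reward (m x) (fst z) (snd z) - reward_gradient m x z \<bullet> (y - x)" for z y
  define \<rho>2 where "\<rho>2 z s' y = ?p y z s' - ?p x z s' - kernel_gradient m x z s' \<bullet> (y - x)" for z s' y
  define \<rho>3 where "\<rho>3 s' y = ?V y s' - ?V x s' - (\<Sum>a\<in>UNIV. ?\<pi> $ s' $ a * (Q_opt y $ s' $ a - Q_opt x $ s' $ a))" for s' y
  have 1: "\<rho>1 z \<in> ?o" for z
    unfolding \<rho>1_def reward_gradient_def
    by (intro has_derivative_remainder has_derivative_gradient reward_differentiable x)
  have 2: "\<rho>2 z s' \<in> ?o" for z s'
    unfolding \<rho>2_def kernel_gradient_def
    by (intro has_derivative_remainder has_derivative_gradient kernel_differentiable x)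
  have 3: "\<rho>3 s' \<in> ?o" for s'
  proof -
    let ?L = "\<lambda>H::real^'a^'s. \<Sum>a\<in>UNIV. ?\<pi> $ s' $ a * H $ s' $ a"
    have D: "((\<lambda>Q. soft_maximum lam Q s') has_derivative ?L) (at (Q_opt x))"
      unfolding opt_policy_def
      by (rule soft_maximum_has_derivative_comp[OF lam has_derivative_entry])
    have "(\<lambda>Q. soft_maximum lam Q s' - soft_maximum lam (Q_opt x) s' - ?L (Q - Q_opt x))
        \<in> o[nhds (Q_opt x)](\<lambda>Q. norm (Q - Q_opt x))"
      by (rule has_derivative_iff_smallo[OF has_derivative_bounded_linear[OF D], THEN iffD1, OF D])
    from landau_o.small.compose[OF this limQ]
    have "\<rho>3 s' \<in> o[nhds x](\<lambda>y. norm (Q_opt y - Q_opt x))"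
      by (simp add: \<rho>3_def [abs_def])
    then show ?thesis using bigQ by (rule landau_o.small_big_trans)
  qed
  have 4: "(\<lambda>y. (?p y z s' - ?p x z s') * (?V y s' - ?V x s')) \<in> ?o" for z s'
  proof -
    have "(\<lambda>y. ?p y z s' - ?p x z s') \<in> O[nhds x](\<lambda>y. norm (y - x))"
      by (rule bigoI[where c = Kp])
        (use ev kernel_Lipschitz[OF e(2)] in \<open>auto elim!: eventually_mono\<close>)
    moreover have "(\<lambda>y. ?V y s' - ?V x s') \<in> o[nhds x](\<lambda>_. 1)"
    proof (rule smalloI_tendsto)
      have c: "isCont (\<lambda>Q. soft_maximum lam Q s') (Q_opt x)"
        by (rule has_derivative_continuous[OF soft_maximum_has_derivative_comp[OF lam has_derivative_entry]])
      have "((\<lambda>y. ?V y s') \<longlongrightarrow> ?V x s') (nhds x)"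
        by (rule isCont_tendsto_compose[OF c limQ])
      from LIM_zero[OF this] show "((\<lambda>y. (?V y s' - ?V x s') / 1) \<longlongrightarrow> 0) (nhds x)"
        by simp
    qed auto
    ultimately have "(\<lambda>y. (?p y z s' - ?p x z s') * (?V y s' - ?V x s')) \<in> o[nhds x](\<lambda>y. norm (y - x) * 1)"
      by (rule landau_o.big_small_mult)
    then show ?thesis by simp
  qed
  define \<rho> where "\<rho> z y = \<rho>1 z y + \<gamma> * (\<Sum>s'\<in>UNIV. \<rho>2 z s' y * ?V x s' + (?p y z s' - ?p x z s') * (?V y s' - ?V x s')
      + ?p x z s' * \<rho>3 s' y)" for z y
  have \<rho>: "\<rho> z \<in> ?o" for z
  proof -
    have c: "(\<lambda>y. c * g y) \<in> ?o" "(\<lambda>y. g y * c) \<in> ?o" if "g \<in> ?o" for c g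
      using that by (cases "c = 0"; simp)+
    show ?thesis
      unfolding \<rho>_def
      by (rule sum_in_smallo(1), rule 1, rule c(1), rule big_sum_in_smallo, rule sum_in_smallo(1),
          rule sum_in_smallo(1), rule c(2), rule 2, rule 4, rule c(1), rule 3)
  qed
  have rec: "\<epsilon> y z = \<rho> z y + \<gamma> * \<E> (sa_step (m x) ?\<pi> z) (\<epsilon> y)" if y: "y \<in> ball x e" for y z
  proof -
    have yX: "y \<in> X" using y e by auto
    have Wz: "W z \<bullet> h = reward_gradient m x z \<bullet> h + \<gamma> * (\<Sum>s'\<in>UNIV. ?V x s' * (kernel_gradient m x z s' \<bullet> h))
        + \<gamma> * (\<Sum>s'\<in>UNIV. ?p x z s' * (\<Sum>a\<in>UNIV. ?\<pi> $ s' $ a * (W (s', a) \<bullet> h)))" for h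
      unfolding W_def
      by (subst value_gradient_Bellman[OF x pol])
        (simp add: inner_add_left inner_sum_left policy_state_value_opt[OF x] expectation_sa_step[OF pol] expect_next_def)
    have E: "\<E> (sa_step (m x) ?\<pi> z) (\<epsilon> y) = (\<Sum>s'\<in>UNIV. ?p x z s' *
        ((\<Sum>a\<in>UNIV. ?\<pi> $ s' $ a * (Q_opt y $ s' $ a - Q_opt x $ s' $ a)) - (\<Sum>a\<in>UNIV. ?\<pi> $ s' $ a * (W (s', a) \<bullet> (y - x)))))"
      unfolding expectation_sa_step[OF pol] expect_next_def \<epsilon>_def
      by (simp add: right_diff_distrib sum_subtractf)
    show ?thesis
      unfolding E \<rho>_def \<epsilon>_def Wz Q_opt_fixed[OF x] Q_opt_fixed[OF yX] expect_next_def \<rho>1_def \<rho>2_def \<rho>3_def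
      by (simp add: algebra_simps sum.distrib sum_subtractf sum_distrib_left)
  qed
  have bound: "\<bar>\<epsilon> y z\<bar> \<le> (\<Sum>z\<in>UNIV. \<bar>\<rho> z y\<bar>) / (1 - \<gamma>)" if y: "y \<in> ball x e" for y z
  proof -
    have "norm (\<epsilon> y z) \<le> (\<Sum>z\<in>UNIV. \<bar>\<rho> z y\<bar>) / (1 - \<gamma>)"
    proof (rule sup_contraction_bound[where e = "\<epsilon> y", OF \<gamma>(2)])
      fix b z assume b: "\<forall>z'. norm (\<epsilon> y z') \<le> b"
      have "\<bar>\<rho> z y\<bar> \<le> (\<Sum>z\<in>UNIV. \<bar>\<rho> z y\<bar>)" by (rule member_le_sum) auto
      moreover have "\<bar>\<gamma> * \<E> (sa_step (m x) ?\<pi> z) (\<epsilon> y)\<bar> \<le> \<gamma> * b"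
        using \<gamma> abs_expectation_le[of "\<epsilon> y" b, OF b[rule_format, unfolded real_norm_def]]
        by (simp add: abs_mult)
      ultimately show "norm (\<epsilon> y z) \<le> (\<Sum>z\<in>UNIV. \<bar>\<rho> z y\<bar>) + \<gamma> * b"
        unfolding real_norm_def rec[OF y, of z] by linarith
    qed
    then show ?thesis by simp
  qed
  have "(\<lambda>y. \<epsilon> y (s, a)) \<in> O[nhds x](\<lambda>y. \<Sum>z\<in>UNIV. \<bar>\<rho> z y\<bar>)"
    by (rule bigoI[where c = "1 / (1 - \<gamma>)"])
      (use ev in \<open>rule eventually_mono, use bound in \<open>auto simp: sum_nonneg\<close>\<close>)
  moreover have "(\<lambda>y. \<Sum>z\<in>UNIV. \<bar>\<rho> z y\<bar>) \<in> ?o"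
    by (rule big_sum_in_smallo) (use \<rho> in simp)
  ultimately have "(\<lambda>y. \<epsilon> y (s, a)) \<in> ?o" by (rule landau_o.big_small_trans)
  then show ?thesis
    unfolding has_derivative_iff_smallo[OF bounded_linear_inner_right]
    by (simp add: \<epsilon>_def W_def)
qed

text \<open>The logarithm of a softmax probability is an entry of \<open>Q\<close> minus the soft maximum, divided by \<open>lam\<close>. Hence the
advantage appears.\<close>

lemma opt_policy_has_derivative:
  assumes x: "x \<in> X"
  shows "((\<lambda>y. opt_policy lam (m y) $ s $ a) has_derivative
    (\<lambda>h. (opt_policy lam (m x) $ s $ a / lam) * (advantage_gradient lam m x (opt_policy lam (m x)) s a \<bullet> h))) (at x)"
proof -
  let ?W = "value_gradient lam m x (opt_policy lam (m x))"
  note V = soft_maximum_has_derivative_comp[where Q = Q_opt and D = "\<lambda>a h. ?W (s, a) \<bullet> h" and s = s,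
      OF lam Q_opt_has_derivative[OF x]]
  let ?u = "\<lambda>y. (Q_opt y $ s $ a - soft_maximum lam (Q_opt y) s) / lam"
  let ?v = "\<lambda>h. (?W (s, a) \<bullet> h - (\<Sum>b\<in>UNIV. softmax_policy lam (Q_opt x) $ s $ b * (?W (s, b) \<bullet> h))) / lam"
  have "(?u has_derivative ?v) (at x)"
    unfolding divide_inverse
    by (intro has_derivative_mult_left has_derivative_diff Q_opt_has_derivative[OF x] V)
  then have "((\<lambda>y. exp (?u y)) has_derivative (\<lambda>h. ?v h * exp (?u x))) (at x)"
    by (rule has_derivative_exp)
  moreover have "?v h * exp (?u x) = (opt_policy lam (m x) $ s $ a / lam)
      * (advantage_gradient lam m x (opt_policy lam (m x)) s a \<bullet> h)" for h
    using softmax_policy_eq_exp[OF lam, of "Q_opt x" s a, symmetric]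
    by (simp add: opt_policy_def advantage_gradient_def inner_diff_left inner_sum_left mult.commute)
  moreover have "(\<lambda>y. opt_policy lam (m y) $ s $ a) = (\<lambda>y. exp (?u y))"
    by (simp add: opt_policy_def softmax_policy_eq_exp[OF lam])
  ultimately show ?thesis by (simp only:)
qed

lemma inner_array: "(v :: real^'a^'s) \<bullet> w = (\<Sum>s\<in>UNIV. \<Sum>a\<in>UNIV. v $ s $ a * w $ s $ a)"
  by (simp add: inner_vec_def)

lemma has_derivative_array:
  fixes P :: "'v::real_normed_vector \<Rightarrow> real^'a^'s"
  assumes "\<And>s a. ((\<lambda>y. P y $ s $ a) has_derivative D s a) (at x)"
  shows "(P has_derivative (\<lambda>h. \<chi> s a. D s a h)) (at x)"
proof (rule has_derivative_componentwise_within[THEN iffD2], rule ballI)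
  fix i :: "real^'a^'s" assume "i \<in> Basis"
  then obtain s a where "i = axis s (axis a 1)" by (auto simp: Basis_vec_def)
  then show "((\<lambda>y. P y \<bullet> i) has_derivative (\<lambda>h. (\<chi> s a. D s a h) \<bullet> i)) (at x)"
    using assms[of s a] by (simp add: inner_axis)
qed

lemma leader_loss_has_derivative:
  assumes x: "x \<in> X" and f: "(\<lambda>(y, p). f y p) differentiable (at (x, opt_policy lam (m x)))"
  shows "((\<lambda>y. f y (opt_policy lam (m y))) has_derivative
    (\<lambda>h. policy_hypergradient lam m f x (opt_policy lam (m x)) \<bullet> h)) (at x)"
proof -
  let ?\<pi> = "\<lambda>y. opt_policy lam (m y)"
  let ?A = "advantage_gradient lam m x (?\<pi> x)"
  obtain D where D: "((\<lambda>(y, p). f y p) has_derivative D) (at (x, ?\<pi> x))"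
    using f unfolding differentiable_def by blast
  interpret D: bounded_linear D using D by (rule has_derivative_bounded_linear)
  have "((\<lambda>y. (case (y, ?\<pi> x) of (y, p) \<Rightarrow> f y p)) has_derivative (\<lambda>h. D (h, 0))) (at x)"
    by (rule has_derivative_compose[where g = "\<lambda>(y, p). f y p" and f = "\<lambda>y. (y, ?\<pi> x)", OF _ D])
      (auto intro!: derivative_eq_intros)
  then have D1: "((\<lambda>y. f y (?\<pi> x)) has_derivative (\<lambda>h. D (h, 0))) (at x)" by simp
  have "((\<lambda>p. (case (x, p) of (y, p) \<Rightarrow> f y p)) has_derivative (\<lambda>h. D (0, h))) (at (?\<pi> x))"
    by (rule has_derivative_compose[where g = "\<lambda>(y, p). f y p" and f = "\<lambda>p. (x, p)", OF _ D])
      (auto intro!: derivative_eq_intros)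
  then have D2: "(f x has_derivative (\<lambda>h. D (0, h))) (at (?\<pi> x))" by simp
  have e1: "D (h, 0) = gradient (\<lambda>y. f y (?\<pi> x)) x \<bullet> h" for h
    using has_derivative_unique[OF D1 has_derivative_gradient] D1 by (metis differentiableI)
  have e2: "D (0, h) = gradient (f x) (?\<pi> x) \<bullet> h" for h
    using has_derivative_unique[OF D2 has_derivative_gradient] D2 by (metis differentiableI)
  have P: "(?\<pi> has_derivative (\<lambda>h. \<chi> s a. (?\<pi> x $ s $ a / lam) * (?A s a \<bullet> h))) (at x)"
    by (rule has_derivative_array) (rule opt_policy_has_derivative[OF x])
  have "((\<lambda>y. (case (y, ?\<pi> y) of (y, p) \<Rightarrow> f y p)) has_derivative
      (\<lambda>h. D (h, \<chi> s a. (?\<pi> x $ s $ a / lam) * (?A s a \<bullet> h)))) (at x)"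
    by (rule has_derivative_compose[where g = "\<lambda>(y, p). f y p" and f = "\<lambda>y. (y, ?\<pi> y)", OF _ D])
      (intro has_derivative_Pair has_derivative_ident P)
  moreover have "D (h, k) = gradient (\<lambda>y. f y (?\<pi> x)) x \<bullet> h + gradient (f x) (?\<pi> x) \<bullet> k" for h k
    using D.add[of "(h, 0)" "(0, k)"] by (simp add: e1 e2)
  ultimately have *: "((\<lambda>y. f y (?\<pi> y)) has_derivative (\<lambda>h. gradient (\<lambda>y. f y (?\<pi> x)) x \<bullet> h
      + gradient (f x) (?\<pi> x) \<bullet> (\<chi> s a. (?\<pi> x $ s $ a / lam) * (?A s a \<bullet> h)))) (at x)"
    by simp
  have "policy_hypergradient lam m f x (?\<pi> x) \<bullet> h = gradient (\<lambda>y. f y (?\<pi> x)) x \<bullet> h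
      + gradient (f x) (?\<pi> x) \<bullet> (\<chi> s a. (?\<pi> x $ s $ a / lam) * (?A s a \<bullet> h))" for h
    unfolding policy_hypergradient_def inner_add_left inner_sum_left inner_array by (simp add: mult.assoc)
  with * show ?thesis by simp
qed

lemma opt_policy_Lipschitz:
  assumes "ball x e \<subseteq> X" "y \<in> ball x e"
  shows "\<bar>opt_policy lam (m y) $ s $ a - opt_policy lam (m x) $ s $ a\<bar> \<le> 2 * (Q_Lipschitz * norm (y - x)) / lam"
  unfolding opt_policy_def
  by (rule softmax_policy_Lipschitz[OF lam Q_opt_Lipschitz[OF assms]])

end

section \<open>Bounds and Lipschitz constants uniform in the context\<close>

text \<open>The constant is shared by all members of the family. Algebraic operations preserve the property, so that
it can be established for the hypergradient one ingredient at a time.\<close>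

definition bounded_Lipschitz_family :: "'i set \<Rightarrow> 'q::real_normed_vector set \<Rightarrow> ('i \<Rightarrow> 'q \<Rightarrow> 'v::real_normed_vector) \<Rightarrow> bool" where
  "bounded_Lipschitz_family I S F \<longleftrightarrow> (\<exists>C\<ge>0. \<forall>i\<in>I. \<forall>q\<in>S. norm (F i q) \<le> C \<and>
     (\<forall>q'\<in>S. norm (F i q - F i q') \<le> C * norm (q - q')))"

lemma bounded_Lipschitz_familyI:
  assumes "\<And>i q. i \<in> I \<Longrightarrow> q \<in> S \<Longrightarrow> norm (F i q) \<le> C"
    and "\<And>i q q'. i \<in> I \<Longrightarrow> q \<in> S \<Longrightarrow> q' \<in> S \<Longrightarrow> norm (F i q - F i q') \<le> L * norm (q - q')"
  shows "bounded_Lipschitz_family I S F"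
  unfolding bounded_Lipschitz_family_def
proof (intro exI[of _ "max 0 (max C L)"] conjI ballI)
  fix i q q' assume i: "i \<in> I" "q \<in> S"
  show "norm (F i q) \<le> max 0 (max C L)" using assms(1)[OF i] by simp
  assume "q' \<in> S"
  from assms(2)[OF i this] have "norm (F i q - F i q') \<le> L * norm (q - q')" .
  also have "\<dots> \<le> max 0 (max C L) * norm (q - q')" by (intro mult_right_mono) auto
  finally show "norm (F i q - F i q') \<le> max 0 (max C L) * norm (q - q')" .
qed simp

lemma bounded_Lipschitz_familyE:
  assumes "bounded_Lipschitz_family I S F"
  obtains C where "C \<ge> 0" "\<And>i q. i \<in> I \<Longrightarrow> q \<in> S \<Longrightarrow> norm (F i q) \<le> C"
    "\<And>i q q'. i \<in> I \<Longrightarrow> q \<in> S \<Longrightarrow> q' \<in> S \<Longrightarrow> norm (F i q - F i q') \<le> C * norm (q - q')"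
  using assms unfolding bounded_Lipschitz_family_def by blast

lemma bounded_Lipschitz_family_const:
  assumes "\<And>i. i \<in> I \<Longrightarrow> norm (c i) \<le> C"
  shows "bounded_Lipschitz_family I S (\<lambda>i q. c i)"
  by (rule bounded_Lipschitz_familyI[where C = C and L = 0]) (use assms in auto)

lemma bounded_Lipschitz_family_add:
  assumes "bounded_Lipschitz_family I S F" "bounded_Lipschitz_family I S G"
  shows "bounded_Lipschitz_family I S (\<lambda>i q. F i q + G i q)"
proof -
  from assms(1) obtain C where C: "C \<ge> 0" "\<And>i q. i \<in> I \<Longrightarrow> q \<in> S \<Longrightarrow> norm (F i q) \<le> C"
    "\<And>i q q'. i \<in> I \<Longrightarrow> q \<in> S \<Longrightarrow> q' \<in> S \<Longrightarrow> norm (F i q - F i q') \<le> C * norm (q - q')"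
    by (rule bounded_Lipschitz_familyE) metis
  from assms(2) obtain D where D: "D \<ge> 0" "\<And>i q. i \<in> I \<Longrightarrow> q \<in> S \<Longrightarrow> norm (G i q) \<le> D"
    "\<And>i q q'. i \<in> I \<Longrightarrow> q \<in> S \<Longrightarrow> q' \<in> S \<Longrightarrow> norm (G i q - G i q') \<le> D * norm (q - q')"
    by (rule bounded_Lipschitz_familyE) metis
  show ?thesis
  proof (rule bounded_Lipschitz_familyI[where C = "C + D" and L = "C + D"])
    fix i q assume i: "i \<in> I" "q \<in> S"
    show "norm (F i q + G i q) \<le> C + D" using C(2)[OF i] D(2)[OF i] norm_triangle_ineq[of "F i q" "G i q"] by linarith
    fix q' assume q': "q' \<in> S"
    have "norm (F i q + G i q - (F i q' + G i q')) \<le> norm (F i q - F i q') + norm (G i q - G i q')"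
      by (rule norm_diff_triangle_ineq)
    also have "\<dots> \<le> (C + D) * norm (q - q')" using C(3)[OF i q'] D(3)[OF i q'] by (simp add: distrib_right)
    finally show "norm (F i q + G i q - (F i q' + G i q')) \<le> (C + D) * norm (q - q')" .
  qed
qed

lemma bounded_Lipschitz_family_scaleR:
  fixes F :: "_ \<Rightarrow> _ \<Rightarrow> real"
  assumes "bounded_Lipschitz_family I S F" "bounded_Lipschitz_family I S G"
  shows "bounded_Lipschitz_family I S (\<lambda>i q. F i q *\<^sub>R G i q)"
proof -
  from assms(1) obtain C where C: "C \<ge> 0" "\<And>i q. i \<in> I \<Longrightarrow> q \<in> S \<Longrightarrow> norm (F i q) \<le> C"
    "\<And>i q q'. i \<in> I \<Longrightarrow> q \<in> S \<Longrightarrow> q' \<in> S \<Longrightarrow> norm (F i q - F i q') \<le> C * norm (q - q')"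
    by (rule bounded_Lipschitz_familyE) metis
  from assms(2) obtain D where D: "D \<ge> 0" "\<And>i q. i \<in> I \<Longrightarrow> q \<in> S \<Longrightarrow> norm (G i q) \<le> D"
    "\<And>i q q'. i \<in> I \<Longrightarrow> q \<in> S \<Longrightarrow> q' \<in> S \<Longrightarrow> norm (G i q - G i q') \<le> D * norm (q - q')"
    by (rule bounded_Lipschitz_familyE) metis
  show ?thesis
  proof (rule bounded_Lipschitz_familyI[where C = "C * D" and L = "C * D + C * D"])
    fix i q assume i: "i \<in> I" "q \<in> S"
    show "norm (F i q *\<^sub>R G i q) \<le> C * D"
      unfolding norm_scaleR real_norm_def[symmetric] by (intro mult_mono C(2) D(2) i C(1)) simp
    fix q' assume q': "q' \<in> S"
    have "F i q *\<^sub>R G i q - F i q' *\<^sub>R G i q' = F i q *\<^sub>R (G i q - G i q') + (F i q - F i q') *\<^sub>R G i q'"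
      by (simp add: algebra_simps)
    also have "norm \<dots> \<le> norm (F i q) * norm (G i q - G i q') + norm (F i q - F i q') * norm (G i q')"
      by (rule order_trans[OF norm_triangle_ineq]) simp
    also have "\<dots> \<le> C * (D * norm (q - q')) + (C * norm (q - q')) * D"
      using C(1) by (intro add_mono mult_mono C(2) D(2) C(3) D(3) i q') auto
    also have "\<dots> = (C * D + C * D) * norm (q - q')" by (simp add: algebra_simps)
    finally show "norm (F i q *\<^sub>R G i q - F i q' *\<^sub>R G i q') \<le> (C * D + C * D) * norm (q - q')" .
  qed
qed

lemma bounded_Lipschitz_family_mult:
  fixes F G :: "_ \<Rightarrow> _ \<Rightarrow> real"
  assumes "bounded_Lipschitz_family I S F" "bounded_Lipschitz_family I S G"
  shows "bounded_Lipschitz_family I S (\<lambda>i q. F i q * G i q)"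
  using bounded_Lipschitz_family_scaleR[OF assms] by simp

lemma bounded_Lipschitz_family_sum:
  assumes "\<And>j. j \<in> J \<Longrightarrow> bounded_Lipschitz_family I S (F j)"
  shows "bounded_Lipschitz_family I S (\<lambda>i q. \<Sum>j\<in>J. F j i q)"
  using assms
proof (induction J rule: infinite_finite_induct)
  case (insert j J)
  then show ?case by (simp add: bounded_Lipschitz_family_add)
qed (auto intro: bounded_Lipschitz_family_const[where C = 0 and c = "\<lambda>_. 0"])

lemma bounded_Lipschitz_family_cmult:
  assumes "bounded_Lipschitz_family I S F"
  shows "bounded_Lipschitz_family I S (\<lambda>i q. (c::real) *\<^sub>R F i q)"
  by (intro bounded_Lipschitz_family_scaleR assms bounded_Lipschitz_family_const[where C = "\<bar>c\<bar>"]) simp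

lemma bounded_Lipschitz_family_diff:
  assumes "bounded_Lipschitz_family I S F" "bounded_Lipschitz_family I S G"
  shows "bounded_Lipschitz_family I S (\<lambda>i q. F i q - G i q)"
  using bounded_Lipschitz_family_add[OF assms(1) bounded_Lipschitz_family_cmult[OF assms(2), of "-1"]] by simp

text \<open>The regularity assumptions in terms of Euclidean norms, with constants that do not depend on the context.\<close>

locale context_family =
  fixes M :: "real^'d \<Rightarrow> 'x \<Rightarrow> ('s::finite, 'a::finite) mdp" and I :: "'x set"
    and f :: "real^'d \<Rightarrow> real^'a^'s \<Rightarrow> 'x \<Rightarrow> real"
    and X :: "(real^'d) set" and x :: "real^'d" and lam \<gamma> R Kr Kp Kf Sf :: real and \<nu> :: "'s pmf"
  assumes family: "\<And>\<xi>. \<xi> \<in> I \<Longrightarrow> soft_mdp_family (\<lambda>y. M y \<xi>) X lam \<gamma> R Kr Kp"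
    and x: "x \<in> X" and lam: "lam > 0" and \<gamma>: "0 < \<gamma>" "\<gamma> < 1" and R: "0 \<le> R"
    and loss_gradient1: "\<And>\<xi> \<pi>. \<xi> \<in> I \<Longrightarrow> is_policy \<pi> \<Longrightarrow> norm (gradient (\<lambda>y. f y \<pi> \<xi>) x) \<le> Kf"
    and loss_gradient2: "\<And>\<xi> \<pi>. \<xi> \<in> I \<Longrightarrow> is_policy \<pi> \<Longrightarrow> norm (gradient (\<lambda>p. f x p \<xi>) \<pi>) \<le> Kf"
    and loss_smooth1: "\<And>\<xi> \<pi> \<pi>'. \<xi> \<in> I \<Longrightarrow> is_policy \<pi> \<Longrightarrow> is_policy \<pi>' \<Longrightarrow>
        norm (gradient (\<lambda>y. f y \<pi> \<xi>) x - gradient (\<lambda>y. f y \<pi>' \<xi>) x) \<le> Sf * norm (\<pi> - \<pi>')"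
    and loss_smooth2: "\<And>\<xi> \<pi> \<pi>'. \<xi> \<in> I \<Longrightarrow> is_policy \<pi> \<Longrightarrow> is_policy \<pi>' \<Longrightarrow>
        norm (gradient (\<lambda>p. f x p \<xi>) \<pi> - gradient (\<lambda>p. f x p \<xi>) \<pi>') \<le> Sf * norm (\<pi> - \<pi>')"
    and Sf: "0 \<le> Sf"
    and \<nu>: "set_pmf \<nu> = UNIV"
begin

abbreviation m where "m \<xi> \<equiv> (\<lambda>y. M y \<xi>)"
abbreviation soft where "soft \<equiv> softmax_policy lam :: real^'a^'s \<Rightarrow> real^'a^'s"
definition Q_box where "Q_box = (entry_ball (q_bound R \<gamma> lam CARD('a)) :: (real^'a^'s) set)"

abbreviation blip where "blip \<equiv> bounded_Lipschitz_family I Q_box"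

lemma discount: "\<xi> \<in> I \<Longrightarrow> discount (M x \<xi>) = \<gamma>"
  using soft_mdp_family.discount[OF family x] .

lemma blip_entry: "blip (\<lambda>\<xi> Q. Q $ s $ a)"
  by (rule bounded_Lipschitz_familyI[where C = "q_bound R \<gamma> lam CARD('a)" and L = 1])
    (use abs_entry_le_norm[of "_ - _" s a] in \<open>auto simp: Q_box_def entry_ball_def\<close>)

lemma abs_entry_diff_le: "\<bar>Q $ s $ a - Q' $ s $ a\<bar> \<le> norm (Q - Q')" for Q Q' :: "real^'a^'s"
  using abs_entry_le_norm[of "Q - Q'" s a] by simp

lemma blip_soft_maximum: "blip (\<lambda>\<xi> Q. soft_maximum lam Q s)"
proof (rule bounded_Lipschitz_familyI[where L = 1])
  show "norm (soft_maximum lam Q s) \<le> q_bound R \<gamma> lam CARD('a) + lam * ln (real CARD('a))" if "Q \<in> Q_box" for Q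
    using abs_soft_maximum_le[OF lam, of Q s] that by (simp add: Q_box_def entry_ball_def)
  show "norm (soft_maximum lam Q s - soft_maximum lam Q' s) \<le> 1 * norm (Q - Q')" for Q Q' :: "real^'a^'s"
    using soft_maximum_Lipschitz[OF lam abs_entry_diff_le] by simp
qed

lemma policy_entry_le_1: "is_policy \<pi> \<Longrightarrow> \<pi> $ s $ a \<le> 1"
  unfolding is_policy_def by (metis UNIV_I finite member_le_sum)

lemma softmax_entry_Lipschitz: "\<bar>soft Q $ s $ a - soft Q' $ s $ a\<bar> \<le> 2 / lam * norm (Q - Q')"
  using softmax_policy_Lipschitz[where Q = Q and Q' = Q' and \<delta> = "norm (Q - Q')" and s = s and a = a,
    OF lam abs_entry_diff_le] by simp

lemma softmax_Lipschitz: "norm (soft Q - soft Q') \<le> real CARD('s) * real CARD('a) * (2 / lam) * norm (Q - Q')"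
proof -
  have "norm (soft Q - soft Q') \<le> (\<Sum>s\<in>(UNIV::'s set). \<Sum>a\<in>(UNIV::'a set). 2 / lam * norm (Q - Q'))"
    by (rule order_trans[OF norm_le_sum_entries]) (intro sum_mono, use softmax_entry_Lipschitz in simp)
  then show ?thesis by simp
qed

lemma blip_softmax: "blip (\<lambda>\<xi> Q. soft Q $ s $ a)"
proof (rule bounded_Lipschitz_familyI[where C = 1 and L = "2 / lam"])
  show "norm (soft Q $ s $ a) \<le> 1" for Q
    using policy_entry_le_1[OF is_policy_softmax_policy, of lam Q s a] softmax_policy_pos[of lam Q s a] by simp
qed (use softmax_entry_Lipschitz in simp)

text \<open>On the box the log-probabilities are bounded, so the entropy is Lipschitz in \<open>Q\<close>, although as a function of the
policy its slope is unbounded near the boundary of the simplex.\<close>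

lemma blip_entropy: "blip (\<lambda>\<xi> Q. policy_entropy (soft Q) s)"
proof -
  have "blip (\<lambda>\<xi> Q. (-1) *\<^sub>R (\<Sum>a\<in>UNIV. soft Q $ s $ a * ((1 / lam) *\<^sub>R (Q $ s $ a - soft_maximum lam Q s))))"
    by (intro bounded_Lipschitz_family_cmult bounded_Lipschitz_family_sum bounded_Lipschitz_family_mult
        bounded_Lipschitz_family_diff blip_entry blip_soft_maximum blip_softmax)
  then show ?thesis
    by (simp add: policy_entropy_def ln_softmax_policy[OF lam])
qed

lemma blip_soft_reward: "blip (\<lambda>\<xi> Q. soft_reward lam (M x \<xi>) (soft Q) z)"
proof -
  have "blip (\<lambda>\<xi> Q. reward (M x \<xi>) (fst z) (snd z))"
    by (rule bounded_Lipschitz_family_const[where C = R])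
      (use soft_mdp_family.reward_bound[OF family x] in auto)
  then have "blip (\<lambda>\<xi> Q. reward (M x \<xi>) (fst z) (snd z) + lam *\<^sub>R policy_entropy (soft Q) (fst z))"
    by (intro bounded_Lipschitz_family_add bounded_Lipschitz_family_cmult blip_entropy)
  then show ?thesis by (simp add: soft_reward_def)
qed

text \<open>The difference of the solutions for \<open>Q\<close> and \<open>Q'\<close> solves the same kind of equation, with an inhomogeneity
that consists of the change of the data and of the change of the policy acting on a bounded solution.
Contraction bounds both solutions and their difference.\<close>

lemma blip_fixed_point:
  fixes U G :: "'x \<Rightarrow> real^'a^'s \<Rightarrow> 's \<times> 'a \<Rightarrow> 'v::euclidean_space"
  assumes G: "\<And>z. blip (\<lambda>\<xi> Q. G \<xi> Q z)"
    and U: "\<And>\<xi> Q z. \<xi> \<in> I \<Longrightarrow> Q \<in> Q_box \<Longrightarrow>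
      U \<xi> Q z = G \<xi> Q z + \<gamma> *\<^sub>R \<E> (sa_step (M x \<xi>) (soft Q) z) (U \<xi> Q)"
  shows "blip (\<lambda>\<xi> Q. U \<xi> Q z)"
proof -
  have "\<forall>z. \<exists>C\<ge>0. (\<forall>\<xi>\<in>I. \<forall>Q\<in>Q_box. norm (G \<xi> Q z) \<le> C \<and> (\<forall>Q'\<in>Q_box. norm (G \<xi> Q z - G \<xi> Q' z) \<le> C * norm (Q - Q')))"
    using G unfolding bounded_Lipschitz_family_def by blast
  then obtain c where c: "\<And>z. 0 \<le> c z" "\<And>z \<xi> Q. \<xi> \<in> I \<Longrightarrow> Q \<in> Q_box \<Longrightarrow> norm (G \<xi> Q z) \<le> c z"
      "\<And>z \<xi> Q Q'. \<xi> \<in> I \<Longrightarrow> Q \<in> Q_box \<Longrightarrow> Q' \<in> Q_box \<Longrightarrow> norm (G \<xi> Q z - G \<xi> Q' z) \<le> c z * norm (Q - Q')"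
    by metis
  define C where "C = (\<Sum>z\<in>UNIV. c z)"
  have cC: "c z \<le> C" for z unfolding C_def by (rule member_le_sum) (use c in auto)
  have C: "0 \<le> C" unfolding C_def using c by (simp add: sum_nonneg)
  have GC: "norm (G \<xi> Q z) \<le> C" if "\<xi> \<in> I" "Q \<in> Q_box" for \<xi> Q z
    using c(2)[OF that, of z] cC[of z] by linarith
  have GL: "norm (G \<xi> Q z - G \<xi> Q' z) \<le> C * norm (Q - Q')" if "\<xi> \<in> I" "Q \<in> Q_box" "Q' \<in> Q_box" for \<xi> Q Q' z
    using c(3)[OF that, of z] mult_right_mono[OF cC[of z] norm_ge_zero[of "Q - Q'"]] by linarith
  define D where "D = C / (1 - \<gamma>)"
  have D: "0 \<le> D" using C \<gamma> by (simp add: D_def)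
  have UD: "norm (U \<xi> Q z) \<le> D" if i: "\<xi> \<in> I" "Q \<in> Q_box" for \<xi> Q z
    unfolding D_def
  proof (rule sup_contraction_bound[where e = "U \<xi> Q", OF \<gamma>(2)])
    fix b z assume b: "\<forall>z'. norm (U \<xi> Q z') \<le> b"
    have "norm (U \<xi> Q z) \<le> norm (G \<xi> Q z) + norm (\<gamma> *\<^sub>R \<E> (sa_step (M x \<xi>) (soft Q) z) (U \<xi> Q))"
      by (subst U[OF i]) (rule norm_triangle_ineq)
    also have "\<dots> \<le> C + \<gamma> * b"
      using GC[OF i, of z] \<gamma> expectation_const_bound(1)[of "sa_step (M x \<xi>) (soft Q) z" "U \<xi> Q" b] b
      by (simp add: add_mono mult_left_mono)
    finally show "norm (U \<xi> Q z) \<le> C + \<gamma> * b" .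
  qed
  define E where "E = real CARD('a) * (2 / lam) * D"
  have step: "norm (\<E> (sa_step (M x \<xi>) (soft Q) z) h - \<E> (sa_step (M x \<xi>) (soft Q') z) h)
      \<le> E * norm (Q - Q')" if h: "\<And>z. norm (h z) \<le> D" for h :: "'s \<times> 'a \<Rightarrow> 'v" and \<xi> Q Q' z
  proof -
    have "norm ((\<Sum>a\<in>UNIV. soft Q $ s' $ a *\<^sub>R h (s', a)) - (\<Sum>a\<in>UNIV. soft Q' $ s' $ a *\<^sub>R h (s', a))) \<le> E * norm (Q - Q')" for s'
    proof -
      have "(\<Sum>a\<in>UNIV. soft Q $ s' $ a *\<^sub>R h (s', a)) - (\<Sum>a\<in>UNIV. soft Q' $ s' $ a *\<^sub>R h (s', a))
          = (\<Sum>a\<in>UNIV. (soft Q $ s' $ a - soft Q' $ s' $ a) *\<^sub>R h (s', a))"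
        by (simp add: scaleR_diff_left sum_subtractf)
      also have "norm \<dots> \<le> (\<Sum>a\<in>(UNIV::'a set). 2 / lam * norm (Q - Q') * D)"
        by (rule sum_norm_le, unfold norm_scaleR, rule mult_mono[OF softmax_entry_Lipschitz h]) (use lam in auto)
      also have "\<dots> = E * norm (Q - Q')" by (simp add: E_def)
      finally show ?thesis .
    qed
    then show ?thesis
      unfolding expectation_sa_step[OF is_policy_softmax_policy] expect_next_diff
      by (rule norm_expect_next_le)
  qed
  show ?thesis
  proof (rule bounded_Lipschitz_familyI[where C = D and L = "(C + \<gamma> * E) / (1 - \<gamma>)"])
    show "norm (U \<xi> Q z) \<le> D" if "\<xi> \<in> I" "Q \<in> Q_box" for \<xi> Q by (rule UD[OF that])
    fix \<xi> Q Q' assume i: "\<xi> \<in> I" "Q \<in> Q_box" and i': "Q' \<in> Q_box"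
    have "norm (U \<xi> Q z - U \<xi> Q' z) \<le> ((C + \<gamma> * E) * norm (Q - Q')) / (1 - \<gamma>)"
    proof (rule sup_contraction_bound[where e = "\<lambda>z. U \<xi> Q z - U \<xi> Q' z", OF \<gamma>(2)])
      fix b z assume b: "\<forall>z'. norm (U \<xi> Q z' - U \<xi> Q' z') \<le> b"
      let ?p = "sa_step (M x \<xi>) (soft Q) z" and ?p' = "sa_step (M x \<xi>) (soft Q') z"
      have fin: "integrable (measure_pmf p) h" for p :: "('s \<times> 'a) pmf" and h :: "_ \<Rightarrow> 'v"
        by (rule integrable_measure_pmf_finite) simp
      have "U \<xi> Q z - U \<xi> Q' z = (G \<xi> Q z - G \<xi> Q' z)
          + \<gamma> *\<^sub>R (\<E> ?p (\<lambda>z. U \<xi> Q z - U \<xi> Q' z))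
          + \<gamma> *\<^sub>R (\<E> ?p (U \<xi> Q') - \<E> ?p' (U \<xi> Q'))"
        by (subst U[OF i], subst U[OF i(1) i']) (simp add: fin algebra_simps)
      also have "norm \<dots> \<le> C * norm (Q - Q') + \<gamma> * b + \<gamma> * (E * norm (Q - Q'))"
      proof (rule norm_triangle_le, rule add_mono, rule norm_triangle_le, rule add_mono)
        show "norm (G \<xi> Q z - G \<xi> Q' z) \<le> C * norm (Q - Q')" by (rule GL[OF i i'])
        show "norm (\<gamma> *\<^sub>R \<E> ?p (\<lambda>z. U \<xi> Q z - U \<xi> Q' z)) \<le> \<gamma> * b"
          using \<gamma> expectation_const_bound(1)[of ?p "\<lambda>z. U \<xi> Q z - U \<xi> Q' z" b] b by (simp add: mult_left_mono)
        show "norm (\<gamma> *\<^sub>R (\<E> ?p (U \<xi> Q') - \<E> ?p' (U \<xi> Q'))) \<le> \<gamma> * (E * norm (Q - Q'))"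
          unfolding norm_scaleR using \<gamma> by (intro mult_mono step UD i i') auto
      qed
      finally show "norm (U \<xi> Q z - U \<xi> Q' z) \<le> (C + \<gamma> * E) * norm (Q - Q') + \<gamma> * b"
        by (simp add: algebra_simps)
    qed
    then show "norm (U \<xi> Q z - U \<xi> Q' z) \<le> (C + \<gamma> * E) / (1 - \<gamma>) * norm (Q - Q')" by simp
  qed
qed

lemma blip_policy_action_value: "blip (\<lambda>\<xi> Q. policy_action_value lam (M x \<xi>) (soft Q) z)"
proof (rule blip_fixed_point[OF blip_soft_reward])
  fix \<xi> Q z assume "\<xi> \<in> I"
  then show "policy_action_value lam (M x \<xi>) (soft Q) z = soft_reward lam (M x \<xi>) (soft Q) z
      + \<gamma> *\<^sub>R \<E> (sa_step (M x \<xi>) (soft Q) z) (policy_action_value lam (M x \<xi>) (soft Q))"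
    using policy_action_value_Bellman[of "M x \<xi>" lam "soft Q" z] \<gamma> by (simp add: discount)
qed

lemma blip_value_gradient: "blip (\<lambda>\<xi> Q. value_gradient lam (m \<xi>) x (soft Q) z)"
proof (rule blip_fixed_point)
  show "blip (\<lambda>\<xi> Q. reward_gradient (m \<xi>) x z
      + \<gamma> *\<^sub>R (\<Sum>s'\<in>UNIV. policy_state_value lam (M x \<xi>) (soft Q) s' *\<^sub>R kernel_gradient (m \<xi>) x z s'))" for z
    unfolding policy_state_value_def
    by (intro bounded_Lipschitz_family_add bounded_Lipschitz_family_cmult bounded_Lipschitz_family_sum
        bounded_Lipschitz_family_scaleR bounded_Lipschitz_family_mult blip_softmax blip_policy_action_value
        bounded_Lipschitz_family_const[of I "\<lambda>\<xi>. reward_gradient (m \<xi>) x z", OF soft_mdp_family.norm_reward_gradient[OF family x]]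
        bounded_Lipschitz_family_const[of I "\<lambda>\<xi>. kernel_gradient (m \<xi>) x z _", OF soft_mdp_family.norm_kernel_gradient[OF family x]])
next
  fix \<xi> Q z assume "\<xi> \<in> I"
  from soft_mdp_family.value_gradient_Bellman[OF family[OF this] x is_policy_softmax_policy]
  show "value_gradient lam (m \<xi>) x (soft Q) z = reward_gradient (m \<xi>) x z
      + \<gamma> *\<^sub>R (\<Sum>s'\<in>UNIV. policy_state_value lam (M x \<xi>) (soft Q) s' *\<^sub>R kernel_gradient (m \<xi>) x z s')
      + \<gamma> *\<^sub>R \<E> (sa_step (M x \<xi>) (soft Q) z) (value_gradient lam (m \<xi>) x (soft Q))" .
qed

lemma blip_advantage_gradient: "blip (\<lambda>\<xi> Q. advantage_gradient lam (m \<xi>) x (soft Q) s a)"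
  unfolding advantage_gradient_def
  by (intro bounded_Lipschitz_family_diff bounded_Lipschitz_family_sum bounded_Lipschitz_family_scaleR
      blip_softmax blip_value_gradient)

lemma blip_loss_gradient1: "blip (\<lambda>\<xi> Q. gradient (\<lambda>y. f y (soft Q) \<xi>) x)"
proof (rule bounded_Lipschitz_familyI[where C = Kf and L = "Sf * (real CARD('s) * real CARD('a) * (2 / lam))"])
  fix \<xi> and Q Q' :: "real^'a^'s" assume \<xi>: "\<xi> \<in> I"
  show "norm (gradient (\<lambda>y. f y (soft Q) \<xi>) x) \<le> Kf" by (rule loss_gradient1[OF \<xi> is_policy_softmax_policy])
  have "norm (gradient (\<lambda>y. f y (soft Q) \<xi>) x - gradient (\<lambda>y. f y (soft Q') \<xi>) x) \<le> Sf * norm (soft Q - soft Q')"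
    by (rule loss_smooth1[OF \<xi> is_policy_softmax_policy is_policy_softmax_policy])
  also have "\<dots> \<le> Sf * (real CARD('s) * real CARD('a) * (2 / lam) * norm (Q - Q'))"
    by (rule mult_left_mono[OF softmax_Lipschitz Sf])
  finally show "norm (gradient (\<lambda>y. f y (soft Q) \<xi>) x - gradient (\<lambda>y. f y (soft Q') \<xi>) x)
      \<le> Sf * (real CARD('s) * real CARD('a) * (2 / lam)) * norm (Q - Q')" by (simp add: mult.assoc)
qed

lemma blip_loss_gradient2: "blip (\<lambda>\<xi> Q. gradient (\<lambda>p. f x p \<xi>) (soft Q) $ s $ a)"
proof (rule bounded_Lipschitz_familyI[where C = Kf and L = "Sf * (real CARD('s) * real CARD('a) * (2 / lam))"])
  fix \<xi> and Q Q' :: "real^'a^'s" assume \<xi>: "\<xi> \<in> I"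
  show "norm (gradient (\<lambda>p. f x p \<xi>) (soft Q) $ s $ a) \<le> Kf"
    using loss_gradient2[OF \<xi> is_policy_softmax_policy, of lam Q] abs_entry_le_norm[of "gradient (\<lambda>p. f x p \<xi>) (soft Q)" s a]
    by simp
  have "norm (gradient (\<lambda>p. f x p \<xi>) (soft Q) $ s $ a - gradient (\<lambda>p. f x p \<xi>) (soft Q') $ s $ a)
      \<le> Sf * norm (soft Q - soft Q')"
    using loss_smooth2[OF \<xi> is_policy_softmax_policy is_policy_softmax_policy, of lam Q lam Q']
      abs_entry_diff_le[of "gradient (\<lambda>p. f x p \<xi>) (soft Q)" s a "gradient (\<lambda>p. f x p \<xi>) (soft Q')"] by simp
  also have "\<dots> \<le> Sf * (real CARD('s) * real CARD('a) * (2 / lam) * norm (Q - Q'))"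
    by (rule mult_left_mono[OF softmax_Lipschitz Sf])
  finally show "norm (gradient (\<lambda>p. f x p \<xi>) (soft Q) $ s $ a - gradient (\<lambda>p. f x p \<xi>) (soft Q') $ s $ a)
      \<le> Sf * (real CARD('s) * real CARD('a) * (2 / lam)) * norm (Q - Q')" by (simp add: mult.assoc)
qed

lemma blip_policy_hypergradient: "blip (\<lambda>\<xi> Q. policy_hypergradient lam (m \<xi>) (\<lambda>y p. f y p \<xi>) x (soft Q))"
  unfolding policy_hypergradient_def divide_inverse
  by (intro bounded_Lipschitz_family_add bounded_Lipschitz_family_sum bounded_Lipschitz_family_scaleR
      bounded_Lipschitz_family_mult blip_loss_gradient1 blip_loss_gradient2 blip_softmax blip_advantage_gradient
      bounded_Lipschitz_family_const[of I "\<lambda>_. inverse lam", OF order_refl])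

text \<open>This bounds the importance ratios between two levels.\<close>

lemma softmax_lower_bound:
  obtains c where "c > 0" "\<And>Q s a. Q \<in> Q_box \<Longrightarrow> c \<le> soft Q $ s $ a"
proof -
  let ?B = "q_bound R \<gamma> lam CARD('a)"
  have "exp (- (2 * ?B + lam * ln (real CARD('a))) / lam) \<le> soft Q $ s $ a" if "Q \<in> Q_box" for Q s a
  proof -
    have "\<bar>Q $ s $ a\<bar> \<le> ?B" using that by (simp add: Q_box_def entry_ball_def)
    moreover have "\<bar>soft_maximum lam Q s\<bar> \<le> ?B + lam * ln (real CARD('a))"
      by (rule abs_soft_maximum_le[OF lam]) (use that in \<open>simp add: Q_box_def entry_ball_def\<close>)
    ultimately have "- (2 * ?B + lam * ln (real CARD('a))) \<le> Q $ s $ a - soft_maximum lam Q s" by linarith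
    then show ?thesis using lam by (simp add: softmax_policy_eq_exp[OF lam] divide_right_mono)
  qed
  then show ?thesis using that[of "exp (- (2 * ?B + lam * ln (real CARD('a))) / lam)"] by simp
qed

lemma has_moments_dQ_uniform:
  obtains C where "C \<ge> 0" "\<And>\<xi> Q s a. \<xi> \<in> I \<Longrightarrow> Q \<in> Q_box \<Longrightarrow>
    has_moments (dQ_estimator lam (m \<xi>) x (soft Q) s a) (\<lambda>v. v) (value_gradient lam (m \<xi>) x (soft Q) (s, a)) C"
proof -
  have "\<forall>z. \<exists>G. \<forall>\<xi>\<in>I. \<forall>Q\<in>Q_box. \<bar>soft_reward lam (M x \<xi>) (soft Q) z\<bar> \<le> G"
    using blip_soft_reward unfolding bounded_Lipschitz_family_def by (metis real_norm_def)
  then obtain g where g: "\<And>z \<xi> Q. \<xi> \<in> I \<Longrightarrow> Q \<in> Q_box \<Longrightarrow> \<bar>soft_reward lam (M x \<xi>) (soft Q) z\<bar> \<le> g z"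
    by metis
  define G where "G = Max (range g)"
  have gG: "\<bar>soft_reward lam (M x \<xi>) (soft Q) z\<bar> \<le> G" if "\<xi> \<in> I" "Q \<in> Q_box" for z \<xi> Q
  proof -
    have "g z \<le> G" unfolding G_def by (rule Max_ge) auto
    with g[OF that, of z] show ?thesis by linarith
  qed
  define C where "C = (Kr + \<gamma> / (1 - \<gamma>) * (G / (1 - \<gamma> powr (1/2))) * Kp)\<^sup>2 * second_moment_geometric \<gamma>"
  have C: "C \<ge> 0" unfolding C_def second_moment_geometric_def by simp
  have "has_moments (dQ_estimator lam (m \<xi>) x (soft Q) s a) (\<lambda>v. v) (value_gradient lam (m \<xi>) x (soft Q) (s, a)) C"
    if i: "\<xi> \<in> I" "Q \<in> Q_box" for \<xi> Q s a
  proof -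
    interpret S: soft_mdp_family "m \<xi>" X lam \<gamma> R Kr Kp by (rule family[OF i(1)])
    show ?thesis
      using has_moments_dQ_estimator[where m = "m \<xi>" and x = x, OF _ _ gG[OF i] S.norm_reward_gradient[OF x] S.norm_score[OF x]]
        \<gamma> unfolding C_def value_gradient_def by (simp add: discount[OF i(1)])
  qed
  with C show ?thesis by (rule that)
qed

lemma has_moments_gradient_estimator:
  obtains C where "C \<ge> 0" "\<And>\<xi> Q s a. \<xi> \<in> I \<Longrightarrow> Q \<in> Q_box \<Longrightarrow>
    has_moments (gradient_estimator lam (m \<xi>) x (soft Q) s a) (\<lambda>v. v) (advantage_gradient lam (m \<xi>) x (soft Q) s a) C"
proof -
  obtain C where C: "C \<ge> 0" "\<And>\<xi> Q s a. \<xi> \<in> I \<Longrightarrow> Q \<in> Q_box \<Longrightarrow>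
    has_moments (dQ_estimator lam (m \<xi>) x (soft Q) s a) (\<lambda>v. v) (value_gradient lam (m \<xi>) x (soft Q) (s, a)) C"
    using has_moments_dQ_uniform by blast
  have "has_moments (gradient_estimator lam (m \<xi>) x (soft Q) s a) (\<lambda>v. v) (advantage_gradient lam (m \<xi>) x (soft Q) s a) (4 * C)"
    if i: "\<xi> \<in> I" "Q \<in> Q_box" for \<xi> Q s a
  proof -
    let ?W = "value_gradient lam (m \<xi>) x (soft Q)"
    define V where "V = (\<Sum>b\<in>UNIV. soft Q $ s $ b *\<^sub>R ?W (s, b))"
    have hV: "has_moments (dV_estimator lam (m \<xi>) x (soft Q) s) (\<lambda>v. v) V C"
      unfolding dV_estimator_def V_def expectation_act_pmf[OF is_policy_softmax_policy, symmetric]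
      by (rule has_moments_bind_pmf_const(1)) (rule C(2)[OF i])
    have inner: "has_moments (map_pmf (\<lambda>gV. gQ - gV) (dV_estimator lam (m \<xi>) x (soft Q) s)) (\<lambda>v. v)
        (gQ - V) (2 * C + 2 * (norm gQ)\<^sup>2)" for gQ
    proof -
      show ?thesis
        unfolding has_moments_map_pmf using has_moments_affine_le[OF hV, of "-1" gQ] by simp
    qed
    have hQ: "has_moments (dQ_estimator lam (m \<xi>) x (soft Q) s a) (\<lambda>v. v) (?W (s, a)) C" by (rule C(2)[OF i])
    then have Qi: "integrable (dQ_estimator lam (m \<xi>) x (soft Q) s a) (\<lambda>v. v)"
        "integrable (dQ_estimator lam (m \<xi>) x (soft Q) s a) (\<lambda>v. (norm v)\<^sup>2)"
        "\<E> (dQ_estimator lam (m \<xi>) x (soft Q) s a) (\<lambda>v. v) = ?W (s, a)"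
        "\<E> (dQ_estimator lam (m \<xi>) x (soft Q) s a) (\<lambda>v. (norm v)\<^sup>2) \<le> C"
      by (auto simp: has_moments_def)
    have eq: "gradient_estimator lam (m \<xi>) x (soft Q) s a = bind_pmf (dQ_estimator lam (m \<xi>) x (soft Q) s a)
        (\<lambda>gQ. map_pmf (\<lambda>gV. gQ - gV) (dV_estimator lam (m \<xi>) x (soft Q) s))"
      by (simp add: gradient_estimator_def map_pmf_def)
    have "has_moments (gradient_estimator lam (m \<xi>) x (soft Q) s a) (\<lambda>v. v)
        (\<E> (dQ_estimator lam (m \<xi>) x (soft Q) s a) (\<lambda>gQ. gQ - V))
        (\<E> (dQ_estimator lam (m \<xi>) x (soft Q) s a) (\<lambda>gQ. 2 * C + 2 * (norm gQ)\<^sup>2))"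
      unfolding eq by (rule has_moments_bind_pmf(1)[OF inner]) (use Qi in simp)
    moreover have "\<E> (dQ_estimator lam (m \<xi>) x (soft Q) s a) (\<lambda>gQ. gQ - V) = advantage_gradient lam (m \<xi>) x (soft Q) s a"
      using Qi by (simp add: advantage_gradient_def V_def)
    moreover have "\<E> (dQ_estimator lam (m \<xi>) x (soft Q) s a) (\<lambda>gQ. 2 * C + 2 * (norm gQ)\<^sup>2) \<le> 4 * C"
      using Qi by simp
    ultimately show ?thesis by (simp add: has_moments_mono)
  qed
  with C(1) show ?thesis using that[of "4 * C"] by simp
qed

end

section \<open>Runs of soft Q-learning\<close>

lemma has_moments_finite:
  assumes "finite (set_pmf p)" "\<E> p (\<lambda>z. (norm (X z))\<^sup>2) \<le> B"
  shows "has_moments (measure_pmf p) X (\<E> p X) B"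
  using assms by (simp add: has_moments_def prob_space_measure_pmf integrable_measure_pmf_finite)

lemma expectation_norm_le_sqrt:
  assumes "finite (set_pmf p)" "\<E> p (\<lambda>z. (norm (X z :: 'v::euclidean_space))\<^sup>2) \<le> B"
  shows "\<E> p (\<lambda>z. norm (X z)) \<le> sqrt B"
proof -
  have "has_moments (measure_pmf p) (\<lambda>z. norm (X z)) (\<E> p (\<lambda>z. norm (X z))) B"
    by (rule has_moments_finite) (use assms in auto)
  from has_moments_norm_mean[OF this] show ?thesis
    by (intro real_le_rsqrt) simp
qed

lemma has_moments_fst_pair_pmf:
  "has_moments (measure_pmf p) F \<mu> B \<Longrightarrow> has_moments (pair_pmf p q) (\<lambda>z. F (fst z)) \<mu> B"
  by (subst has_moments_map_pmf[symmetric]) (simp add: map_fst_pair_pmf)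

lemma has_moments_snd_pair_pmf:
  "has_moments (measure_pmf q) F \<mu> B \<Longrightarrow> has_moments (pair_pmf p q) (\<lambda>z. F (snd z)) \<mu> B"
  by (subst has_moments_map_pmf[symmetric]) (simp add: map_snd_pair_pmf)

lemma length_soft_q_run: "h \<in> set_pmf (soft_q_run lam m \<pi>\<^sub>B \<alpha> s\<^sub>0 n) \<Longrightarrow> length h = Suc n"
  by (induction n arbitrary: h) (auto simp: Let_def)

lemma finite_set_soft_q_run:
  fixes m :: "('s::finite, 'a::finite) mdp"
  shows "finite (set_pmf (soft_q_run lam m \<pi>\<^sub>B \<alpha> s\<^sub>0 n))"
  by (induction n) (auto simp: Let_def)

text \<open>A run only appends to its record. So the iterates that a long run records at an earlier time are
distributed as those of a shorter run.\<close>

lemma map_take_soft_q_run: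
  "j \<le> n \<Longrightarrow> map_pmf (take (Suc j)) (soft_q_run lam m \<pi>\<^sub>B \<alpha> s\<^sub>0 n) = soft_q_run lam m \<pi>\<^sub>B \<alpha> s\<^sub>0 j"
proof (induction n)
  case 0
  then show ?case by simp
next
  case (Suc n)
  show ?case
  proof (cases "j = Suc n")
    case True
    have "map_pmf (take (Suc j)) (soft_q_run lam m \<pi>\<^sub>B \<alpha> s\<^sub>0 (Suc n)) = map_pmf (\<lambda>h. h) (soft_q_run lam m \<pi>\<^sub>B \<alpha> s\<^sub>0 (Suc n))"
      by (rule map_pmf_cong[OF refl]) (use True in \<open>simp only: length_soft_q_run take_all order_refl\<close>)
    then show ?thesis using True by (simp only: map_pmf_ident)
  next
    case False
    with Suc.prems have j: "j \<le> n" by simp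
    let ?r = "soft_q_run lam m \<pi>\<^sub>B \<alpha> s\<^sub>0 n"
    have "map_pmf (take (Suc j)) (soft_q_run lam m \<pi>\<^sub>B \<alpha> s\<^sub>0 (Suc n))
        = bind_pmf ?r (\<lambda>h. bind_pmf (act_pmf \<pi>\<^sub>B (snd (last h))) (\<lambda>a. bind_pmf (kernel m (snd (last h)) a)
            (\<lambda>s'. return_pmf (take (Suc j) (h @ [(q_update lam m (\<alpha> n) (snd (last h)) a s' (fst (last h)), s')])))))"
      by (simp add: map_bind_pmf Let_def)
    also have "\<dots> = bind_pmf ?r (\<lambda>h. bind_pmf (act_pmf \<pi>\<^sub>B (snd (last h))) (\<lambda>a. bind_pmf (kernel m (snd (last h)) a)
            (\<lambda>s'. return_pmf (take (Suc j) h))))"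
      by (intro bind_pmf_cong refl) (use j length_soft_q_run in fastforce)
    also have "\<dots> = map_pmf (take (Suc j)) ?r"
      by (simp add: map_pmf_def)
    finally show ?thesis using Suc.IH[OF j] by simp
  qed
qed

lemma expectation_q_iterate_prefix:
  fixes m :: "('s::finite, 'a::finite) mdp" and \<phi> :: "_ \<Rightarrow> 'v::{banach, second_countable_topology}"
  assumes "j \<le> n"
  shows "\<E> (soft_q_run lam m \<pi>\<^sub>B \<alpha> s\<^sub>0 n) (\<lambda>h. \<phi> (q_iterate h j))
    = \<E> (soft_q_run lam m \<pi>\<^sub>B \<alpha> s\<^sub>0 j) (\<lambda>h. \<phi> (q_iterate h j))"
proof -
  have "q_iterate (take (Suc j) h) j = q_iterate h j" for h :: "((real^'a^'s) \<times> 's) list"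
    by (simp add: q_iterate_def)
  then show ?thesis
    unfolding map_take_soft_q_run[OF assms, symmetric] by simp
qed

text \<open>The new entry is a convex combination of the old one and of a soft Bellman target, and both obey the bound.\<close>

lemma q_update_in_entry_ball:
  fixes m :: "('s::finite, 'a::finite) mdp"
  assumes lam: "lam > 0" and \<gamma>: "0 \<le> discount m" "discount m < 1" and r: "\<And>s a. \<bar>reward m s a\<bar> \<le> R"
    and \<eta>: "0 \<le> \<eta>" "\<eta> \<le> 1" and Q: "Q \<in> entry_ball (q_bound R (discount m) lam CARD('a))"
  shows "q_update lam m \<eta> s a s' Q \<in> entry_ball (q_bound R (discount m) lam CARD('a))"
proof -
  let ?B = "q_bound R (discount m) lam CARD('a)"
  have QB: "\<bar>Q $ s $ a\<bar> \<le> ?B" for s a using Q by (simp add: entry_ball_def)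
  have T: "\<bar>reward m s a + discount m * soft_maximum lam Q s'\<bar> \<le> ?B"
    by (rule soft_target_bound[OF lam \<gamma> r Q abs_soft_maximum_le[OF lam QB]])
  have "\<bar>Q $ s $ a + \<eta> * (reward m s a + discount m * lam * ln (\<Sum>a'\<in>UNIV. exp (Q $ s' $ a' / lam)) - Q $ s $ a)\<bar> \<le> ?B"
  proof -
    have "Q $ s $ a + \<eta> * (reward m s a + discount m * lam * ln (\<Sum>a'\<in>UNIV. exp (Q $ s' $ a' / lam)) - Q $ s $ a)
        = (1 - \<eta>) * Q $ s $ a + \<eta> * (reward m s a + discount m * soft_maximum lam Q s')"
      by (simp add: soft_maximum_def algebra_simps)
    also have "\<bar>\<dots>\<bar> \<le> (1 - \<eta>) * \<bar>Q $ s $ a\<bar> + \<eta> * \<bar>reward m s a + discount m * soft_maximum lam Q s'\<bar>"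
      using \<eta> abs_triangle_ineq[of "(1 - \<eta>) * Q $ s $ a" "\<eta> * (reward m s a + discount m * soft_maximum lam Q s')"]
      by (simp add: abs_mult)
    also have "\<dots> \<le> (1 - \<eta>) * ?B + \<eta> * ?B"
      using \<eta> by (intro add_mono mult_left_mono QB T) auto
    finally show ?thesis by (simp add: algebra_simps)
  qed
  then show ?thesis using QB by (simp add: entry_ball_def q_update_def)
qed

lemma soft_q_run_in_entry_ball:
  fixes m :: "('s::finite, 'a::finite) mdp"
  assumes lam: "lam > 0" and \<gamma>: "0 \<le> discount m" "discount m < 1" and r: "\<And>s a. \<bar>reward m s a\<bar> \<le> R"
    and \<alpha>: "\<And>n. 0 \<le> \<alpha> n \<and> \<alpha> n \<le> 1"
    and h: "h \<in> set_pmf (soft_q_run lam m \<pi>\<^sub>B \<alpha> s\<^sub>0 n)" and z: "z \<in> set h"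
  shows "fst z \<in> entry_ball (q_bound R (discount m) lam CARD('a))"
  using h z
proof (induction n arbitrary: h z)
  case 0
  have "0 \<le> R" using r abs_ge_zero order_trans by blast
  then have "0 \<le> q_bound R (discount m) lam CARD('a)"
    using lam \<gamma> by (intro q_bound_nonneg) (auto simp: Suc_leI)
  then show ?case using 0 by (simp add: entry_ball_def)
next
  case (Suc n)
  from Suc.prems(1) obtain h' a s' where h': "h' \<in> set_pmf (soft_q_run lam m \<pi>\<^sub>B \<alpha> s\<^sub>0 n)"
    and h: "h = h' @ [(q_update lam m (\<alpha> n) (snd (last h')) a s' (fst (last h')), s')]"
    by (auto simp: Let_def)
  have "h' \<noteq> []" using length_soft_q_run[OF h'] by auto
  then have "fst (last h') \<in> entry_ball (q_bound R (discount m) lam CARD('a))"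
    using Suc.IH[OF h'] last_in_set by blast
  then have "q_update lam m (\<alpha> n) (snd (last h')) a s' (fst (last h')) \<in> entry_ball (q_bound R (discount m) lam CARD('a))"
    using \<alpha>[of n] by (intro q_update_in_entry_ball[OF lam \<gamma> r]) auto
  moreover have "z \<in> set h' \<or> z = (q_update lam m (\<alpha> n) (snd (last h')) a s' (fst (last h')), s')"
    using Suc.prems(2) unfolding h by auto
  ultimately show ?case using Suc.IH[OF h'] by (metis fst_conv)
qed

section \<open>The estimators for one context\<close>

context context_family
begin

abbreviation loss where "loss \<xi> \<equiv> (\<lambda>y p. f y p \<xi>)"
abbreviation \<Psi> where "\<Psi> \<xi> Q \<equiv> policy_hypergradient lam (m \<xi>) (loss \<xi>) x (soft Q)"
abbreviation Adv where "Adv \<xi> Q s a \<equiv> advantage_gradient lam (m \<xi>) x (soft Q) s a"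
abbreviation d1 where "d1 \<xi> Q \<equiv> gradient (\<lambda>y. f y (soft Q) \<xi>) x"
abbreviation coef where "coef \<xi> Q s a \<equiv> 1 / (lam * pmf \<nu> s) * gradient (\<lambda>p. f x p \<xi>) (soft Q) $ s $ a"
abbreviation grad_est where "grad_est \<xi> Q s a \<equiv> gradient_estimator lam (m \<xi>) x (soft Q) s a"

text \<open>The mean of the hypergradient estimate given the sampled state and action.\<close>

definition term_mean where "term_mean \<xi> Q s a = coef \<xi> Q s a *\<^sub>R Adv \<xi> Q s a + d1 \<xi> Q"

lemma pmf_\<nu>_pos: "0 < pmf \<nu> s"
  using \<nu> by (simp add: pmf_positive)

text \<open>Sampling the state from \<open>\<nu>\<close> is compensated by the factor \<open>1 / \<nu> s\<close>, and sampling the action from the policy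
supplies the factor \<open>\<pi> (a; s)\<close> of the derivative of the softmax.\<close>

lemma expectation_term_mean:
  "\<E> \<nu> (\<lambda>s. \<E> (act_pmf (soft Q) s) (term_mean \<xi> Q s)) = \<Psi> \<xi> Q"
proof -
  have "pmf \<nu> s *\<^sub>R (\<Sum>a\<in>UNIV. soft Q $ s $ a *\<^sub>R term_mean \<xi> Q s a) = pmf \<nu> s *\<^sub>R d1 \<xi> Q
      + (\<Sum>a\<in>UNIV. (gradient (\<lambda>p. f x p \<xi>) (soft Q) $ s $ a * soft Q $ s $ a / lam) *\<^sub>R Adv \<xi> Q s a)" for s
  proof -
    have 1: "(\<Sum>a\<in>UNIV. soft Q $ s $ a *\<^sub>R term_mean \<xi> Q s a)
        = (\<Sum>a\<in>UNIV. (soft Q $ s $ a * coef \<xi> Q s a) *\<^sub>R Adv \<xi> Q s a) + d1 \<xi> Q"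
    proof -
      have "(\<Sum>a\<in>UNIV. soft Q $ s $ a *\<^sub>R d1 \<xi> Q) = d1 \<xi> Q"
        using is_policy_softmax_policy[of lam Q] by (simp add: is_policy_def flip: scaleR_sum_left)
      then show ?thesis by (simp add: term_mean_def scaleR_add_right sum.distrib)
    qed
    have 2: "pmf \<nu> s *\<^sub>R (\<Sum>a\<in>UNIV. (soft Q $ s $ a * coef \<xi> Q s a) *\<^sub>R Adv \<xi> Q s a)
        = (\<Sum>a\<in>UNIV. (gradient (\<lambda>p. f x p \<xi>) (soft Q) $ s $ a * soft Q $ s $ a / lam) *\<^sub>R Adv \<xi> Q s a)"
      unfolding scaleR_sum_right
      by (rule sum.cong) (use pmf_\<nu>_pos[of s] in \<open>simp_all add: mult.commute\<close>)
    show ?thesis unfolding 1 scaleR_add_right 2 by (rule add.commute)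
  qed
  moreover have "(\<Sum>s\<in>UNIV. pmf \<nu> s *\<^sub>R d1 \<xi> Q) = d1 \<xi> Q"
    by (simp add: sum_pmf_UNIV flip: scaleR_sum_left)
  ultimately show ?thesis
    unfolding expectation_act_pmf[OF is_policy_softmax_policy] policy_hypergradient_def
    by (subst integral_measure_pmf[of UNIV]) (simp_all add: sum.distrib)
qed

lemma coef_bound: obtains c where "c \<ge> 0" "\<And>\<xi> Q s a. \<xi> \<in> I \<Longrightarrow> Q \<in> Q_box \<Longrightarrow> \<bar>coef \<xi> Q s a\<bar> \<le> c"
proof -
  have b: "\<bar>coef \<xi> Q s a\<bar> \<le> Kf / (lam * pmf \<nu> s)" if "\<xi> \<in> I" for \<xi> Q s a
  proof -
    have "\<bar>gradient (\<lambda>p. f x p \<xi>) (soft Q) $ s $ a\<bar> \<le> Kf"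
      using loss_gradient2[OF that is_policy_softmax_policy, of lam Q] abs_entry_le_norm[of "gradient (\<lambda>p. f x p \<xi>) (soft Q)" s a]
      by simp
    then show ?thesis using lam pmf_\<nu>_pos[of s] by (simp add: abs_mult divide_right_mono)
  qed
  define c where "c = Max (range (\<lambda>s. \<bar>Kf / (lam * pmf \<nu> s)\<bar>))"
  have c: "\<bar>Kf / (lam * pmf \<nu> s)\<bar> \<le> c" for s unfolding c_def by (rule abs_le_Max_range)
  show ?thesis
  proof (rule that[of c])
    show "0 \<le> c" using c[of undefined] by linarith
    show "\<bar>coef \<xi> Q s a\<bar> \<le> c" if "\<xi> \<in> I" for \<xi> Q s a by (rule order_trans[OF b[OF that] order_trans[OF abs_ge_self c]])
  qed
qed

lemma has_moments_hypergradient_term: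
  obtains C where "C \<ge> 0" "\<And>\<xi> Q s a. \<xi> \<in> I \<Longrightarrow> Q \<in> Q_box \<Longrightarrow>
    has_moments (grad_est \<xi> Q s a) (\<lambda>g. hypergradient_term lam \<nu> (loss \<xi>) x (soft Q) s a g) (term_mean \<xi> Q s a) C"
proof -
  obtain C where C: "C \<ge> 0" "\<And>\<xi> Q s a. \<xi> \<in> I \<Longrightarrow> Q \<in> Q_box \<Longrightarrow>
    has_moments (grad_est \<xi> Q s a) (\<lambda>v. v) (Adv \<xi> Q s a) C"
    using has_moments_gradient_estimator by blast
  obtain c where c: "c \<ge> 0" "\<And>\<xi> Q s a. \<xi> \<in> I \<Longrightarrow> Q \<in> Q_box \<Longrightarrow> \<bar>coef \<xi> Q s a\<bar> \<le> c"
    using coef_bound by blast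
  have "has_moments (grad_est \<xi> Q s a) (\<lambda>g. hypergradient_term lam \<nu> (loss \<xi>) x (soft Q) s a g)
      (term_mean \<xi> Q s a) (2 * c\<^sup>2 * C + 2 * Kf\<^sup>2)" if i: "\<xi> \<in> I" "Q \<in> Q_box" for \<xi> Q s a
  proof -
    have "(coef \<xi> Q s a)\<^sup>2 \<le> c\<^sup>2" using c(2)[OF i, of s a] by (simp add: abs_le_square_iff[symmetric] c(1))
    moreover have "(norm (d1 \<xi> Q))\<^sup>2 \<le> Kf\<^sup>2"
      by (intro power_mono loss_gradient1 i is_policy_softmax_policy) simp
    ultimately have le: "2 * (coef \<xi> Q s a)\<^sup>2 * C + 2 * (norm (d1 \<xi> Q))\<^sup>2 \<le> 2 * c\<^sup>2 * C + 2 * Kf\<^sup>2"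
      using C(1) by (intro add_mono mult_right_mono mult_left_mono) auto
    have "hypergradient_term lam \<nu> (loss \<xi>) x (soft Q) s a g = coef \<xi> Q s a *\<^sub>R g + d1 \<xi> Q" for g
      by (simp add: hypergradient_term_def add.commute)
    then show ?thesis
      using has_moments_mono[OF has_moments_affine_le[where a = "coef \<xi> Q s a" and c = "d1 \<xi> Q", OF C(2)[OF i]] le]
      by (simp add: term_mean_def)
  qed
  moreover have "0 \<le> 2 * c\<^sup>2 * C + 2 * Kf\<^sup>2" using C(1) by simp
  ultimately show ?thesis using that by blast
qed

text \<open>The mean of the lower level \<open>Q'\<close> given a state and an action that are drawn for the upper level \<open>Q\<close>.\<close>

definition ratio_mean where
  "ratio_mean \<xi> Q Q' s a = (soft Q' $ s $ a / soft Q $ s $ a * coef \<xi> Q' s a) *\<^sub>R Adv \<xi> Q' s a + d1 \<xi> Q'"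

text \<open>The importance ratio corrects the law of the action.\<close>

lemma expectation_ratio_mean:
  "\<E> (act_pmf (soft Q) s) (ratio_mean \<xi> Q Q' s)
    = \<E> (act_pmf (soft Q') s) (term_mean \<xi> Q' s)"
proof -
  have one: "(\<Sum>a\<in>UNIV. soft Q $ s $ a) = 1" for Q
    using is_policy_softmax_policy[of lam Q] by (simp add: is_policy_def)
  have "soft Q $ s $ a *\<^sub>R ratio_mean \<xi> Q Q' s a = (soft Q' $ s $ a * coef \<xi> Q' s a) *\<^sub>R Adv \<xi> Q' s a + soft Q $ s $ a *\<^sub>R d1 \<xi> Q'" for a
    using softmax_policy_pos[of lam Q s a] by (simp add: ratio_mean_def scaleR_add_right)
  moreover have "soft Q' $ s $ a *\<^sub>R term_mean \<xi> Q' s a = (soft Q' $ s $ a * coef \<xi> Q' s a) *\<^sub>R Adv \<xi> Q' s a + soft Q' $ s $ a *\<^sub>R d1 \<xi> Q'" for a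
    by (simp add: term_mean_def scaleR_add_right)
  ultimately show ?thesis
    unfolding expectation_act_pmf[OF is_policy_softmax_policy]
    by (simp add: sum.distrib one flip: scaleR_sum_left)
qed

lemma blip_coef_Adv: "blip (\<lambda>\<xi> Q. coef \<xi> Q s a *\<^sub>R Adv \<xi> Q s a)"
  by (intro bounded_Lipschitz_family_scaleR bounded_Lipschitz_family_mult blip_advantage_gradient blip_loss_gradient2
      bounded_Lipschitz_family_const[of I "\<lambda>_. 1 / (lam * pmf \<nu> s)", OF order_refl])

text \<open>Because both levels are evaluated at the same state and action, their difference is controlled by the
distance of the iterates. The importance ratio contributes \<open>\<bar>1 - ratio\<bar>\<close>, which is of the same order since the
denominator is bounded below.\<close>

lemma term_mean_ratio_mean_diff:
  obtains L where "L \<ge> 0" "\<And>\<xi> Q Q' s a. \<xi> \<in> I \<Longrightarrow> Q \<in> Q_box \<Longrightarrow> Q' \<in> Q_box \<Longrightarrow>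
    norm (term_mean \<xi> Q s a - ratio_mean \<xi> Q Q' s a) \<le> L * norm (Q - Q')"
proof -
  have "\<forall>z. \<exists>C\<ge>0. \<forall>\<xi>\<in>I. \<forall>Q\<in>Q_box. norm (coef \<xi> Q (fst z) (snd z) *\<^sub>R Adv \<xi> Q (fst z) (snd z)) \<le> C \<and>
     (\<forall>Q'\<in>Q_box. norm (coef \<xi> Q (fst z) (snd z) *\<^sub>R Adv \<xi> Q (fst z) (snd z)
        - coef \<xi> Q' (fst z) (snd z) *\<^sub>R Adv \<xi> Q' (fst z) (snd z)) \<le> C * norm (Q - Q'))"
    using blip_coef_Adv unfolding bounded_Lipschitz_family_def by blast
  then obtain c where c: "\<And>z. 0 \<le> c z"
      "\<And>z \<xi> Q. \<xi> \<in> I \<Longrightarrow> Q \<in> Q_box \<Longrightarrow> norm (coef \<xi> Q (fst z) (snd z) *\<^sub>R Adv \<xi> Q (fst z) (snd z)) \<le> c z"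
      "\<And>z \<xi> Q Q'. \<xi> \<in> I \<Longrightarrow> Q \<in> Q_box \<Longrightarrow> Q' \<in> Q_box \<Longrightarrow> norm (coef \<xi> Q (fst z) (snd z) *\<^sub>R Adv \<xi> Q (fst z) (snd z)
        - coef \<xi> Q' (fst z) (snd z) *\<^sub>R Adv \<xi> Q' (fst z) (snd z)) \<le> c z * norm (Q - Q')"
    by metis
  define C where "C = (\<Sum>z\<in>UNIV. c z)"
  have cC: "c z \<le> C" for z unfolding C_def by (rule member_le_sum) (use c in auto)
  have C: "0 \<le> C" unfolding C_def using c by (simp add: sum_nonneg)
  from blip_loss_gradient1 obtain D where D: "D \<ge> 0" "\<And>\<xi> Q Q'. \<xi> \<in> I \<Longrightarrow> Q \<in> Q_box \<Longrightarrow> Q' \<in> Q_box \<Longrightarrow>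
      norm (d1 \<xi> Q - d1 \<xi> Q') \<le> D * norm (Q - Q')"
    by (rule bounded_Lipschitz_familyE) metis
  obtain l where l: "l > 0" "\<And>Q s a. Q \<in> Q_box \<Longrightarrow> l \<le> soft Q $ s $ a" using softmax_lower_bound by blast
  have "norm (term_mean \<xi> Q s a - ratio_mean \<xi> Q Q' s a) \<le> (C + 2 / lam / l * C + D) * norm (Q - Q')"
    if i: "\<xi> \<in> I" "Q \<in> Q_box" and i': "Q' \<in> Q_box" for \<xi> Q Q' s a
  proof -
    let ?r = "soft Q' $ s $ a / soft Q $ s $ a"
    let ?G = "\<lambda>Q. coef \<xi> Q s a *\<^sub>R Adv \<xi> Q s a"
    have pos: "0 < soft Q $ s $ a" by (rule softmax_policy_pos)
    have "\<bar>1 - ?r\<bar> = \<bar>soft Q $ s $ a - soft Q' $ s $ a\<bar> / soft Q $ s $ a"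
      using pos by (simp add: field_simps)
    also have "\<dots> \<le> (2 / lam * norm (Q - Q')) / l"
      by (rule frac_le) (use softmax_entry_Lipschitz[of Q s a Q'] l i lam in auto)
    finally have r: "\<bar>1 - ?r\<bar> \<le> 2 / lam / l * norm (Q - Q')" by simp
    have "term_mean \<xi> Q s a - ratio_mean \<xi> Q Q' s a = (?G Q - ?G Q') + (1 - ?r) *\<^sub>R ?G Q' + (d1 \<xi> Q - d1 \<xi> Q')"
    proof -
      have e: "(?r * coef \<xi> Q' s a) *\<^sub>R Adv \<xi> Q' s a = ?r *\<^sub>R ?G Q'" by (simp only: scaleR_scaleR)
      have ident: "u + v - (w + y) = (u - z) + (z - w) + (v - y)" for u v w y z :: "real^'d" by simp
      show ?thesis
        unfolding term_mean_def ratio_mean_def e scaleR_diff_left[of 1] scaleR_one by (rule ident)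
    qed
    also have "norm \<dots> \<le> C * norm (Q - Q') + (2 / lam / l * norm (Q - Q')) * C + D * norm (Q - Q')"
    proof (rule norm_triangle_le, rule add_mono, rule norm_triangle_le, rule add_mono)
      show "norm (?G Q - ?G Q') \<le> C * norm (Q - Q')"
        using c(3)[OF i i', of "(s, a)"] mult_right_mono[OF cC[of "(s, a)"] norm_ge_zero[of "Q - Q'"]] by simp
      have "norm (?G Q') \<le> C" using c(2)[OF i(1) i', of "(s, a)"] cC[of "(s, a)"] by simp
      then show "norm ((1 - ?r) *\<^sub>R ?G Q') \<le> (2 / lam / l * norm (Q - Q')) * C"
        unfolding norm_scaleR[of "1 - ?r"] using r l lam by (intro mult_mono) auto
      show "norm (d1 \<xi> Q - d1 \<xi> Q') \<le> D * norm (Q - Q')" by (rule D(2)[OF i i'])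
    qed
    also have "\<dots> = (C + 2 / lam / l * C + D) * norm (Q - Q')" by (simp add: algebra_simps)
    finally show ?thesis .
  qed
  moreover have "0 \<le> C + 2 / lam / l * C + D" using C D l lam by simp
  ultimately show ?thesis using that by blast
qed

end

lemma has_moments_bind_pmf_eq:
  assumes "\<And>i. i \<in> set_pmf q \<Longrightarrow> has_moments (measure_pmf (F i)) X (\<mu> i) B"
    and "\<E> q \<mu> = \<mu>'"
  shows "has_moments (bind_pmf q F) X \<mu>' B"
  using has_moments_bind_pmf_const(1)[where q = q and F = F and X = X and \<mu> = \<mu> and B = B, OF assms(1)] assms(2) by simp

lemma has_moments_bind_pmf_finite:
  assumes "finite (set_pmf q)"
    and "\<And>i. i \<in> set_pmf q \<Longrightarrow> has_moments (measure_pmf (F i)) X (\<mu> i) (B i)"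
    and "\<E> q \<mu> = \<mu>'" and "\<E> q B \<le> B'"
  shows "has_moments (bind_pmf q F) X \<mu>' B'"
  using has_moments_mono[OF has_moments_bind_pmf(1)[where q = q and F = F and X = X and \<mu> = \<mu> and B = B, OF assms(2) integrable_measure_pmf_finite[OF assms(1)]] assms(4)]
    assms(3) by simp

lemma has_moments_AE_const:
  assumes "\<And>z. z \<in> set_pmf p \<Longrightarrow> X z = c"
  shows "has_moments (measure_pmf p) X c ((norm c)\<^sup>2)"
proof -
  have "map_pmf X p = map_pmf (\<lambda>_. c) p" by (rule map_pmf_cong) (use assms in auto)
  then have "map_pmf X p = return_pmf c" by simp
  then show ?thesis
    using has_moments_map_pmf[of X p "\<lambda>v. v" c "(norm c)\<^sup>2"] has_moments_return_pmf[of c "\<lambda>v. v"] by simp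
qed

locale learning = context_family M I f X x lam \<gamma> R Kr Kp Kf Sf \<nu>
  for M :: "real^'d \<Rightarrow> 'x \<Rightarrow> ('s::finite, 'a::finite) mdp" and I f X x lam \<gamma> R Kr Kp Kf Sf \<nu> +
  fixes \<pi>\<^sub>B :: "real^'a^'s" and \<alpha> :: "nat \<Rightarrow> real" and s\<^sub>0 :: 's and t :: "nat \<Rightarrow> nat" and Cq :: real
  assumes step_sizes: "\<And>n. 0 \<le> \<alpha> n \<and> \<alpha> n \<le> 1"
    and t_mono: "mono_on {1..} t"
    and Cq: "0 \<le> Cq" "\<And>\<xi> k. \<xi> \<in> I \<Longrightarrow> 1 \<le> k \<Longrightarrow>
      \<E> (soft_q_run lam (M x \<xi>) \<pi>\<^sub>B \<alpha> s\<^sub>0 (t k))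
        (\<lambda>h. (infnorm (q_iterate h (t k) - opt_soft_q lam (M x \<xi>)))\<^sup>2) \<le> Cq * (1/2) ^ k"
begin

abbreviation run where "run \<xi> n \<equiv> soft_q_run lam (M x \<xi>) \<pi>\<^sub>B \<alpha> s\<^sub>0 n"
abbreviation Q_star where "Q_star \<xi> \<equiv> opt_soft_q lam (M x \<xi>)"

lemma q_iterate_in_box:
  assumes \<xi>: "\<xi> \<in> I" and h: "h \<in> set_pmf (run \<xi> n)" and i: "i \<le> n"
  shows "q_iterate h i \<in> Q_box"
proof -
  have "h ! i \<in> set h" using length_soft_q_run[OF h] i by simp
  from soft_q_run_in_entry_ball[OF lam _ _ soft_mdp_family.reward_bound[OF family[OF \<xi>] x] step_sizes h this]
  show ?thesis using \<gamma> by (simp add: Q_box_def q_iterate_def discount[OF \<xi>])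
qed

lemma Q_star_in_box: "\<xi> \<in> I \<Longrightarrow> Q_star \<xi> \<in> Q_box"
  using soft_mdp_family.Q_opt_in_entry_ball[OF family x] soft_mdp_family.Q_radius_def[OF family]
  by (simp add: Q_box_def)

lemma fin_run: "finite (set_pmf (run \<xi> n))" by (rule finite_set_soft_q_run)

lemma int_run: "integrable (run \<xi> n) g" for g :: "_ \<Rightarrow> 'v::{banach, second_countable_topology}"
  by (rule integrable_measure_pmf_finite[OF fin_run])

definition Cn where "Cn = (real DIM(real^'a^'s))\<^sup>2 * Cq"

lemma Cn_nonneg: "0 \<le> Cn" using Cq by (simp add: Cn_def)

lemma iterate_error:
  assumes \<xi>: "\<xi> \<in> I" and k: "1 \<le> k"
  shows "\<E> (run \<xi> (t k)) (\<lambda>h. (norm (q_iterate h (t k) - Q_star \<xi>))\<^sup>2) \<le> Cn * (1/2) ^ k"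
proof -
  let ?D = "real DIM(real^'a^'s)"
  have "\<E> (run \<xi> (t k)) (\<lambda>h. (norm (q_iterate h (t k) - Q_star \<xi>))\<^sup>2)
      \<le> \<E> (run \<xi> (t k)) (\<lambda>h. ?D\<^sup>2 * (infnorm (q_iterate h (t k) - Q_star \<xi>))\<^sup>2)"
    unfolding power_mult_distrib[symmetric]
    by (intro integral_mono int_run power_mono norm_le_DIM_infnorm) simp
  also have "\<dots> = ?D\<^sup>2 * \<E> (run \<xi> (t k)) (\<lambda>h. (infnorm (q_iterate h (t k) - Q_star \<xi>))\<^sup>2)" by simp
  also have "\<dots> \<le> ?D\<^sup>2 * (Cq * (1/2) ^ k)" by (intro mult_left_mono Cq \<xi> k) simp
  finally show ?thesis by (simp add: Cn_def mult.assoc)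
qed

lemma norm_diff_square_le: "(norm (u - v))\<^sup>2 \<le> 2 * (norm u)\<^sup>2 + 2 * (norm v)\<^sup>2" for u v :: "'v::real_inner"
proof -
  have "0 \<le> (norm (u + v))\<^sup>2" by simp
  then show ?thesis by (simp add: power2_norm_eq_inner inner_add_left inner_add_right inner_diff_left inner_diff_right inner_commute)
qed

lemma t_le: "1 \<le> j \<Longrightarrow> j \<le> k \<Longrightarrow> t j \<le> t k"
  using t_mono by (auto simp: mono_on_def)

text \<open>Both iterates are close to the optimal Q-function.\<close>

lemma iterate_increment:
  assumes \<xi>: "\<xi> \<in> I" and k: "1 \<le> k"
  shows "\<E> (run \<xi> (t (k + 1))) (\<lambda>h. (norm (q_iterate h (t (k + 1)) - q_iterate h (t k)))\<^sup>2) \<le> 4 * Cn * (1/2) ^ k"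
proof -
  let ?r = "run \<xi> (t (k + 1))"
  let ?e = "\<lambda>j h. (norm (q_iterate h (t j) - Q_star \<xi>))\<^sup>2"
  have "\<E> ?r (\<lambda>h. (norm (q_iterate h (t (k + 1)) - q_iterate h (t k)))\<^sup>2) \<le> \<E> ?r (\<lambda>h. 2 * ?e (k + 1) h + 2 * ?e k h)"
  proof (intro integral_mono int_run)
    show "(norm (q_iterate h (t (k + 1)) - q_iterate h (t k)))\<^sup>2 \<le> 2 * ?e (k + 1) h + 2 * ?e k h" for h
      using norm_diff_square_le[of "q_iterate h (t (k + 1)) - Q_star \<xi>" "q_iterate h (t k) - Q_star \<xi>"] by simp
  qed
  also have "\<dots> = 2 * \<E> ?r (?e (k + 1)) + 2 * \<E> ?r (?e k)" by (simp add: int_run)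
  also have "\<E> ?r (?e k) = \<E> (run \<xi> (t k)) (?e k)"
    by (rule expectation_q_iterate_prefix[where \<phi> = "\<lambda>Q. (norm (Q - Q_star \<xi>))\<^sup>2"]) (use t_le k in simp)
  also have "2 * \<E> ?r (?e (k + 1)) + 2 * \<E> (run \<xi> (t k)) (?e k) \<le> 2 * (Cn * (1/2) ^ (k + 1)) + 2 * (Cn * (1/2) ^ k)"
    using iterate_error[OF \<xi>, of "k + 1"] iterate_error[OF \<xi> k] by simp
  also have "\<dots> \<le> 4 * Cn * (1/2) ^ k" using Cn_nonneg by simp
  finally show ?thesis .
qed

text \<open>The mean of the vanilla estimator at level \<open>j\<close>, given the context.\<close>

definition \<psi> where "\<psi> \<xi> j = \<E> (run \<xi> (t j)) (\<lambda>h. \<Psi> \<xi> (q_iterate h (t j)))"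

text \<open>The hypergradient is Lipschitz in the Q-function, and the mean error is at most the root of the mean squared error.\<close>

lemma \<psi>_bias:
  obtains C where "C \<ge> 0" "\<And>\<xi> j. \<xi> \<in> I \<Longrightarrow> 1 \<le> j \<Longrightarrow> norm (\<psi> \<xi> j - \<Psi> \<xi> (Q_star \<xi>)) \<le> C * 2 powr (- real j / 2)"
proof -
  from blip_policy_hypergradient obtain C where C: "C \<ge> 0"
    "\<And>\<xi> Q Q'. \<xi> \<in> I \<Longrightarrow> Q \<in> Q_box \<Longrightarrow> Q' \<in> Q_box \<Longrightarrow> norm (\<Psi> \<xi> Q - \<Psi> \<xi> Q') \<le> C * norm (Q - Q')"
    by (rule bounded_Lipschitz_familyE) metis
  have "norm (\<psi> \<xi> j - \<Psi> \<xi> (Q_star \<xi>)) \<le> (C * sqrt Cn) * 2 powr (- real j / 2)" if \<xi>: "\<xi> \<in> I" and j: "1 \<le> j" for \<xi> j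
  proof -
    let ?r = "run \<xi> (t j)"
    have "\<psi> \<xi> j - \<Psi> \<xi> (Q_star \<xi>) = \<E> ?r (\<lambda>h. \<Psi> \<xi> (q_iterate h (t j)) - \<Psi> \<xi> (Q_star \<xi>))"
      by (simp add: \<psi>_def int_run)
    also have "norm \<dots> \<le> \<E> ?r (\<lambda>h. norm (\<Psi> \<xi> (q_iterate h (t j)) - \<Psi> \<xi> (Q_star \<xi>)))"
      by (rule integral_norm_bound)
    also have "\<dots> \<le> \<E> ?r (\<lambda>h. C * norm (q_iterate h (t j) - Q_star \<xi>))"
      by (rule integral_mono_AE)
        (auto simp: AE_measure_pmf_iff int_run intro!: C(2) \<xi> Q_star_in_box q_iterate_in_box[OF \<xi>])
    also have "\<dots> = C * \<E> ?r (\<lambda>h. norm (q_iterate h (t j) - Q_star \<xi>))" by simp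
    also have "\<dots> \<le> C * sqrt (Cn * (1/2) ^ j)"
      by (intro mult_left_mono expectation_norm_le_sqrt fin_run iterate_error \<xi> j C)
    also have "sqrt ((1/2) ^ j :: real) = 2 powr (- real j / 2)"
    proof -
      have "((1/2) ^ j :: real) = 2 powr (- real j)"
        by (simp add: powr_minus powr_realpow power_one_over inverse_eq_divide)
      then show ?thesis by (simp add: powr_half_sqrt[symmetric] powr_powr)
    qed
    then have "C * sqrt (Cn * (1/2) ^ j) = (C * sqrt Cn) * 2 powr (- real j / 2)"
      by (simp add: real_sqrt_mult)
    finally show ?thesis .
  qed
  moreover have "0 \<le> C * sqrt Cn" using C Cn_nonneg by simp
  ultimately show ?thesis using that by blast
qed

abbreviation vanilla where "vanilla \<xi> K \<equiv> vanilla_estimator lam (m \<xi>) (loss \<xi>) x \<pi>\<^sub>B \<alpha> s\<^sub>0 t \<nu> K"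
abbreviation rtq where "rtq \<xi> K \<equiv> rtq_estimator lam (m \<xi>) (loss \<xi>) x \<pi>\<^sub>B \<alpha> s\<^sub>0 t \<nu> K"

lemma vanilla_moments:
  obtains C where "C \<ge> 0" "\<And>\<xi> K. \<xi> \<in> I \<Longrightarrow> has_moments (vanilla \<xi> K) fst (\<psi> \<xi> K) C"
proof -
  obtain C where C: "C \<ge> 0" "\<And>\<xi> Q s a. \<xi> \<in> I \<Longrightarrow> Q \<in> Q_box \<Longrightarrow>
    has_moments (grad_est \<xi> Q s a) (\<lambda>g. hypergradient_term lam \<nu> (loss \<xi>) x (soft Q) s a g) (term_mean \<xi> Q s a) C"
    using has_moments_hypergradient_term by blast
  have "has_moments (vanilla \<xi> K) fst (\<psi> \<xi> K) C" if \<xi>: "\<xi> \<in> I" for \<xi> K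
    unfolding vanilla_estimator_def Let_def map_pmf_def[symmetric]
  proof (rule has_moments_bind_pmf_eq, rule has_moments_bind_pmf_eq, rule has_moments_bind_pmf_eq)
    fix h s a assume h: "h \<in> set_pmf (run \<xi> (t K))"
    show "has_moments (map_pmf (\<lambda>g. (hypergradient_term lam \<nu> (loss \<xi>) x (soft (q_iterate h (t K))) s a g, num_iterations h))
        (grad_est \<xi> (q_iterate h (t K)) s a)) fst (term_mean \<xi> (q_iterate h (t K)) s a) C"
      unfolding has_moments_map_pmf fst_conv by (rule C(2)[OF \<xi> q_iterate_in_box[OF \<xi> h order_refl]])
  next
    show "\<E> (act_pmf (soft (q_iterate h (t K))) s) (term_mean \<xi> (q_iterate h (t K)) s)
        = \<E> (act_pmf (soft (q_iterate h (t K))) s) (term_mean \<xi> (q_iterate h (t K)) s)" for h s ..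
    show "\<E> \<nu> (\<lambda>s. \<E> (act_pmf (soft (q_iterate h (t K))) s) (term_mean \<xi> (q_iterate h (t K)) s)) = \<Psi> \<xi> (q_iterate h (t K))" for h
      by (rule expectation_term_mean)
    show "\<E> (run \<xi> (t K)) (\<lambda>h. \<Psi> \<xi> (q_iterate h (t K))) = \<psi> \<xi> K" unfolding \<psi>_def ..
  qed
  with C(1) show ?thesis by (rule that)
qed

lemma vanilla_iterations: "has_moments (vanilla \<xi> K) (\<lambda>z. real (snd z)) (real (t K)) ((real (t K))\<^sup>2)"
proof -
  have "has_moments (vanilla \<xi> K) (\<lambda>z. real (snd z)) (real (t K)) ((norm (real (t K)))\<^sup>2)"
    by (rule has_moments_AE_const)
      (auto simp: vanilla_estimator_def Let_def num_iterations_def dest: length_soft_q_run)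
  then show ?thesis by simp
qed

text \<open>The randomly truncated estimate for given iterates, state and actions, as a function of the three
independent batches of gradient estimates in \<open>level_samples\<close>.\<close>

definition level_value where
  "level_value \<xi> w Q1 Qc Qn s a a' z = hypergradient_term lam \<nu> (loss \<xi>) x (soft Q1) s a' (snd (snd z))
     + w *\<^sub>R (hypergradient_term lam \<nu> (loss \<xi>) x (soft Qn) s a (average (fst z))
        - (d1 \<xi> Qc + (soft Qc $ s $ a / soft Qn $ s $ a * coef \<xi> Qc s a) *\<^sub>R average (fst (snd z))))"

definition level_samples where
  "level_samples \<xi> k Q1 Qc Qn s a a' = pair_pmf (replicate_pmf (2 ^ k) (grad_est \<xi> Qn s a))
     (pair_pmf (replicate_pmf (2 ^ k) (grad_est \<xi> Qc s a)) (grad_est \<xi> Q1 s a'))"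

text \<open>The difference of the levels splits into the noise of two averages of \<open>2\<^sup>k\<close> samples and the difference of the
means given the state and the action. The first has second moment \<open>O(2\<^sup>-\<^sup>k)\<close>, the second is Lipschitz in the iterates.\<close>

lemma level_moments:
  obtains C D where "C \<ge> 0" "D \<ge> 0" "\<And>\<xi> k w Q1 Qc Qn s a a'. \<xi> \<in> I \<Longrightarrow> Q1 \<in> Q_box \<Longrightarrow> Qc \<in> Q_box \<Longrightarrow> Qn \<in> Q_box \<Longrightarrow>
    has_moments (level_samples \<xi> k Q1 Qc Qn s a a') (level_value \<xi> w Q1 Qc Qn s a a')
      (term_mean \<xi> Q1 s a' + w *\<^sub>R (term_mean \<xi> Qn s a - ratio_mean \<xi> Qn Qc s a))
      (C + D * w\<^sup>2 * ((1/2) ^ k + (norm (Qn - Qc))\<^sup>2))"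
proof -
  obtain Ch where Ch: "Ch \<ge> 0" "\<And>\<xi> Q s a. \<xi> \<in> I \<Longrightarrow> Q \<in> Q_box \<Longrightarrow>
    has_moments (grad_est \<xi> Q s a) (\<lambda>g. hypergradient_term lam \<nu> (loss \<xi>) x (soft Q) s a g) (term_mean \<xi> Q s a) Ch"
    using has_moments_hypergradient_term by blast
  obtain C where C: "C \<ge> 0" "\<And>\<xi> Q s a. \<xi> \<in> I \<Longrightarrow> Q \<in> Q_box \<Longrightarrow>
    has_moments (grad_est \<xi> Q s a) (\<lambda>v. v) (Adv \<xi> Q s a) C"
    using has_moments_gradient_estimator by blast
  obtain c where c: "c \<ge> 0" "\<And>\<xi> Q s a. \<xi> \<in> I \<Longrightarrow> Q \<in> Q_box \<Longrightarrow> \<bar>coef \<xi> Q s a\<bar> \<le> c"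
    using coef_bound by blast
  obtain L where L: "L \<ge> 0" "\<And>\<xi> Q Q' s a. \<xi> \<in> I \<Longrightarrow> Q \<in> Q_box \<Longrightarrow> Q' \<in> Q_box \<Longrightarrow>
    norm (term_mean \<xi> Q s a - ratio_mean \<xi> Q Q' s a) \<le> L * norm (Q - Q')"
    using term_mean_ratio_mean_diff by blast
  obtain l where l: "l > 0" "\<And>Q s a. Q \<in> Q_box \<Longrightarrow> l \<le> soft Q $ s $ a" using softmax_lower_bound by blast
  define D where "D = 16 * (c\<^sup>2 * C + L\<^sup>2 + (c / l)\<^sup>2 * C)"
  have D: "0 \<le> D" using C by (simp add: D_def)
  have main: "has_moments (level_samples \<xi> k Q1 Qc Qn s a a') (level_value \<xi> w Q1 Qc Qn s a a')
      (term_mean \<xi> Q1 s a' + w *\<^sub>R (term_mean \<xi> Qn s a - ratio_mean \<xi> Qn Qc s a))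
      (2 * Ch + D * w\<^sup>2 * ((1/2) ^ k + (norm (Qn - Qc))\<^sup>2))"
    if \<xi>: "\<xi> \<in> I" and Q: "Q1 \<in> Q_box" "Qc \<in> Q_box" "Qn \<in> Q_box" for \<xi> k w Q1 Qc Qn s a a'
  proof -
    let ?J = "level_samples \<xi> k Q1 Qc Qn s a a'"
    let ?D = "term_mean \<xi> Qn s a - ratio_mean \<xi> Qn Qc s a"
    let ?r = "soft Qc $ s $ a / soft Qn $ s $ a * coef \<xi> Qc s a"
    have avg: "has_moments (replicate_pmf (2 ^ k) (grad_est \<xi> Q s a)) (\<lambda>vs. average vs - Adv \<xi> Q s a) 0 (C * (1/2) ^ k)"
      if "Q \<in> Q_box" for Q
      using has_moments_average_replicate_pmf[OF C(2)[OF \<xi> that], of "2 ^ k" s a]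
      by (simp add: power_one_over)
    have cn: "(coef \<xi> Qn s a)\<^sup>2 \<le> c\<^sup>2" using c(2)[OF \<xi> Q(3), of s a] by (simp add: abs_le_square_iff[symmetric] c(1))
    have "\<bar>?r\<bar> \<le> 1 / l * c"
      unfolding abs_mult
    proof (rule mult_mono)
      have "soft Qc $ s $ a / soft Qn $ s $ a \<le> 1 / l"
        by (rule frac_le) (use l Q policy_entry_le_1[OF is_policy_softmax_policy] in auto)
      then show "\<bar>soft Qc $ s $ a / soft Qn $ s $ a\<bar> \<le> 1 / l"
        using softmax_policy_pos[of lam Qc s a] softmax_policy_pos[of lam Qn s a] by simp
    qed (use l c(2)[OF \<xi> Q(2), of s a] in auto)
    then have r: "?r\<^sup>2 \<le> (c / l)\<^sup>2" using c(1) l by (simp add: abs_le_square_iff[symmetric])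
    have ND: "(norm ?D)\<^sup>2 \<le> L\<^sup>2 * (norm (Qn - Qc))\<^sup>2"
      unfolding power_mult_distrib[symmetric] by (rule power_mono[OF L(2)[OF \<xi> Q(3) Q(2)]]) simp
    have 1: "has_moments (measure_pmf ?J) (\<lambda>z. hypergradient_term lam \<nu> (loss \<xi>) x (soft Q1) s a' (snd (snd z))) (term_mean \<xi> Q1 s a') Ch"
      unfolding level_samples_def by (intro has_moments_snd_pair_pmf Ch \<xi> Q)
    have 2: "has_moments (measure_pmf ?J) (\<lambda>z. coef \<xi> Qn s a *\<^sub>R (average (fst z) - Adv \<xi> Qn s a) + ?D)
        (coef \<xi> Qn s a *\<^sub>R 0 + ?D) (2 * (coef \<xi> Qn s a)\<^sup>2 * (C * (1/2) ^ k) + 2 * (norm ?D)\<^sup>2)"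
      unfolding level_samples_def by (intro has_moments_affine_le has_moments_fst_pair_pmf avg Q)
    have 3: "has_moments (measure_pmf ?J) (\<lambda>z. (- ?r) *\<^sub>R (average (fst (snd z)) - Adv \<xi> Qc s a) + 0)
        ((- ?r) *\<^sub>R 0 + 0) (2 * (- ?r)\<^sup>2 * (C * (1/2) ^ k) + 2 * (norm (0 :: real^'d))\<^sup>2)"
      unfolding level_samples_def
      by (intro has_moments_affine_le has_moments_snd_pair_pmf has_moments_fst_pair_pmf avg Q)
    note 4 = has_moments_affine_le[OF has_moments_add[OF 2 3], of w 0]
    note 5 = has_moments_add[OF 1 4]
    have val: "level_value \<xi> w Q1 Qc Qn s a a' = (\<lambda>z. hypergradient_term lam \<nu> (loss \<xi>) x (soft Q1) s a' (snd (snd z)) +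
        (w *\<^sub>R (coef \<xi> Qn s a *\<^sub>R (average (fst z) - Adv \<xi> Qn s a) + ?D
          + ((- ?r) *\<^sub>R (average (fst (snd z)) - Adv \<xi> Qc s a) + 0)) + 0))"
    proof
      fix z
      have ident: "d + cn *\<^sub>R u - (e + r *\<^sub>R v) = cn *\<^sub>R (u - A) + (cn *\<^sub>R A + d - (r *\<^sub>R B + e)) + (- r) *\<^sub>R (v - B)"
        for u v d e A B :: "real^'d" and cn r :: real
        by (simp add: scaleR_diff_right)
      show "level_value \<xi> w Q1 Qc Qn s a a' z = hypergradient_term lam \<nu> (loss \<xi>) x (soft Q1) s a' (snd (snd z)) +
        (w *\<^sub>R (coef \<xi> Qn s a *\<^sub>R (average (fst z) - Adv \<xi> Qn s a) + ?D
          + ((- ?r) *\<^sub>R (average (fst (snd z)) - Adv \<xi> Qc s a) + 0)) + 0)"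
        unfolding level_value_def term_mean_def ratio_mean_def add_0_right
          hypergradient_term_def[of _ _ _ _ "soft Qn"] ident[of _ _ _ _ _ _ "Adv \<xi> Qn s a" "Adv \<xi> Qc s a"] ..
    qed
    have mean: "term_mean \<xi> Q1 s a' + w *\<^sub>R ?D = term_mean \<xi> Q1 s a' + (w *\<^sub>R ((coef \<xi> Qn s a *\<^sub>R 0 + ?D) + ((- ?r) *\<^sub>R 0 + 0)) + 0)"
      by simp
    show ?thesis
      unfolding val mean
    proof (rule has_moments_mono[OF 5])
      let ?p = "(1/2) ^ k :: real" and ?n = "(norm (Qn - Qc))\<^sup>2"
      have scale: "2 * Ch + 2 * (2 * w\<^sup>2 * u + 2 * (norm (0 :: real^'d))\<^sup>2) \<le> 2 * Ch + 16 * v * w\<^sup>2 * (p + n)"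
        if "w\<^sup>2 * u \<le> w\<^sup>2 * (4 * v * (p + n))" for u v p n :: real
        using that by (simp add: algebra_simps)
      have "2 * (2 * (coef \<xi> Qn s a)\<^sup>2 * (C * ?p) + 2 * (norm ?D)\<^sup>2) + 2 * (2 * (- ?r)\<^sup>2 * (C * ?p) + 2 * (norm (0 :: real^'d))\<^sup>2)
          \<le> 2 * (2 * c\<^sup>2 * (C * ?p) + 2 * (L\<^sup>2 * ?n)) + 2 * (2 * (c / l)\<^sup>2 * (C * ?p) + 2 * (norm (0 :: real^'d))\<^sup>2)"
        unfolding power2_minus
        by (intro add_mono mult_left_mono mult_right_mono cn r ND order_refl) (use C in auto)
      also have "\<dots> \<le> 4 * (c\<^sup>2 * C + L\<^sup>2 + (c / l)\<^sup>2 * C) * (?p + ?n)"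
      proof -
        have "0 \<le> c\<^sup>2 * C * ?n" "0 \<le> L\<^sup>2 * ?p" "0 \<le> (c / l)\<^sup>2 * C * ?n" using C by simp_all
        then show ?thesis by (simp add: algebra_simps)
      qed
      finally have "w\<^sup>2 * (2 * (2 * (coef \<xi> Qn s a)\<^sup>2 * (C * ?p) + 2 * (norm ?D)\<^sup>2) + 2 * (2 * (- ?r)\<^sup>2 * (C * ?p) + 2 * (norm (0 :: real^'d))\<^sup>2))
          \<le> w\<^sup>2 * (4 * (c\<^sup>2 * C + L\<^sup>2 + (c / l)\<^sup>2 * C) * (?p + ?n))"
        by (rule mult_left_mono) simp
      then show "2 * Ch + 2 * (2 * w\<^sup>2 * (2 * (2 * (coef \<xi> Qn s a)\<^sup>2 * (C * ?p) + 2 * (norm ?D)\<^sup>2)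
          + 2 * (2 * (- ?r)\<^sup>2 * (C * ?p) + 2 * (norm (0 :: real^'d))\<^sup>2)) + 2 * (norm (0 :: real^'d))\<^sup>2)
          \<le> 2 * Ch + D * w\<^sup>2 * (?p + ?n)"
        unfolding D_def by (rule scale)
    qed
  qed
  have "0 \<le> 2 * Ch" using Ch by simp
  then show ?thesis by (rule that[OF _ D main])
qed

definition sampled_level where
  "sampled_level \<xi> w k Q1 Qc Qn n = bind_pmf \<nu> (\<lambda>s. bind_pmf (act_pmf (soft Qn) s) (\<lambda>a. bind_pmf (act_pmf (soft Q1) s) (\<lambda>a'.
     map_pmf (\<lambda>z. (level_value \<xi> w Q1 Qc Qn s a a' z, n :: nat)) (level_samples \<xi> k Q1 Qc Qn s a a'))))"

definition level_estimator where
  "level_estimator \<xi> K k = bind_pmf (run \<xi> (t (k + 1))) (\<lambda>h. sampled_level \<xi> (1 / level_prob K k) k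
     (q_iterate h (t 1)) (q_iterate h (t k)) (q_iterate h (t (k + 1))) (num_iterations h))"

lemma rtq_estimator_eq: "rtq \<xi> K = bind_pmf (level_pmf K) (level_estimator \<xi> K)"
  unfolding rtq_estimator_def level_estimator_def [abs_def] sampled_level_def Let_def level_samples_def level_value_def
    pair_pmf_def map_pmf_def bind_assoc_pmf bind_return_pmf fst_conv snd_conv mult.assoc ..

lemma sampled_level_moments:
  obtains C D where "C \<ge> 0" "D \<ge> 0" "\<And>\<xi> w k Q1 Qc Qn n. \<xi> \<in> I \<Longrightarrow> Q1 \<in> Q_box \<Longrightarrow> Qc \<in> Q_box \<Longrightarrow> Qn \<in> Q_box \<Longrightarrow>
    has_moments (sampled_level \<xi> w k Q1 Qc Qn n) fst (\<Psi> \<xi> Q1 + w *\<^sub>R (\<Psi> \<xi> Qn - \<Psi> \<xi> Qc))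
      (C + D * w\<^sup>2 * ((1/2) ^ k + (norm (Qn - Qc))\<^sup>2))"
proof -
  obtain C D where C: "C \<ge> 0" and D: "D \<ge> 0"
    and hm: "\<And>\<xi> k w Q1 Qc Qn s a a'. \<xi> \<in> I \<Longrightarrow> Q1 \<in> Q_box \<Longrightarrow> Qc \<in> Q_box \<Longrightarrow> Qn \<in> Q_box \<Longrightarrow>
    has_moments (level_samples \<xi> k Q1 Qc Qn s a a') (level_value \<xi> w Q1 Qc Qn s a a')
      (term_mean \<xi> Q1 s a' + w *\<^sub>R (term_mean \<xi> Qn s a - ratio_mean \<xi> Qn Qc s a))
      (C + D * w\<^sup>2 * ((1/2) ^ k + (norm (Qn - Qc))\<^sup>2))"
    using level_moments by metis
  have fin: "integrable (measure_pmf p) g" for p :: "'i::finite pmf" and g :: "'i \<Rightarrow> real^'d"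
    by (rule integrable_measure_pmf_finite) simp
  have "has_moments (sampled_level \<xi> w k Q1 Qc Qn n) fst (\<Psi> \<xi> Q1 + w *\<^sub>R (\<Psi> \<xi> Qn - \<Psi> \<xi> Qc))
      (C + D * w\<^sup>2 * ((1/2) ^ k + (norm (Qn - Qc))\<^sup>2))"
    if "\<xi> \<in> I" "Q1 \<in> Q_box" "Qc \<in> Q_box" "Qn \<in> Q_box" for \<xi> w k Q1 Qc Qn n
    unfolding sampled_level_def
  proof (rule has_moments_bind_pmf_eq, rule has_moments_bind_pmf_eq, rule has_moments_bind_pmf_eq)
    show "has_moments (map_pmf (\<lambda>z. (level_value \<xi> w Q1 Qc Qn s a a' z, n)) (level_samples \<xi> k Q1 Qc Qn s a a'))
        fst (term_mean \<xi> Q1 s a' + w *\<^sub>R (term_mean \<xi> Qn s a - ratio_mean \<xi> Qn Qc s a)) (C + D * w\<^sup>2 * ((1/2) ^ k + (norm (Qn - Qc))\<^sup>2))"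
      for s a a'
      unfolding has_moments_map_pmf fst_conv by (rule hm[OF that])
    show "\<E> (act_pmf (soft Q1) s) (\<lambda>a'. term_mean \<xi> Q1 s a' + w *\<^sub>R (term_mean \<xi> Qn s a - ratio_mean \<xi> Qn Qc s a))
        = \<E> (act_pmf (soft Q1) s) (term_mean \<xi> Q1 s) + w *\<^sub>R (term_mean \<xi> Qn s a - ratio_mean \<xi> Qn Qc s a)" for s a
      by (simp add: fin)
    show "\<E> (act_pmf (soft Qn) s) (\<lambda>a. \<E> (act_pmf (soft Q1) s) (term_mean \<xi> Q1 s) + w *\<^sub>R (term_mean \<xi> Qn s a - ratio_mean \<xi> Qn Qc s a))
        = \<E> (act_pmf (soft Q1) s) (term_mean \<xi> Q1 s) + w *\<^sub>R (\<E> (act_pmf (soft Qn) s) (term_mean \<xi> Qn s) - \<E> (act_pmf (soft Qc) s) (term_mean \<xi> Qc s))" for s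
      unfolding expectation_ratio_mean[where Q = Qn and Q' = Qc, symmetric] by (simp add: fin)
    show "\<E> \<nu> (\<lambda>s. \<E> (act_pmf (soft Q1) s) (term_mean \<xi> Q1 s) + w *\<^sub>R (\<E> (act_pmf (soft Qn) s) (term_mean \<xi> Qn s) - \<E> (act_pmf (soft Qc) s) (term_mean \<xi> Qc s)))
        = \<Psi> \<xi> Q1 + w *\<^sub>R (\<Psi> \<xi> Qn - \<Psi> \<xi> Qc)"
      unfolding expectation_term_mean[symmetric] by (simp add: fin)
  qed
  with C D show ?thesis by (rule that)
qed

lemma level_estimator_moments:
  obtains C D where "C \<ge> 0" "D \<ge> 0" "\<And>\<xi> K k. \<xi> \<in> I \<Longrightarrow> 1 \<le> k \<Longrightarrow>
    has_moments (level_estimator \<xi> K k) fst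
      (\<psi> \<xi> 1 + (1 / level_prob K k) *\<^sub>R (\<psi> \<xi> (k + 1) - \<psi> \<xi> k)) (C + D * (1 / level_prob K k)\<^sup>2 * (1/2) ^ k)"
proof -
  obtain C D where C: "C \<ge> 0" and D: "D \<ge> 0"
    and hm: "\<And>\<xi> w k Q1 Qc Qn n. \<xi> \<in> I \<Longrightarrow> Q1 \<in> Q_box \<Longrightarrow> Qc \<in> Q_box \<Longrightarrow> Qn \<in> Q_box \<Longrightarrow>
    has_moments (sampled_level \<xi> w k Q1 Qc Qn n) fst (\<Psi> \<xi> Q1 + w *\<^sub>R (\<Psi> \<xi> Qn - \<Psi> \<xi> Qc))
      (C + D * w\<^sup>2 * ((1/2) ^ k + (norm (Qn - Qc))\<^sup>2))"
    using sampled_level_moments by metis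
  define D' where "D' = D * (1 + 4 * Cn)"
  have D': "0 \<le> D'" using D Cn_nonneg by (simp add: D'_def)
  have "has_moments (level_estimator \<xi> K k) fst
      (\<psi> \<xi> 1 + (1 / level_prob K k) *\<^sub>R (\<psi> \<xi> (k + 1) - \<psi> \<xi> k)) (C + D' * (1 / level_prob K k)\<^sup>2 * (1/2) ^ k)"
    if \<xi>: "\<xi> \<in> I" and k: "1 \<le> k" for \<xi> K k
  proof -
    define w where "w = 1 / level_prob K k"
    let ?r = "run \<xi> (t (k + 1))"
    let ?d = "\<lambda>h. (norm (q_iterate h (t (k + 1)) - q_iterate h (t k)))\<^sup>2"
    show ?thesis
      unfolding level_estimator_def w_def[symmetric]
    proof (rule has_moments_bind_pmf_finite[OF fin_run hm])
      fix h assume h: "h \<in> set_pmf ?r"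
      show "q_iterate h (t 1) \<in> Q_box" "q_iterate h (t k) \<in> Q_box" "q_iterate h (t (k + 1)) \<in> Q_box"
        by (rule q_iterate_in_box[OF \<xi> h], rule t_le, use k in simp_all)+
    next
      have pre: "\<E> ?r (\<lambda>h. \<Psi> \<xi> (q_iterate h (t j))) = \<psi> \<xi> j" if "1 \<le> j" "j \<le> k + 1" for j
        unfolding \<psi>_def by (rule expectation_q_iterate_prefix) (use t_le that in simp)
      show "\<E> ?r (\<lambda>h. \<Psi> \<xi> (q_iterate h (t 1)) + w *\<^sub>R (\<Psi> \<xi> (q_iterate h (t (k + 1))) - \<Psi> \<xi> (q_iterate h (t k))))
          = \<psi> \<xi> 1 + w *\<^sub>R (\<psi> \<xi> (k + 1) - \<psi> \<xi> k)"
        using k pre[of 1] pre[of k] pre[of "k + 1"] by (simp add: int_run)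
      have "\<E> ?r (\<lambda>h. C + D * w\<^sup>2 * ((1/2) ^ k + ?d h)) = C + D * w\<^sup>2 * ((1/2) ^ k + \<E> ?r ?d)"
        by (simp add: int_run)
      also have "\<dots> \<le> C + D * w\<^sup>2 * ((1/2) ^ k + 4 * Cn * (1/2) ^ k)"
        using iterate_increment[OF \<xi> k] D by (intro add_left_mono mult_left_mono) auto
      also have "\<dots> = C + D' * w\<^sup>2 * (1/2) ^ k" by (simp add: D'_def algebra_simps)
      finally show "\<E> ?r (\<lambda>h. C + D * w\<^sup>2 * ((1/2) ^ k + ?d h)) \<le> C + D' * w\<^sup>2 * (1/2) ^ k" .
    qed (rule \<xi>)
  qed
  with C D' show ?thesis by (rule that)
qed

lemma set_level_pmf: "1 \<le> K \<Longrightarrow> set_pmf (level_pmf K) \<subseteq> {1..K}"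
  by (auto simp: set_pmf_eq pmf_level_pmf level_prob_def split: if_splits)

lemma expectation_level_pmf:
  fixes g :: "nat \<Rightarrow> 'v::{banach, second_countable_topology}"
  assumes "1 \<le> K"
  shows "\<E> (level_pmf K) g = (\<Sum>k=1..K. level_prob K k *\<^sub>R g k)"
  by (subst integral_measure_pmf[of "{1..K}"]) (use set_level_pmf[OF assms] in \<open>auto simp: pmf_level_pmf[OF assms]\<close>)

lemma level_prob_pos: "1 \<le> k \<Longrightarrow> k \<le> K \<Longrightarrow> 0 < level_prob K k"
  by (simp add: level_prob_def power_less_one_iff)

lemma sum_level_prob: "1 \<le> K \<Longrightarrow> (\<Sum>k=1..K. level_prob K k) = 1"
  using expectation_level_pmf[of K "\<lambda>_. 1 :: real"] by simp

text \<open>The probability of a level cancels its weight in the mean, and the differences telescope. In the second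
moment one factor \<open>1 / p\<^sub>k\<close> remains and meets \<open>2\<^sup>-\<^sup>k\<close>, so that each level contributes a constant.\<close>

lemma rtq_moments:
  obtains C D where "C \<ge> 0" "D \<ge> 0" "\<And>\<xi> K. \<xi> \<in> I \<Longrightarrow> 1 \<le> K \<Longrightarrow>
    has_moments (rtq \<xi> K) fst (\<psi> \<xi> (K + 1)) (C + D * real K)"
proof -
  obtain C D where C: "C \<ge> 0" and D: "D \<ge> 0" and hm: "\<And>\<xi> K k. \<xi> \<in> I \<Longrightarrow> 1 \<le> k \<Longrightarrow>
    has_moments (level_estimator \<xi> K k) fst
      (\<psi> \<xi> 1 + (1 / level_prob K k) *\<^sub>R (\<psi> \<xi> (k + 1) - \<psi> \<xi> k)) (C + D * (1 / level_prob K k)\<^sup>2 * (1/2) ^ k)"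
    using level_estimator_moments by metis
  have "has_moments (rtq \<xi> K) fst (\<psi> \<xi> (K + 1)) (C + D * real K)" if \<xi>: "\<xi> \<in> I" and K: "1 \<le> K" for \<xi> K
    unfolding rtq_estimator_eq
  proof (rule has_moments_bind_pmf_finite[OF _ hm[OF \<xi>]])
    show "finite (set_pmf (level_pmf K))" by (rule finite_subset[OF set_level_pmf[OF K]]) simp
    show "1 \<le> k" if "k \<in> set_pmf (level_pmf K)" for k using set_level_pmf[OF K] that by auto
    have "(\<Sum>k=1..K. level_prob K k *\<^sub>R (\<psi> \<xi> 1 + (1 / level_prob K k) *\<^sub>R (\<psi> \<xi> (k + 1) - \<psi> \<xi> k)))
        = (\<Sum>k=1..K. level_prob K k *\<^sub>R \<psi> \<xi> 1 + (\<psi> \<xi> (k + 1) - \<psi> \<xi> k))"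
    proof (rule sum.cong[OF refl])
      fix k assume "k \<in> {1..K}"
      then have "level_prob K k \<noteq> 0" using level_prob_pos[of k K] by auto
      then show "level_prob K k *\<^sub>R (\<psi> \<xi> 1 + (1 / level_prob K k) *\<^sub>R (\<psi> \<xi> (k + 1) - \<psi> \<xi> k))
          = level_prob K k *\<^sub>R \<psi> \<xi> 1 + (\<psi> \<xi> (k + 1) - \<psi> \<xi> k)" by (simp add: scaleR_add_right)
    qed
    also have "\<dots> = (\<Sum>k=1..K. level_prob K k) *\<^sub>R \<psi> \<xi> 1 + (\<psi> \<xi> (K + 1) - \<psi> \<xi> 1)"
      using sum_Suc_diff[of 1 K "\<psi> \<xi>"] by (simp add: sum.distrib scaleR_sum_left)
    finally show "\<E> (level_pmf K) (\<lambda>k. \<psi> \<xi> 1 + (1 / level_prob K k) *\<^sub>R (\<psi> \<xi> (k + 1) - \<psi> \<xi> k)) = \<psi> \<xi> (K + 1)"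
      unfolding expectation_level_pmf[OF K] sum_level_prob[OF K] by simp
    have "(\<Sum>k=1..K. level_prob K k *\<^sub>R (C + D * (1 / level_prob K k)\<^sup>2 * (1/2) ^ k))
        \<le> (\<Sum>k=1..K. level_prob K k * C + D)"
    proof (rule sum_mono)
      fix k assume "k \<in> {1..K}"
      then have k: "1 \<le> k" "k \<le> K" by auto
      have p: "(1/2) ^ K < (1::real)" using K by (simp add: power_less_one_iff)
      have "level_prob K k * (D * (1 / level_prob K k)\<^sup>2 * (1/2) ^ k) = D * ((1/2) ^ k / level_prob K k)"
        using level_prob_pos[OF k] by (simp add: power2_eq_square)
      also have "(1/2) ^ k / level_prob K k = 1 - (1/2) ^ K"
        using k p by (simp add: level_prob_def)
      also have "D * (1 - (1/2) ^ K) \<le> D" using D by (simp add: mult_left_le)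
      finally show "level_prob K k *\<^sub>R (C + D * (1 / level_prob K k)\<^sup>2 * (1/2) ^ k) \<le> level_prob K k * C + D"
        by (simp add: distrib_left)
    qed
    also have "\<dots> = C + D * real K"
      using sum_level_prob[OF K] by (simp add: sum.distrib flip: sum_distrib_right)
    finally show "\<E> (level_pmf K) (\<lambda>k. C + D * (1 / level_prob K k)\<^sup>2 * (1/2) ^ k) \<le> C + D * real K"
      unfolding expectation_level_pmf[OF K] .
  qed
  with C D show ?thesis by (rule that)
qed

lemma rtq_iterations:
  assumes K: "1 \<le> K"
  shows "has_moments (rtq \<xi> K) (\<lambda>z. real (snd z))
    (\<Sum>k=1..K. level_prob K k * real (t (k + 1))) (\<Sum>k=1..K. level_prob K k * (real (t (k + 1)))\<^sup>2)"
  unfolding rtq_estimator_eq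
proof (rule has_moments_bind_pmf_finite)
  show "finite (set_pmf (level_pmf K))" by (rule finite_subset[OF set_level_pmf[OF K]]) simp
  show "has_moments (level_estimator \<xi> K k) (\<lambda>z. real (snd z)) (real (t (k + 1))) ((norm (real (t (k + 1))))\<^sup>2)" for k
    by (rule has_moments_AE_const)
      (auto simp: level_estimator_def sampled_level_def num_iterations_def simp del: soft_q_run.simps dest!: length_soft_q_run)
qed (simp_all add: expectation_level_pmf[OF K])

end

section \<open>Measurability in the context\<close>

lemma borel_measurable_entry:
  fixes q :: "'x \<Rightarrow> real^'a::finite^'s::finite"
  assumes "q \<in> borel_measurable N"
  shows "(\<lambda>\<xi>. q \<xi> $ s $ a) \<in> borel_measurable N"
  by (rule measurable_compose[OF assms]) (intro borel_measurable_continuous_onI continuous_intros)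

lemma borel_measurable_array:
  fixes q :: "'x \<Rightarrow> real^'a::finite^'s::finite"
  assumes "\<And>s a. (\<lambda>\<xi>. q \<xi> $ s $ a) \<in> borel_measurable N"
  shows "q \<in> borel_measurable N"
proof (rule borel_measurable_euclidean_space[THEN iffD2], rule ballI)
  fix i :: "real^'a^'s" assume "i \<in> Basis"
  then obtain s a where "i = axis s (axis a 1)" by (auto simp: Basis_vec_def)
  then show "(\<lambda>\<xi>. q \<xi> \<bullet> i) \<in> borel_measurable N"
    using assms[of s a] by (simp add: inner_axis)
qed

lemma measurable_family_bind_const:
  assumes "measurable_family N (range (\<lambda>c \<xi>. c)) E" and "\<And>c. measurable_family N H (\<lambda>\<xi>. F \<xi> c)"
  shows "measurable_family N H (\<lambda>\<xi>. bind_pmf (E \<xi>) (F \<xi>))"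
  by (rule measurable_family_bind[OF assms(1)]) (use assms(2) in auto)

lemma measurable_family_return_const: "measurable_family N (range (\<lambda>c \<xi>. c)) (\<lambda>\<xi>. return_pmf c)"
  by (rule measurable_family_return) blast

lemma measurable_family_act_pmf:
  fixes \<pi> :: "'x \<Rightarrow> real^'a::finite^'s::finite"
  assumes \<pi>: "\<pi> \<in> borel_measurable N" "\<And>\<xi>. \<xi> \<in> space N \<Longrightarrow> is_policy (\<pi> \<xi>)"
  shows "measurable_family N (range (\<lambda>c \<xi>. c)) (\<lambda>\<xi>. act_pmf (\<pi> \<xi>) s)"
proof (rule measurable_family_countable)
  fix a
  show "(\<lambda>\<xi>. pmf (act_pmf (\<pi> \<xi>) s) a) \<in> borel_measurable N"
    using borel_measurable_entry[OF \<pi>(1), of s a] by (subst measurable_cong[OF pmf_act_pmf[OF \<pi>(2)]])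
qed

text \<open>Trajectories only use transitions of positive probability, and there the score is the quotient of two
measurable functions of the context.\<close>

lemma pmf_kernel_trajectory_pos:
  "\<tau> \<in> set_pmf (trajectory m \<pi> n z) \<Longrightarrow> i < n \<Longrightarrow> pmf (kernel m (fst (\<tau> ! i)) (snd (\<tau> ! i))) (fst (\<tau> ! Suc i)) > 0"
proof (induction n arbitrary: z \<tau> i)
  case (Suc n)
  from Suc.prems(1) obtain z' \<tau>' where z': "z' \<in> set_pmf (sa_step m \<pi> z)"
    and \<tau>': "\<tau>' \<in> set_pmf (trajectory m \<pi> n z')" and \<tau>: "\<tau> = z # \<tau>'" by auto
  obtain \<tau>'' where \<tau>'': "\<tau>' = z' # \<tau>''" using trajectory_Cons[OF \<tau>'] by blast
  show ?case
  proof (cases i)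
    case 0
    have "fst z' \<in> set_pmf (kernel m (fst z) (snd z))" using z' by (auto simp: sa_step_def)
    then show ?thesis unfolding \<tau> \<tau>'' 0 by (simp add: pmf_positive)
  next
    case (Suc j)
    then show ?thesis using Suc.IH[OF \<tau>', of j] Suc.prems(2) unfolding \<tau> by simp
  qed
qed simp

lemma borel_measurable_sum_list:
  fixes hs :: "('x \<Rightarrow> 'v::euclidean_space) list"
  assumes "set hs \<subseteq> borel_measurable N"
  shows "(\<lambda>\<xi>. sum_list (map (\<lambda>h. h \<xi>) hs)) \<in> borel_measurable N"
  using assms by (induction hs) auto

locale measurable_learning = learning M "space \<Xi>" f X x lam \<gamma> R Kr Kp Kf Sf \<nu> \<pi>\<^sub>B \<alpha> s\<^sub>0 t Cq
  for M :: "real^'d \<Rightarrow> 'x \<Rightarrow> ('s::finite, 'a::finite) mdp" and \<Xi> :: "'x measure" and f X x lam \<gamma> R Kr Kp Kf Sf \<nu> \<pi>\<^sub>B \<alpha> s\<^sub>0 t Cq +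
  fixes U :: "(real^'a^'s) set"
  assumes prob: "prob_space \<Xi>"
    and open_U: "open U" and policies_U: "\<And>\<pi>. is_policy \<pi> \<Longrightarrow> \<pi> \<in> U"
    and reward_measurable: "\<And>y s a. y \<in> X \<Longrightarrow> (\<lambda>\<xi>. reward (M y \<xi>) s a) \<in> borel_measurable \<Xi>"
    and kernel_measurable: "\<And>y s a s'. y \<in> X \<Longrightarrow> (\<lambda>\<xi>. pmf (kernel (M y \<xi>) s a) s') \<in> borel_measurable \<Xi>"
    and loss_measurable: "\<And>y \<pi>. y \<in> X \<Longrightarrow> \<pi> \<in> U \<Longrightarrow> f y \<pi> \<in> borel_measurable \<Xi>"
    and loss_differentiable1: "\<And>\<xi> \<pi>. \<xi> \<in> space \<Xi> \<Longrightarrow> \<pi> \<in> U \<Longrightarrow> (\<lambda>y. f y \<pi> \<xi>) differentiable (at x)"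
    and loss_differentiable2: "\<And>\<xi> \<pi>. \<xi> \<in> space \<Xi> \<Longrightarrow> \<pi> \<in> U \<Longrightarrow> (\<lambda>p. f x p \<xi>) differentiable (at \<pi>)"
    and continuous_loss_gradient1: "\<And>\<xi>. \<xi> \<in> space \<Xi> \<Longrightarrow> continuous_on U (\<lambda>\<pi>. gradient (\<lambda>y. f y \<pi> \<xi>) x)"
    and continuous_loss_gradient2: "\<And>\<xi>. \<xi> \<in> space \<Xi> \<Longrightarrow> continuous_on U (\<lambda>\<pi>. gradient (\<lambda>p. f x p \<xi>) \<pi>)"
    and policy_B: "is_policy \<pi>\<^sub>B"
begin

lemma open_X: "open X"
  using prob_space.not_empty[OF prob] soft_mdp_family.open_X[OF family] by blast

abbreviation meas where "meas \<equiv> borel_measurable \<Xi>"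
abbreviation consts_fam where "consts_fam \<equiv> measurable_family \<Xi> (range (\<lambda>c \<xi>. c))"

lemma softmax_measurable: "q \<in> meas \<Longrightarrow> (\<lambda>\<xi>. soft (q \<xi>)) \<in> meas"
proof (rule borel_measurable_array)
  fix s a assume q: "q \<in> meas"
  note [measurable] = borel_measurable_entry[OF q]
  show "(\<lambda>\<xi>. soft (q \<xi>) $ s $ a) \<in> meas"
    unfolding softmax_policy_def vec_lambda_beta by measurable
qed

lemma loss_gradient1_measurable:
  assumes \<pi>: "\<pi> \<in> meas" "\<And>\<xi>. is_policy (\<pi> \<xi>)"
  shows "(\<lambda>\<xi>. gradient (\<lambda>y. f y (\<pi> \<xi>) \<xi>) x) \<in> meas"
proof (rule borel_measurable_Caratheodory[where \<phi> = "\<lambda>p \<xi>. gradient (\<lambda>y. f y p \<xi>) x", OF open_U _ continuous_loss_gradient1 \<pi>(1)])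
  show "(\<lambda>\<xi>. gradient (\<lambda>y. f y p \<xi>) x) \<in> meas" if "p \<in> U" for p
    by (rule borel_measurable_gradient[OF open_X x]) (use loss_measurable loss_differentiable1 that in auto)
qed (use policies_U \<pi> in auto)

lemma loss_gradient2_measurable:
  assumes \<pi>: "\<pi> \<in> meas" "\<And>\<xi>. is_policy (\<pi> \<xi>)"
  shows "(\<lambda>\<xi>. gradient (\<lambda>p. f x p \<xi>) (\<pi> \<xi>)) \<in> meas"
proof (rule borel_measurable_Caratheodory[where \<phi> = "\<lambda>\<pi> \<xi>. gradient (\<lambda>p. f x p \<xi>) \<pi>", OF open_U _ continuous_loss_gradient2 \<pi>(1)])
  show "(\<lambda>\<xi>. gradient (\<lambda>p. f x p \<xi>) \<pi>) \<in> meas" if "\<pi> \<in> U" for \<pi>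
    by (rule borel_measurable_gradient[OF open_U that]) (use loss_measurable[OF x] loss_differentiable2 that in auto)
qed (use policies_U \<pi> in auto)

lemma reward_gradient_measurable: "(\<lambda>\<xi>. reward_gradient (m \<xi>) x z) \<in> meas"
  unfolding reward_gradient_def
  by (rule borel_measurable_gradient[OF open_X x])
    (use reward_measurable soft_mdp_family.reward_differentiable[OF family x] in auto)

lemma kernel_gradient_measurable: "(\<lambda>\<xi>. kernel_gradient (m \<xi>) x z s') \<in> meas"
  unfolding kernel_gradient_def
  by (rule borel_measurable_gradient[OF open_X x])
    (use kernel_measurable soft_mdp_family.kernel_differentiable[OF family x] in auto)

lemma kernel_family: "consts_fam (\<lambda>\<xi>. kernel (M x \<xi>) s a)"
  by (rule measurable_family_countable[OF kernel_measurable[OF x]])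

lemma act_family: "\<pi> \<in> meas \<Longrightarrow> (\<And>\<xi>. is_policy (\<pi> \<xi>)) \<Longrightarrow> consts_fam (\<lambda>\<xi>. act_pmf (\<pi> \<xi>) s)"
  by (rule measurable_family_act_pmf)

lemma trajectory_family:
  assumes \<pi>: "\<pi> \<in> meas" "\<And>\<xi>. is_policy (\<pi> \<xi>)"
  shows "consts_fam (\<lambda>\<xi>. trajectory (M x \<xi>) (\<pi> \<xi>) n z)"
proof (induction n arbitrary: z)
  case 0
  show ?case by (simp add: measurable_family_return_const)
next
  case (Suc n)
  have step: "consts_fam (\<lambda>\<xi>. sa_step (M x \<xi>) (\<pi> \<xi>) z)"
    unfolding sa_step_def
    by (rule measurable_family_bind_const[OF kernel_family], rule measurable_family_bind_const[OF act_family[OF \<pi>]],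
        rule measurable_family_return_const)
  show ?case
    unfolding trajectory.simps
    by (rule measurable_family_bind_const[OF step], rule measurable_family_bind_const[OF Suc.IH],
        rule measurable_family_return_const)
qed

lemma dQ_family:
  assumes \<pi>: "\<pi> \<in> meas" "\<And>\<xi>. is_policy (\<pi> \<xi>)"
  shows "measurable_family \<Xi> meas (\<lambda>\<xi>. dQ_estimator lam (m \<xi>) x (\<pi> \<xi>) s a)"
proof -
  let ?p = "\<lambda>\<xi> z s'. pmf (kernel (M x \<xi>) (fst z) (snd z)) s'"
  define V where "V \<xi> T T' \<tau> = (\<Sum>t=0..T. reward_gradient (m \<xi>) x (\<tau> ! t))
     + (\<gamma> / (1 - \<gamma>) * weighted_return (\<gamma> powr (1/2)) (soft_reward lam (M x \<xi>) (\<pi> \<xi>)) T' (drop (Suc T) \<tau>))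
       *\<^sub>R ((1 / ?p \<xi> (\<tau> ! T) (fst (\<tau> ! Suc T))) *\<^sub>R kernel_gradient (m \<xi>) x (\<tau> ! T) (fst (\<tau> ! Suc T)))" for \<xi> T T' \<tau>
  have Vm: "(\<lambda>\<xi>. V \<xi> T T' \<tau>) \<in> meas" for T T' \<tau>
  proof -
    note [measurable] = borel_measurable_entry[OF \<pi>(1)] reward_gradient_measurable kernel_gradient_measurable
      kernel_measurable[OF x] reward_measurable[OF x]
    show ?thesis
      unfolding V_def weighted_return_def soft_reward_def policy_entropy_def by measurable
  qed
  have eq: "dQ_estimator lam (m \<xi>) x (\<pi> \<xi>) s a = bind_pmf (geometric_pmf (1 - \<gamma>))
    (\<lambda>T. bind_pmf (geometric_pmf (1 - \<gamma> powr (1/2))) (\<lambda>T'. bind_pmf (trajectory (M x \<xi>) (\<pi> \<xi>) (T + T' + 1) (s, a))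
      (\<lambda>\<tau>. return_pmf (V \<xi> T T' \<tau>))))" if \<xi>: "\<xi> \<in> space \<Xi>" for \<xi>
  proof -
    interpret S: soft_mdp_family "m \<xi>" X lam \<gamma> R Kr Kp by (rule family[OF \<xi>])
    have "trajectory_gradient lam (m \<xi>) x (\<pi> \<xi>) T T' \<tau> = V \<xi> T T' \<tau>"
      if "\<tau> \<in> set_pmf (trajectory (M x \<xi>) (\<pi> \<xi>) (T + T' + 1) (s, a))" for T T' \<tau>
    proof -
      have pos: "?p \<xi> (\<tau> ! T) (fst (\<tau> ! Suc T)) > 0" by (rule pmf_kernel_trajectory_pos[OF that]) simp
      have "score (m \<xi>) x (\<tau> ! T) (fst (\<tau> ! Suc T))
          = (1 / ?p \<xi> (\<tau> ! T) (fst (\<tau> ! Suc T))) *\<^sub>R kernel_gradient (m \<xi>) x (\<tau> ! T) (fst (\<tau> ! Suc T))"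
        unfolding S.pmf_scaleR_score[OF x, symmetric] using pos by simp
      then show ?thesis by (simp add: trajectory_gradient_def V_def discount[OF \<xi>])
    qed
    then show ?thesis
      using \<gamma> by (subst dQ_estimator_eq[where m = "m \<xi>" and x = x])
        (auto simp: discount[OF \<xi>] map_pmf_def simp del: trajectory.simps intro!: bind_pmf_cong)
  qed
  have "measurable_family \<Xi> meas (\<lambda>\<xi>. bind_pmf (geometric_pmf (1 - \<gamma>))
    (\<lambda>T. bind_pmf (geometric_pmf (1 - \<gamma> powr (1/2))) (\<lambda>T'. bind_pmf (trajectory (M x \<xi>) (\<pi> \<xi>) (T + T' + 1) (s, a))
      (\<lambda>\<tau>. return_pmf (V \<xi> T T' \<tau>)))))"
    by (rule measurable_family_bind_countable[where E = "\<lambda>_. geometric_pmf (1 - \<gamma>)"], simp,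
        rule measurable_family_bind_countable[where E = "\<lambda>_. geometric_pmf (1 - \<gamma> powr (1/2))"], simp,
        rule measurable_family_bind_const[OF trajectory_family[OF \<pi>]], rule measurable_family_return, rule Vm)
  then show ?thesis by (subst measurable_family_cong[OF eq])
qed

lemma gradient_estimator_family:
  assumes \<pi>: "\<pi> \<in> meas" "\<And>\<xi>. is_policy (\<pi> \<xi>)"
  shows "measurable_family \<Xi> meas (\<lambda>\<xi>. gradient_estimator lam (m \<xi>) x (\<pi> \<xi>) s a)"
  unfolding gradient_estimator_def dV_estimator_def
  by (rule measurable_family_bind[OF dQ_family[OF \<pi>]],
      rule measurable_family_bind[OF measurable_family_bind_const[OF act_family[OF \<pi>] dQ_family[OF \<pi>]]],
      rule measurable_family_return) simp

text \<open>The runs that visit the same states for all contexts and whose iterates are measurable in the context.\<close>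

definition run_paths :: "nat \<Rightarrow> ('x \<Rightarrow> ((real^'a^'s) \<times> 's) list) set" where
  "run_paths n = {h. \<exists>qs. length qs = Suc n \<and> (\<forall>z\<in>set qs. fst z \<in> meas) \<and> (\<forall>\<xi>. h \<xi> = map (\<lambda>z. (fst z \<xi>, snd z)) qs)}"

lemma q_update_measurable:
  assumes q: "q \<in> meas"
  shows "(\<lambda>\<xi>. q_update lam (M x \<xi>) \<eta> s a s' (q \<xi>)) \<in> meas"
proof (rule borel_measurable_array)
  fix u b
  note [measurable] = borel_measurable_entry[OF q] reward_measurable[OF x]
  have d: "(\<lambda>\<xi>. discount (M x \<xi>)) \<in> meas" by (subst measurable_cong[OF discount]) auto
  note [measurable] = d
  show "(\<lambda>\<xi>. q_update lam (M x \<xi>) \<eta> s a s' (q \<xi>) $ u $ b) \<in> meas"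
    unfolding q_update_def vec_lambda_beta by measurable
qed

lemma run_family: "measurable_family \<Xi> (run_paths n) (\<lambda>\<xi>. run \<xi> n)"
proof (induction n)
  case 0
  have "(\<lambda>\<xi>. [(0, s\<^sub>0)]) \<in> run_paths 0"
    unfolding run_paths_def by (auto intro!: exI[of _ "[(\<lambda>_. 0, s\<^sub>0)]"])
  then show ?case unfolding soft_q_run.simps by (rule measurable_family_return)
next
  case (Suc n)
  show ?case
    unfolding soft_q_run.simps Let_def
  proof (rule measurable_family_bind[OF Suc.IH])
    fix h assume "h \<in> run_paths n"
    then obtain qs where qs: "length qs = Suc n" "\<And>z. z \<in> set qs \<Longrightarrow> fst z \<in> meas"
      and h: "h = (\<lambda>\<xi>. map (\<lambda>z. (fst z \<xi>, snd z)) qs)"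
      unfolding run_paths_def by blast
    then have ne: "qs \<noteq> []" by auto
    have last: "last (h \<xi>) = (fst (last qs) \<xi>, snd (last qs))" for \<xi>
      unfolding h by (simp add: last_map ne)
    show "measurable_family \<Xi> (run_paths (Suc n)) (\<lambda>\<xi>. bind_pmf (act_pmf \<pi>\<^sub>B (snd (last (h \<xi>))))
        (\<lambda>a. bind_pmf (kernel (M x \<xi>) (snd (last (h \<xi>))) a)
          (\<lambda>s'. return_pmf (h \<xi> @ [(q_update lam (M x \<xi>) (\<alpha> n) (snd (last (h \<xi>))) a s' (fst (last (h \<xi>))), s')]))))"
      unfolding last fst_conv snd_conv
    proof (rule measurable_family_bind_const[OF act_family], simp, rule policy_B,
        rule measurable_family_bind_const[OF kernel_family], rule measurable_family_return)
      fix a s'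
      let ?q = "\<lambda>\<xi>. q_update lam (M x \<xi>) (\<alpha> n) (snd (last qs)) a s' (fst (last qs) \<xi>)"
      have "?q \<in> meas" by (rule q_update_measurable) (use qs(2) ne in auto)
      then show "(\<lambda>\<xi>. h \<xi> @ [(?q \<xi>, s')]) \<in> run_paths (Suc n)"
        unfolding run_paths_def h using qs by (auto intro!: exI[of _ "qs @ [(?q, s')]"])
    qed
  qed
qed

lemma run_paths_iterate: "h \<in> run_paths n \<Longrightarrow> i \<le> n \<Longrightarrow> (\<lambda>\<xi>. q_iterate (h \<xi>) i) \<in> meas"
  unfolding run_paths_def q_iterate_def by (auto simp: nth_map)

lemma run_paths_num: "h \<in> run_paths n \<Longrightarrow> num_iterations (h \<xi>) = n"
  unfolding run_paths_def num_iterations_def by auto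

abbreviation pair_meas where "pair_meas \<equiv> measurable \<Xi> (borel \<Otimes>\<^sub>M count_space (UNIV :: nat set))"

lemma soft_act_family: "q \<in> meas \<Longrightarrow> consts_fam (\<lambda>\<xi>. act_pmf (soft (q \<xi>)) s)"
  by (rule act_family[OF softmax_measurable is_policy_softmax_policy])

lemma soft_gradient_estimator_family: "q \<in> meas \<Longrightarrow> measurable_family \<Xi> meas (\<lambda>\<xi>. grad_est \<xi> (q \<xi>) s a)"
  by (rule gradient_estimator_family[OF softmax_measurable is_policy_softmax_policy])

lemma nu_family: "consts_fam (\<lambda>\<xi>. \<nu>)"
  by (rule measurable_family_countable) simp

lemma hypergradient_term_measurable:
  assumes q: "q \<in> meas" and g: "g \<in> meas"
  shows "(\<lambda>\<xi>. hypergradient_term lam \<nu> (loss \<xi>) x (soft (q \<xi>)) s a (g \<xi>)) \<in> meas"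
proof -
  note [measurable] = g loss_gradient1_measurable[OF softmax_measurable[OF q] is_policy_softmax_policy]
    borel_measurable_entry[OF loss_gradient2_measurable[OF softmax_measurable[OF q] is_policy_softmax_policy]]
  show ?thesis unfolding hypergradient_term_def by measurable
qed

lemma vanilla_family: "measurable_family \<Xi> pair_meas (\<lambda>\<xi>. vanilla \<xi> K)"
  unfolding vanilla_estimator_def Let_def
proof (rule measurable_family_bind[OF run_family], goal_cases)
  case (1 h)
  note q = run_paths_iterate[OF 1 order_refl]
  show ?case
    unfolding run_paths_num[OF 1]
    by (rule measurable_family_bind_const[OF nu_family], rule measurable_family_bind_const[OF soft_act_family[OF q]],
        rule measurable_family_bind[OF soft_gradient_estimator_family[OF q]], rule measurable_family_return)
      (intro measurable_Pair hypergradient_term_measurable q measurable_const, auto)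
qed

lemma average_measurable:
  assumes "gs \<in> {gs. \<exists>hs. length hs = n \<and> set hs \<subseteq> meas \<and> (\<forall>\<xi>. gs \<xi> = map (\<lambda>h. h \<xi>) hs)}"
  shows "(\<lambda>\<xi>. average (gs \<xi> :: (real^'d) list)) \<in> meas"
proof -
  obtain hs where hs: "set hs \<subseteq> meas" and gs: "gs = (\<lambda>\<xi>. map (\<lambda>h. h \<xi>) hs)" using assms by blast
  note [measurable] = borel_measurable_sum_list[OF hs]
  show ?thesis unfolding gs average_def length_map by measurable
qed

text \<open>Levels are positive, which is what the monotonicity of the iteration numbers needs.\<close>

lemma level_family: "1 \<le> K \<Longrightarrow> measurable_family \<Xi> {\<lambda>\<xi>. k | k. 1 \<le> k} (\<lambda>\<xi>. level_pmf K)"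
  unfolding measurable_family_def
proof (intro exI conjI ballI allI)
  assume "1 \<le> K"
  then have "map_pmf (\<lambda>k. max 1 k) (level_pmf K) = map_pmf (\<lambda>k. k) (level_pmf K)"
    using set_level_pmf by (intro map_pmf_cong[OF refl]) fastforce
  then show "level_pmf K = map_pmf (\<lambda>k. max 1 k) (level_pmf K)" by simp
qed auto

lemma rtq_family:
  assumes K: "1 \<le> K"
  shows "measurable_family \<Xi> pair_meas (\<lambda>\<xi>. rtq \<xi> K)"
  unfolding rtq_estimator_def Let_def
proof (rule measurable_family_bind[OF level_family[OF K]], goal_cases)
  case (1 g)
  then obtain k where g: "g = (\<lambda>\<xi>. k)" and k: "1 \<le> k" by blast
  show ?case
    unfolding g
  proof (rule measurable_family_bind[OF run_family], goal_cases)
    case (1 h)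
    have q1: "(\<lambda>\<xi>. q_iterate (h \<xi>) (t 1)) \<in> meas" and qc: "(\<lambda>\<xi>. q_iterate (h \<xi>) (t k)) \<in> meas"
      and qn: "(\<lambda>\<xi>. q_iterate (h \<xi>) (t (k + 1))) \<in> meas"
      by (rule run_paths_iterate[OF 1], rule t_le, use k in simp_all)+
    show ?case
      unfolding run_paths_num[OF 1]
    proof (rule measurable_family_bind_const[OF nu_family], rule measurable_family_bind_const[OF soft_act_family[OF qn]],
        rule measurable_family_bind_const[OF soft_act_family[OF q1]],
        rule measurable_family_bind[OF measurable_family_replicate_pmf[OF soft_gradient_estimator_family[OF qn]]],
        rule measurable_family_bind[OF measurable_family_replicate_pmf[OF soft_gradient_estimator_family[OF qc]]],
        rule measurable_family_bind[OF soft_gradient_estimator_family[OF q1]], rule measurable_family_return, goal_cases)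
      case (1 s a a' gs_next gs_cur g1)
      note [measurable] = average_measurable[OF 1(2)] hypergradient_term_measurable[OF q1 1(3)]
        hypergradient_term_measurable[OF qn average_measurable[OF 1(1)]]
        borel_measurable_entry[OF softmax_measurable[OF qc]] borel_measurable_entry[OF softmax_measurable[OF qn]]
        loss_gradient1_measurable[OF softmax_measurable[OF qc] is_policy_softmax_policy]
        borel_measurable_entry[OF loss_gradient2_measurable[OF softmax_measurable[OF qc] is_policy_softmax_policy]]
      show ?case by measurable
    qed
  qed
qed

end

section \<open>Bias, variance and complexity\<close>

lemma borel_measurable_infnorm: "infnorm \<in> borel_measurable (borel :: 'v::euclidean_space measure)"
  by (intro borel_measurable_continuous_onI continuous_at_imp_continuous_on ballI continuous_infnorm continuous_ident)

text \<open>Bias and variance are measured in the maximum norm, which is at most the Euclidean norm of \<open>has_moments\<close>.\<close>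

lemma
  fixes L :: "((real^'d::finite) \<times> nat) measure"
  assumes v: "has_moments L fst \<mu> B" and n: "has_moments L (\<lambda>z. real (snd z)) c B'"
  shows well_defined_momentsI: "well_defined_moments L"
    and estimator_variance_le: "estimator_variance L \<le> B"
    and estimator_bias_le: "estimator_bias L g \<le> norm (g - \<mu>)"
    and estimator_bias_nonneg: "0 \<le> estimator_bias L g"
    and estimator_variance_nonneg: "0 \<le> estimator_variance L"
    and iteration_complexity_eq: "iteration_complexity L = c"
proof -
  interpret prob_space L using v by (simp add: has_moments_def)
  have i: "integrable L fst" "(\<integral>z. fst z \<partial>L) = \<mu>" using v by (auto simp: has_moments_def)
  have "has_moments L (\<lambda>z. fst z - \<mu>) 0 B" by (rule has_moments_center[OF v])
  then have c: "integrable L (\<lambda>z. (norm (fst z - \<mu>))\<^sup>2)" "(\<integral>z. (norm (fst z - \<mu>))\<^sup>2 \<partial>L) \<le> B"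
    by (auto simp: has_moments_def)
  have le: "(infnorm (fst z - \<mu>))\<^sup>2 \<le> (norm (fst z - \<mu>))\<^sup>2" for z
    by (rule power_mono[OF infnorm_le_norm infnorm_pos_le])
  have sq: "integrable L (\<lambda>z. (infnorm (fst z - \<mu>))\<^sup>2)"
  proof (rule Bochner_Integration.integrable_bound[OF c(1)])
    have "(\<lambda>z. fst z - \<mu>) \<in> borel_measurable L" using i(1) by auto
    then show "(\<lambda>z. (infnorm (fst z - \<mu>))\<^sup>2) \<in> borel_measurable L"
      by (intro borel_measurable_power measurable_compose[OF _ borel_measurable_infnorm])
  qed (use le in auto)
  show "well_defined_moments L"
    using sq i n unfolding well_defined_moments_def by (simp add: prob_space_axioms has_moments_def)
  have "(\<integral>z. (infnorm (fst z - \<mu>))\<^sup>2 \<partial>L) \<le> (\<integral>z. (norm (fst z - \<mu>))\<^sup>2 \<partial>L)"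
    by (rule integral_mono[OF sq c(1) le])
  then show "estimator_variance L \<le> B" using c(2) by (simp add: estimator_variance_def i(2))
  have "(\<integral>z. (g - fst z) \<partial>L) = g - \<mu>" using i by (simp add: prob_space)
  then show "estimator_bias L g \<le> norm (g - \<mu>)"
    by (simp add: estimator_bias_def infnorm_le_norm)
  show "0 \<le> estimator_bias L g" by (simp add: estimator_bias_def infnorm_pos_le)
  show "0 \<le> estimator_variance L" by (simp add: estimator_variance_def)
  show "iteration_complexity L = c" using n by (simp add: iteration_complexity_def has_moments_def)
qed

text \<open>Since \<open>p\<^sub>k \<le> 2 (1/2)\<^sup>k\<close>, the growth \<open>2\<^sup>k\<^sup>+\<^sup>1\<close> of the iteration number is cancelled and a term of order
\<open>k\<close> is left. The asymptotic bound on \<open>t\<close> is needed for every \<open>k \<ge> 1\<close>, so its constant is enlarged to cover the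
finitely many exceptions.\<close>

lemma bigo_level_sum:
  fixes t :: "nat \<Rightarrow> nat"
  assumes t: "(\<lambda>k. real (t k)) \<in> O(\<lambda>k. real k * 2 ^ k)"
  shows "(\<lambda>K. \<Sum>k=1..K. level_prob K k * real (t (k + 1))) \<in> O(\<lambda>K. (real K)\<^sup>2)"
proof -
  obtain c where c: "c > 0" "eventually (\<lambda>k. norm (real (t k)) \<le> c * norm (real k * 2 ^ k)) at_top"
    using landau_o.bigE[OF t] by metis
  then obtain N where N: "\<And>k. k \<ge> N \<Longrightarrow> real (t k) \<le> c * (real k * 2 ^ k)"
    by (auto simp: eventually_at_top_linorder)
  \<comment> \<open>the added sum dominates the exceptional \<open>t k\<close>, since \<open>k * 2 ^ k\<close> is at least 1\<close>
  define c' where "c' = c + (\<Sum>k<N. real (t k))"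
  have c': "0 \<le> c'" "c \<le> c'" using c(1) by (auto simp: c'_def sum_nonneg)
  have tk: "real (t k) \<le> c' * (real k * 2 ^ k)" if k: "1 \<le> k" for k
  proof (cases "k \<ge> N")
    case True
    have "c * (real k * 2 ^ k) \<le> c' * (real k * 2 ^ k)" by (rule mult_right_mono[OF c'(2)]) simp
    with N[OF True] show ?thesis by linarith
  next
    case False
    then have "real (t k) \<le> (\<Sum>k<N. real (t k))" by (intro member_le_sum) auto
    also have "\<dots> \<le> c' * 1" using c(1) by (simp add: c'_def)
    also have "\<dots> \<le> c' * (real k * 2 ^ k)"
    proof (rule mult_left_mono[OF _ c'(1)])
      have "1 * 1 \<le> real k * 2 ^ k" using k by (intro mult_mono) auto
      then show "1 \<le> real k * 2 ^ k" by simp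
    qed
    finally show ?thesis .
  qed
  show ?thesis
  proof (rule bigoI[where c = "8 * c'"], rule eventually_mono[OF eventually_ge_at_top[of 1]])
    fix K :: nat assume K: "1 \<le> K"
    have "level_prob K k * real (t (k + 1)) \<le> 4 * c' * (2 * real K)" if k: "k \<in> {1..K}" for k
    proof -
      have "(1/2) ^ K \<le> ((1/2) ^ 1 :: real)" by (rule power_decreasing) (use K in auto)
      then have "(1/2) ^ k / (1 - (1/2) ^ K) \<le> (1/2) ^ k / (1/2 :: real)"
        by (intro divide_left_mono) auto
      then have "level_prob K k \<le> (1/2) ^ k / (1/2)"
        using k unfolding level_prob_def by simp
      moreover have "0 \<le> level_prob K k" using pmf_level_pmf[OF K, of k] pmf_nonneg[of "level_pmf K" k] by simp
      ultimately have "level_prob K k * real (t (k + 1)) \<le> (1/2) ^ k / (1/2) * (c' * (real (k + 1) * 2 ^ (k + 1)))"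
        using tk[of "k + 1"] by (intro mult_mono) auto
      also have "\<dots> = 4 * c' * real (k + 1)" by (simp add: power_one_over)
      also have "\<dots> \<le> 4 * c' * (2 * real K)" using k c' K by (intro mult_left_mono) auto
      finally show ?thesis .
    qed
    then have "(\<Sum>k=1..K. level_prob K k * real (t (k + 1))) \<le> (\<Sum>k=1..K. 4 * c' * (2 * real K))"
      by (rule sum_mono)
    also have "\<dots> = 8 * c' * (real K)\<^sup>2" by (simp add: power2_eq_square)
    finally have le: "(\<Sum>k=1..K. level_prob K k * real (t (k + 1))) \<le> 8 * c' * (real K)\<^sup>2" .
    have "0 \<le> (\<Sum>k=1..K. level_prob K k * real (t (k + 1)))"
      using pmf_level_pmf[OF K, symmetric] by (intro sum_nonneg mult_nonneg_nonneg) auto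
    with le show "norm (\<Sum>k=1..K. level_prob K k * real (t (k + 1))) \<le> 8 * c' * norm ((real K)\<^sup>2)" by simp
  qed
qed

lemma partial_differentiable:
  assumes "(\<lambda>(y, p). g y p) differentiable (at (x, \<pi>))"
  shows "(\<lambda>y. g y \<pi>) differentiable (at x)" "(\<lambda>p. g x p) differentiable (at \<pi>)"
proof -
  obtain D where D: "((\<lambda>(y, p). g y p) has_derivative D) (at (x, \<pi>))"
    using assms unfolding differentiable_def by blast
  have "((\<lambda>y. (case (y, \<pi>) of (y, p) \<Rightarrow> g y p)) has_derivative (\<lambda>h. D (h, 0))) (at x)"
    by (rule has_derivative_compose[where g = "\<lambda>(y, p). g y p" and f = "\<lambda>y. (y, \<pi>)", OF _ D])
      (auto intro!: derivative_eq_intros)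
  then show "(\<lambda>y. g y \<pi>) differentiable (at x)" by (auto intro: differentiableI)
  have "((\<lambda>p. (case (x, p) of (y, p) \<Rightarrow> g y p)) has_derivative (\<lambda>h. D (0, h))) (at \<pi>)"
    by (rule has_derivative_compose[where g = "\<lambda>(y, p). g y p" and f = "\<lambda>p. (x, p)", OF _ D])
      (auto intro!: derivative_eq_intros)
  then show "(\<lambda>p. g x p) differentiable (at \<pi>)" by (auto intro: differentiableI)
qed

lemma soft_mdp_family_regular:
  fixes M :: "real^'d::finite \<Rightarrow> 'x \<Rightarrow> ('s::finite, 'a::finite) mdp"
  assumes "open X" "lam > 0" "0 < \<gamma>" "\<gamma> < 1" "\<xi> \<in> space \<Xi>"
    and "\<And>y. y \<in> X \<Longrightarrow> discount (M y \<xi>) = \<gamma>" and mdps: "regular_mdps X \<Xi> M R K\<^sub>1 K\<^sub>2"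
  shows "soft_mdp_family (\<lambda>y. M y \<xi>) X lam \<gamma> R (real DIM(real^'d) * \<bar>K\<^sub>2\<bar>) (real DIM(real^'d) * \<bar>K\<^sub>1\<bar>)"
proof
  fix y s a and s' :: 's and z :: "'s \<times> 'a" assume y: "y \<in> X"
  note reg = mdps[unfolded regular_mdps_def, rule_format, OF \<open>\<xi> \<in> space \<Xi>\<close> y]
  have norm_le: "norm v \<le> real DIM(real^'d) * \<bar>K\<bar>" if "infnorm v < K" for v :: "real^'d" and K
  proof -
    have "real DIM(real^'d) * infnorm v \<le> real DIM(real^'d) * \<bar>K\<bar>"
      by (rule mult_left_mono) (use that in auto)
    then show ?thesis using norm_le_DIM_infnorm[of v] by linarith
  qed
  show "(\<lambda>y. reward (M y \<xi>) s a) differentiable (at y)" using reg[of s a] by blast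
  show "\<bar>reward (M y \<xi>) s a\<bar> \<le> R" using reg[of s a] by linarith
  show "norm (reward_gradient (\<lambda>y. M y \<xi>) y z) \<le> real DIM(real^'d) * \<bar>K\<^sub>2\<bar>"
    unfolding reward_gradient_def by (rule norm_le) (use reg[of "fst z" "snd z"] in blast)
  show "(\<lambda>y. pmf (kernel (M y \<xi>) s a) s') differentiable (at y)" using reg[of s a] by blast
  show "norm (score (\<lambda>y. M y \<xi>) y z s') \<le> real DIM(real^'d) * \<bar>K\<^sub>1\<bar>"
    if "0 < pmf (kernel (M y \<xi>) (fst z) (snd z)) s'"
    unfolding score_def by (rule norm_le) (use reg[of "fst z" "snd z"] that in blast)
qed (use assms in auto)

theorem theorem4:
  fixes X :: "(real^'d::finite) set"
    and U :: "(real^'a::finite^'s::finite) set"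
    and \<Xi> :: "'x measure"
    and M :: "real^'d \<Rightarrow> 'x \<Rightarrow> ('s, 'a) mdp"
    and f :: "real^'d \<Rightarrow> real^'a^'s \<Rightarrow> 'x \<Rightarrow> real"
    and lam \<gamma> L\<^sub>f S\<^sub>f R K\<^sub>1 K\<^sub>2 :: real
    and \<pi>\<^sub>B :: "real^'a^'s"
    and \<alpha> :: "nat \<Rightarrow> real"
    and s\<^sub>0 :: 's
    and t :: "nat \<Rightarrow> nat"
    and \<nu> :: "'s pmf"
    and x :: "real^'d"
  assumes context_space: "prob_space \<Xi>"
    and X: "open X" "x \<in> X"
    and U: "open U" "{\<pi>. is_policy \<pi>} \<subseteq> U"
    and lam: "lam > 0"
    and \<gamma>: "0 < \<gamma>" "\<gamma> < 1" "\<And>y \<xi>. y \<in> X \<Longrightarrow> \<xi> \<in> space \<Xi> \<Longrightarrow> discount (M y \<xi>) = \<gamma>"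
    and meas: "measurable_data X U \<Xi> M f"
    and F_defined: "\<And>y. y \<in> X \<Longrightarrow> integrable \<Xi> (\<lambda>\<xi>. f y (opt_policy lam (M y \<xi>)) \<xi>)"
    and loss: "regular_loss X U \<Xi> f L\<^sub>f S\<^sub>f"
    and mdps: "regular_mdps X \<Xi> M R K\<^sub>1 K\<^sub>2"
    and behaviour: "is_policy \<pi>\<^sub>B" "\<And>\<xi>. \<xi> \<in> space \<Xi> \<Longrightarrow> ergodic_policy (M x \<xi>) \<pi>\<^sub>B"
    and step_sizes: "\<And>n. 0 \<le> \<alpha> n \<and> \<alpha> n \<le> 1"
    and t: "mono_on {1..} t" "(\<lambda>k. real (t k)) \<in> O(\<lambda>k. real k * 2 ^ k)"
    and q_convergence:
      "\<exists>C. \<forall>\<xi>\<in>space \<Xi>. \<forall>k\<ge>1.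
         measure_pmf.expectation (soft_q_run lam (M x \<xi>) \<pi>\<^sub>B \<alpha> s\<^sub>0 (t k))
           (\<lambda>h. (infnorm (q_iterate h (t k) - opt_soft_q lam (M x \<xi>)))\<^sup>2) \<le> C * (1/2) ^ k"
    and \<nu>: "set_pmf \<nu> = UNIV"
  shows
    "let F = leader_objective lam \<Xi> M f;
         dF = gradient F x;
         vanilla = (\<lambda>K. estimator_law \<Xi> (\<lambda>\<xi>.
           vanilla_estimator lam (\<lambda>y. M y \<xi>) (\<lambda>y p. f y p \<xi>) x \<pi>\<^sub>B \<alpha> s\<^sub>0 t \<nu> K));
         rtq = (\<lambda>K. estimator_law \<Xi> (\<lambda>\<xi>.
           rtq_estimator lam (\<lambda>y. M y \<xi>) (\<lambda>y p. f y p \<xi>) x \<pi>\<^sub>B \<alpha> s\<^sub>0 t \<nu> K))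
     in F differentiable (at x) \<and>
        (\<forall>K\<ge>1. well_defined_moments (vanilla K) \<and> well_defined_moments (rtq K)) \<and>
        (\<lambda>K. estimator_bias (vanilla K) dF) \<in> O(\<lambda>K. 2 powr (- real K / 2)) \<and>
        (\<lambda>K. estimator_variance (vanilla K)) \<in> O(\<lambda>K. 1) \<and>
        (\<lambda>K. iteration_complexity (vanilla K)) \<in> O(\<lambda>K. real K * 2 ^ K) \<and>
        (\<lambda>K. estimator_bias (rtq K) dF) \<in> O(\<lambda>K. 2 powr (- real K / 2)) \<and>
        (\<lambda>K. estimator_variance (rtq K)) \<in> O(\<lambda>K. real K) \<and>
        (\<lambda>K. iteration_complexity (rtq K)) \<in> O(\<lambda>K. (real K)\<^sup>2)"
proof -
  interpret P: prob_space \<Xi> by (rule context_space)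
  obtain \<xi>0 where \<xi>0: "\<xi>0 \<in> space \<Xi>" using P.not_empty by blast
  define Kr where "Kr = real DIM(real^'d) * \<bar>K\<^sub>2\<bar>"
  define Kp where "Kp = real DIM(real^'d) * \<bar>K\<^sub>1\<bar>"
  have fam: "soft_mdp_family (\<lambda>y. M y \<xi>) X lam \<gamma> R Kr Kp" if "\<xi> \<in> space \<Xi>" for \<xi>
    unfolding Kr_def Kp_def
    by (rule soft_mdp_family_regular[OF X(1) lam \<gamma>(1,2) that \<gamma>(3)[OF _ that] mdps])
  have R: "0 \<le> R" using soft_mdp_family.R_nonneg[OF fam[OF \<xi>0] X(2)] .
  note loss' = loss[unfolded regular_loss_def]
  have diff: "(\<lambda>(y, p). f y p \<xi>) differentiable (at (y, \<pi>))" if "\<xi> \<in> space \<Xi>" "y \<in> X" "\<pi> \<in> U" for \<xi> y \<pi>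
    using loss' that by blast
  have Lf: "\<bar>f x1 \<pi>1 \<xi> - f x2 \<pi>2 \<xi>\<bar> \<le> \<bar>L\<^sub>f\<bar> * (infnorm (x1 - x2) + infnorm (\<pi>1 - \<pi>2))"
    if "\<xi> \<in> space \<Xi>" "x1 \<in> X" "x2 \<in> X" "\<pi>1 \<in> U" "\<pi>2 \<in> U" for \<xi> x1 x2 \<pi>1 \<pi>2
  proof -
    have "\<bar>f x1 \<pi>1 \<xi> - f x2 \<pi>2 \<xi>\<bar> \<le> L\<^sub>f * (infnorm (x1 - x2) + infnorm (\<pi>1 - \<pi>2))"
      using loss' that by blast
    also have "\<dots> \<le> \<bar>L\<^sub>f\<bar> * (infnorm (x1 - x2) + infnorm (\<pi>1 - \<pi>2))"
      by (intro mult_right_mono add_nonneg_nonneg infnorm_pos_le) simp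
    finally show ?thesis .
  qed
  define N where "N = real DIM(real^'d) + real DIM(real^'a^'s)"
  define Kf where "Kf = N * \<bar>L\<^sub>f\<bar>"
  define Sf where "Sf = N * \<bar>S\<^sub>f\<bar>"
  have N: "real DIM(real^'d) \<le> N" "real DIM(real^'a^'s) \<le> N" "0 \<le> N" by (simp_all add: N_def)
  have d1: "(\<lambda>y. f y \<pi> \<xi>) differentiable (at x)" and d2: "(\<lambda>p. f x p \<xi>) differentiable (at \<pi>)"
    if "\<xi> \<in> space \<Xi>" "\<pi> \<in> U" for \<xi> \<pi>
    using partial_differentiable[where g = "\<lambda>y p. f y p \<xi>", OF diff[OF that(1) X(2) that(2)]] by auto
  have g1: "norm (gradient (\<lambda>y. f y \<pi> \<xi>) x) \<le> Kf" if "\<xi> \<in> space \<Xi>" "\<pi> \<in> U" for \<xi> \<pi>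
  proof -
    have "norm (gradient (\<lambda>y. f y \<pi> \<xi>) x) \<le> real DIM(real^'d) * \<bar>L\<^sub>f\<bar>"
    proof (rule norm_gradient_le_Lipschitz[OF d1[OF that] X])
      show "\<bar>f y \<pi> \<xi> - f x \<pi> \<xi>\<bar> \<le> \<bar>L\<^sub>f\<bar> * infnorm (y - x)" if "y \<in> X" for y
        using Lf[OF \<open>\<xi> \<in> space \<Xi>\<close> that X(2) \<open>\<pi> \<in> U\<close> \<open>\<pi> \<in> U\<close>] by (simp add: infnorm_0)
    qed simp
    also have "\<dots> \<le> Kf" unfolding Kf_def by (rule mult_right_mono[OF N(1)]) simp
    finally show ?thesis .
  qed
  have g2: "norm (gradient (\<lambda>p. f x p \<xi>) \<pi>) \<le> Kf" if "\<xi> \<in> space \<Xi>" "\<pi> \<in> U" for \<xi> \<pi>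
  proof -
    have "norm (gradient (\<lambda>p. f x p \<xi>) \<pi>) \<le> real DIM(real^'a^'s) * \<bar>L\<^sub>f\<bar>"
    proof (rule norm_gradient_le_Lipschitz[OF d2[OF that] U(1) that(2)])
      show "\<bar>f x p \<xi> - f x \<pi> \<xi>\<bar> \<le> \<bar>L\<^sub>f\<bar> * infnorm (p - \<pi>)" if "p \<in> U" for p
        using Lf[OF \<open>\<xi> \<in> space \<Xi>\<close> X(2) X(2) that \<open>\<pi> \<in> U\<close>] by (simp add: infnorm_0)
    qed simp
    also have "\<dots> \<le> Kf" unfolding Kf_def by (rule mult_right_mono[OF N(2)]) simp
    finally show ?thesis .
  qed
  have sm: "norm v \<le> Sf * norm w" if le: "infnorm v \<le> S\<^sub>f * infnorm w" and D: "real DIM('v) \<le> N"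
    for v :: "'v::euclidean_space" and w :: "real^'a^'s"
  proof -
    have "norm v \<le> real DIM('v) * infnorm v" by (rule norm_le_DIM_infnorm)
    also have "\<dots> \<le> N * (\<bar>S\<^sub>f\<bar> * norm w)"
    proof (rule mult_mono[OF D _ N(3) infnorm_pos_le])
      have "S\<^sub>f * infnorm w \<le> \<bar>S\<^sub>f\<bar> * norm w"
        by (rule mult_mono[OF abs_ge_self infnorm_le_norm abs_ge_zero infnorm_pos_le])
      with le show "infnorm v \<le> \<bar>S\<^sub>f\<bar> * norm w" by linarith
    qed
    finally show ?thesis by (simp add: Sf_def mult.assoc)
  qed
  have s1: "norm (gradient (\<lambda>y. f y \<pi> \<xi>) x - gradient (\<lambda>y. f y \<pi>' \<xi>) x) \<le> Sf * norm (\<pi> - \<pi>')"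
    if "\<xi> \<in> space \<Xi>" "\<pi> \<in> U" "\<pi>' \<in> U" for \<xi> \<pi> \<pi>'
  proof (rule sm[OF _ N(1)])
    have "infnorm (gradient (\<lambda>y. f y \<pi> \<xi>) x - gradient (\<lambda>y. f y \<pi>' \<xi>) x) \<le> S\<^sub>f * (infnorm (x - x) + infnorm (\<pi> - \<pi>'))"
      using loss' that X(2) by blast
    then show "infnorm (gradient (\<lambda>y. f y \<pi> \<xi>) x - gradient (\<lambda>y. f y \<pi>' \<xi>) x) \<le> S\<^sub>f * infnorm (\<pi> - \<pi>')"
      by (simp add: infnorm_0)
  qed
  have s2: "norm (gradient (\<lambda>p. f x p \<xi>) \<pi> - gradient (\<lambda>p. f x p \<xi>) \<pi>') \<le> Sf * norm (\<pi> - \<pi>')"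
    if "\<xi> \<in> space \<Xi>" "\<pi> \<in> U" "\<pi>' \<in> U" for \<xi> \<pi> \<pi>'
  proof (rule sm[OF _ N(2)])
    have "infnorm (gradient (\<lambda>p. f x p \<xi>) \<pi> - gradient (\<lambda>p. f x p \<xi>) \<pi>') \<le> S\<^sub>f * (infnorm (x - x) + infnorm (\<pi> - \<pi>'))"
      using loss' that X(2) by blast
    then show "infnorm (gradient (\<lambda>p. f x p \<xi>) \<pi> - gradient (\<lambda>p. f x p \<xi>) \<pi>') \<le> S\<^sub>f * infnorm (\<pi> - \<pi>')"
      by (simp add: infnorm_0)
  qed
  have pol: "\<pi> \<in> U" if "is_policy \<pi>" for \<pi> using U(2) that by blast
  have Sf: "0 \<le> Sf" using N by (simp add: Sf_def)
  obtain C0 where C0: "\<And>\<xi> k. \<xi> \<in> space \<Xi> \<Longrightarrow> 1 \<le> k \<Longrightarrow>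
      \<E> (soft_q_run lam (M x \<xi>) \<pi>\<^sub>B \<alpha> s\<^sub>0 (t k))
        (\<lambda>h. (infnorm (q_iterate h (t k) - opt_soft_q lam (M x \<xi>)))\<^sup>2) \<le> C0 * (1/2) ^ k"
    using q_convergence by blast
  \<comment> \<open>the smoothness of the loss on the open set \<open>U\<close> makes its gradients continuous in the policy, which their measurability requires\<close>
  have cont: "continuous_on U G" if "\<And>\<pi> \<pi>'. \<pi> \<in> U \<Longrightarrow> \<pi>' \<in> U \<Longrightarrow> norm (G \<pi> - G \<pi>') \<le> Sf * norm (\<pi> - \<pi>')"
    for G :: "real^'a^'s \<Rightarrow> 'v::euclidean_space"
    by (rule lipschitz_on_continuous_on[where L = Sf]) (use that Sf in \<open>auto simp: lipschitz_on_def dist_norm\<close>)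
  interpret L: measurable_learning M \<Xi> f X x lam \<gamma> R Kr Kp Kf Sf \<nu> \<pi>\<^sub>B \<alpha> s\<^sub>0 t "\<bar>C0\<bar>" U
  proof (intro measurable_learning.intro learning.intro context_family.intro
      measurable_learning_axioms.intro learning_axioms.intro)
    show "\<E> (soft_q_run lam (M x \<xi>) \<pi>\<^sub>B \<alpha> s\<^sub>0 (t k))
        (\<lambda>h. (infnorm (q_iterate h (t k) - opt_soft_q lam (M x \<xi>)))\<^sup>2) \<le> \<bar>C0\<bar> * (1/2) ^ k"
      if "\<xi> \<in> space \<Xi>" "1 \<le> k" for \<xi> k
      by (rule order_trans[OF C0[OF that] mult_right_mono[OF abs_ge_self]]) simp
    show "continuous_on U (\<lambda>\<pi>. gradient (\<lambda>y. f y \<pi> \<xi>) x)" if "\<xi> \<in> space \<Xi>" for \<xi>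
      by (rule cont) (rule s1[OF that])
    show "continuous_on U (\<lambda>\<pi>. gradient (\<lambda>p. f x p \<xi>) \<pi>)" if "\<xi> \<in> space \<Xi>" for \<xi>
      by (rule cont) (rule s2[OF that])
    show "(\<lambda>\<xi>. reward (M y \<xi>) s a) \<in> borel_measurable \<Xi>" if "y \<in> X" for y s a
      using meas that by (simp add: measurable_data_def)
    show "(\<lambda>\<xi>. pmf (kernel (M y \<xi>) s a) s') \<in> borel_measurable \<Xi>" if "y \<in> X" for y s a s'
      using meas that by (simp add: measurable_data_def)
    show "f y \<pi> \<in> borel_measurable \<Xi>" if "y \<in> X" "\<pi> \<in> U" for y \<pi>
      using meas that by (simp add: measurable_data_def)
  qed (use fam X U lam \<gamma> R g1 g2 s1 s2 pol Sf \<nu> step_sizes t behaviour(1) d1 d2 context_space in auto)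
  let ?Q = "\<lambda>\<xi>. opt_soft_q lam (M x \<xi>)"
  let ?\<Psi> = "\<lambda>\<xi> Q. policy_hypergradient lam (\<lambda>y. M y \<xi>) (\<lambda>y p. f y p \<xi>) x (softmax_policy lam Q)"
  let ?B = "borel \<Otimes>\<^sub>M count_space UNIV :: ((real^'d) \<times> nat) measure"
  have spB: "space ?B = UNIV" by (simp add: space_pair_measure)

  obtain e where e: "e > 0" "ball x e \<subseteq> X" using X open_contains_ball by blast
  from L.blip_policy_hypergradient obtain C1 where C1: "C1 \<ge> 0"
    "\<And>\<xi> Q. \<xi> \<in> space \<Xi> \<Longrightarrow> Q \<in> L.Q_box \<Longrightarrow> norm (?\<Psi> \<xi> Q) \<le> C1"
    by (rule bounded_Lipschitz_familyE) metis
  define QL where "QL = (Kr + \<gamma> * (real CARD('s) * Kp * (q_bound R \<gamma> lam CARD('a) + lam * ln (real CARD('a))))) / (1 - \<gamma>)"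
  define C2 where "C2 = \<bar>L\<^sub>f\<bar> * (1 + real CARD('s) * real CARD('a) * (2 * QL / lam))"
  let ?\<phi> = "\<lambda>y \<xi>. f y (opt_policy lam (M y \<xi>)) \<xi>"
  have Lip: "\<bar>?\<phi> y \<xi> - ?\<phi> x \<xi>\<bar> \<le> C2 * norm (y - x)" if \<xi>: "\<xi> \<in> space \<Xi>" and y: "y \<in> ball x e" for \<xi> y
  proof -
    interpret S: soft_mdp_family "\<lambda>y. M y \<xi>" X lam \<gamma> R Kr Kp by (rule fam[OF \<xi>])
    have QL: "S.Q_Lipschitz = QL" by (simp add: S.Q_Lipschitz_def S.V_bound_def S.Q_radius_def QL_def)
    have "norm (opt_policy lam (M y \<xi>) - opt_policy lam (M x \<xi>))
        \<le> (\<Sum>s\<in>(UNIV::'s set). \<Sum>a\<in>(UNIV::'a set). 2 * (QL * norm (y - x)) / lam)"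
      by (rule order_trans[OF norm_le_sum_entries])
        (intro sum_mono, use S.opt_policy_Lipschitz[OF e(2) y] QL in simp)
    then have n: "norm (opt_policy lam (M y \<xi>) - opt_policy lam (M x \<xi>)) \<le> real CARD('s) * real CARD('a) * (2 * QL / lam) * norm (y - x)"
      by simp
    have pU: "opt_policy lam (M y \<xi>) \<in> U" for y
      unfolding opt_policy_def by (rule pol[OF is_policy_softmax_policy])
    have "\<bar>?\<phi> y \<xi> - ?\<phi> x \<xi>\<bar> \<le> \<bar>L\<^sub>f\<bar> * (infnorm (y - x) + infnorm (opt_policy lam (M y \<xi>) - opt_policy lam (M x \<xi>)))"
      by (rule Lf[OF \<xi> _ X(2) pU pU]) (use e y in auto)
    also have "\<dots> \<le> \<bar>L\<^sub>f\<bar> * (norm (y - x) + real CARD('s) * real CARD('a) * (2 * QL / lam) * norm (y - x))"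
      by (intro mult_left_mono add_mono infnorm_le_norm order_trans[OF infnorm_le_norm n]) simp
    also have "\<dots> = C2 * norm (y - x)" by (simp add: C2_def algebra_simps)
    finally show ?thesis .
  qed
  \<comment> \<open>the hypergradient of the optimal policy is the pointwise derivative, and its mean that of the objective\<close>
  have der: "((\<lambda>y. ?\<phi> y \<xi>) has_derivative (\<lambda>h. ?\<Psi> \<xi> (?Q \<xi>) \<bullet> h)) (at x)" if \<xi>: "\<xi> \<in> space \<Xi>" for \<xi>
  proof -
    have "opt_policy lam (M x \<xi>) \<in> U" unfolding opt_policy_def by (rule pol[OF is_policy_softmax_policy])
    from soft_mdp_family.leader_loss_has_derivative[OF fam[OF \<xi>] X(2) diff[OF \<xi> X(2) this]]
    show ?thesis by (simp add: opt_policy_def)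
  qed
  have Lip': "\<bar>?\<phi> y \<xi> - ?\<phi> x \<xi>\<bar> \<le> max C1 C2 * norm (y - x)" if "\<xi> \<in> space \<Xi>" "y \<in> ball x e" for \<xi> y
    by (rule order_trans[OF Lip[OF that]], rule mult_right_mono) auto
  have bound: "norm (?\<Psi> \<xi> (?Q \<xi>)) \<le> max C1 C2" if "\<xi> \<in> space \<Xi>" for \<xi>
    using C1(2)[OF that L.Q_star_in_box[OF that]] by simp
  have int: "integrable \<Xi> (?\<phi> y)" if "y \<in> ball x e" for y
    by (rule F_defined) (use that e in auto)
  note dom = has_derivative_integral_dominated[OF context_space open_ball centre_in_ball[THEN iffD2, OF e(1)] int der Lip' bound]
  define dF where "dF = (\<integral>\<xi>. ?\<Psi> \<xi> (?Q \<xi>) \<partial>\<Xi>)"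
  have objective: "leader_objective lam \<Xi> M f = (\<lambda>y. \<integral>\<xi>. ?\<phi> y \<xi> \<partial>\<Xi>)"
    by (rule ext) (simp add: leader_objective_def)
  have F: "leader_objective lam \<Xi> M f differentiable (at x)" "gradient (leader_objective lam \<Xi> M f) x = dF"
    unfolding objective dF_def using differentiableI[OF dom(2)] gradient_eqI[OF dom(2)] by simp_all

  define VL where "VL K = estimator_law \<Xi> (\<lambda>\<xi>. L.vanilla \<xi> K)" for K
  define RL where "RL K = estimator_law \<Xi> (\<lambda>\<xi>. L.rtq \<xi> K)" for K
  obtain CV where CV: "CV \<ge> 0" "\<And>\<xi> K. \<xi> \<in> space \<Xi> \<Longrightarrow> has_moments (measure_pmf (L.vanilla \<xi> K)) fst (L.\<psi> \<xi> K) CV"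
    using L.vanilla_moments by blast
  obtain CR DR where CR: "CR \<ge> 0" "DR \<ge> 0" "\<And>\<xi> K. \<xi> \<in> space \<Xi> \<Longrightarrow> 1 \<le> K \<Longrightarrow>
      has_moments (measure_pmf (L.rtq \<xi> K)) fst (L.\<psi> \<xi> (K + 1)) (CR + DR * real K)"
    using L.rtq_moments by blast
  obtain Cb where Cb: "Cb \<ge> 0" "\<And>\<xi> j. \<xi> \<in> space \<Xi> \<Longrightarrow> 1 \<le> j \<Longrightarrow>
      norm (L.\<psi> \<xi> j - ?\<Psi> \<xi> (?Q \<xi>)) \<le> Cb * 2 powr (- real j / 2)"
    using L.\<psi>_bias by blast
  have fst_m: "fst \<in> borel_measurable ?B" and snd_m: "(\<lambda>z. real (snd z)) \<in> borel_measurable ?B"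
    by measurable
  have V: "has_moments (VL K) fst (\<integral>\<xi>. L.\<psi> \<xi> K \<partial>\<Xi>) CV" for K
    unfolding VL_def estimator_law_def
    by (rule has_moments_mixture[OF context_space L.vanilla_family spB fst_m CV(2)])
  have Vn: "has_moments (VL K) (\<lambda>z. real (snd z)) (real (t K)) ((real (t K))\<^sup>2)" for K
    using has_moments_mixture[OF context_space L.vanilla_family spB snd_m L.vanilla_iterations]
    unfolding VL_def estimator_law_def by (simp add: P.prob_space)
  have int\<psi>: "integrable \<Xi> (\<lambda>\<xi>. L.\<psi> \<xi> K)" for K
    by (rule integrable_mean_mixture[OF context_space L.vanilla_family spB fst_m CV(2)])
  have Rm: "has_moments (RL K) fst (\<integral>\<xi>. L.\<psi> \<xi> (K + 1) \<partial>\<Xi>) (CR + DR * real K)" if "1 \<le> K" for K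
    unfolding RL_def estimator_law_def
    by (rule has_moments_mixture[OF context_space L.rtq_family[OF that] spB fst_m CR(3)[OF _ that]])
  let ?c = "\<lambda>K. \<Sum>k=1..K. level_prob K k * real (t (k + 1))"
  have Rn: "has_moments (RL K) (\<lambda>z. real (snd z)) (?c K) (\<Sum>k=1..K. level_prob K k * (real (t (k + 1)))\<^sup>2)" if "1 \<le> K" for K
    using has_moments_mixture[OF context_space L.rtq_family[OF that] spB snd_m L.rtq_iterations[OF that]]
    unfolding RL_def estimator_law_def by (simp add: P.prob_space)

  have bias: "norm (dF - (\<integral>\<xi>. L.\<psi> \<xi> j \<partial>\<Xi>)) \<le> Cb * 2 powr (- real j / 2)" if "1 \<le> j" for j
  proof -
    have "norm (dF - (\<integral>\<xi>. L.\<psi> \<xi> j \<partial>\<Xi>)) = norm (\<integral>\<xi>. L.\<psi> \<xi> j - ?\<Psi> \<xi> (?Q \<xi>) \<partial>\<Xi>)"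
      using int\<psi> dom(1) by (simp add: dF_def norm_minus_commute)
    also have "\<dots> \<le> (\<integral>\<xi>. norm (L.\<psi> \<xi> j - ?\<Psi> \<xi> (?Q \<xi>)) \<partial>\<Xi>)" by (rule integral_norm_bound)
    also have "\<dots> \<le> (\<integral>\<xi>. Cb * 2 powr (- real j / 2) \<partial>\<Xi>)"
      by (rule integral_mono) (use int\<psi> dom(1) Cb(2) that in auto)
    finally show ?thesis by (simp add: P.prob_space)
  qed
  have ge1: "eventually (\<lambda>K::nat. 1 \<le> K) at_top" by (rule eventually_ge_at_top)
  have "\<forall>K\<ge>1. well_defined_moments (VL K) \<and> well_defined_moments (RL K)"
    using well_defined_momentsI[OF V Vn] well_defined_momentsI[OF Rm Rn] by blast
  moreover have "(\<lambda>K. estimator_bias (VL K) dF) \<in> O(\<lambda>K. 2 powr (- real K / 2))"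
  proof (rule bigoI[where c = Cb], rule eventually_mono[OF ge1])
    fix K :: nat assume "1 \<le> K"
    from order_trans[OF estimator_bias_le[OF V Vn] bias[OF this]] estimator_bias_nonneg[OF V Vn, of K dF]
    show "norm (estimator_bias (VL K) dF) \<le> Cb * norm (2 powr (- real K / 2))" by simp
  qed
  moreover have "(\<lambda>K. estimator_variance (VL K)) \<in> O(\<lambda>K. 1)"
    by (rule bigoI[where c = CV], rule always_eventually)
      (use estimator_variance_le[OF V Vn] estimator_variance_nonneg[OF V Vn] in auto)
  moreover have "(\<lambda>K. iteration_complexity (VL K)) \<in> O(\<lambda>K. real K * 2 ^ K)"
    using t(2) by (simp add: iteration_complexity_eq[OF V Vn])
  moreover have "(\<lambda>K. estimator_bias (RL K) dF) \<in> O(\<lambda>K. 2 powr (- real K / 2))"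
  proof (rule bigoI[where c = Cb], rule eventually_mono[OF ge1])
    fix K :: nat assume K: "1 \<le> K"
    have "Cb * 2 powr (- real (K + 1) / 2) \<le> Cb * 2 powr (- real K / 2)"
      by (rule mult_left_mono[OF _ Cb(1)]) simp
    with order_trans[OF estimator_bias_le[OF Rm[OF K] Rn[OF K]] bias[of "K + 1"]]
      estimator_bias_nonneg[OF Rm[OF K] Rn[OF K], of dF]
    show "norm (estimator_bias (RL K) dF) \<le> Cb * norm (2 powr (- real K / 2))" by simp
  qed
  moreover have "(\<lambda>K. estimator_variance (RL K)) \<in> O(\<lambda>K. real K)"
  proof (rule bigoI[where c = "CR + DR"], rule eventually_mono[OF ge1])
    fix K :: nat assume K: "1 \<le> K"
    have "CR * 1 \<le> CR * real K" by (rule mult_left_mono[OF _ CR(1)]) (use K in simp)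
    with estimator_variance_le[OF Rm[OF K] Rn[OF K]] estimator_variance_nonneg[OF Rm[OF K] Rn[OF K]]
    show "norm (estimator_variance (RL K)) \<le> (CR + DR) * norm (real K)" by (simp add: distrib_right)
  qed
  moreover have "(\<lambda>K. iteration_complexity (RL K)) \<in> O(\<lambda>K. (real K)\<^sup>2)"
  proof -
    have "eventually (\<lambda>K. iteration_complexity (RL K) = ?c K) at_top"
      by (rule eventually_mono[OF ge1]) (rule iteration_complexity_eq[OF Rm Rn])
    from landau_o.big.in_cong[OF this] bigo_level_sum[OF t(2)] show ?thesis by blast
  qed
  ultimately show ?thesis
    unfolding Let_def F(2) using F(1) unfolding VL_def RL_def by blast
qed

end
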